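(* Let $X$ be a smooth complex curve, $D$ an effective divisor on $X$, $\mathcal{A}=\mathcal{T}_X(-D)$, and let $G=\Pi_1(X,D)$ be the source-simply connected Lie groupoid integrating $\mathcal{A}$, with source and target maps $s,t:G\to X$. Let $\widehat{X}$ be the formal neighbourhood of $D$ in $X$ and $\widehat{G}$ the formal neighbourhood in $G$ of the full subgroupoid $G|_D$ of $G$ over $D$. Let $(\mathcal{E}_1,\nabla_1)$ and $(\mathcal{E}_2,\nabla_2)$ be representations of $\mathcal{A}$, and let $\widehat{\phi}:\widehat{\mathcal{E}}_1\to\widehat{\mathcal{E}}_2$ be a formal isomorphism between them along $\widehat{X}$, so that $$\widehat{\phi}\circ\widehat{\nabla}_1=\widehat{\nabla}_2\circ\widehat{\phi}.$$ If $\Psi_1:s^*\mathcal{E}_1\to t^*\mathcal{E}_1$ is the integration of $\nabla_1$ to a representation of $G$, with restriction $\widehat{\Psi}_1$ to $\widehat{G}$, then the formal isomorphism along $\widehat{G}$ given by $$\Sigma(\widehat{\Psi}_1,\widehat{\phi})=(t^*\widehat{\phi})\cdot\widehat{\Psi}_1\cdot(s^*\widehat{\phi})^{-1}$$ coincides with the restriction to $\widehat{G}$ of the $G$-representation $\Psi_2$ integrating $(\mathcal{E}_2,\nabla_2)$. In particular, $\Sigma(\widehat{\Psi}_1,\widehat{\phi})$, when represented in coordinates centred at a point in $\widehat{G}$, is a power series in two variables with a nontrivial domain of convergence.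
   Context: $\mathcal{T}_X(-D)$ is the sheaf of holomorphic vector fields on $X$ vanishing along $D$ (with multiplicity), a Lie algebroid with anchor the inclusion into $\mathcal{T}_X$ and bracket the Lie bracket of vector fields. A representation of $\mathcal{A}=\mathcal{T}_X(-D)$ is a holomorphic vector bundle $\mathcal{E}$ of finite rank with a flat $\mathcal{A}$-connection; equivalently, a meromorphic connection $\nabla:\mathcal{E}\to\Omega^1_X(D)\otimes\mathcal{E}$ with poles bounded by $D$ (automatically flat since $\dim X=1$). A (holomorphic) Lie groupoid $G$ over $X$ has holomorphic submersions $s,t:G\to X$, an identity embedding $\mathrm{id}:X\to G$, and a composition $gh$ defined when $s(g)=t(h)$. Its Lie algebroid is the normal bundle to $\mathrm{id}(X)$, with bracket obtained by identifying its sections with right-invariant vector fields tangent to the source fibres, and anchor given by the derivative of $t$. An integration of a Lie algebroid $\mathcal{A}$ is a Lie groupoid together with an isomorphism of its Lie algebroid with $\mathcal{A}$; a groupoid is source-simply connected if the fibres of $s$ are connected and simply connected. $\Pi_1(X,D)$ denotes the source-simply connected integration of $\mathcal{T}_X(-D)$, which exists and is unique up to isomorphism; it is a complex manifold of dimension 2 (possibly non-Hausdorff when $X=\mathbb{P}^1$ and $D$ is a single point of multiplicity one). The full subgroupoid $G|_D$ over $D$ is $s^{-1}(D)\cap t^{-1}(D)$. A representation of $G$ on a vector bundle $\mathcal{E}$ over $X$ is a holomorphic isomorphism $\Psi:s^*\mathcal{E}\to t^*\mathcal{E}$ over $G$ that is multiplicative: $\Psi(gh)=\Psi(g)\Psi(h)$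 for composable $g,h$. Every representation $(\mathcal{E},\nabla)$ of $\mathcal{A}$ integrates to a unique representation $\Psi$ of the source-simply connected groupoid $G$. The formal neighbourhood $\widehat{X}$ of $D$ is the formal completion of $X$ along $D$ (functions on it are formal power series in coordinates centred at points of $D$), and $\widehat{G}$ is the formal completion of $G$ along $G|_D$; it also coincides with $G|_{\widehat{X}}$. Hats on bundles, connections and groupoid representations denote restriction to these formal neighbourhoods. A formal isomorphism is an isomorphism of the restrictions of the bundles to the formal neighbourhood. *)

theory Defs
  imports "HOL-Complex_Analysis.Complex_Analysis"
begin

section \<open>Holomorphic maps between complex normed spaces\<close>

class complex_normed_space = real_normed_vector +
  fixes scaleC :: "complex \<Rightarrow> 'a \<Rightarrow> 'a"  (infixr \<open>*\<^sub>C\<close> 75)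
  assumes scaleC_add_right: "a *\<^sub>C (x + y) = a *\<^sub>C x + a *\<^sub>C y"
    and scaleC_add_left: "(a + b) *\<^sub>C x = a *\<^sub>C x + b *\<^sub>C x"
    and scaleC_scaleC: "a *\<^sub>C (b *\<^sub>C x) = (a * b) *\<^sub>C x"
    and scaleC_of_real: "of_real r *\<^sub>C x = r *\<^sub>R x"
    and norm_scaleC: "norm (a *\<^sub>C x) = cmod a * norm x"

instantiation complex :: complex_normed_space
begin
definition "scaleC_complex (a::complex) (x::complex) = a * x"
instance
  by standard (auto simp: scaleC_complex_def algebra_simps norm_mult scaleR_conv_of_real)
end

instantiation prod :: (complex_normed_space, complex_normed_space) complex_normed_space
begin
definition "scaleC_prod (a::complex) (x::'a \<times> 'b) = (a *\<^sub>C fst x, a *\<^sub>C snd x)"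
instance
proof
  fix a :: complex and x :: "'a \<times> 'b"
  have "norm (a *\<^sub>C x) = sqrt ((cmod a)\<^sup>2 * ((norm (fst x))\<^sup>2 + (norm (snd x))\<^sup>2))"
    by (simp add: scaleC_prod_def norm_prod_def norm_scaleC power_mult_distrib algebra_simps)
  then show "norm (a *\<^sub>C x) = cmod a * norm x"
    by (simp add: norm_prod_def real_sqrt_mult)
qed (auto simp: scaleC_prod_def prod_eq_iff scaleC_add_right scaleC_add_left scaleC_scaleC
      scaleC_of_real)
end

instantiation vec :: (complex_normed_space, finite) complex_normed_space
begin
definition "scaleC_vec (a::complex) (x::'a^'b) = (\<chi> i. a *\<^sub>C (x $ i))"
instance
  by standard (auto simp: scaleC_vec_def vec_eq_iff scaleC_add_right scaleC_add_left scaleC_scaleC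
      scaleC_of_real norm_vec_def norm_scaleC L2_set_right_distrib)
end

text \<open>Only used on open sets.\<close>

definition holo_on ::
  "('a::complex_normed_space \<Rightarrow> 'b::complex_normed_space) \<Rightarrow> 'a set \<Rightarrow> bool" where
  "holo_on f S \<longleftrightarrow>
     (\<forall>z\<in>S. \<exists>f'. (f has_derivative f') (at z) \<and> (\<forall>a h. f' (a *\<^sub>C h) = a *\<^sub>C f' h))"

lemma holo_on_complex_iff:
  fixes f :: "complex \<Rightarrow> complex"
  assumes "open S"
  shows "holo_on f S \<longleftrightarrow> f holomorphic_on S"
proof -
  have "(\<exists>f'. (f has_derivative f') (at z) \<and> (\<forall>a h. f' (a *\<^sub>C h) = a *\<^sub>C f' h))
        \<longleftrightarrow> f field_differentiable (at z)" for z
  proof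
    assume "\<exists>f'. (f has_derivative f') (at z) \<and> (\<forall>a h. f' (a *\<^sub>C h) = a *\<^sub>C f' h)"
    then obtain f' where f': "(f has_derivative f') (at z)" "\<And>a h. f' (a * h) = a * f' h"
      by (auto simp: scaleC_complex_def)
    have "f' = (\<lambda>h. f' 1 * h)"
    proof
      fix h
      show "f' h = f' 1 * h"
        using f'(2)[of h 1] by (simp add: mult.commute)
    qed
    then have "(f has_field_derivative f' 1) (at z)"
      using f'(1) by (simp add: has_field_derivative_def)
    then show "f field_differentiable (at z)"
      using field_differentiable_def by blast
  next
    assume "f field_differentiable (at z)"
    then obtain c where "(f has_field_derivative c) (at z)"
      using field_differentiable_def by blast
    then show "\<exists>f'. (f has_derivative f') (at z) \<and> (\<forall>a h. f' (a *\<^sub>C h) = a *\<^sub>C f' h)"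
      by (auto simp: has_field_derivative_def scaleC_complex_def intro!: exI[of _ "(*) c"])
  qed
  then show ?thesis
    using holomorphic_on_open[OF assms] unfolding holo_on_def field_differentiable_def by blast
qed


section \<open>Complex manifolds\<close>

type_synonym ('a, 'm) chart = "'a set \<times> ('a \<Rightarrow> 'm)"

record ('a, 'm) cmanifold =
  mtop :: "'a topology"
  atlas :: "('a, 'm) chart set"

definition points :: "('a, 'm) cmanifold \<Rightarrow> 'a set" where
  "points M = topspace (mtop M)"

definition chart_inv :: "('a, 'm) chart \<Rightarrow> 'm \<Rightarrow> 'a" where
  "chart_inv K = inv_into (fst K) (snd K)"

definition top_chart :: "'a topology \<Rightarrow> ('a, 'm::complex_normed_space) chart \<Rightarrow> bool" where
  "top_chart T K \<longleftrightarrow> openin T (fst K) \<and> open (snd K ` fst K) \<and>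
     homeomorphic_map (subtopology T (fst K)) (top_of_set (snd K ` fst K)) (snd K)"

definition holo_transition ::
  "('a, 'm::complex_normed_space) chart \<Rightarrow> ('a, 'm) chart \<Rightarrow> bool" where
  "holo_transition K L \<longleftrightarrow> holo_on (snd L \<circ> chart_inv K) (snd K ` (fst K \<inter> fst L))"

text \<open>No separation or countability axiom is part of this definition: arrow spaces of groupoids
  may be non-Hausdorff.\<close>

definition complex_manifold :: "('a, 'm::complex_normed_space) cmanifold \<Rightarrow> bool" where
  "complex_manifold M \<longleftrightarrow>
     (\<forall>K\<in>atlas M. top_chart (mtop M) K) \<and>
     (\<Union>K\<in>atlas M. fst K) = points M \<and>
     (\<forall>K\<in>atlas M. \<forall>L\<in>atlas M. holo_transition K L)"

text \<open>Local holomorphic coordinates, i.e. members of the maximal atlas.\<close>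

definition coordinate ::
  "('a, 'm::complex_normed_space) cmanifold \<Rightarrow> ('a, 'm) chart \<Rightarrow> bool" where
  "coordinate M K \<longleftrightarrow> top_chart (mtop M) K \<and>
     (\<forall>L\<in>atlas M. holo_transition K L \<and> holo_transition L K)"

definition complex_curve :: "('a, complex) cmanifold \<Rightarrow> bool" where
  "complex_curve X \<longleftrightarrow>
     complex_manifold X \<and> Hausdorff_space (mtop X) \<and> second_countable (mtop X)"

definition holo_fun ::
  "('a, 'm::complex_normed_space) cmanifold \<Rightarrow> 'a set \<Rightarrow> ('a \<Rightarrow> 'v::complex_normed_space) \<Rightarrow> bool"
  where
  "holo_fun M W f \<longleftrightarrow> openin (mtop M) W \<and>
     (\<forall>K\<in>atlas M. holo_on (f \<circ> chart_inv K) (snd K ` (fst K \<inter> W)))"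

definition holo_map ::
  "('a, 'm::complex_normed_space) cmanifold \<Rightarrow> ('b, 'n::complex_normed_space) cmanifold \<Rightarrow>
   ('a \<Rightarrow> 'b) \<Rightarrow> bool" where
  "holo_map M N f \<longleftrightarrow> continuous_map (mtop M) (mtop N) f \<and>
     (\<forall>K\<in>atlas M. \<forall>L\<in>atlas N.
        holo_on (snd L \<circ> f \<circ> chart_inv K) (snd K ` (fst K \<inter> f -` fst L)))"

definition holo_submersion ::
  "('a, 'm::complex_normed_space) cmanifold \<Rightarrow> ('b, 'n::complex_normed_space) cmanifold \<Rightarrow>
   ('a \<Rightarrow> 'b) \<Rightarrow> bool" where
  "holo_submersion M N f \<longleftrightarrow> holo_map M N f \<and>
     (\<forall>K\<in>atlas M. \<forall>L\<in>atlas N. \<forall>x \<in> fst K \<inter> f -` fst L.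
        surj (frechet_derivative (snd L \<circ> f \<circ> chart_inv K) (at (snd K x))))"


section \<open>Vector fields and divisors\<close>

text \<open>A holomorphic vector field on an open set \<open>W\<close> is a derivation of the sheaf of holomorphic
  functions on \<open>W\<close>. It is given by a single operator on (total) functions, of which only the action
  on functions holomorphic on open subsets of \<open>W\<close> matters; \<open>vf_eq M W\<close> is equality of vector fields
  on \<open>W\<close>.\<close>

type_synonym 'a vf = "('a \<Rightarrow> complex) \<Rightarrow> 'a \<Rightarrow> complex"

definition vector_field ::
  "('a, 'm::complex_normed_space) cmanifold \<Rightarrow> 'a set \<Rightarrow> 'a vf \<Rightarrow> bool" where
  "vector_field M W \<xi> \<longleftrightarrow> openin (mtop M) W \<and>
     (\<forall>V f. V \<subseteq> W \<and> holo_fun M V f \<longrightarrow>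
        holo_fun M V (\<xi> f) \<and>
        (\<forall>a. \<forall>x\<in>V. \<xi> (\<lambda>y. a * f y) x = a * \<xi> f x) \<and>
        (\<forall>g. holo_fun M V g \<longrightarrow>
           (\<forall>x\<in>V. \<xi> (\<lambda>y. f y + g y) x = \<xi> f x + \<xi> g x) \<and>
           (\<forall>x\<in>V. \<xi> (\<lambda>y. f y * g y) x = \<xi> f x * g x + f x * \<xi> g x) \<and>
           ((\<forall>x\<in>V. f x = g x) \<longrightarrow> (\<forall>x\<in>V. \<xi> f x = \<xi> g x))))"

definition vf_eq ::
  "('a, 'm::complex_normed_space) cmanifold \<Rightarrow> 'a set \<Rightarrow> 'a vf \<Rightarrow> 'a vf \<Rightarrow> bool" where
  "vf_eq M W \<xi> \<eta> \<longleftrightarrow> (\<forall>V f. V \<subseteq> W \<and> holo_fun M V f \<longrightarrow> (\<forall>x\<in>V. \<xi> f x = \<eta> f x))"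

definition vf_add :: "'a vf \<Rightarrow> 'a vf \<Rightarrow> 'a vf" where
  "vf_add \<xi> \<eta> = (\<lambda>f x. \<xi> f x + \<eta> f x)"

definition vf_mult :: "('a \<Rightarrow> complex) \<Rightarrow> 'a vf \<Rightarrow> 'a vf" where
  "vf_mult h \<xi> = (\<lambda>f x. h x * \<xi> f x)"

definition vf_bracket :: "'a vf \<Rightarrow> 'a vf \<Rightarrow> 'a vf" where
  "vf_bracket \<xi> \<eta> = (\<lambda>f x. \<xi> (\<eta> f) x - \<eta> (\<xi> f) x)"

definition effective_divisor :: "('x, complex) cmanifold \<Rightarrow> ('x \<Rightarrow> nat) \<Rightarrow> bool" where
  "effective_divisor X D \<longleftrightarrow>
     (\<forall>x\<in>points X. \<exists>U. openin (mtop X) U \<and> x \<in> U \<and> finite {p\<in>U. D p \<noteq> 0})"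

definition div_support :: "('x, complex) cmanifold \<Rightarrow> ('x \<Rightarrow> nat) \<Rightarrow> 'x set" where
  "div_support X D = {p\<in>points X. D p \<noteq> 0}"

definition vanishes_to_order ::
  "('x, complex) cmanifold \<Rightarrow> nat \<Rightarrow> 'x \<Rightarrow> ('x \<Rightarrow> complex) \<Rightarrow> bool" where
  "vanishes_to_order X n p f \<longleftrightarrow>
     (\<exists>K h. coordinate X K \<and> p \<in> fst K \<and> holo_fun X (fst K) h \<and>
        (\<forall>x\<in>fst K. f x = (snd K x - snd K p) ^ n * h x))"

text \<open>Sections over \<open>U\<close> of the Lie algebroid of vector fields vanishing along \<open>D\<close>; its anchor is the
  inclusion and its bracket is \<open>vf_bracket\<close>.\<close>

definition vf_vanishing ::
  "('x, complex) cmanifold \<Rightarrow> ('x \<Rightarrow> nat) \<Rightarrow> 'x set \<Rightarrow> 'x vf \<Rightarrow> bool" where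
  "vf_vanishing X D U \<xi> \<longleftrightarrow> vector_field X U \<xi> \<and>
     (\<forall>V f. V \<subseteq> U \<and> holo_fun X V f \<longrightarrow> (\<forall>p\<in>V. vanishes_to_order X (D p) p (\<xi> f)))"


section \<open>Lie groupoids and their Lie algebroids\<close>

record ('x, 'g) groupoid =
  arrows :: "('g, complex \<times> complex) cmanifold"
  src :: "'g \<Rightarrow> 'x"
  tgt :: "'g \<Rightarrow> 'x"
  idn :: "'x \<Rightarrow> 'g"
  cmp :: "'g \<Rightarrow> 'g \<Rightarrow> 'g"
  ginv :: "'g \<Rightarrow> 'g"

definition is_groupoid :: "('x, complex) cmanifold \<Rightarrow> ('x, 'g) groupoid \<Rightarrow> bool" where
  "is_groupoid X G \<longleftrightarrow> (let A = points (arrows G); s = src G; t = tgt G in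
     (\<forall>g\<in>A. s g \<in> points X \<and> t g \<in> points X) \<and>
     (\<forall>x\<in>points X. idn G x \<in> A \<and> s (idn G x) = x \<and> t (idn G x) = x) \<and>
     (\<forall>g\<in>A. \<forall>h\<in>A. s g = t h \<longrightarrow>
        cmp G g h \<in> A \<and> s (cmp G g h) = s h \<and> t (cmp G g h) = t g) \<and>
     (\<forall>g\<in>A. \<forall>h\<in>A. \<forall>k\<in>A. s g = t h \<and> s h = t k \<longrightarrow>
        cmp G (cmp G g h) k = cmp G g (cmp G h k)) \<and>
     (\<forall>g\<in>A. cmp G g (idn G (s g)) = g \<and> cmp G (idn G (t g)) g = g) \<and>
     (\<forall>g\<in>A. ginv G g \<in> A \<and> s (ginv G g) = t g \<and> t (ginv G g) = s g \<and>
        cmp G (ginv G g) g = idn G (s g) \<and> cmp G g (ginv G g) = idn G (t g)))"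

text \<open>Holomorphy of the composition on the submanifold of composable pairs: near each composable pair
  it is, in charts, the restriction of a holomorphic map of the ambient product.\<close>

definition holo_composition :: "('x, 'g) groupoid \<Rightarrow> bool" where
  "holo_composition G \<longleftrightarrow>
     (\<forall>K\<in>atlas (arrows G). \<forall>L\<in>atlas (arrows G). \<forall>M\<in>atlas (arrows G).
      \<forall>g\<in>fst K. \<forall>h\<in>fst L. src G g = tgt G h \<and> cmp G g h \<in> fst M \<longrightarrow>
        (\<exists>N F. open N \<and> (snd K g, snd L h) \<in> N \<and> holo_on F N \<and>
           (\<forall>g'\<in>fst K. \<forall>h'\<in>fst L. src G g' = tgt G h' \<and> (snd K g', snd L h') \<in> N \<longrightarrow>
              cmp G g' h' \<in> fst M \<and> snd M (cmp G g' h') = F (snd K g', snd L h'))))"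

text \<open>The identity map is automatically an embedding, being a holomorphic section of \<open>src G\<close>.\<close>

definition lie_groupoid :: "('x, complex) cmanifold \<Rightarrow> ('x, 'g) groupoid \<Rightarrow> bool" where
  "lie_groupoid X G \<longleftrightarrow>
     complex_manifold (arrows G) \<and> is_groupoid X G \<and>
     holo_submersion (arrows G) X (src G) \<and> holo_submersion (arrows G) X (tgt G) \<and>
     holo_map X (arrows G) (idn G) \<and> holo_map (arrows G) (arrows G) (ginv G) \<and>
     holo_composition G"

definition simply_connected_space :: "'a topology \<Rightarrow> bool" where
  "simply_connected_space T \<longleftrightarrow> path_connected_space T \<and>
     (\<forall>\<gamma>. pathin T \<gamma> \<and> \<gamma> 1 = \<gamma> 0 \<longrightarrow>
        (\<exists>a\<in>topspace T. homotopic_with (\<lambda>r. r 1 = r 0) (top_of_set {0..1}) T \<gamma> (\<lambda>_. a)))"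

definition source_simply_connected :: "('x, complex) cmanifold \<Rightarrow> ('x, 'g) groupoid \<Rightarrow> bool" where
  "source_simply_connected X G \<longleftrightarrow>
     (\<forall>x\<in>points X. simply_connected_space
        (subtopology (mtop (arrows G)) {g\<in>points (arrows G). src G g = x}))"

definition src_pre :: "('x, 'g) groupoid \<Rightarrow> 'x set \<Rightarrow> 'g set" where
  "src_pre G U = {g\<in>points (arrows G). src G g \<in> U}"

definition tgt_pre :: "('x, 'g) groupoid \<Rightarrow> 'x set \<Rightarrow> 'g set" where
  "tgt_pre G U = {g\<in>points (arrows G). tgt G g \<in> U}"

text \<open>Sections over \<open>U\<close> of the Lie algebroid of \<open>G\<close>, as right-invariant vector fields on \<open>tgt_pre G U\<close>
  tangent to the source fibres. Right translation by \<open>k\<close> is only defined on the source fibre over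
  \<open>tgt G k\<close>, so invariance is tested on functions \<open>F'\<close> on an open set which restrict on that fibre to
  the right translate of a function \<open>F\<close>.\<close>

definition right_invariant_vf ::
  "('x, complex) cmanifold \<Rightarrow> ('x, 'g) groupoid \<Rightarrow> 'x set \<Rightarrow> 'g vf \<Rightarrow> bool" where
  "right_invariant_vf X G U \<zeta> \<longleftrightarrow>
     openin (mtop X) U \<and> vector_field (arrows G) (tgt_pre G U) \<zeta> \<and>
     (\<forall>V f. holo_fun X V f \<longrightarrow> (\<forall>g \<in> tgt_pre G U \<inter> src_pre G V. \<zeta> (f \<circ> src G) g = 0)) \<and>
     (\<forall>h k W W' F F'.
        h \<in> W \<and> k \<in> points (arrows G) \<and> src G h = tgt G k \<and> cmp G h k \<in> W' \<and>
        W \<subseteq> tgt_pre G U \<and> W' \<subseteq> tgt_pre G U \<and>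
        holo_fun (arrows G) W F' \<and> holo_fun (arrows G) W' F \<and>
        (\<forall>h'\<in>W. src G h' = tgt G k \<longrightarrow> cmp G h' k \<in> W' \<and> F' h' = F (cmp G h' k)) \<longrightarrow>
        \<zeta> F' h = \<zeta> F (cmp G h k))"

text \<open>An isomorphism \<open>\<theta>\<close> of Lie algebroids from the vector fields vanishing along \<open>D\<close> to the Lie
  algebroid of \<open>G\<close>: an isomorphism of sheaves of modules over the structure sheaf that preserves
  brackets and anchors. The anchor of \<open>G\<close> is the derivative of the target map at the identities.\<close>

definition lie_algebroid_iso ::
  "('x, complex) cmanifold \<Rightarrow> ('x \<Rightarrow> nat) \<Rightarrow> ('x, 'g) groupoid \<Rightarrow> ('x vf \<Rightarrow> 'g vf) \<Rightarrow> bool" where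
  "lie_algebroid_iso X D G \<theta> \<longleftrightarrow> (\<forall>U. openin (mtop X) U \<longrightarrow>
     (let A = vf_vanishing X D U; R = right_invariant_vf X G U;
          eqX = vf_eq X U; eqG = vf_eq (arrows G) (tgt_pre G U) in
      (\<forall>\<xi>. A \<xi> \<longrightarrow> R (\<theta> \<xi>)) \<and>
      (\<forall>\<xi> \<eta>. A \<xi> \<and> A \<eta> \<longrightarrow>
         (eqX \<xi> \<eta> \<longleftrightarrow> eqG (\<theta> \<xi>) (\<theta> \<eta>)) \<and>
         eqG (\<theta> (vf_add \<xi> \<eta>)) (vf_add (\<theta> \<xi>) (\<theta> \<eta>)) \<and>
         eqG (\<theta> (vf_bracket \<xi> \<eta>)) (vf_bracket (\<theta> \<xi>) (\<theta> \<eta>))) \<and>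
      (\<forall>\<xi> f. A \<xi> \<and> holo_fun X U f \<longrightarrow> eqG (\<theta> (vf_mult f \<xi>)) (vf_mult (f \<circ> tgt G) (\<theta> \<xi>))) \<and>
      (\<forall>\<zeta>. R \<zeta> \<longrightarrow> (\<exists>\<xi>. A \<xi> \<and> eqG (\<theta> \<xi>) \<zeta>)) \<and>
      (\<forall>\<xi> V f. A \<xi> \<and> V \<subseteq> U \<and> holo_fun X V f \<longrightarrow>
         (\<forall>x\<in>V. \<theta> \<xi> (f \<circ> tgt G) (idn G x) = \<xi> f x))))"

text \<open>\<open>G\<close>, with the identification \<open>\<theta>\<close> of its Lie algebroid, is the source-simply connected
  integration of the Lie algebroid of vector fields vanishing along \<open>D\<close>.\<close>

definition is_Pi1 ::
  "('x, complex) cmanifold \<Rightarrow> ('x \<Rightarrow> nat) \<Rightarrow> ('x, 'g) groupoid \<Rightarrow> ('x vf \<Rightarrow> 'g vf) \<Rightarrow> bool" where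
  "is_Pi1 X D G \<theta> \<longleftrightarrow>
     lie_groupoid X G \<and> lie_algebroid_iso X D G \<theta> \<and> source_simply_connected X G"

definition arrows_over ::
  "('x, complex) cmanifold \<Rightarrow> ('x \<Rightarrow> nat) \<Rightarrow> ('x, 'g) groupoid \<Rightarrow> 'g set" where
  "arrows_over X D G = src_pre G (div_support X D) \<inter> tgt_pre G (div_support X D)"


section \<open>Vector bundles and representations\<close>

type_synonym ('x, 'e, 'r) trivialization = "'x set \<times> ('e \<Rightarrow> complex^'r)"

record ('x, 'e, 'r) vbundle =
  total :: "'e set"
  proj :: "'e \<Rightarrow> 'x"
  vadd :: "'e \<Rightarrow> 'e \<Rightarrow> 'e"
  vscale :: "complex \<Rightarrow> 'e \<Rightarrow> 'e"
  trivs :: "('x, 'e, 'r) trivialization set"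

definition fibre :: "('x, 'e, 'r) vbundle \<Rightarrow> 'x \<Rightarrow> 'e set" where
  "fibre E x = {v\<in>total E. proj E v = x}"

definition frame :: "('x, 'e, 'r::finite) vbundle \<Rightarrow> ('x, 'e, 'r) trivialization \<Rightarrow> 'x \<Rightarrow> 'r \<Rightarrow> 'e"
  where
  "frame E \<tau> x j = inv_into (fibre E x) (snd \<tau>) (axis j 1)"

text \<open>Matrix of a map \<open>T\<close> from the fibre of \<open>E\<close> at \<open>x\<close> to a fibre of a second bundle, in the frame
  \<open>\<tau>\<close> of \<open>E\<close> and the frame \<open>\<sigma>\<close> of the second bundle.\<close>

definition frame_matrix ::
  "('x, 'e, 'r::finite) vbundle \<Rightarrow> ('x, 'e, 'r) trivialization \<Rightarrow> ('x, 'f, 'q::finite) trivialization \<Rightarrow>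
   ('e \<Rightarrow> 'f) \<Rightarrow> 'x \<Rightarrow> complex^'r^'q" where
  "frame_matrix E \<tau> \<sigma> T x = (\<chi> i j. snd \<sigma> (T (frame E \<tau> x j)) $ i)"

definition fibrewise_linear_chart ::
  "('x, complex) cmanifold \<Rightarrow> ('x, 'e, 'r::finite) vbundle \<Rightarrow> ('x, 'e, 'r) trivialization \<Rightarrow> bool"
  where
  "fibrewise_linear_chart X E \<tau> \<longleftrightarrow> openin (mtop X) (fst \<tau>) \<and>
     (\<forall>x\<in>fst \<tau>. bij_betw (snd \<tau>) (fibre E x) UNIV \<and>
        (\<forall>v\<in>fibre E x. \<forall>w\<in>fibre E x.
           vadd E v w \<in> fibre E x \<and> snd \<tau> (vadd E v w) = snd \<tau> v + snd \<tau> w) \<and>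
        (\<forall>a. \<forall>v\<in>fibre E x. vscale E a v \<in> fibre E x \<and> snd \<tau> (vscale E a v) = a *s snd \<tau> v))"

definition triv_transition ::
  "('x, complex) cmanifold \<Rightarrow> ('x, 'e, 'r::finite) vbundle \<Rightarrow>
   ('x, 'e, 'r) trivialization \<Rightarrow> ('x, 'e, 'r) trivialization \<Rightarrow> bool" where
  "triv_transition X E \<tau> \<tau>' \<longleftrightarrow> holo_fun X (fst \<tau> \<inter> fst \<tau>') (frame_matrix E \<tau> \<tau>' id)"

definition vector_bundle ::
  "('x, complex) cmanifold \<Rightarrow> ('x, 'e, 'r::finite) vbundle \<Rightarrow> bool" where
  "vector_bundle X E \<longleftrightarrow>
     proj E ` total E \<subseteq> points X \<and>
     (\<forall>\<tau>\<in>trivs E. fibrewise_linear_chart X E \<tau>) \<and>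
     (\<Union>\<tau>\<in>trivs E. fst \<tau>) = points X \<and>
     (\<forall>\<tau>\<in>trivs E. \<forall>\<tau>'\<in>trivs E. triv_transition X E \<tau> \<tau>')"

text \<open>Arbitrary local holomorphic frames, i.e. the maximal family of trivializations.\<close>

definition local_frame ::
  "('x, complex) cmanifold \<Rightarrow> ('x, 'e, 'r::finite) vbundle \<Rightarrow> ('x, 'e, 'r) trivialization \<Rightarrow> bool"
  where
  "local_frame X E \<tau> \<longleftrightarrow> fibrewise_linear_chart X E \<tau> \<and>
     (\<forall>\<tau>'\<in>trivs E. triv_transition X E \<tau> \<tau>' \<and> triv_transition X E \<tau>' \<tau>)"

definition holo_section ::
  "('x, complex) cmanifold \<Rightarrow> ('x, 'e, 'r::finite) vbundle \<Rightarrow> 'x set \<Rightarrow> ('x \<Rightarrow> 'e) \<Rightarrow> bool" where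
  "holo_section X E U u \<longleftrightarrow> openin (mtop X) U \<and> (\<forall>x\<in>U. u x \<in> fibre E x) \<and>
     (\<forall>\<tau>\<in>trivs E. holo_fun X (U \<inter> fst \<tau>) (snd \<tau> \<circ> u))"

text \<open>A flat connection along the vector fields vanishing along \<open>D\<close>. As for vector fields, one operator
  \<open>nabla\<close> on total functions encodes a morphism of sheaves.\<close>

type_synonym ('x, 'e) connection = "'x vf \<Rightarrow> ('x \<Rightarrow> 'e) \<Rightarrow> 'x \<Rightarrow> 'e"

definition flat_connection ::
  "('x, complex) cmanifold \<Rightarrow> ('x \<Rightarrow> nat) \<Rightarrow> ('x, 'e, 'r::finite) vbundle \<Rightarrow>
   ('x, 'e) connection \<Rightarrow> bool" where
  "flat_connection X D E nabla \<longleftrightarrow>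
     (\<forall>U \<xi> u. vf_vanishing X D U \<xi> \<and> holo_section X E U u \<longrightarrow>
        holo_section X E U (nabla \<xi> u) \<and>
        (\<forall>f. holo_fun X U f \<longrightarrow> (\<forall>x\<in>U.
           nabla (vf_mult f \<xi>) u x = vscale E (f x) (nabla \<xi> u x) \<and>
           nabla \<xi> (\<lambda>y. vscale E (f y) (u y)) x =
             vadd E (vscale E (\<xi> f x) (u x)) (vscale E (f x) (nabla \<xi> u x)))) \<and>
        (\<forall>v. holo_section X E U v \<longrightarrow> (\<forall>x\<in>U.
           nabla \<xi> (\<lambda>y. vadd E (u y) (v y)) x = vadd E (nabla \<xi> u x) (nabla \<xi> v x))) \<and>
        (\<forall>\<eta>. vf_vanishing X D U \<eta> \<longrightarrow> (\<forall>x\<in>U.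
           nabla (vf_add \<xi> \<eta>) u x = vadd E (nabla \<xi> u x) (nabla \<eta> u x) \<and>
           nabla \<xi> (nabla \<eta> u) x =
             vadd E (nabla \<eta> (nabla \<xi> u) x) (nabla (vf_bracket \<xi> \<eta>) u x))) \<and>
        (\<forall>\<eta> v. vf_vanishing X D U \<eta> \<and> vf_eq X U \<xi> \<eta> \<and>
           holo_section X E U v \<and> (\<forall>x\<in>U. u x = v x) \<longrightarrow>
           (\<forall>x\<in>U. nabla \<xi> u x = nabla \<eta> v x)))"

definition algebroid_rep ::
  "('x, complex) cmanifold \<Rightarrow> ('x \<Rightarrow> nat) \<Rightarrow> ('x, 'e, 'r::finite) vbundle \<Rightarrow>
   ('x, 'e) connection \<Rightarrow> bool" where
  "algebroid_rep X D E nabla \<longleftrightarrow> vector_bundle X E \<and> flat_connection X D E nabla"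

definition groupoid_rep ::
  "('x, complex) cmanifold \<Rightarrow> ('x, 'g) groupoid \<Rightarrow> ('x, 'e, 'r::finite) vbundle \<Rightarrow>
   ('g \<Rightarrow> 'e \<Rightarrow> 'e) \<Rightarrow> bool" where
  "groupoid_rep X G E \<Psi> \<longleftrightarrow>
     (\<forall>g\<in>points (arrows G).
        bij_betw (\<Psi> g) (fibre E (src G g)) (fibre E (tgt G g)) \<and>
        (\<forall>v\<in>fibre E (src G g). \<forall>w\<in>fibre E (src G g).
           \<Psi> g (vadd E v w) = vadd E (\<Psi> g v) (\<Psi> g w)) \<and>
        (\<forall>a. \<forall>v\<in>fibre E (src G g). \<Psi> g (vscale E a v) = vscale E a (\<Psi> g v))) \<and>
     (\<forall>\<tau>\<in>trivs E. \<forall>\<tau>'\<in>trivs E.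
        holo_fun (arrows G) (src_pre G (fst \<tau>) \<inter> tgt_pre G (fst \<tau>'))
          (\<lambda>g. frame_matrix E \<tau> \<tau>' (\<Psi> g) (src G g))) \<and>
     (\<forall>g\<in>points (arrows G). \<forall>h\<in>points (arrows G). src G g = tgt G h \<longrightarrow>
        (\<forall>v\<in>fibre E (src G h). \<Psi> (cmp G g h) v = \<Psi> g (\<Psi> h v)))"

text \<open>\<open>\<Psi>\<close> integrates \<open>nabla\<close>: the covariant derivative of a section \<open>u\<close> at \<open>x\<close> along \<open>\<xi>\<close> is the
  derivative at the identity of \<open>x\<close>, in the direction of \<open>\<theta> \<xi>\<close> (which is tangent to the source fibre),
  of \<open>g \<mapsto> \<Psi>(g)\<^sup>-\<^sup>1 (u (t g))\<close>, a function with values in the fibre at \<open>x\<close>.\<close>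

definition integrates_connection ::
  "('x, complex) cmanifold \<Rightarrow> ('x \<Rightarrow> nat) \<Rightarrow> ('x, 'g) groupoid \<Rightarrow> ('x vf \<Rightarrow> 'g vf) \<Rightarrow>
   ('x, 'e, 'r::finite) vbundle \<Rightarrow> ('x, 'e) connection \<Rightarrow> ('g \<Rightarrow> 'e \<Rightarrow> 'e) \<Rightarrow> bool" where
  "integrates_connection X D G \<theta> E nabla \<Psi> \<longleftrightarrow> groupoid_rep X G E \<Psi> \<and>
     (\<forall>U \<xi> u. vf_vanishing X D U \<xi> \<and> holo_section X E U u \<longrightarrow>
        (\<forall>\<tau>\<in>trivs E. \<forall>x \<in> U \<inter> fst \<tau>. \<forall>i.
           \<theta> \<xi> (\<lambda>g. snd \<tau> (\<Psi> (ginv G g) (u (tgt G g))) $ i) (idn G x) = snd \<tau> (nabla \<xi> u x) $ i))"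


section \<open>Power series expansions\<close>

text \<open>A power series in two variables is an element of \<open>complex fps fps\<close>; the coefficient of
  \<open>u ^ i * v ^ j\<close> in \<open>F\<close> is \<open>fps_nth (fps_nth F i) j\<close>.\<close>

definition fps2_expansion :: "(complex \<times> complex \<Rightarrow> complex) \<Rightarrow> complex \<times> complex \<Rightarrow> complex fps fps"
  where
  "fps2_expansion f z = Abs_fps (\<lambda>i. Abs_fps (\<lambda>j.
     (deriv ^^ i) (\<lambda>u. (deriv ^^ j) (\<lambda>v. f (u, v)) (snd z)) (fst z) / (fact i * fact j)))"

text \<open>Substitution of \<open>F\<close>, which must have zero constant coefficient, into \<open>a\<close>: the powers of \<open>F\<close>
  with exponent above \<open>i + j\<close> do not contribute to the coefficient of \<open>u ^ i * v ^ j\<close>.\<close>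

definition fps2_subst :: "complex fps \<Rightarrow> complex fps fps \<Rightarrow> complex fps fps" where
  "fps2_subst a F = Abs_fps (\<lambda>i. Abs_fps (\<lambda>j.
     \<Sum>k\<le>i + j. fps_nth a k * fps_nth (fps_nth (F ^ k) i) j))"

definition fps2_convergent :: "complex fps fps \<Rightarrow> bool" where
  "fps2_convergent F \<longleftrightarrow> (\<exists>r>0. \<forall>u v. cmod u < r \<and> cmod v < r \<longrightarrow>
     (\<lambda>(i, j). fps_nth (fps_nth F i) j * u ^ i * v ^ j) summable_on UNIV)"

text \<open>Expansions of a function on a manifold at \<open>p\<close>, in the coordinates \<open>K\<close> recentred at \<open>p\<close>.\<close>

definition expand :: "('x, complex) chart \<Rightarrow> 'x \<Rightarrow> ('x \<Rightarrow> complex) \<Rightarrow> complex fps" where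
  "expand K p f = fps_expansion (f \<circ> chart_inv K) (snd K p)"

definition expand2 ::
  "('g, complex \<times> complex) chart \<Rightarrow> 'g \<Rightarrow> ('g \<Rightarrow> complex) \<Rightarrow> complex fps fps" where
  "expand2 K g f = fps2_expansion (f \<circ> chart_inv K) (snd K g)"

definition expand_matrix ::
  "('x, complex) chart \<Rightarrow> 'x \<Rightarrow> ('x \<Rightarrow> complex^'r^'q) \<Rightarrow> (complex fps)^'r^'q" where
  "expand_matrix K p T = (\<chi> i j. expand K p (\<lambda>x. T x $ i $ j))"

definition expand2_matrix ::
  "('g, complex \<times> complex) chart \<Rightarrow> 'g \<Rightarrow> ('g \<Rightarrow> complex^'r^'q) \<Rightarrow> (complex fps fps)^'r^'q" where
  "expand2_matrix K g T = (\<chi> i j. expand2 K g (\<lambda>h. T h $ i $ j))"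


section \<open>The formal neighbourhood of the divisor\<close>

text \<open>The support of \<open>D\<close> is discrete, so a morphism of bundles over the formal neighbourhood of \<open>D\<close>
  is a matrix of power series at each point \<open>p\<close> of the support, for each coordinate \<open>K\<close> at \<open>p\<close> and
  frames \<open>\<tau>\<close>, \<open>\<sigma>\<close> of the two bundles near \<open>p\<close>, transforming in the evident way under changes of
  coordinate and frames.\<close>

type_synonym ('x, 'e, 'r, 'f, 'q) formal_hom =
  "'x \<Rightarrow> ('x, complex) chart \<Rightarrow> ('x, 'e, 'r) trivialization \<Rightarrow> ('x, 'f, 'q) trivialization \<Rightarrow>
   (complex fps)^'r^'q"

definition adapted ::
  "('x, complex) cmanifold \<Rightarrow> ('x, 'e, 'r::finite) vbundle \<Rightarrow> ('x, 'f, 'q::finite) vbundle \<Rightarrow>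
   'x \<Rightarrow> ('x, complex) chart \<Rightarrow> ('x, 'e, 'r) trivialization \<Rightarrow> ('x, 'f, 'q) trivialization \<Rightarrow> bool"
  where
  "adapted X E F p K \<tau> \<sigma> \<longleftrightarrow>
     coordinate X K \<and> local_frame X E \<tau> \<and> local_frame X F \<sigma> \<and> p \<in> fst K \<inter> fst \<tau> \<inter> fst \<sigma>"

definition formal_isomorphism ::
  "('x, complex) cmanifold \<Rightarrow> ('x \<Rightarrow> nat) \<Rightarrow> ('x, 'e, 'r::finite) vbundle \<Rightarrow>
   ('x, 'f, 'q::finite) vbundle \<Rightarrow> ('x, 'e, 'r, 'f, 'q) formal_hom \<Rightarrow> bool" where
  "formal_isomorphism X D E F \<phi> \<longleftrightarrow>
     (\<forall>p\<in>div_support X D. \<forall>K \<tau> \<sigma>. adapted X E F p K \<tau> \<sigma> \<longrightarrow>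
        invertible (\<phi> p K \<tau> \<sigma>) \<and>
        (\<forall>K' \<tau>' \<sigma>'. adapted X E F p K' \<tau>' \<sigma>' \<longrightarrow>
           \<phi> p K \<tau> \<sigma> =
             expand_matrix K p (frame_matrix F \<sigma>' \<sigma> id) **
             map_matrix (\<lambda>a. fps_compose a (expand K p (\<lambda>x. snd K' x - snd K' p)))
               (\<phi> p K' \<tau>' \<sigma>') **
             expand_matrix K p (frame_matrix E \<tau> \<tau>' id)))"

text \<open>With \<open>z\<close> the coordinate \<open>K\<close> recentred at \<open>p\<close>, this is the local generator \<open>z ^ n * d/dz\<close> of the
  vector fields vanishing to order \<open>n\<close> at \<open>p\<close>.\<close>

definition vf_generator :: "('x, complex) chart \<Rightarrow> 'x \<Rightarrow> nat \<Rightarrow> 'x vf" where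
  "vf_generator K p n = (\<lambda>f x. (snd K x - snd K p) ^ n * deriv (f \<circ> chart_inv K) (snd K x))"

text \<open>The restriction of \<open>nabla\<close> to the formal neighbourhood, contracted with the generator of the
  vector fields vanishing along \<open>D\<close> (equivalently, the coefficient of the generator
  \<open>dz / z ^ D p\<close> of the forms with poles bounded by \<open>D\<close>): it acts on formal sections, written in the
  frame \<open>\<tau>\<close>, by the Leibniz rule and the expansions of the covariant derivatives of the frame.\<close>

definition formal_connection ::
  "('x \<Rightarrow> nat) \<Rightarrow> ('x, 'e, 'r::finite) vbundle \<Rightarrow> ('x, 'e) connection \<Rightarrow> 'x \<Rightarrow>
   ('x, complex) chart \<Rightarrow> ('x, 'e, 'r) trivialization \<Rightarrow> (complex fps)^'r \<Rightarrow> (complex fps)^'r" where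
  "formal_connection D E nabla p K \<tau> u =
     (\<chi> i. fps_X ^ D p * fps_deriv (u $ i)) +
     (\<chi> i j. expand K p
        (\<lambda>x. snd \<tau> (nabla (vf_generator K p (D p)) (\<lambda>y. frame E \<tau> y j) x) $ i)) *v u"

definition formally_intertwines ::
  "('x, complex) cmanifold \<Rightarrow> ('x \<Rightarrow> nat) \<Rightarrow> ('x, 'e, 'r::finite) vbundle \<Rightarrow> ('x, 'e) connection \<Rightarrow>
   ('x, 'f, 'q::finite) vbundle \<Rightarrow> ('x, 'f) connection \<Rightarrow> ('x, 'e, 'r, 'f, 'q) formal_hom \<Rightarrow> bool"
  where
  "formally_intertwines X D E nabla F nabla' \<phi> \<longleftrightarrow>
     (\<forall>p\<in>div_support X D. \<forall>K \<tau> \<sigma>. adapted X E F p K \<tau> \<sigma> \<longrightarrow>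
        (\<forall>u. \<phi> p K \<tau> \<sigma> *v formal_connection D E nabla p K \<tau> u =
             formal_connection D F nabla' p K \<sigma> (\<phi> p K \<tau> \<sigma> *v u)))"


section \<open>The formal neighbourhood of the full subgroupoid over the divisor\<close>

text \<open>A section over the formal completion of \<open>arrows G\<close> along \<open>arrows_over X D G\<close> is recorded through
  its power series at all points \<open>g\<close> of \<open>arrows_over X D G\<close>, in arbitrary coordinates \<open>K\<close> of
  \<open>arrows G\<close> at \<open>g\<close> and frames near \<open>src G g\<close> and \<open>tgt G g\<close>; these series determine it.\<close>

definition formal_groupoid_rep ::
  "('x, 'g) groupoid \<Rightarrow> ('x, 'e, 'r::finite) vbundle \<Rightarrow> ('g \<Rightarrow> 'e \<Rightarrow> 'e) \<Rightarrow> 'g \<Rightarrow>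
   ('g, complex \<times> complex) chart \<Rightarrow> ('x, 'e, 'r) trivialization \<Rightarrow> ('x, 'e, 'r) trivialization \<Rightarrow>
   (complex fps fps)^'r^'r" where
  "formal_groupoid_rep G E \<Psi> g K \<tau>s \<tau>t =
     expand2_matrix K g (\<lambda>h. frame_matrix E \<tau>s \<tau>t (\<Psi> h) (src G h))"

text \<open>The pullback of \<open>\<phi>\<close> along a map \<open>f\<close> (the source or target map), at \<open>g\<close>.\<close>

definition formal_pullback ::
  "('g \<Rightarrow> 'x) \<Rightarrow> ('x, 'e, 'r::finite, 'f, 'q::finite) formal_hom \<Rightarrow> 'g \<Rightarrow>
   ('g, complex \<times> complex) chart \<Rightarrow> ('x, complex) chart \<Rightarrow>
   ('x, 'e, 'r) trivialization \<Rightarrow> ('x, 'f, 'q) trivialization \<Rightarrow> (complex fps fps)^'r^'q" where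
  "formal_pullback f \<phi> g K L \<tau> \<sigma> =
     map_matrix (\<lambda>a. fps2_subst a (expand2 K g (\<lambda>h. snd L (f h) - snd L (f g))))
       (\<phi> (f g) L \<tau> \<sigma>)"

definition formal_Sigma ::
  "('x, 'g) groupoid \<Rightarrow> ('x, 'e, 'r::finite) vbundle \<Rightarrow> ('g \<Rightarrow> 'e \<Rightarrow> 'e) \<Rightarrow>
   ('x, 'e, 'r, 'f, 'q::finite) formal_hom \<Rightarrow> 'g \<Rightarrow> ('g, complex \<times> complex) chart \<Rightarrow>
   ('x, complex) chart \<Rightarrow> ('x, complex) chart \<Rightarrow>
   ('x, 'e, 'r) trivialization \<Rightarrow> ('x, 'e, 'r) trivialization \<Rightarrow>
   ('x, 'f, 'q) trivialization \<Rightarrow> ('x, 'f, 'q) trivialization \<Rightarrow> (complex fps fps)^'q^'q" where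
  "formal_Sigma G E \<Psi> \<phi> g K Ls Lt \<tau>s \<tau>t \<sigma>s \<sigma>t =
     formal_pullback (tgt G) \<phi> g K Lt \<tau>t \<sigma>t **
     formal_groupoid_rep G E \<Psi> g K \<tau>s \<tau>t **
     matrix_inv (formal_pullback (src G) \<phi> g K Ls \<tau>s \<sigma>s)"

end

theory Submission
  imports Defs
begin

text \<open>Near a point \<open>p\<close> of \<open>D\<close> of multiplicity \<open>n\<close>, let \<open>z\<close> be a coordinate centred at \<open>p\<close>. Truncating
  the series of \<open>\<phi>\<close> at order \<open>N\<close> gives a holomorphic matrix \<open>P\<close> which intertwines the two connections up
  to a residual in \<open>O(z ^ N)\<close>. Both groupoid representations solve linear equations along the
  right-invariant vector field \<open>\<theta> (z ^ n * d/dz)\<close>, so the derivative of \<open>\<Psi>2(h)\<^sup>-\<^sup>1 * P(t h) * \<Psi>1(h) - P(s h)\<close>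
  along it is in \<open>O(z(t h) ^ N)\<close>. This matrix vanishes at the identities; integrating along the source
  fibres, where that vector field degenerates to order \<open>n\<close>, the defect \<open>P(t h) * \<Psi>1(h) - \<Psi>2(h) * P(s h)\<close>
  is in \<open>O(z(s h) ^ (N - n))\<close> near the identity of \<open>p\<close>. The defect is a cocycle, so the set of arrows at
  which this estimate holds is open and closed in the source fibre of \<open>p\<close>, which is connected, and which
  is contained in the full subgroupoid over \<open>D\<close> because the orbit of \<open>p\<close> is \<open>{p}\<close>. Letting \<open>N\<close> tend to
  infinity, all Taylor coefficients of the difference of \<open>(t\<^sup>*\<phi>) \<Psi>1\<close> and \<open>\<Psi>2 (s\<^sup>*\<phi>)\<close> vanish.\<close>

section \<open>Complex differentiability at a point\<close>

text \<open>The arrow space is not given by formulas: \<open>\<theta>\<close> is only known to be an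
  isomorphism of sheaves. That the orbit of \<open>p\<close> is a point is therefore extracted from
  the surjectivity of \<open>\<theta>\<close>: were the target regular along the source fibre at the
  unit of \<open>p\<close>, differentiation with respect to the target would be a right-invariant
  field that no vector field vanishing at \<open>p\<close> induces. So the target is critical there,
  and translations in the groupoid turn this critical point into constancy. Truncation is forced
  because \<open>\<theta> \<xi>\<close> acts on holomorphic functions only, so a formal series must
  become a polynomial before it can be differentiated. The loss of \<open>n\<close> orders comes
  from the coefficient of \<open>\<theta> \<xi>\<close> in a chart, which is unknown; it is
  eliminated against the known value of \<open>\<theta> \<xi>\<close> on the coordinate of the
  target. The loss is harmless as \<open>N\<close> is arbitrary. Estimates are Landau bounds along
  \<open>nhdsin\<close>, which make sense on a non-Hausdorff arrow space. Holomorphy means complex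
  differentiability only, whence the Cauchy theory in two variables at the start.\<close>

definition cdiff :: "('a::complex_normed_space \<Rightarrow> 'b::complex_normed_space) \<Rightarrow> 'a \<Rightarrow> bool" where
  "cdiff f z \<longleftrightarrow> (\<exists>f'. (f has_derivative f') (at z) \<and> (\<forall>a h. f' (a *\<^sub>C h) = a *\<^sub>C f' h))"

lemma holo_on_iff_cdiff: "holo_on f S \<longleftrightarrow> (\<forall>z\<in>S. cdiff f z)"
  by (simp add: holo_on_def cdiff_def)

lemma cdiffI:
  "(f has_derivative f') (at z) \<Longrightarrow> (\<And>a h. f' (a *\<^sub>C h) = a *\<^sub>C f' h) \<Longrightarrow> cdiff f z"
  by (auto simp: cdiff_def)

lemma cdiff_imp_isCont: "cdiff f z \<Longrightarrow> isCont f z"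
  using cdiff_def has_derivative_continuous by blast

lemma cdiff_complex_iff:
  fixes f :: "complex \<Rightarrow> complex"
  shows "cdiff f z \<longleftrightarrow> f field_differentiable (at z)"
proof
  assume "cdiff f z"
  then obtain f' where f': "(f has_derivative f') (at z)" "\<And>a h. f' (a * h) = a * f' h"
    unfolding cdiff_def scaleC_complex_def by blast
  have "f' = (*) (f' 1)"
  proof
    fix h show "f' h = f' 1 * h"
      using f'(2)[of h 1] by (simp add: mult.commute)
  qed
  then show "f field_differentiable (at z)"
    using f'(1) by (metis field_differentiable_def has_field_derivative_def)
next
  assume "f field_differentiable (at z)"
  then show "cdiff f z"
    by (auto simp: field_differentiable_def has_field_derivative_def cdiff_def scaleC_complex_def)
qed

lemma cdiff_cong:
  assumes "\<forall>\<^sub>F y in nhds z. f y = g y"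
  shows "cdiff f z \<longleftrightarrow> cdiff g z"
proof -
  have *: "(g has_derivative f') (at z)"
    if "\<forall>\<^sub>F y in nhds z. f y = g y" "(f has_derivative f') (at z)" for f g :: "'a \<Rightarrow> 'b" and f'
  proof (rule has_derivative_transform_eventually[OF that(2)])
    show "\<forall>\<^sub>F x' in at z. f x' = g x'"
      using that(1) by (simp add: eventually_at_filter eventually_mono)
  qed (use that(1) eventually_nhds_x_imp_x in auto)
  have "\<forall>\<^sub>F y in nhds z. g y = f y"
    using assms by (rule eventually_mono) simp
  then have "(f has_derivative f') (at z) \<longleftrightarrow> (g has_derivative f') (at z)" for f'
    using *[OF assms] *[of g f] by blast
  then show ?thesis by (simp add: cdiff_def)
qed

lemma cdiff_cong_open:
  assumes "open S" "z \<in> S" "\<And>y. y \<in> S \<Longrightarrow> f y = g y"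
  shows "cdiff f z \<longleftrightarrow> cdiff g z"
  using assms by (intro cdiff_cong) (auto simp: eventually_nhds)

lemma cdiff_compose:
  assumes "cdiff f z" "cdiff g (f z)"
  shows "cdiff (\<lambda>x. g (f x)) z"
proof -
  obtain f' g' where *: "(f has_derivative f') (at z)" "\<And>a h. f' (a *\<^sub>C h) = a *\<^sub>C f' h"
    "(g has_derivative g') (at (f z))" "\<And>a h. g' (a *\<^sub>C h) = a *\<^sub>C g' h"
    using assms unfolding cdiff_def by blast
  show ?thesis
    by (rule cdiffI[OF diff_chain_at[OF *(1,3), unfolded o_def]]) (simp add: * o_def)
qed

lemma cdiff_const [simp, intro]: "cdiff (\<lambda>_. c) z"
proof (rule cdiffI)
  show "((\<lambda>_. c) has_derivative (\<lambda>_. 0)) (at z)" by simp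
\<comment> \<open>The remaining goal is \<open>0 = a *\<^sub>C 0\<close>, which is decided by taking
  norms.\<close>
qed (metis norm_scaleC norm_zero mult_zero_right norm_eq_zero)

lemma cdiff_ident [simp, intro]: "cdiff (\<lambda>x. x) z"
  by (rule cdiffI[of _ "\<lambda>h. h"]) auto

lemma cdiff_Pair:
  assumes "cdiff f z" "cdiff g z"
  shows "cdiff (\<lambda>x. (f x, g x)) z"
proof -
  obtain f' g' where *: "(f has_derivative f') (at z)" "\<And>a h. f' (a *\<^sub>C h) = a *\<^sub>C f' h"
    "(g has_derivative g') (at z)" "\<And>a h. g' (a *\<^sub>C h) = a *\<^sub>C g' h"
    using assms unfolding cdiff_def by blast
  show ?thesis
    by (rule cdiffI[OF has_derivative_Pair[OF *(1,3)]]) (simp add: * scaleC_prod_def)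
qed

lemma cdiff_fst_proj [simp, intro]: "cdiff fst z"
  by (rule cdiffI[of _ fst]) (auto intro!: derivative_eq_intros simp: scaleC_prod_def)

lemma cdiff_snd_proj [simp, intro]: "cdiff snd z"
  by (rule cdiffI[of _ snd]) (auto intro!: derivative_eq_intros simp: scaleC_prod_def)

lemma cdiff_fst: "cdiff f z \<Longrightarrow> cdiff (\<lambda>x. fst (f x)) z"
  by (rule cdiff_compose) auto

lemma cdiff_snd: "cdiff f z \<Longrightarrow> cdiff (\<lambda>x. snd (f x)) z"
  by (rule cdiff_compose) auto

lemma cdiff_add:
  assumes "cdiff f z" "cdiff g z"
  shows "cdiff (\<lambda>x. f x + g x) z"
proof -
  obtain f' g' where *: "(f has_derivative f') (at z)" "\<And>a h. f' (a *\<^sub>C h) = a *\<^sub>C f' h"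
    "(g has_derivative g') (at z)" "\<And>a h. g' (a *\<^sub>C h) = a *\<^sub>C g' h"
    using assms unfolding cdiff_def by blast
  show ?thesis
    by (rule cdiffI[OF has_derivative_add[OF *(1,3)]]) (simp add: * scaleC_add_right)
qed

lemma cdiff_mult:
  fixes f g :: "'a::complex_normed_space \<Rightarrow> complex"
  assumes "cdiff f z" "cdiff g z"
  shows "cdiff (\<lambda>x. f x * g x) z"
proof -
  obtain f' g' where *: "(f has_derivative f') (at z)" "\<And>a h. f' (a *\<^sub>C h) = a *\<^sub>C f' h"
    "(g has_derivative g') (at z)" "\<And>a h. g' (a *\<^sub>C h) = a *\<^sub>C g' h"
    using assms unfolding cdiff_def by blast
  show ?thesis
    by (rule cdiffI[OF has_derivative_mult[OF *(1,3)]]) (simp add: * scaleC_complex_def algebra_simps)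
qed

lemma cdiff_minus: "cdiff f z \<Longrightarrow> cdiff (\<lambda>x. - f x) z" for f :: "_ \<Rightarrow> complex"
  using cdiff_mult[of "\<lambda>_. -1" z f] by simp

lemma cdiff_diff: "cdiff f z \<Longrightarrow> cdiff g z \<Longrightarrow> cdiff (\<lambda>x. f x - g x) z" for f :: "_ \<Rightarrow> complex"
  using cdiff_add[of f z "\<lambda>x. - g x"] cdiff_minus[of g z] by simp

lemma cdiff_power: "cdiff f z \<Longrightarrow> cdiff (\<lambda>x. f x ^ n) z" for f :: "_ \<Rightarrow> complex"
  by (induction n) (auto intro: cdiff_mult)

lemma cdiff_sum: "(\<And>i. i \<in> A \<Longrightarrow> cdiff (f i) z) \<Longrightarrow> cdiff (\<lambda>x. \<Sum>i\<in>A. f i x) z"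
  by (induction A rule: infinite_finite_induct) (auto intro: cdiff_add)

text \<open>Serves to reassemble a vector-valued map from its components by a finite sum of linear
  embeddings.\<close>

lemma bounded_linear_axis: "bounded_linear (axis i :: 'b::real_normed_vector \<Rightarrow> 'b^'n::finite)"
proof (rule bounded_linear_intro[of _ 1])
  fix x :: 'b
  have "(norm (axis i x $ j :: 'b))\<^sup>2 = (if j = i then (norm x)\<^sup>2 else 0)" for j :: 'n
    by (simp add: axis_def)
  then have "norm (axis i x :: 'b^'n) = norm x"
    by (simp add: norm_vec_def L2_set_def)
  then show "norm (axis i x :: 'b^'n) \<le> norm x * 1" by simp
qed (auto simp: axis_def vec_eq_iff)

lemma cdiff_vec_iff:
  fixes f :: "'a::complex_normed_space \<Rightarrow> 'b::complex_normed_space^'n::finite"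
  shows "cdiff f z \<longleftrightarrow> (\<forall>i. cdiff (\<lambda>x. f x $ i) z)"
proof
  assume f: "cdiff f z"
  show "\<forall>i. cdiff (\<lambda>x. f x $ i) z"
  proof
    fix i
    have "cdiff (\<lambda>v::'b^'n. v $ i) (f z)"
      by (rule cdiffI[OF bounded_linear_imp_has_derivative[OF bounded_linear_vec_nth]])
        (simp add: scaleC_vec_def)
    from cdiff_compose[OF f this] show "cdiff (\<lambda>x. f x $ i) z" .
  qed
next
  assume f: "\<forall>i. cdiff (\<lambda>x. f x $ i) z"
  have zero: "a *\<^sub>C 0 = (0::'b)" for a
    by (metis norm_scaleC norm_zero mult_zero_right norm_eq_zero)
  have "cdiff (axis i :: 'b \<Rightarrow> 'b^'n) v" for i v
    by (rule cdiffI[OF bounded_linear_imp_has_derivative[OF bounded_linear_axis]])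
      (auto simp: scaleC_vec_def axis_def vec_eq_iff zero)
  with f have "cdiff (\<lambda>x. \<Sum>i\<in>UNIV. axis i (f x $ i)) z"
    by (intro cdiff_sum) (auto intro: cdiff_compose)
  moreover have "(\<Sum>i\<in>UNIV. axis i (f x $ i)) = f x" for x
    by (simp add: vec_eq_iff axis_def if_distrib cong: if_cong)
  ultimately show "cdiff f z" by simp
qed

section \<open>Functions of two complex variables\<close>

definition D1 :: "(complex \<times> complex \<Rightarrow> complex) \<Rightarrow> complex \<times> complex \<Rightarrow> complex" where
  "D1 f z = deriv (\<lambda>u. f (u, snd z)) (fst z)"

definition D2 :: "(complex \<times> complex \<Rightarrow> complex) \<Rightarrow> complex \<times> complex \<Rightarrow> complex" where
  "D2 f z = deriv (\<lambda>v. f (fst z, v)) (snd z)"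

text \<open>Through this symmetry the results on the second partial derivative follow from those on
  the first.\<close>

lemma D1_swap: "D1 (f \<circ> prod.swap) (prod.swap z) = D2 f z"
  by (simp add: D1_def D2_def)

lemma open_swap_image: "open W \<Longrightarrow> open (prod.swap ` W)"
  for W :: "('a::topological_space \<times> 'b::topological_space) set"
proof -
  assume W: "open W"
  have "prod.swap ` W = prod.swap -` W"
    by force
  then show ?thesis
    using W by (simp add: open_vimage continuous_on_swap)
qed

lemma product_box_in_open:
  fixes z :: "complex \<times> complex"
  assumes "open W" "z \<in> W"
  obtains r :: real where "r > 0" "cball (fst z) r \<times> cball (snd z) r \<subseteq> W"
proof -
  obtain A B where AB: "open A" "open B" "z \<in> A \<times> B" "A \<times> B \<subseteq> W"
    using open_prod_elim[OF assms] by metis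
  obtain r1 r2 where "r1 > 0" "cball (fst z) r1 \<subseteq> A" "r2 > 0" "cball (snd z) r2 \<subseteq> B"
    using AB open_contains_cball by (metis mem_Times_iff)
  then show ?thesis
    using AB by (intro that[of "min r1 r2"] order_trans[OF _ AB(4)]) auto
qed

section \<open>Cauchy's formula for partial derivatives and Osgood's lemma\<close>

lemma circlepath_01: "t \<in> {0..1} \<Longrightarrow> 0 \<le> r \<Longrightarrow> circlepath z r t \<in> sphere z r"
  using path_image_circlepath[of z r] by (auto simp: path_image_def)

lemma continuous_on_circlepath: "continuous_on {0..1} (circlepath z r)"
  using path_circlepath by (auto simp: path_def)

text \<open>Integrand of Cauchy's formula for the first partial derivative, on a circle parametrised
  by the unit interval; the last factor is the velocity of \<open>circlepath\<close>. An integral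
  over a fixed interval can be treated by the theorems on integrals depending on a
  parameter.\<close>

definition cauchy_kernel :: "(complex \<times> complex \<Rightarrow> complex) \<Rightarrow> complex \<Rightarrow> real \<Rightarrow>
    complex \<times> complex \<Rightarrow> real \<Rightarrow> complex" where
  "cauchy_kernel f a r w t = f (circlepath a r t, snd w) / (circlepath a r t - fst w)^2 *
      (2 * pi * \<i> * r * exp (2 * of_real pi * \<i> * t))"

lemma D1_eq_integral:
  assumes "continuous_on W f"
    and d: "\<And>z. z \<in> W \<Longrightarrow> (\<lambda>u. f (u, snd z)) field_differentiable (at (fst z))"
    and r: "cball a r \<times> cball b r \<subseteq> W" and w: "w \<in> ball a r \<times> ball b r"
  shows "D1 f w = 1 / (2 * of_real pi * \<i>) * integral (cbox 0 1) (cauchy_kernel f a r w)"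
proof -
  have "((\<lambda>u. f (u, snd w)) has_field_derivative (1 / (2 * of_real pi * \<i>) *
      contour_integral (circlepath a r) (\<lambda>u. f (u, snd w) / (u - fst w)\<^sup>2))) (at (fst w))"
  proof (rule Cauchy_derivative_integral_circlepath(2))
    have sub: "u \<in> cball a r \<Longrightarrow> (u, snd w) \<in> W" for u
      using w r by force
    show "continuous_on (cball a r) (\<lambda>u. f (u, snd w))"
      by (intro continuous_on_compose2[OF assms(1)] continuous_intros) (use sub in auto)
    show "(\<lambda>u. f (u, snd w)) holomorphic_on ball a r"
      using d sub by (force simp: holomorphic_on_def intro: field_differentiable_at_within)
  qed (use w in auto)
  then show ?thesis
    by (simp add: D1_def DERIV_imp_deriv contour_integral_integral vector_derivative_circlepath
        cauchy_kernel_def[abs_def] cbox_interval)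
qed

lemma continuous_on_cauchy_kernel:
  assumes "continuous_on W f" "cball a r \<times> cball b r \<subseteq> W" "r > 0"
  shows "continuous_on ((ball a r \<times> ball b r) \<times> cbox 0 1) (\<lambda>(w, t). cauchy_kernel f a r w t)"
proof -
  let ?P = "(ball a r \<times> ball b r) \<times> cbox 0 (1::real)"
  have c: "continuous_on ?P (\<lambda>x. circlepath a r (snd x))"
    by (intro continuous_on_compose2[OF continuous_on_circlepath] continuous_intros) auto
  have s: "circlepath a r (snd x) \<in> sphere a r" if "x \<in> ?P" for x
    using that assms(3) by (intro circlepath_01) auto
  show ?thesis
    unfolding cauchy_kernel_def case_prod_unfold
  proof (intro continuous_intros c)
    show "continuous_on ?P (\<lambda>x. f (circlepath a r (snd x), snd (fst x)))"
    proof (rule continuous_on_compose2[OF assms(1)])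
      show "continuous_on ?P (\<lambda>x. (circlepath a r (snd x), snd (fst x)))"
        by (intro continuous_intros c)
      show "(\<lambda>x. (circlepath a r (snd x), snd (fst x))) ` ?P \<subseteq> W"
      proof
        fix y assume "y \<in> (\<lambda>x. (circlepath a r (snd x), snd (fst x))) ` ?P"
        then obtain x where x: "x \<in> ?P" "y = (circlepath a r (snd x), snd (fst x))" by blast
        with s[OF x(1)] have "y \<in> cball a r \<times> cball b r" by auto
        then show "y \<in> W" using assms(2) by blast
      qed
    qed
    show "\<forall>x\<in>?P. (circlepath a r (snd x) - fst (fst x))\<^sup>2 \<noteq> 0"
    proof
      fix x assume x: "x \<in> ?P"
      then have "fst (fst x) \<in> ball a r" by auto
      with s[OF x] show "(circlepath a r (snd x) - fst (fst x))\<^sup>2 \<noteq> 0" by auto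
    qed
  qed
qed

text \<open>Locally the derivative is a Cauchy integral whose integrand is jointly continuous in the
  point and the parameter of the circle.\<close>

lemma continuous_on_D1:
  assumes "open W" "continuous_on W f"
    and d: "\<And>z. z \<in> W \<Longrightarrow> (\<lambda>u. f (u, snd z)) field_differentiable (at (fst z))"
  shows "continuous_on W (D1 f)"
proof (rule continuous_at_imp_continuous_on, rule ballI)
  fix z assume "z \<in> W"
  then obtain r where r: "r > 0" "cball (fst z) r \<times> cball (snd z) r \<subseteq> W"
    using product_box_in_open assms(1) by blast
  let ?P = "ball (fst z) r \<times> ball (snd z) r"
  have "continuous_on ?P (\<lambda>w. 1 / (2 * of_real pi * \<i>) * integral (cbox 0 1) (cauchy_kernel f (fst z) r w))"
    by (intro continuous_intros integral_continuous_on_param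
        continuous_on_cauchy_kernel[OF assms(2) r(2,1)])
  then have "continuous_on ?P (D1 f)"
    by (rule continuous_on_eq) (simp add: D1_eq_integral[OF assms(2) d r(2)])
  moreover have "open ?P" "z \<in> ?P" using r by (auto simp: open_Times mem_Times_iff)
  ultimately show "isCont (D1 f) z"
    using continuous_on_eq_continuous_at by blast
qed

lemma continuous_on_D2:
  assumes "open W" "continuous_on W f"
    and d: "\<And>z. z \<in> W \<Longrightarrow> (\<lambda>v. f (fst z, v)) field_differentiable (at (snd z))"
  shows "continuous_on W (D2 f)"
proof -
  have "continuous_on (prod.swap ` W) (D1 (f \<circ> prod.swap))"
  proof (rule continuous_on_D1)
    show "open (prod.swap ` W)" using assms(1) by (rule open_swap_image)
    show "continuous_on (prod.swap ` W) (f \<circ> prod.swap)"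
      by (intro continuous_on_compose continuous_on_swap) (simp add: image_image assms)
  qed (use d in auto)
  then have "continuous_on W (\<lambda>z. D1 (f \<circ> prod.swap) (prod.swap z))"
    by (rule continuous_on_compose2) (auto intro: continuous_on_swap)
  then show ?thesis by (simp only: D1_swap)
qed

lemma field_diff_within_open: "f field_differentiable (at x) \<Longrightarrow> (f has_derivative (*) (deriv f x)) (at x within S)"
  using DERIV_deriv_iff_field_differentiable has_derivative_at_withinI has_field_derivative_def
  by blast

text \<open>Osgood's lemma: the partial derivatives are continuous by Cauchy's formula, and
  continuous partial derivatives give total differentiability.\<close>

lemma separately_holomorphic_has_derivative:
  assumes "open W" "continuous_on W f"
    and d1: "\<And>z. z \<in> W \<Longrightarrow> (\<lambda>u. f (u, snd z)) field_differentiable (at (fst z))"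
    and d2: "\<And>z. z \<in> W \<Longrightarrow> (\<lambda>v. f (fst z, v)) field_differentiable (at (snd z))"
    and z: "z \<in> W"
  shows "(f has_derivative (\<lambda>h. D1 f z * fst h + D2 f z * snd h)) (at z)"
proof -
  obtain r where r: "r > 0" "cball (fst z) r \<times> cball (snd z) r \<subseteq> W"
    using product_box_in_open assms(1) z by blast
  define A where "A = ball (fst z) r"
  define B where "B = ball (snd z) r"
  have AB: "A \<times> B \<subseteq> W" "open (A \<times> B)" "z \<in> A \<times> B" "open A" "open B"
    using r by (auto simp: A_def B_def open_Times mem_Times_iff)
  have "((\<lambda>(x, y). f (x, y)) has_derivative
      (\<lambda>(tx, ty). D1 f z * tx + blinfun_mult_right (D2 f (fst z, snd z)) ty)) (at (fst z, snd z) within A \<times> B)"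
  proof (rule has_derivative_partialsI[where fy="\<lambda>x y. blinfun_mult_right (D2 f (x,y))"])
    show "((\<lambda>x. f (x, snd z)) has_derivative (*) (D1 f z)) (at (fst z) within A)"
      unfolding D1_def by (rule field_diff_within_open) (use d1 z in auto)
    show "((\<lambda>y. f (x, y)) has_derivative blinfun_apply (blinfun_mult_right (D2 f (x,y)))) (at y within B)"
      if "x \<in> A" "y \<in> B" for x y
    proof -
      have "(\<lambda>v. f (x, v)) field_differentiable (at y)"
        using d2[of "(x,y)"] that AB(1) by auto
      from field_diff_within_open[OF this] show ?thesis by (simp add: D2_def)
    qed
    have "continuous_on (A \<times> B) (\<lambda>w. blinfun_mult_right (D2 f w))"
      by (intro continuous_intros continuous_on_subset[OF continuous_on_D2[OF assms(1,2) d2]] AB(1))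
    then have "continuous (at z within A \<times> B) (\<lambda>w. blinfun_mult_right (D2 f w))"
      using AB(3) unfolding continuous_on_eq_continuous_within by blast
    then show "continuous (at (fst z, snd z) within A \<times> B) (\<lambda>(x, y). blinfun_mult_right (D2 f (x, y)))"
      by (simp add: case_prod_unfold)
  qed (use AB B_def in \<open>auto simp: mem_Times_iff\<close>)
  then have "(f has_derivative (\<lambda>h. D1 f z * fst h + D2 f z * snd h)) (at z within A \<times> B)"
    by (simp add: case_prod_beta')
  then show ?thesis
    by (simp only: at_within_open[OF AB(3,2)])
qed

lemma separately_holomorphic_cdiff:
  fixes f :: "complex \<times> complex \<Rightarrow> complex"
  assumes "open W" "continuous_on W f"
    and d1: "\<And>z. z \<in> W \<Longrightarrow> (\<lambda>u. f (u, snd z)) field_differentiable (at (fst z))"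
    and d2: "\<And>z. z \<in> W \<Longrightarrow> (\<lambda>v. f (fst z, v)) field_differentiable (at (snd z))"
    and z: "z \<in> W"
  shows "cdiff f z"
  using separately_holomorphic_has_derivative[OF assms]
  by (rule cdiffI) (auto simp: scaleC_complex_def scaleC_prod_def algebra_simps)

lemma cdiff_slice1: "cdiff f (a, b) \<Longrightarrow> (\<lambda>u. f (u, b)) field_differentiable (at a)"
  for f :: "complex \<times> complex \<Rightarrow> complex"
  unfolding cdiff_complex_iff[symmetric]
  by (rule cdiff_compose[of "\<lambda>u. (u,b)" a f]) (auto intro: cdiff_Pair)

lemma cdiff_slice2: "cdiff f (a, b) \<Longrightarrow> (\<lambda>v. f (a, v)) field_differentiable (at b)"
  for f :: "complex \<times> complex \<Rightarrow> complex"
  unfolding cdiff_complex_iff[symmetric]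
  by (rule cdiff_compose[of "\<lambda>v. (a,v)" b f]) (auto intro: cdiff_Pair)

lemma holo_on_continuous_on: "holo_on f S \<Longrightarrow> continuous_on S f"
  by (simp add: holo_on_iff_cdiff cdiff_imp_isCont continuous_at_imp_continuous_on)

lemma holo_on_2_continuous_D:
  assumes "open W" "holo_on f W"
  shows "continuous_on W (D1 f)" "continuous_on W (D2 f)"
proof -
  note * = assms(1) holo_on_continuous_on[OF assms(2)]
  show "continuous_on W (D1 f)"
    by (rule continuous_on_D1[OF *]) (use assms(2) in \<open>auto simp: holo_on_iff_cdiff intro: cdiff_slice1\<close>)
  show "continuous_on W (D2 f)"
    by (rule continuous_on_D2[OF *]) (use assms(2) in \<open>auto simp: holo_on_iff_cdiff intro: cdiff_slice2\<close>)
qed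

text \<open>A complex linear map on pairs is determined by its values at \<open>(1,0)\<close> and
  \<open>(0,1)\<close>, which the chain rule along the two axes identifies with the partial
  derivatives.\<close>

lemma cdiff_has_derivative_D:
  fixes f :: "complex \<times> complex \<Rightarrow> complex"
  assumes "cdiff f z"
  shows "(f has_derivative (\<lambda>h. D1 f z * fst h + D2 f z * snd h)) (at z)"
proof -
  obtain f' where f': "(f has_derivative f') (at z)" "\<And>a h. f' (a *\<^sub>C h) = a *\<^sub>C f' h"
    using assms by (auto simp: cdiff_def)
  interpret f': bounded_linear f' using f'(1) by (rule has_derivative_bounded_linear)
  have lin: "f' (u, v) = f' (1,0) * u + f' (0,1) * v" for u v
  proof -
    have "f' (u, v) = f' (u, 0) + f' (0, v)"
      using f'.add[of "(u,0)" "(0,v)"] by simp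
    moreover have "f' (u, 0) = f' (1,0) * u"
      using f'(2)[of u "(1,0)"] by (simp add: scaleC_complex_def scaleC_prod_def mult.commute)
    moreover have "f' (0, v) = f' (0,1) * v"
      using f'(2)[of v "(0,1)"] by (simp add: scaleC_complex_def scaleC_prod_def mult.commute)
    ultimately show ?thesis by simp
  qed
  have e1: "(\<lambda>h. f' (h, 0)) = (*) (f' (1,0))"
  proof
    fix h show "f' (h, 0) = f' (1,0) * h" using lin[of h 0] by (rule trans) simp
  qed
  have e2: "(\<lambda>h. f' (0, h)) = (*) (f' (0,1))"
  proof
    fix h show "f' (0, h) = f' (0,1) * h" using lin[of 0 h] by (rule trans) simp
  qed
  have "((\<lambda>u. (u, snd z)) has_derivative (\<lambda>h. (h, 0))) (at (fst z))"
    by (auto intro!: derivative_eq_intros)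
  from diff_chain_at[OF this, of f f'] f'(1)
  have "((\<lambda>u. f (u, snd z)) has_derivative (*) (f' (1,0))) (at (fst z))"
    by (simp add: o_def e1)
  then have *: "D1 f z = f' (1, 0)"
    unfolding D1_def by (intro DERIV_imp_deriv) (simp add: has_field_derivative_def)
  have "((\<lambda>u. (fst z, u)) has_derivative (\<lambda>h. (0, h))) (at (snd z))"
    by (auto intro!: derivative_eq_intros)
  from diff_chain_at[OF this, of f f'] f'(1)
  have "((\<lambda>u. f (fst z, u)) has_derivative (*) (f' (0,1))) (at (snd z))"
    by (simp add: o_def e2)
  then have **: "D2 f z = f' (0, 1)"
    unfolding D2_def by (intro DERIV_imp_deriv) (simp add: has_field_derivative_def)
  have "f' = (\<lambda>h. D1 f z * fst h + D2 f z * snd h)"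
  proof
    fix h show "f' h = D1 f z * fst h + D2 f z * snd h"
      unfolding * ** using lin[of "fst h" "snd h"] by (simp only: prod.collapse)
  qed
  then show ?thesis using f'(1) by simp
qed

text \<open>By Osgood's lemma only separate differentiability of \<open>D1 f\<close> is at stake. In
  the first variable it is the derivative of a holomorphic function of one variable; in the second
  the Cauchy integral is differentiated under the integral sign.\<close>

lemma D1_cdiff:
  assumes W: "open W" and f: "holo_on f W" and z: "z \<in> W"
  shows "cdiff (D1 f) z"
proof (rule separately_holomorphic_cdiff[OF W _ _ _ z])
  show "continuous_on W (D1 f)" by (rule holo_on_2_continuous_D[OF W f])
next
  fix z assume z: "z \<in> W"
  let ?S = "(\<lambda>u. (u, snd z)) -` W"
  have "(\<lambda>u. f (u, snd z)) holomorphic_on ?S"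
    using f by (auto simp: holomorphic_on_def holo_on_iff_cdiff intro: field_differentiable_at_within cdiff_slice1)
  moreover have "open ?S" by (intro open_vimage W continuous_intros)
  ultimately have "deriv (\<lambda>u. f (u, snd z)) field_differentiable at (fst z)"
    by (metis holomorphic_deriv holomorphic_on_imp_differentiable_at prod.collapse vimageI z)
  then show "(\<lambda>u. D1 f (u, snd z)) field_differentiable at (fst z)"
    by (simp add: D1_def[abs_def])
next
  fix z assume "z \<in> W"
  then obtain r where r: "r > 0" "cball (fst z) r \<times> cball (snd z) r \<subseteq> W"
    using product_box_in_open W by blast
  define a where "a = fst z"
  define B where "B = ball (snd z) r"
  note f' = holo_on_continuous_on[OF f]
  note d2 = holo_on_2_continuous_D(2)[OF W f]
  have d: "(\<lambda>u. f (u, snd z)) field_differentiable (at (fst z))" if "z \<in> W" for z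
    using that f cdiff_slice1 by (simp add: holo_on_iff_cdiff)
  have k: "continuous_on (B \<times> cbox 0 1) (\<lambda>(v, t). cauchy_kernel g a r (a, v) t)"
    if "continuous_on W g" for g
  proof -
    have "continuous_on (B \<times> cbox 0 1) (\<lambda>x. (\<lambda>(w, t). cauchy_kernel g a r w t) ((a, fst x), snd x))"
      by (rule continuous_on_compose2[OF continuous_on_cauchy_kernel[OF that r(2,1), folded a_def]])
        (use r in \<open>auto intro!: continuous_intros simp: B_def a_def\<close>)
    then show ?thesis by (simp add: case_prod_unfold)
  qed
  \<comment> \<open>The kernel is linear in \<open>f\<close> and depends on \<open>v\<close> only
    through \<open>f\<close>, so differentiation in \<open>v\<close> replaces \<open>f\<close> by
    \<open>D2 f\<close>.\<close>
  have "((\<lambda>v. integral (cbox 0 1) (cauchy_kernel f a r (a, v))) has_field_derivative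
     integral (cbox 0 1) (cauchy_kernel (D2 f) a r (a, snd z))) (at (snd z) within B)"
  proof (rule leibniz_rule_field_derivative)
    fix v t assume v: "v \<in> B" and t: "t \<in> cbox 0 (1::real)"
    have "(circlepath a r t, v) \<in> cball (fst z) r \<times> cball (snd z) r"
      using v t circlepath_01[of t r a] r by (auto simp: B_def a_def)
    then have "cdiff f (circlepath a r t, v)" using r(2) f unfolding holo_on_iff_cdiff by blast
    then have *: "((\<lambda>v. f (circlepath a r t, v)) has_field_derivative D2 f (circlepath a r t, v)) (at v)"
      using DERIV_deriv_iff_field_differentiable cdiff_slice2 by (fastforce simp: D2_def)
    show "((\<lambda>x. cauchy_kernel f a r (a, x) t) has_field_derivative cauchy_kernel (D2 f) a r (a, v) t) (at v within B)"
      unfolding cauchy_kernel_def snd_conv fst_conv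
      by (rule has_field_derivative_at_within[OF DERIV_cmult_right[OF DERIV_cdivide[OF *]]])
  next
    fix v assume "v \<in> B"
    then have "continuous_on (cbox 0 1) (\<lambda>t. cauchy_kernel f a r (a, v) t)"
      using continuous_on_compose2[OF k[OF f'], of "cbox 0 1" "\<lambda>t. (v, t)"]
      by (force intro!: continuous_intros)
    then show "cauchy_kernel f a r (a, v) integrable_on cbox 0 1"
      by (rule integrable_continuous)
  qed (use k[OF d2] r in \<open>auto simp: B_def\<close>)
  then have "(\<lambda>v. 1 / (2 * of_real pi * \<i>) * integral (cbox 0 1) (cauchy_kernel f a r (a, v)))
      field_differentiable (at (snd z) within B)"
    unfolding field_differentiable_def using DERIV_cmult by blast
  moreover have "at (snd z) within B = at (snd z)"
    using r by (intro at_within_open) (auto simp: B_def)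
  ultimately have "(\<lambda>v. 1 / (2 * of_real pi * \<i>) * integral (cbox 0 1) (cauchy_kernel f a r (a, v)))
      field_differentiable (at (snd z))" by simp
  moreover have "\<forall>\<^sub>F v in nhds (snd z). 1 / (2 * of_real pi * \<i>) * integral (cbox 0 1) (cauchy_kernel f a r (a, v)) = D1 f (a, v)"
  proof (rule eventually_mono)
    show "\<forall>\<^sub>F v in nhds (snd z). v \<in> B"
      using eventually_nhds_in_open[of B "snd z"] r by (simp add: B_def)
    show "1 / (2 * of_real pi * \<i>) * integral (cbox 0 1) (cauchy_kernel f a r (a, v)) = D1 f (a, v)"
      if "v \<in> B" for v
      using D1_eq_integral[OF f' d r(2), of "(a, v)"] that r by (simp add: B_def a_def)
  qed
  ultimately show "(\<lambda>v. D1 f (fst z, v)) field_differentiable at (snd z)"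
    unfolding a_def cdiff_complex_iff[symmetric] by (simp add: cdiff_cong)
qed

lemma cdiff_swap: "cdiff prod.swap z" for z :: "complex \<times> complex"
  unfolding prod.swap_def by (intro cdiff_Pair cdiff_fst cdiff_snd cdiff_ident)

lemma holo_on_swap:
  fixes f :: "complex \<times> complex \<Rightarrow> complex"
  assumes "holo_on f W"
  shows "holo_on (f \<circ> prod.swap) (prod.swap ` W)"
  unfolding holo_on_iff_cdiff o_def
  by (rule ballI, rule cdiff_compose[OF cdiff_swap]) (use assms in \<open>auto simp: holo_on_iff_cdiff\<close>)

lemma D2_cdiff:
  assumes W: "open W" and f: "holo_on f W" and z: "z \<in> W"
  shows "cdiff (D2 f) z"
proof -
  have "cdiff (D1 (f \<circ> prod.swap)) (prod.swap z)"
    by (rule D1_cdiff[OF open_swap_image[OF W] holo_on_swap[OF f]]) (use z in auto)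
  then have "cdiff (\<lambda>x. D1 (f \<circ> prod.swap) (prod.swap x)) z"
    by (rule cdiff_compose[OF cdiff_swap])
  then show ?thesis unfolding D1_swap .
qed

lemma holo_on_D:
  assumes "open W" "holo_on f W"
  shows "holo_on (D1 f) W" "holo_on (D2 f) W"
  using D1_cdiff[OF assms] D2_cdiff[OF assms] by (auto simp: holo_on_iff_cdiff)

section \<open>Hadamard quotients and the inverse function theorem for graph maps\<close>

lemma holo_on_subset: "holo_on f S \<Longrightarrow> T \<subseteq> S \<Longrightarrow> holo_on f T"
  by (auto simp: holo_on_def)

lemma cdiff_DERIV1: "cdiff f (a, b) \<Longrightarrow> ((\<lambda>u. f (u, b)) has_field_derivative D1 f (a, b)) (at a)"
  using DERIV_deriv_iff_field_differentiable cdiff_slice1 by (fastforce simp: D1_def)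

lemma cdiff_DERIV2: "cdiff f (a, b) \<Longrightarrow> ((\<lambda>v. f (a, v)) has_field_derivative D2 f (a, b)) (at b)"
  using DERIV_deriv_iff_field_differentiable cdiff_slice2 by (fastforce simp: D2_def)

text \<open>The quotient \<open>H w\<close> is the mean of \<open>D1 f\<close> over the segment from
  \<open>(a, snd w)\<close> to \<open>w\<close>. The identity is the fundamental theorem of calculus
  on that segment, and \<open>H\<close> is holomorphic by differentiation under the integral sign in
  each variable.\<close>

lemma hadamard_first_variable:
  fixes f :: "complex \<times> complex \<Rightarrow> complex"
  assumes f: "holo_on f (ball a r \<times> ball b r)" and r: "r > 0"
  shows "\<exists>H. holo_on H (ball a r \<times> ball b r) \<and> H (a, b) = D1 f (a, b) \<and>
    (\<forall>w\<in>ball a r \<times> ball b r. f w = f (a, snd w) + (fst w - a) * H w)"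
proof -
  define V where "V = ball a r \<times> ball b r"
  have V: "open V" "convex V" by (auto simp: V_def open_Times convex_Times)
  have f: "holo_on f V" using f by (simp add: V_def)
  define g where "g = D1 f"
  have g: "holo_on g V" unfolding g_def using V f by (intro holo_on_D)
  have cg: "continuous_on V g" "continuous_on V (D1 g)" "continuous_on V (D2 g)"
    using holo_on_2_continuous_D[OF V(1) g] holo_on_continuous_on[OF g] by auto
  define p where "p = (\<lambda>(w::complex\<times>complex) t. (a + of_real t * (fst w - a), snd w))"
  have p: "p w t \<in> V" if "w \<in> V" "t \<in> cbox 0 1" for w t
  proof -
    have "dist a (a + of_real t * (fst w - a)) = t * dist a (fst w)"
      using that by (simp add: dist_norm norm_mult norm_minus_commute)
    also have "\<dots> \<le> dist a (fst w)" using that by (simp add: mult_left_le_one_le)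
    also have "\<dots> < r" using that by (auto simp: V_def)
    finally show ?thesis using that by (auto simp: p_def V_def)
  qed
  have pc: "continuous_on (V \<times> cbox 0 1) (\<lambda>x. p (fst x) (snd x))"
    unfolding p_def by (intro continuous_intros)
  have c: "continuous_on (V \<times> cbox 0 1) (\<lambda>x. k (p (fst x) (snd x)))" if "continuous_on V k" for k :: "_ \<Rightarrow> complex"
    by (rule continuous_on_compose2[OF that pc], rule image_subsetI) (rule p, simp_all only: mem_Times_iff)
  define H where "H = (\<lambda>w. integral (cbox 0 1) (\<lambda>t. g (p w t)))"
  have int: "(\<lambda>t. g (p w t)) integrable_on cbox 0 1" if "w \<in> V" for w
  proof (rule integrable_continuous)
    have "continuous_on (cbox 0 1) (\<lambda>t. g (p (fst (w, t)) (snd (w, t))))"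
      by (rule continuous_on_compose2[OF c[OF cg(1)], of _ "\<lambda>t. (w, t)"])
        (use that in \<open>auto intro!: continuous_intros\<close>)
    then show "continuous_on (cbox 0 1) (\<lambda>t. g (p w t))" by simp
  qed
  have "cdiff H z" if "z \<in> V" for z
  proof (rule separately_holomorphic_cdiff[OF V(1) _ _ _ that])
    show "continuous_on V H"
      unfolding H_def by (rule integral_continuous_on_param) (use c[OF cg(1)] in \<open>simp add: case_prod_unfold\<close>)
  next
    fix z assume z: "z \<in> V"
    then have zb: "fst z \<in> ball a r" "snd z \<in> ball b r" by (auto simp: V_def)
    have "((\<lambda>u. integral (cbox 0 1) (\<lambda>t. g (p (u, snd z) t))) has_field_derivative
       integral (cbox 0 1) (\<lambda>t. D1 g (p (fst z, snd z) t) * t)) (at (fst z) within ball a r)"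
    proof (rule leibniz_rule_field_derivative)
      fix u and t :: real assume u: "u \<in> ball a r" "t \<in> cbox 0 1"
      then have "cdiff g (p (u, snd z) t)"
        using p[of "(u, snd z)" t] g zb by (auto simp: V_def holo_on_iff_cdiff)
      then have "((\<lambda>u. g (u, snd z)) has_field_derivative D1 g (p (u, snd z) t)) (at (a + of_real t * (u - a)))"
        unfolding p_def fst_conv snd_conv by (rule cdiff_DERIV1)
      moreover have "((\<lambda>u. a + of_real t * (u - a)) has_field_derivative of_real t) (at u within ball a r)"
        by (auto intro!: derivative_eq_intros)
      ultimately show "((\<lambda>u. g (p (u, snd z) t)) has_field_derivative D1 g (p (u, snd z) t) * t) (at u within ball a r)"
        unfolding p_def fst_conv snd_conv by (rule DERIV_chain2)
    next
      have "continuous_on (ball a r \<times> cbox 0 1) (\<lambda>x. D1 g (p (fst ((fst x, snd z), snd x)) (snd ((fst x, snd z), snd x))))"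
        by (rule continuous_on_compose2[OF c[OF cg(2)], of _ "\<lambda>x. ((fst x, snd z), snd x)"])
          (use zb in \<open>auto intro!: continuous_intros simp: V_def\<close>)
      then show "continuous_on (ball a r \<times> cbox 0 1) (\<lambda>(u, t). D1 g (p (u, snd z) t) * complex_of_real t)"
        by (simp add: case_prod_unfold) (intro continuous_intros)
    qed (use zb int in \<open>auto simp: V_def\<close>)
    then show "(\<lambda>u. H (u, snd z)) field_differentiable at (fst z)"
      using at_within_open[OF zb(1)] by (auto simp: H_def field_differentiable_def)
    have "((\<lambda>v. integral (cbox 0 1) (\<lambda>t. g (p (fst z, v) t))) has_field_derivative
       integral (cbox 0 1) (\<lambda>t. D2 g (p (fst z, snd z) t))) (at (snd z) within ball b r)"
    proof (rule leibniz_rule_field_derivative)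
      fix v and t :: real assume v: "v \<in> ball b r" "t \<in> cbox 0 1"
      then have "cdiff g (p (fst z, v) t)"
        using p[of "(fst z, v)" t] g zb by (auto simp: V_def holo_on_iff_cdiff)
      then show "((\<lambda>v. g (p (fst z, v) t)) has_field_derivative D2 g (p (fst z, v) t)) (at v within ball b r)"
        unfolding p_def fst_conv snd_conv by (rule has_field_derivative_at_within[OF cdiff_DERIV2])
    next
      have "continuous_on (ball b r \<times> cbox 0 1) (\<lambda>x. D2 g (p (fst ((fst z, fst x), snd x)) (snd ((fst z, fst x), snd x))))"
        by (rule continuous_on_compose2[OF c[OF cg(3)], of _ "\<lambda>x. ((fst z, fst x), snd x)"])
          (use zb in \<open>auto intro!: continuous_intros simp: V_def\<close>)
      then show "continuous_on (ball b r \<times> cbox 0 1) (\<lambda>(v, t). D2 g (p (fst z, v) t))"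
        by (simp add: case_prod_unfold)
    qed (use zb int in \<open>auto simp: V_def\<close>)
    then show "(\<lambda>v. H (fst z, v)) field_differentiable at (snd z)"
      using at_within_open[OF zb(2)] by (auto simp: H_def field_differentiable_def)
  qed
  moreover have "H (a, b) = D1 f (a, b)"
    by (simp add: H_def p_def g_def)
  moreover have "f w = f (a, snd w) + (fst w - a) * H w" if w: "w \<in> V" for w
  proof -
    have "((\<lambda>t. (fst w - a) * g (p w t)) has_integral (f (p w 1) - f (p w 0))) {0..1}"
    proof (rule fundamental_theorem_of_calculus)
      fix t :: real assume t: "t \<in> {0..1}"
      then have "cdiff f (p w t)" using p[OF w, of t] f by (auto simp: holo_on_iff_cdiff)
      then have "((\<lambda>u. f (u, snd w)) has_field_derivative g (p w t)) (at (a + of_real t * (fst w - a)))"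
        unfolding p_def g_def by (rule cdiff_DERIV1)
      moreover have "((\<lambda>u. a + of_real u * (fst w - a)) has_vector_derivative (fst w - a)) (at t within {0..1})"
        by (auto intro!: derivative_eq_intros)
      ultimately show "((\<lambda>t. f (p w t)) has_vector_derivative (fst w - a) * g (p w t)) (at t within {0..1})"
        unfolding p_def using field_vector_diff_chain_within[of "\<lambda>u. a + of_real u * (fst w - a)" "fst w - a" t "{0..1}" "\<lambda>u. f (u, snd w)"]
        by (simp add: o_def has_field_derivative_at_within)
    qed simp
    then have "integral {0..1} (\<lambda>t. (fst w - a) * g (p w t)) = f (p w 1) - f (p w 0)"
      by (rule integral_unique)
    then have "(fst w - a) * H w = f (p w 1) - f (p w 0)"
      by (simp only: H_def cbox_interval integral_mult_right)
    then show ?thesis by (simp add: p_def)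
  qed
  ultimately show ?thesis by (auto simp: holo_on_iff_cdiff V_def)
qed

text \<open>Divide first by \<open>fst w - a\<close>; the remainder \<open>f (a, snd w)\<close>
  depends on the second variable alone and is divided by \<open>snd w - b\<close>. This is what
  determines a derivation by its values on the two coordinates.\<close>

lemma hadamard_two_variables:
  fixes f :: "complex \<times> complex \<Rightarrow> complex"
  assumes f: "holo_on f (ball a r \<times> ball b r)" and r: "r > 0"
  obtains H K where "holo_on H (ball a r \<times> ball b r)" "holo_on K (ball a r \<times> ball b r)"
    "H (a, b) = D1 f (a, b)" "K (a, b) = D2 f (a, b)"
    "\<forall>w\<in>ball a r \<times> ball b r. f w = f (a, b) + (fst w - a) * H w + (snd w - b) * K w"
proof -
  obtain H where H: "holo_on H (ball a r \<times> ball b r)" "H (a, b) = D1 f (a, b)"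
    "\<And>w. w \<in> ball a r \<times> ball b r \<Longrightarrow> f w = f (a, snd w) + (fst w - a) * H w"
    using hadamard_first_variable[OF f r] by blast
  have "holo_on (f \<circ> prod.swap) (ball b r \<times> ball a r)"
    using holo_on_swap[OF f] by (simp add: product_swap)
  from hadamard_first_variable[OF this r]
  obtain K where K: "holo_on K (ball b r \<times> ball a r)" "K (b, a) = D1 (f \<circ> prod.swap) (b, a)"
    "\<And>w. w \<in> ball b r \<times> ball a r \<Longrightarrow> (f \<circ> prod.swap) w = (f \<circ> prod.swap) (b, snd w) + (fst w - b) * K w"
    by blast
  show ?thesis
  proof (rule that[OF H(1) _ H(2)])
    \<comment> \<open>\<open>K\<close> belongs to the swapped function, and the second division
      takes place on the line where the first variable equals \<open>a\<close>, hence the arguments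
      \<open>(snd w, a)\<close>.\<close>
    show "holo_on (\<lambda>w. K (snd w, a)) (ball a r \<times> ball b r)"
      unfolding holo_on_iff_cdiff
    proof
      fix z assume "z \<in> ball a r \<times> ball b r"
      then have "cdiff K (snd z, a)" using K(1) r by (auto simp: holo_on_iff_cdiff)
      then show "cdiff (\<lambda>w. K (snd w, a)) z"
        by (intro cdiff_compose[of "\<lambda>w. (snd w, a)" z K] cdiff_Pair) auto
    qed
    show "K (snd (a, b), a) = D2 f (a, b)" using K(2) D1_swap[of f "(a,b)"] by simp
    show "\<forall>w\<in>ball a r \<times> ball b r. f w = f (a, b) + (fst w - a) * H w + (snd w - b) * K (snd w, a)"
    proof
      fix w assume w: "w \<in> ball a r \<times> ball b r"
      show "f w = f (a, b) + (fst w - a) * H w + (snd w - b) * K (snd w, a)"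
        using H(3)[OF w] K(3)[of "(snd w, a)"] w r by auto
    qed
  qed
qed

text \<open>The first component is kept, so injectivity is a matter of the second variable alone. It
  holds on a box where \<open>D2 u\<close> stays within half of its modulus at \<open>z\<close>;
  openness is then invariance of domain, and the inverse inherits a complex linear
  derivative.\<close>

lemma graph_map_locally_biholomorphic:
  fixes u :: "complex \<times> complex \<Rightarrow> complex"
  assumes W: "open W" and u: "holo_on u W" and z: "z \<in> W" and nz: "D2 u z \<noteq> 0"
  defines "\<Theta> \<equiv> \<lambda>w. (fst w, u w)"
  obtains V where "open V" "z \<in> V" "V \<subseteq> W" "inj_on \<Theta> V"
    "\<forall>V'. open V' \<and> V' \<subseteq> V \<longrightarrow> open (\<Theta> ` V')" "holo_on (inv_into V \<Theta>) (\<Theta> ` V)"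
proof -
  define c where "c = D2 u z"
  have "continuous_on W (D2 u)" by (rule holo_on_2_continuous_D[OF W u])
  then have "isCont (D2 u) z" using W z by (simp add: continuous_on_eq_continuous_at)
  then have "\<forall>\<^sub>F w in nhds z. dist (D2 u w) c < cmod c / 2"
    using nz unfolding c_def isCont_def tendsto_at_iff_tendsto_nhds[symmetric]
    by (intro tendstoD) (auto simp: tendsto_at_iff_tendsto_nhds)
  then obtain W1 where W1: "open W1" "z \<in> W1" "\<And>w. w \<in> W1 \<Longrightarrow> dist (D2 u w) c < cmod c / 2"
    by (auto simp: eventually_nhds)
  obtain r where r: "r > 0" "cball (fst z) r \<times> cball (snd z) r \<subseteq> W \<inter> W1"
    using product_box_in_open[of "W \<inter> W1" z] W1 W z by auto
  define V where "V = ball (fst z) r \<times> ball (snd z) r"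
  have V: "open V" "z \<in> V" "V \<subseteq> W" "V \<subseteq> W1"
    using r by (auto simp: V_def open_Times mem_Times_iff)
  have inj: "inj_on \<Theta> V"
  proof (rule inj_onI)
    fix x y assume xy: "x \<in> V" "y \<in> V" "\<Theta> x = \<Theta> y"
    define a where "a = fst x"
    have fa: "fst y = a" "u (a, snd x) = u (a, snd y)" using xy(3) by (cases x; cases y; auto simp: \<Theta>_def a_def)+
    \<comment> \<open>\<open>u (a, v) - c * v\<close> is Lipschitz in \<open>v\<close> with constant
      half of \<open>cmod c\<close>, so \<open>u (a, v)\<close> cannot take a value twice.\<close>
    have "norm ((u (a, snd x) - c * snd x) - (u (a, snd y) - c * snd y)) \<le> cmod c / 2 * norm (snd x - snd y)"
    proof (rule field_differentiable_bound[of "ball (snd z) r" _ "\<lambda>v. D2 u (a, v) - c"])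
      fix v assume v: "v \<in> ball (snd z) r"
      then have av: "(a, v) \<in> V" using xy by (auto simp: V_def a_def)
      then have "cdiff u (a, v)" using V u by (auto simp: holo_on_iff_cdiff)
      then have "((\<lambda>v. u (a, v) - c * v) has_field_derivative D2 u (a, v) - c) (at v)"
        by (auto intro!: derivative_eq_intros cdiff_DERIV2)
      then show "((\<lambda>v. u (a, v) - c * v) has_field_derivative D2 u (a, v) - c) (at v within ball (snd z) r)"
        by (rule has_field_derivative_at_within)
      show "norm (D2 u (a, v) - c) \<le> cmod c / 2"
        using W1(3)[of "(a,v)"] V av by (auto simp: dist_norm)
    qed (use xy in \<open>auto simp: V_def\<close>)
    then have "cmod c * norm (snd x - snd y) \<le> cmod c / 2 * norm (snd x - snd y)"
      using fa(2) by (simp add: norm_mult[symmetric] right_diff_distrib norm_minus_commute)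
    then have "snd x = snd y" using nz by (auto simp: c_def mult_le_cancel_right)
    then show "x = y" using fa by (auto simp: a_def prod_eq_iff)
  qed
  have cu: "cdiff u w" if "w \<in> V" for w using that V u by (auto simp: holo_on_iff_cdiff)
  have c\<Theta>: "cdiff \<Theta> w" if "w \<in> V" for w
    unfolding \<Theta>_def by (intro cdiff_Pair cu that) auto
  have cont: "continuous_on V \<Theta>"
    by (intro continuous_at_imp_continuous_on ballI cdiff_imp_isCont c\<Theta>)
  have op: "open (\<Theta> ` V')" if "open V'" "V' \<subseteq> V" for V'
    by (rule invariance_of_domain) (use that cont inj in \<open>auto intro: continuous_on_subset inj_on_subset\<close>)
  have "cdiff (inv_into V \<Theta>) (\<Theta> x)" if x: "x \<in> V" for x
  proof -
    have n: "D2 u x \<noteq> 0"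
      using W1(3)[of x] x V(4) nz by (auto simp: c_def dist_norm)
    let ?f = "\<lambda>h. (fst h, D1 u x * fst h + D2 u x * snd h)"
    let ?g = "\<lambda>k. (fst k, (snd k - D1 u x * fst k) / D2 u x)"
    have "(\<Theta> has_derivative ?f) (at x)"
      unfolding \<Theta>_def by (intro has_derivative_Pair cdiff_has_derivative_D cu x) (auto intro!: derivative_eq_intros)
    then have "(inv_into V \<Theta> has_derivative ?g) (at (\<Theta> x))"
      by (intro has_derivative_inverse_strong[OF V(1) x cont, of _ ?f])
        (use n inj in \<open>auto simp: fun_eq_iff\<close>)
    then show ?thesis
      by (rule cdiffI) (auto simp: scaleC_prod_def scaleC_complex_def field_simps)
  qed
  then show ?thesis using that[OF V(1-3) inj] op by (auto simp: holo_on_iff_cdiff)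
qed

section \<open>Power series expansions in two variables\<close>

lemma holo_on_D2_funpow: "open W \<Longrightarrow> holo_on f W \<Longrightarrow> holo_on ((D2 ^^ j) f) W"
  by (induction j) (auto intro: holo_on_D)

lemma funpow_deriv_eq_D2:
  assumes "open W" "holo_on f W" "(u, v) \<in> W"
  shows "(deriv ^^ j) (\<lambda>v. f (u, v)) v = (D2 ^^ j) f (u, v)"
  using assms(3)
proof (induction j arbitrary: v)
  case (Suc j)
  let ?S = "(\<lambda>v. (u, v)) -` W"
  have "open ?S" by (intro open_vimage assms continuous_intros)
  then have "\<forall>\<^sub>F v in nhds v. (deriv ^^ j) (\<lambda>v. f (u, v)) v = (D2 ^^ j) f (u, v)"
    using Suc by (auto simp: eventually_nhds intro!: exI[of _ ?S])
  then have "deriv ((deriv ^^ j) (\<lambda>v. f (u, v))) v = deriv (\<lambda>v. (D2 ^^ j) f (u, v)) v"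
    by (rule deriv_cong_ev) simp
  then show ?case by (simp add: D2_def[of "(D2 ^^ j) f"])
qed simp

text \<open>For fixed \<open>j\<close> the coefficients are those of a one-variable expansion in the
  first variable. This gives access to the calculus of \<open>fps_expansion\<close>.\<close>

lemma fps2_expansion_eq:
  assumes "open W" "holo_on f W" "z \<in> W"
  shows "fps_nth (fps_nth (fps2_expansion f z) i) j =
    fps_nth (fps_expansion (\<lambda>u. (D2 ^^ j) f (u, snd z) / fact j) (fst z)) i"
proof -
  let ?S = "(\<lambda>u. (u, snd z)) -` W"
  have S: "open ?S" by (intro open_vimage assms continuous_intros)
  have "\<forall>\<^sub>F u in nhds (fst z). (deriv ^^ j) (\<lambda>v. f (u, v)) (snd z) = (D2 ^^ j) f (u, snd z)"
    using S assms by (auto simp: eventually_nhds funpow_deriv_eq_D2 intro!: exI[of _ ?S])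
  then have "(deriv ^^ i) (\<lambda>u. (deriv ^^ j) (\<lambda>v. f (u, v)) (snd z)) (fst z) =
      (deriv ^^ i) (\<lambda>u. (D2 ^^ j) f (u, snd z)) (fst z)"
    by (intro higher_deriv_cong_ev) auto
  moreover have "(deriv ^^ i) (\<lambda>u. (1 / fact j) * (D2 ^^ j) f (u, snd z)) (fst z) =
      (1 / fact j) * (deriv ^^ i) (\<lambda>u. (D2 ^^ j) f (u, snd z)) (fst z)"
  proof (rule higher_deriv_cmult[where A = ?S])
    show "(\<lambda>u. (D2 ^^ j) f (u, snd z)) holomorphic_on ?S"
      using holo_on_D2_funpow[OF assms(1,2), of j]
      by (auto simp: holomorphic_on_def holo_on_iff_cdiff intro: field_differentiable_at_within cdiff_slice1)
  qed (use S assms in auto)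
  ultimately show ?thesis
    by (simp add: fps2_expansion_def fps_expansion_def)
qed

lemma analytic_D2_slice:
  assumes "open W" "holo_on f W" "z \<in> W"
  shows "(\<lambda>u. (D2 ^^ j) f (u, snd z)) analytic_on {fst z}"
proof -
  let ?S = "(\<lambda>u. (u, snd z)) -` W"
  have "open ?S" by (intro open_vimage assms continuous_intros)
  moreover have "(\<lambda>u. (D2 ^^ j) f (u, snd z)) holomorphic_on ?S"
    using holo_on_D2_funpow[OF assms(1,2), of j]
    by (auto simp: holomorphic_on_def holo_on_iff_cdiff intro: field_differentiable_at_within cdiff_slice1)
  moreover have "fst z \<in> ?S" using assms by simp
  ultimately show ?thesis
    by (meson analytic_at)
qed

lemma fps_expansion_eqI_at:
  assumes "f analytic_on {z}" "(\<lambda>x. f (z + x)) has_fps_expansion F"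
  shows "fps_expansion f z = F"
  using fps_expansion_unique_complex analytic_at_imp_has_fps_expansion assms by blast

lemma fps_expansion_sum_mult:
  fixes f g :: "nat \<Rightarrow> complex \<Rightarrow> complex"
  assumes "\<And>k. f k analytic_on {z}" "\<And>k. g k analytic_on {z}"
  shows "fps_expansion (\<lambda>u. \<Sum>k\<le>n. f k u * g k u) z = (\<Sum>k\<le>n. fps_expansion (f k) z * fps_expansion (g k) z)"
proof (rule fps_expansion_eqI_at)
  show "(\<lambda>u. \<Sum>k\<le>n. f k u * g k u) analytic_on {z}"
    by (intro analytic_intros assms)
  show "(\<lambda>x. \<Sum>k\<le>n. f k (z + x) * g k (z + x)) has_fps_expansion (\<Sum>k\<le>n. fps_expansion (f k) z * fps_expansion (g k) z)"
    by (intro fps_expansion_intros analytic_at_imp_has_fps_expansion assms)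
qed

lemma fps2_mult_nth:
  "fps_nth (fps_nth (F * G) i) j =
    (\<Sum>a\<le>i. \<Sum>b\<le>j. fps_nth (fps_nth F a) b * fps_nth (fps_nth G (i - a)) (j - b))"
  for F G :: "'a::comm_ring_1 fps fps"
  by (simp add: fps_mult_nth fps_sum_nth atLeast0AtMost)

text \<open>Leibniz' rule in the second variable writes coefficient \<open>j\<close> of the product
  as a convolution of functions of the first variable; one-variable expansions are multiplicative,
  which gives the second convolution.\<close>

lemma fps2_expansion_mult:
  assumes W: "open W" and f: "holo_on f W" and g: "holo_on g W" and z: "z \<in> W"
  shows "fps2_expansion (\<lambda>w. f w * g w) z = fps2_expansion f z * fps2_expansion g z"
proof (rule fps_ext, rule fps_ext)
  fix i j
  have fg: "holo_on (\<lambda>w. f w * g w) W"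
    using f g by (simp add: holo_on_iff_cdiff cdiff_mult)
  let ?S = "(\<lambda>u. (u, snd z)) -` W"
  have S: "open ?S" by (intro open_vimage assms continuous_intros)
  define A where "A = (\<lambda>h j u. (D2 ^^ j) h (u, snd z) / fact j :: complex)"
  have Aeq: "fps_nth (fps_nth (fps2_expansion h z) i) j = fps_nth (fps_expansion (A h j) (fst z)) i"
    if "holo_on h W" for h i j
    by (simp add: fps2_expansion_eq[OF W that z] A_def)
  have "A (\<lambda>w. f w * g w) j u = (\<Sum>b\<le>j. A f b u * A g (j - b) u)" if "u \<in> ?S" for u
  proof -
    let ?T = "(\<lambda>v. (u, v)) -` W"
    have T: "open ?T" by (intro open_vimage assms continuous_intros)
    have h: "(\<lambda>v. h (u, v)) holomorphic_on ?T" if "holo_on h W" for h :: "_ \<Rightarrow> complex"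
      using that
      by (auto simp: holomorphic_on_def holo_on_iff_cdiff intro: field_differentiable_at_within cdiff_slice2)
    have uW: "(u, snd z) \<in> W" using that by simp
    have "(D2 ^^ j) (\<lambda>w. f w * g w) (u, snd z) = (deriv ^^ j) (\<lambda>v. f (u, v) * g (u, v)) (snd z)"
      using funpow_deriv_eq_D2[OF W fg uW] by simp
    also have "\<dots> = (\<Sum>b = 0..j. of_nat (j choose b) * (D2 ^^ b) f (u, snd z) * (D2 ^^ (j - b)) g (u, snd z))"
      using uW by (subst higher_deriv_mult[OF h[OF f] h[OF g] T]) (auto simp: funpow_deriv_eq_D2[OF W f uW] funpow_deriv_eq_D2[OF W g uW])
    also have "\<dots> / fact j = (\<Sum>b\<le>j. A f b u * A g (j - b) u)"
      unfolding sum_divide_distrib atLeast0AtMost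
      by (intro sum.cong refl) (simp add: A_def binomial_fact)
    finally show ?thesis by (simp add: A_def)
  qed
  then have "fps_expansion (A (\<lambda>w. f w * g w) j) (fst z) =
      fps_expansion (\<lambda>u. \<Sum>b\<le>j. A f b u * A g (j - b) u) (fst z)"
    using S z by (intro fps_expansion_cong) (auto simp: eventually_nhds intro!: exI[of _ ?S])
  also have "\<dots> = (\<Sum>b\<le>j. fps_expansion (A f b) (fst z) * fps_expansion (A g (j - b)) (fst z))"
    unfolding A_def by (intro fps_expansion_sum_mult analytic_on_divide analytic_D2_slice[OF W _ z] f g analytic_on_const) auto
  finally have "fps_nth (fps_nth (fps2_expansion (\<lambda>w. f w * g w) z) i) j =
      (\<Sum>b\<le>j. \<Sum>a\<le>i. fps_nth (fps_expansion (A f b) (fst z)) a * fps_nth (fps_expansion (A g (j - b)) (fst z)) (i - a))"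
    by (simp only: Aeq[OF fg] fps_sum_nth fps_mult_nth atLeast0AtMost)
  also have "\<dots> = (\<Sum>a\<le>i. \<Sum>b\<le>j. fps_nth (fps_expansion (A f b) (fst z)) a * fps_nth (fps_expansion (A g (j - b)) (fst z)) (i - a))"
    by (rule sum.swap)
  finally show "fps_nth (fps_nth (fps2_expansion (\<lambda>w. f w * g w) z) i) j = fps_nth (fps_nth (fps2_expansion f z * fps2_expansion g z) i) j"
    by (simp only: fps2_mult_nth Aeq[OF f] Aeq[OF g])
qed

lemma fps2_expansion_const: "fps2_expansion (\<lambda>w. c) z = fps_const (fps_const c)"
proof (rule fps_ext, rule fps_ext)
  fix i j
  have c: "holo_on (\<lambda>w::complex\<times>complex. c) UNIV" by (simp add: holo_on_iff_cdiff)
  have "(D2 ^^ j) (\<lambda>w. c) = (\<lambda>w. if j = 0 then c else 0)" by (induction j) (auto simp: D2_def)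
  moreover have "fps_expansion (\<lambda>u. d) x = fps_const d" for d x :: complex
    by (rule fps_expansion_eqI_at) auto
  ultimately show "fps_nth (fps_nth (fps2_expansion (\<lambda>w. c) z) i) j = fps_nth (fps_nth (fps_const (fps_const c)) i) j"
    unfolding fps2_expansion_eq[OF open_UNIV c UNIV_I] by simp
qed

lemma fps2_expansion_cmult:
  assumes W: "open W" and f: "holo_on f W" and z: "z \<in> W"
  shows "fps2_expansion (\<lambda>w. c * f w) z = fps_const (fps_const c) * fps2_expansion f z"
  using fps2_expansion_mult[OF W _ f z, of "\<lambda>_. c"]
  by (simp add: fps2_expansion_const holo_on_iff_cdiff)

lemma fps2_expansion_add:
  assumes W: "open W" and f: "holo_on f W" and g: "holo_on g W" and z: "z \<in> W"
  shows "fps2_expansion (\<lambda>w. f w + g w) z = fps2_expansion f z + fps2_expansion g z"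
proof (rule fps_ext, rule fps_ext)
  fix i j
  have fg: "holo_on (\<lambda>w. f w + g w) W"
    using f g by (simp add: holo_on_iff_cdiff cdiff_add)
  have *: "(D2 ^^ j) (\<lambda>w. f w + g w) w = (D2 ^^ j) f w + (D2 ^^ j) g w" if "w \<in> W" for w
  proof -
    obtain u v where w: "w = (u, v)" by force
    let ?T = "(\<lambda>v. (u, v)) -` W"
    have T: "open ?T" by (intro open_vimage assms continuous_intros)
    have h: "(\<lambda>v. h (u, v)) holomorphic_on ?T" if "holo_on h W" for h :: "_ \<Rightarrow> complex"
      using that
      by (auto simp: holomorphic_on_def holo_on_iff_cdiff intro: field_differentiable_at_within cdiff_slice2)
    show ?thesis
      using that higher_deriv_add[OF h[OF f] h[OF g] T, of v j] unfolding w
      by (simp add: funpow_deriv_eq_D2[OF W f] funpow_deriv_eq_D2[OF W g] funpow_deriv_eq_D2[OF W fg])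
  qed
  let ?S = "(\<lambda>u. (u, snd z)) -` W"
  have S: "open ?S" by (intro open_vimage assms continuous_intros)
  have "fps_expansion (\<lambda>u. (D2 ^^ j) (\<lambda>w. f w + g w) (u, snd z) / fact j) (fst z) =
     fps_expansion (\<lambda>u. (D2 ^^ j) f (u, snd z) / fact j + (D2 ^^ j) g (u, snd z) / fact j) (fst z)"
    using S z * by (intro fps_expansion_cong) (auto simp: eventually_nhds add_divide_distrib intro!: exI[of _ ?S])
  also have "\<dots> = fps_expansion (\<lambda>u. (D2 ^^ j) f (u, snd z) / fact j) (fst z) +
      fps_expansion (\<lambda>u. (D2 ^^ j) g (u, snd z) / fact j) (fst z)"
    by (rule fps_expansion_eqI_at)
      (auto intro!: analytic_intros analytic_D2_slice[OF W _ z] f g fps_expansion_intros analytic_at_imp_has_fps_expansion)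
  finally show "fps_nth (fps_nth (fps2_expansion (\<lambda>w. f w + g w) z) i) j = fps_nth (fps_nth (fps2_expansion f z + fps2_expansion g z) i) j"
    by (simp add: fps2_expansion_eq[OF W fg z] fps2_expansion_eq[OF W f z] fps2_expansion_eq[OF W g z])
qed

lemma fps2_expansion_sum:
  assumes W: "open W" and f: "\<And>k. k \<in> A \<Longrightarrow> holo_on (f k) W" and z: "z \<in> W"
  shows "fps2_expansion (\<lambda>w. \<Sum>k\<in>A. f k w) z = (\<Sum>k\<in>A. fps2_expansion (f k) z)"
  using f
proof (induction A rule: infinite_finite_induct)
  case (insert x F)
  then have "holo_on (\<lambda>w. \<Sum>k\<in>F. f k w) W" by (auto simp: holo_on_iff_cdiff intro: cdiff_sum)
  then show ?case using insert by (simp add: fps2_expansion_add[OF W _ _ z])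
qed (simp_all add: fps2_expansion_const)

lemma fps2_expansion_power:
  assumes W: "open W" and f: "holo_on f W" and z: "z \<in> W"
  shows "fps2_expansion (\<lambda>w. f w ^ n) z = fps2_expansion f z ^ n"
proof (induction n)
  case 0
  show ?case by (simp add: fps2_expansion_const)
next
  case (Suc n)
  have "holo_on (\<lambda>w. f w ^ n) W" using f by (simp add: holo_on_iff_cdiff cdiff_power)
  then show ?case using Suc fps2_expansion_mult[OF W f _ z] by simp
qed

text \<open>Cauchy's inequality, first in the second variable with the first one fixed, then in the
  first variable.\<close>

lemma fps2_expansion_bound:
  assumes W: "open W" and f: "holo_on f W" and r: "r > 0" "cball (fst z) r \<times> cball (snd z) r \<subseteq> W"
    and B: "\<And>w. w \<in> cball (fst z) r \<times> cball (snd z) r \<Longrightarrow> norm (f w) \<le> B"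
  shows "norm (fps_nth (fps_nth (fps2_expansion f z) i) j) \<le> B / r ^ (i + j)"
proof -
  have z: "z \<in> W" using r by (metis centre_in_cball less_imp_le mem_Times_iff subsetD)
  have cd: "cdiff f (u, v)" if "u \<in> cball (fst z) r" "v \<in> cball (snd z) r" for u v
    using that r(2) f unfolding holo_on_iff_cdiff by blast
  have 1: "norm ((deriv ^^ j) (\<lambda>v. f (u, v)) (snd z)) \<le> fact j * B / r ^ j" if u: "u \<in> cball (fst z) r" for u
  proof (rule Cauchy_inequality)
    show "(\<lambda>v. f (u, v)) holomorphic_on ball (snd z) r"
      unfolding holomorphic_on_def
      by (intro ballI, rule field_differentiable_at_within[OF cdiff_slice2[OF cd[OF u]]]) auto
    show "continuous_on (cball (snd z) r) (\<lambda>v. f (u, v))"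
      by (intro continuous_at_imp_continuous_on ballI field_differentiable_imp_continuous_at cdiff_slice2 cd u)
    show "norm (f (u, x)) \<le> B" if "norm (snd z - x) = r" for x
      using B[of "(u, x)"] u that by (simp add: dist_norm)
  qed (rule r)
  define h where "h = (\<lambda>u. (D2 ^^ j) f (u, snd z) / fact j)"
  have hd: "h field_differentiable at u" if "u \<in> cball (fst z) r" for u
  proof -
    have "(u, snd z) \<in> cball (fst z) r \<times> cball (snd z) r" using that r(1) by simp
    then have "(u, snd z) \<in> W" using r(2) by blast
    then show ?thesis
      unfolding h_def using holo_on_D2_funpow[OF W f, of j]
      by (intro derivative_intros cdiff_slice1) (auto simp: holo_on_iff_cdiff)
  qed
  have "norm ((deriv ^^ i) h (fst z)) \<le> fact i * (B / r ^ j) / r ^ i"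
  proof (rule Cauchy_inequality)
    show "h holomorphic_on ball (fst z) r"
      unfolding holomorphic_on_def by (intro ballI, rule field_differentiable_at_within[OF hd]) auto
    show "continuous_on (cball (fst z) r) h"
      by (intro continuous_at_imp_continuous_on ballI field_differentiable_imp_continuous_at hd)
    show "norm (h u) \<le> B / r ^ j" if "norm (fst z - u) = r" for u
    proof -
      have u: "u \<in> cball (fst z) r" using that by (simp add: dist_norm)
      then have "(u, snd z) \<in> cball (fst z) r \<times> cball (snd z) r" using r(1) by simp
      then have "(u, snd z) \<in> W" using r(2) by blast
      from 1[OF u] funpow_deriv_eq_D2[OF W f this, of j] show ?thesis
        by (simp add: h_def norm_divide field_simps)
    qed
  qed (rule r)
  then show ?thesis
    unfolding fps2_expansion_eq[OF W f z] fps_expansion_def h_def[symmetric]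
    by (simp add: norm_divide field_simps power_add)
qed

text \<open>On the polydisc of half the radius the Cauchy bounds compare the series with a double
  geometric series of ratio one half.\<close>

lemma fps2_convergent_expansion:
  assumes W: "open W" and f: "holo_on f W" and z: "z \<in> W"
  shows "fps2_convergent (fps2_expansion f z)"
proof -
  obtain r where r: "r > 0" "cball (fst z) r \<times> cball (snd z) r \<subseteq> W"
    using product_box_in_open[OF W z] .
  have "compact (f ` (cball (fst z) r \<times> cball (snd z) r))"
    by (intro compact_continuous_image continuous_on_subset[OF holo_on_continuous_on[OF f] r(2)] compact_Times compact_cball)
  then obtain B where B: "\<And>w. w \<in> cball (fst z) r \<times> cball (snd z) r \<Longrightarrow> norm (f w) \<le> B"
    using compact_imp_bounded[THEN bounded_normE] by (metis imageI)
  define c where "c = (\<lambda>i j. fps_nth (fps_nth (fps2_expansion f z) i) j)"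
  have c: "norm (c i j) \<le> B / r ^ (i + j)" for i j
    unfolding c_def by (rule fps2_expansion_bound[OF W f r B])
  have B0: "B \<ge> 0" using B[of z] r(1) by (metis centre_in_cball less_imp_le mem_Times_iff norm_ge_zero order_trans)
  have "(\<lambda>(i, j). c i j * u ^ i * v ^ j) summable_on UNIV" if uv: "cmod u < r / 2" "cmod v < r / 2" for u v
  proof -
    have g: "(\<lambda>n::nat. (1/2::real)^n) summable_on UNIV"
      by (rule norm_summable_imp_summable_on) (simp add: summable_geometric)
    have "(\<lambda>(i::nat, j::nat). B * ((1/2::real)^i * (1/2)^j)) summable_on UNIV"
    proof -
      have "(\<lambda>x. B * ((1/2::real)^fst x * (1/2)^snd x)) summable_on (UNIV \<times> UNIV)"
      proof (intro summable_on_cmult_right summable_on_SigmaI)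
        fix x :: nat
        show "((\<lambda>y::nat. (1/2::real) ^ fst (x, y) * (1/2) ^ snd (x, y)) has_sum (1/2)^x * infsum (\<lambda>n::nat. (1/2::real)^n) UNIV) UNIV"
          using has_sum_cmult_right[OF has_sum_infsum[OF g]] by simp
      qed (use summable_on_cmult_left[OF g] in auto)
      then show ?thesis by (simp add: case_prod_unfold)
    qed
    then have "(\<lambda>x. norm (case x of (i, j) \<Rightarrow> c i j * u ^ i * v ^ j)) summable_on UNIV"
    proof (rule Infinite_Sum.abs_summable_on_comparison_test')
      fix x :: "nat \<times> nat"
      obtain i j where x: "x = (i, j)" by force
      have "norm (c i j * u ^ i * v ^ j) \<le> (B / r ^ (i + j)) * (r / 2) ^ i * (r / 2) ^ j"
        unfolding norm_mult norm_power
        using uv r(1) B0 c by (intro mult_mono power_mono) auto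
      also have "\<dots> = B * ((1/2)^i * (1/2)^j)"
        using r(1) by (simp add: power_add power_divide)
      finally show "norm (case x of (i, j) \<Rightarrow> c i j * u ^ i * v ^ j) \<le> (case x of (i, j) \<Rightarrow> B * ((1/2)^i * (1/2)^j))"
        by (simp add: x)
    qed
    then show ?thesis by (rule abs_summable_summable)
  qed
  then show ?thesis
    unfolding fps2_convergent_def c_def using r(1) by (intro exI[of _ "r/2"]) auto
qed

section \<open>Order of vanishing and substitution for series in two variables\<close>

definition ord2_ge :: "nat \<Rightarrow> 'a::zero fps fps \<Rightarrow> bool" where
  "ord2_ge N F \<longleftrightarrow> (\<forall>i j. i + j < N \<longrightarrow> fps_nth (fps_nth F i) j = 0)"

text \<open>The Cauchy bound on a polydisc of radius \<open>\<rho>\<close> leaves a positive power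
  of \<open>\<rho>\<close> for a coefficient of total degree below \<open>N\<close>; let
  \<open>\<rho>\<close> tend to zero. The factor \<open>2 ^ N\<close> appears because points of that
  polydisc have distance at most \<open>2 * \<rho>\<close> from the centre.\<close>

lemma ord2_ge_expansion:
  assumes W: "open W" and f: "holo_on f W" and z: "z \<in> W"
    and C: "\<forall>\<^sub>F w in nhds z. norm (f w) \<le> C * norm (w - z) ^ N"
  shows "ord2_ge N (fps2_expansion f z)"
  unfolding ord2_ge_def
proof (intro allI impI)
  fix i j assume ij: "i + j < N"
  obtain W1 where W1: "open W1" "z \<in> W1" "\<And>w. w \<in> W1 \<Longrightarrow> norm (f w) \<le> C * norm (w - z) ^ N"
    using C by (auto simp: eventually_nhds)
  obtain r where r: "r > 0" "cball (fst z) r \<times> cball (snd z) r \<subseteq> W \<inter> W1"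
    using product_box_in_open[of "W \<inter> W1" z] W1 W z by auto
  let ?c = "norm (fps_nth (fps_nth (fps2_expansion f z) i) j)"
  have bd: "?c \<le> (\<bar>C\<bar> * 2 ^ N) * \<rho> ^ (N - (i + j))" if \<rho>: "\<rho> > 0" "\<rho> < r" for \<rho>
  proof -
    have sub: "cball (fst z) \<rho> \<times> cball (snd z) \<rho> \<subseteq> cball (fst z) r \<times> cball (snd z) r"
      using \<rho> by (intro Sigma_mono) auto
    have "?c \<le> (\<bar>C\<bar> * (2 * \<rho>) ^ N) / \<rho> ^ (i + j)"
    proof (rule fps2_expansion_bound[OF W f \<rho>(1)])
      show "cball (fst z) \<rho> \<times> cball (snd z) \<rho> \<subseteq> W" using sub r(2) by blast
      fix w assume w: "w \<in> cball (fst z) \<rho> \<times> cball (snd z) \<rho>"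
      then have "norm (f w) \<le> C * norm (w - z) ^ N" using W1(3) sub r(2) by blast
      also have "\<dots> \<le> \<bar>C\<bar> * norm (w - z) ^ N" by (intro mult_right_mono) auto
      also have "norm (w - z) \<le> norm (fst w - fst z) + norm (snd w - snd z)"
        using norm_Pair_le[of "fst w - fst z" "snd w - snd z"] by (simp add: minus_prod_def)
      then have "norm (w - z) \<le> 2 * \<rho>" using w by (auto simp: dist_norm norm_minus_commute)
      then have "\<bar>C\<bar> * norm (w - z) ^ N \<le> \<bar>C\<bar> * (2 * \<rho>) ^ N" by (intro mult_left_mono power_mono) auto
      finally show "norm (f w) \<le> \<bar>C\<bar> * (2 * \<rho>) ^ N" .
    qed
    also have "\<dots> = (\<bar>C\<bar> * 2 ^ N) * \<rho> ^ (N - (i + j))"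
      using \<rho> ij by (simp add: power_mult_distrib power_diff)
    finally show ?thesis .
  qed
  have "((\<lambda>\<rho>. (\<bar>C\<bar> * 2 ^ N) * \<rho> ^ (N - (i + j))) \<longlongrightarrow> (\<bar>C\<bar> * 2 ^ N) * 0 ^ (N - (i + j))) (at_right 0)"
    by (intro tendsto_intros)
  moreover have "\<forall>\<^sub>F \<rho> in at_right 0. ?c \<le> (\<bar>C\<bar> * 2 ^ N) * \<rho> ^ (N - (i + j))"
    unfolding eventually_at_right_field using r(1) bd by (intro exI[of _ r]) auto
  ultimately have "?c \<le> (\<bar>C\<bar> * 2 ^ N) * 0 ^ (N - (i + j))"
    by (intro tendsto_lowerbound) auto
  then show "fps_nth (fps_nth (fps2_expansion f z) i) j = 0"
    using ij by (simp add: zero_power)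
qed

lemma ord2_ge_add: "ord2_ge N F \<Longrightarrow> ord2_ge N G \<Longrightarrow> ord2_ge N (F + G)" for F :: "'a::comm_ring_1 fps fps"
  by (simp add: ord2_ge_def)

lemma ord2_ge_diff: "ord2_ge N F \<Longrightarrow> ord2_ge N G \<Longrightarrow> ord2_ge N (F - G)" for F :: "'a::comm_ring_1 fps fps"
  by (simp add: ord2_ge_def)

lemma ord2_ge_sum: "(\<And>k. k \<in> A \<Longrightarrow> ord2_ge N (F k)) \<Longrightarrow> ord2_ge N (sum F A)" for F :: "_ \<Rightarrow> 'a::comm_ring_1 fps fps"
  by (simp add: ord2_ge_def fps_sum_nth)

lemma ord2_ge_mult:
  fixes F :: "'a::comm_ring_1 fps fps"
  assumes "ord2_ge M F" "ord2_ge N G"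
  shows "ord2_ge (M + N) (F * G)"
  unfolding ord2_ge_def
proof (intro allI impI)
  fix i j assume ij: "i + j < M + N"
  have "fps_nth (fps_nth F a) b * fps_nth (fps_nth G (i - a)) (j - b) = 0" if "a \<le> i" "b \<le> j" for a b
  proof (cases "a + b < M")
    case False
    then have "(i - a) + (j - b) < N" using that ij by linarith
    then show ?thesis using assms(2) by (simp add: ord2_ge_def)
  qed (use assms(1) in \<open>simp add: ord2_ge_def\<close>)
  then show "fps_nth (fps_nth (F * G) i) j = 0"
    unfolding fps2_mult_nth by (intro sum.neutral ballI) auto
qed

lemma ord2_ge_0 [simp]: "ord2_ge 0 F"
  by (simp add: ord2_ge_def)

lemma ord2_ge_mono: "ord2_ge N F \<Longrightarrow> M \<le> N \<Longrightarrow> ord2_ge M F"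
  by (simp add: ord2_ge_def)

lemma ord2_ge_power: "ord2_ge 1 F \<Longrightarrow> ord2_ge k (F ^ k)" for F :: "'a::comm_ring_1 fps fps"
proof (induction k)
  case (Suc k)
  then show ?case using ord2_ge_mult[of 1 F k "F ^ k"] by simp
qed simp

text \<open>The final equality of series is obtained from estimates of every order in this
  way.\<close>

lemma ord2_ge_all_imp_0: "(\<And>N. ord2_ge N F) \<Longrightarrow> F = 0"
  unfolding ord2_ge_def by (intro fps_ext) (metis fps_zero_nth lessI)

text \<open>The cut-off in \<open>fps2_subst\<close> varies with the coefficient; here it is
  replaced by any larger common bound, as products of series require.\<close>

lemma fps2_subst_nth:
  assumes "ord2_ge 1 F" "i + j \<le> M"
  shows "fps_nth (fps_nth (fps2_subst a F) i) j = (\<Sum>k\<le>M. fps_nth a k * fps_nth (fps_nth (F ^ k) i) j)"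
proof -
  have "fps_nth (fps_nth (F ^ k) i) j = 0" if "i + j < k" for k
    using ord2_ge_power[OF assms(1), of k] that by (simp add: ord2_ge_def)
  then show ?thesis
    unfolding fps2_subst_def fps_nth_Abs_fps using assms(2)
    by (intro sum.mono_neutral_left) (auto simp: not_le)
qed

lemma fps2_subst_add: "fps2_subst (a + b) F = fps2_subst a F + fps2_subst b F"
  by (rule fps_ext, rule fps_ext) (simp add: fps2_subst_def algebra_simps sum.distrib)

lemma fps2_subst_0: "fps2_subst 0 F = 0"
  by (rule fps_ext, rule fps_ext) (simp add: fps2_subst_def)

lemma fps2_subst_sum: "fps2_subst (sum a A) F = (\<Sum>k\<in>A. fps2_subst (a k) F)"
  by (induction A rule: infinite_finite_induct) (simp_all add: fps2_subst_add fps2_subst_0)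

lemma fps2_subst_1: "fps2_subst 1 F = 1"
proof (rule fps_ext, rule fps_ext)
  fix i j
  have "fps_nth (fps_nth (fps2_subst 1 F) i) j = (\<Sum>k\<in>{0}. fps_nth 1 k * fps_nth (fps_nth (F ^ k) i) j)"
    unfolding fps2_subst_def fps_nth_Abs_fps by (intro sum.mono_neutral_right) auto
  then show "fps_nth (fps_nth (fps2_subst 1 F) i) j = fps_nth (fps_nth 1 i) j" by simp
qed

text \<open>A coefficient of total degree \<open>M\<close> sees only the polynomials
  \<open>P a\<close> and \<open>P b\<close>, for which the product is a finite computation.
  \<open>F ^ m\<close> has order at least \<open>m\<close>, so terms with \<open>m > M\<close> do
  not contribute.\<close>

lemma fps2_subst_mult:
  assumes F: "ord2_ge 1 F"
  shows "fps2_subst (a * b) F = fps2_subst a F * fps2_subst b F"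
proof (rule fps_ext, rule fps_ext)
  fix i j :: nat
  let ?C = "\<lambda>c. fps_const (fps_const c)"
  define M where "M = i + j"
  define P where "P = (\<lambda>a. \<Sum>k\<le>M. ?C (fps_nth a k) * F ^ k)"
  have P: "fps_nth (fps_nth (fps2_subst a F) i') j' = fps_nth (fps_nth (P a) i') j'" if "i' + j' \<le> M" for i' j' a
    unfolding fps2_subst_nth[OF F that] P_def by (simp add: fps_sum_nth)
  have "fps_nth (fps_nth (fps2_subst a F * fps2_subst b F) i) j = fps_nth (fps_nth (P a * P b) i) j"
    unfolding fps2_mult_nth by (intro sum.cong refl arg_cong2[where f="(*)"] P) (auto simp: M_def)
  also have "P a * P b = (\<Sum>(k, l)\<in>{..M} \<times> {..M}. ?C (fps_nth a k * fps_nth b l) * F ^ (k + l))"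
    unfolding P_def sum_product sum.cartesian_product
    by (intro sum.cong refl) (auto simp: power_add algebra_simps simp flip: fps_const_mult)
  also have "fps_nth (fps_nth \<dots> i) j = (\<Sum>(k, l)\<in>{..M} \<times> {..M}. fps_nth a k * fps_nth b l * fps_nth (fps_nth (F ^ (k + l)) i) j)"
    by (simp add: fps_sum_nth case_prod_unfold)
  \<comment> \<open>Only the triangle where \<open>k + l\<close> is at most \<open>M\<close>
    contributes; it is then regrouped along \<open>m = k + l\<close>.\<close>
  also have "\<dots> = (\<Sum>(k, l)\<in>(SIGMA k:{..M}. {..M - k}). fps_nth a k * fps_nth b l * fps_nth (fps_nth (F ^ (k + l)) i) j)"
  proof (rule sum.mono_neutral_right)
    have *: "k + l \<le> M" if "fps_nth (fps_nth (F ^ (k + l)) i) j \<noteq> 0" for k l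
      using ord2_ge_power[OF F, of "k + l"] that unfolding ord2_ge_def M_def by (meson not_le)
    show "\<forall>x\<in>{..M} \<times> {..M} - (SIGMA k:{..M}. {..M - k}). (case x of (k, l) \<Rightarrow>
        fps_nth a k * fps_nth b l * fps_nth (fps_nth (F ^ (k + l)) i) j) = 0"
    proof (intro ballI)
      fix x assume "x \<in> {..M} \<times> {..M} - (SIGMA k:{..M}. {..M - k})"
      moreover obtain k l where x: "x = (k, l)" by force
      ultimately have "\<not> k + l \<le> M" by auto
      then have "fps_nth (fps_nth (F ^ (k + l)) i) j = 0" using *[of k l] by blast
      then show "(case x of (k, l) \<Rightarrow> fps_nth a k * fps_nth b l * fps_nth (fps_nth (F ^ (k + l)) i) j) = 0"
        by (simp add: x)
    qed
  qed auto
  also have "(SIGMA k:{..M}. {..M - k}) = {(k, l). k + l \<le> M}" by auto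
  also have "(\<Sum>(k, l)\<in>\<dots>. fps_nth a k * fps_nth b l * fps_nth (fps_nth (F ^ (k + l)) i) j) =
      (\<Sum>m\<le>M. \<Sum>k\<le>m. fps_nth a k * fps_nth b (m - k) * fps_nth (fps_nth (F ^ (k + (m - k))) i) j)"
    by (rule sum.triangle_reindex_eq)
  also have "\<dots> = (\<Sum>m\<le>M. \<Sum>k\<le>m. fps_nth a k * fps_nth b (m - k) * fps_nth (fps_nth (F ^ m) i) j)"
    by simp
  also have "\<dots> = fps_nth (fps_nth (fps2_subst (a * b) F) i) j"
    unfolding fps2_subst_nth[OF F order_refl] M_def
    by (simp add: fps_mult_nth atLeast0AtMost sum_distrib_right)
  finally show "fps_nth (fps_nth (fps2_subst (a * b) F) i) j = fps_nth (fps_nth (fps2_subst a F * fps2_subst b F) i) j" ..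
qed

lemma ord2_ge_subst_truncation:
  assumes F: "ord2_ge 1 F"
  shows "ord2_ge N (fps2_subst a F - (\<Sum>k<N. fps_const (fps_const (fps_nth a k)) * F ^ k))"
  unfolding ord2_ge_def
proof (intro allI impI)
  fix i j assume ij: "i + j < N"
  then have "fps_nth (fps_nth (fps2_subst a F) i) j = (\<Sum>k<N. fps_nth a k * fps_nth (fps_nth (F ^ k) i) j)"
    using fps2_subst_nth[OF F, of i j "N - 1" a] by (cases N) (auto simp: lessThan_Suc_atMost)
  then show "fps_nth (fps_nth (fps2_subst a F - (\<Sum>k<N. fps_const (fps_const (fps_nth a k)) * F ^ k)) i) j = 0"
    by (simp add: fps_sum_nth)
qed

lemma has_fps_expansion_bigo:
  fixes f :: "complex \<Rightarrow> complex"
  assumes f: "f has_fps_expansion F" and F: "\<And>k. k < N \<Longrightarrow> fps_nth F k = 0"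
  shows "f \<in> O[nhds 0](\<lambda>z. z ^ N)"
proof (cases "F = 0")
  \<comment> \<open>The zero series has subdegree \<open>0\<close> by convention, so it escapes the
    division by \<open>z ^ N\<close> below.\<close>
  case True
  then have "\<forall>\<^sub>F z in nhds 0. f z = 0" using f by (simp add: has_fps_expansion_0_iff)
  then show ?thesis by (intro bigoI[of _ 0]) (auto elim: eventually_mono)
next
  case False
  then have sub: "N \<le> subdegree F" using F by (meson not_less nth_subdegree_nonzero)
  define g where "g = (\<lambda>x. if x = 0 then fps_nth F N else f x / x ^ N)"
  have "g has_fps_expansion fps_shift N F"
    unfolding g_def by (rule has_fps_expansion_shift[OF f sub]) simp
  then have "continuous (at 0) g" by (rule has_fps_expansion_imp_continuous)
  then have "(g \<longlongrightarrow> g 0) (nhds 0)" unfolding isCont_def tendsto_at_iff_tendsto_nhds .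
  then have g1: "g \<in> O[nhds 0](\<lambda>_. 1)" by (intro bigoI_tendsto) auto
  \<comment> \<open>The filter \<open>nhds 0\<close> contains the point \<open>0\<close> itself, so
    the value of \<open>f\<close> there has to match as well.\<close>
  have "f 0 = fps_nth F 0" using f has_fps_expansion_imp_0_eq_fps_nth_0 by blast
  then have eq: "f x = g x * x ^ N" for x using F[of 0] by (cases "N = 0"; cases "x = 0"; simp add: g_def zero_power)
  have "(\<lambda>x. g x * x ^ N) \<in> O[nhds 0](\<lambda>x. 1 * x ^ N)"
    by (intro landau_o.big.mult g1) auto
  then show ?thesis by (simp add: eq[symmetric] del: if_split)
qed

section \<open>Charts and holomorphic functions on manifolds\<close>

lemma top_chart_inj: "top_chart T K \<Longrightarrow> inj_on (snd K) (fst K)"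
  unfolding top_chart_def
  by (metis homeomorphic_imp_injective_map openin_subset topspace_subtopology_subset)

lemma top_chart_openin: "top_chart T K \<Longrightarrow> openin T (fst K)"
  by (simp add: top_chart_def)

lemma top_chart_vimage:
  assumes "top_chart T K" "open V"
  shows "openin T (fst K \<inter> snd K -` V)"
proof -
  have "continuous_map (subtopology T (fst K)) (top_of_set (snd K ` fst K)) (snd K)"
    using assms by (auto simp: top_chart_def homeomorphic_imp_continuous_map)
  moreover have "openin (top_of_set (snd K ` fst K)) (snd K ` fst K \<inter> V)"
    using assms(2) by auto
  ultimately have "openin (subtopology T (fst K)) {x \<in> topspace (subtopology T (fst K)). snd K x \<in> snd K ` fst K \<inter> V}"
    by (rule openin_continuous_map_preimage)
  moreover have "{x \<in> topspace (subtopology T (fst K)). snd K x \<in> snd K ` fst K \<inter> V} = fst K \<inter> snd K -` V"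
    using openin_subset[OF top_chart_openin[OF assms(1)]] by auto
  ultimately show ?thesis
    using top_chart_openin[OF assms(1)] by (simp add: openin_open_subtopology)
qed

lemma top_chart_image:
  assumes "top_chart T K" "openin T W"
  shows "open (snd K ` (fst K \<inter> W))"
proof -
  have "open_map (subtopology T (fst K)) (top_of_set (snd K ` fst K)) (snd K)"
    using assms by (auto simp: top_chart_def homeomorphic_imp_open_map)
  moreover have "openin (subtopology T (fst K)) (fst K \<inter> W)"
    using assms(2) by (auto simp: openin_subtopology)
  ultimately have "openin (top_of_set (snd K ` fst K)) (snd K ` (fst K \<inter> W))"
    by (simp add: open_map_def)
  moreover have "open (snd K ` fst K)" using assms by (simp add: top_chart_def)
  ultimately show ?thesis using openin_open_trans by blast
qed

lemma chart_inv_apply [simp]: "top_chart T K \<Longrightarrow> x \<in> fst K \<Longrightarrow> chart_inv K (snd K x) = x"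
  by (simp add: chart_inv_def top_chart_inj)

lemma top_chartI:
  assumes "openin T U" "inj_on k U" "\<And>V. open V \<Longrightarrow> openin T (U \<inter> k -` V)"
    "\<And>W. openin T W \<Longrightarrow> W \<subseteq> U \<Longrightarrow> open (k ` W)"
  shows "top_chart T (U, k)"
proof -
  have ts: "topspace (subtopology T U) = U" using openin_subset[OF assms(1)] by auto
  have "homeomorphic_map (subtopology T U) (top_of_set (k ` U)) k"
  proof (rule bijective_open_imp_homeomorphic_map)
    show "continuous_map (subtopology T U) (top_of_set (k ` U)) k"
      unfolding continuous_map_def ts
    proof (intro conjI allI impI)
      show "k \<in> U \<rightarrow> topspace (top_of_set (k ` U))" by simp
      fix S assume "openin (top_of_set (k ` U)) S"
      then obtain V where V: "open V" "S = k ` U \<inter> V" by (auto simp: openin_open)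
      then have "{x \<in> U. k x \<in> S} = U \<inter> k -` V" by auto
      then show "openin (subtopology T U) {x \<in> U. k x \<in> S}"
        using assms(1,3) V by (simp add: openin_open_subtopology)
    qed
    show "open_map (subtopology T U) (top_of_set (k ` U)) k"
      unfolding open_map_def using assms(1,4)
      by (auto simp: openin_open_subtopology intro!: open_openin_trans image_mono)
    show "k ` topspace (subtopology T U) = topspace (top_of_set (k ` U))" using ts by simp
    show "inj_on k (topspace (subtopology T U))" using assms(2) ts by simp
  qed
  then show ?thesis using assms by (simp add: top_chart_def)
qed

text \<open>Pointwise form of holomorphy. On a complex manifold a single chart decides, by
  \<open>mdiff_coordinate\<close>, so closure rules can be proved at a point without tracking open
  sets.\<close>

definition mdiff ::
  "('a, 'm::complex_normed_space) cmanifold \<Rightarrow> ('a \<Rightarrow> 'v::complex_normed_space) \<Rightarrow> 'a \<Rightarrow> bool" where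
  "mdiff M f x \<longleftrightarrow> (\<exists>K\<in>atlas M. x \<in> fst K \<and> cdiff (f \<circ> chart_inv K) (snd K x))"

lemma holo_transition_iff:
  "holo_transition K L \<longleftrightarrow> (\<forall>x \<in> fst K \<inter> fst L. cdiff (snd L \<circ> chart_inv K) (snd K x))"
  by (auto simp: holo_transition_def holo_on_iff_cdiff)

lemma atlas_coordinate: "complex_manifold M \<Longrightarrow> K \<in> atlas M \<Longrightarrow> coordinate M K"
  by (auto simp: complex_manifold_def coordinate_def)

lemma atlas_cover: "complex_manifold M \<Longrightarrow> x \<in> points M \<Longrightarrow> \<exists>K\<in>atlas M. x \<in> fst K"
  by (auto simp: complex_manifold_def)

lemma coordinate_top_chart: "coordinate M K \<Longrightarrow> top_chart (mtop M) K"
  by (simp add: coordinate_def)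

lemma coordinate_points: "coordinate M K \<Longrightarrow> x \<in> fst K \<Longrightarrow> x \<in> points M"
  using openin_subset[OF top_chart_openin[OF coordinate_top_chart]] unfolding points_def by fast

lemma openin_points: "openin (mtop M) W \<Longrightarrow> x \<in> W \<Longrightarrow> x \<in> points M"
  using openin_subset[of "mtop M" W] unfolding points_def by blast

lemma cdiff_change_chart:
  assumes K: "top_chart T K" and L: "top_chart T L" and x: "x \<in> fst K" "x \<in> fst L"
    and t: "cdiff (snd L \<circ> chart_inv K) (snd K x)" and f: "cdiff (f \<circ> chart_inv L) (snd L x)"
  shows "cdiff (f \<circ> chart_inv K) (snd K x)"
proof -
  have "cdiff (\<lambda>z. (f \<circ> chart_inv L) ((snd L \<circ> chart_inv K) z)) (snd K x)"
    by (rule cdiff_compose[OF t]) (use K x f in \<open>simp add: o_def\<close>)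
  moreover have "cdiff (f \<circ> chart_inv K) (snd K x) \<longleftrightarrow>
      cdiff (\<lambda>z. (f \<circ> chart_inv L) ((snd L \<circ> chart_inv K) z)) (snd K x)"
    by (rule cdiff_cong_open[OF top_chart_image[OF K top_chart_openin[OF L]]]) (use K L x in auto)
  ultimately show ?thesis by simp
qed

lemma mdiff_coordinate:
  assumes M: "complex_manifold M" and K: "coordinate M K" and x: "x \<in> fst K"
  shows "mdiff M f x \<longleftrightarrow> cdiff (f \<circ> chart_inv K) (snd K x)"
proof
  assume "mdiff M f x"
  then obtain L where L: "L \<in> atlas M" "x \<in> fst L" "cdiff (f \<circ> chart_inv L) (snd L x)"
    by (auto simp: mdiff_def)
  show "cdiff (f \<circ> chart_inv K) (snd K x)"
  proof (rule cdiff_change_chart[OF coordinate_top_chart[OF K] _ x L(2) _ L(3)])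
    show "top_chart (mtop M) L" using M L(1) by (simp add: complex_manifold_def)
    show "cdiff (snd L \<circ> chart_inv K) (snd K x)"
      using K L x by (auto simp: coordinate_def holo_transition_iff)
  qed
next
  assume f: "cdiff (f \<circ> chart_inv K) (snd K x)"
  obtain L where L: "L \<in> atlas M" "x \<in> fst L"
    using atlas_cover[OF M coordinate_points[OF K x]] by blast
  have "cdiff (f \<circ> chart_inv L) (snd L x)"
  proof (rule cdiff_change_chart[OF _ coordinate_top_chart[OF K] L(2) x _ f])
    show "top_chart (mtop M) L" using M L(1) by (simp add: complex_manifold_def)
    show "cdiff (snd K \<circ> chart_inv L) (snd L x)"
      using K L x by (auto simp: coordinate_def holo_transition_iff)
  qed
  then show "mdiff M f x" using L by (auto simp: mdiff_def)
qed

lemma holo_fun_iff: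
  assumes M: "complex_manifold M"
  shows "holo_fun M W f \<longleftrightarrow> openin (mtop M) W \<and> (\<forall>x\<in>W. mdiff M f x)"
proof -
  have "(\<forall>K\<in>atlas M. holo_on (f \<circ> chart_inv K) (snd K ` (fst K \<inter> W))) \<longleftrightarrow> (\<forall>x\<in>W. mdiff M f x)"
    if W: "openin (mtop M) W"
  proof
    assume h: "\<forall>K\<in>atlas M. holo_on (f \<circ> chart_inv K) (snd K ` (fst K \<inter> W))"
    show "\<forall>x\<in>W. mdiff M f x"
    proof
      fix x assume x: "x \<in> W"
      obtain L where L: "L \<in> atlas M" "x \<in> fst L"
        using atlas_cover[OF M openin_points[OF W x]] by blast
      with h x show "mdiff M f x" unfolding mdiff_def holo_on_iff_cdiff by blast
    qed
  next
    assume h: "\<forall>x\<in>W. mdiff M f x"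
    then show "\<forall>K\<in>atlas M. holo_on (f \<circ> chart_inv K) (snd K ` (fst K \<inter> W))"
      unfolding holo_on_iff_cdiff using mdiff_coordinate[OF M atlas_coordinate[OF M]] by blast
  qed
  then show ?thesis by (auto simp: holo_fun_def)
qed

lemma holo_funI:
  "complex_manifold M \<Longrightarrow> openin (mtop M) W \<Longrightarrow> (\<And>x. x \<in> W \<Longrightarrow> mdiff M f x) \<Longrightarrow> holo_fun M W f"
  by (simp add: holo_fun_iff)

lemma holo_fun_mdiff: "complex_manifold M \<Longrightarrow> holo_fun M W f \<Longrightarrow> x \<in> W \<Longrightarrow> mdiff M f x"
  by (simp add: holo_fun_iff)

lemma holo_fun_openin: "holo_fun M W f \<Longrightarrow> openin (mtop M) W"
  by (simp add: holo_fun_def)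

lemma holo_fun_subset:
  "complex_manifold M \<Longrightarrow> holo_fun M W f \<Longrightarrow> openin (mtop M) V \<Longrightarrow> V \<subseteq> W \<Longrightarrow> holo_fun M V f"
  by (auto simp: holo_fun_iff)

lemma mdiff_points: "complex_manifold M \<Longrightarrow> mdiff M f x \<Longrightarrow> x \<in> points M"
  by (auto simp: mdiff_def intro: coordinate_points atlas_coordinate)

lemma mdiff_cong:
  assumes M: "complex_manifold M" and V: "openin (mtop M) V" "x \<in> V" and eq: "\<And>y. y \<in> V \<Longrightarrow> f y = g y"
  shows "mdiff M f x \<longleftrightarrow> mdiff M g x"
proof -
  obtain K where K: "K \<in> atlas M" "x \<in> fst K"
    using atlas_cover[OF M openin_points[OF V]] by blast
  have K': "coordinate M K" using M K(1) by (rule atlas_coordinate)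
  note tc = coordinate_top_chart[OF K']
  have "cdiff (f \<circ> chart_inv K) (snd K x) \<longleftrightarrow> cdiff (g \<circ> chart_inv K) (snd K x)"
    by (rule cdiff_cong_open[OF top_chart_image[OF tc V(1)]]) (use K V tc eq in auto)
  then show ?thesis by (simp add: mdiff_coordinate[OF M K' K(2)])
qed

lemma mdiff_cdiff_compose:
  assumes M: "complex_manifold M" and f: "mdiff M f x" and g: "cdiff g (f x)"
  shows "mdiff M (\<lambda>y. g (f y)) x"
proof -
  obtain K where K: "K \<in> atlas M" "x \<in> fst K" "cdiff (f \<circ> chart_inv K) (snd K x)"
    using f by (auto simp: mdiff_def)
  have K': "coordinate M K" using M K(1) by (rule atlas_coordinate)
  have "cdiff (\<lambda>z. g ((f \<circ> chart_inv K) z)) (snd K x)"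
    by (rule cdiff_compose[OF K(3)]) (use g coordinate_top_chart[OF K'] K in simp)
  then show ?thesis using K by (auto simp: mdiff_def o_def)
qed

lemma mdiff_Pair:
  assumes M: "complex_manifold M" and f: "mdiff M f x" and g: "mdiff M g x"
  shows "mdiff M (\<lambda>y. (f y, g y)) x"
proof -
  obtain K where K: "K \<in> atlas M" "x \<in> fst K" "cdiff (f \<circ> chart_inv K) (snd K x)"
    using f by (auto simp: mdiff_def)
  have K': "coordinate M K" using M K(1) by (rule atlas_coordinate)
  have "cdiff (g \<circ> chart_inv K) (snd K x)" using g mdiff_coordinate[OF M K' K(2)] by blast
  from cdiff_Pair[OF K(3) this] show ?thesis using K by (auto simp: mdiff_def o_def)
qed

lemma mdiff_const: "complex_manifold M \<Longrightarrow> x \<in> points M \<Longrightarrow> mdiff M (\<lambda>_. c) x"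
  using atlas_cover by (fastforce simp: mdiff_def o_def)

lemma mdiff_add:
  assumes M: "complex_manifold M" and f: "mdiff M f x" and g: "mdiff M g x"
  shows "mdiff M (\<lambda>y. f y + g y) x"
  using mdiff_cdiff_compose[OF M mdiff_Pair[OF M f g], of "\<lambda>p. fst p + snd p"]
  by (simp add: cdiff_add)

lemma mdiff_mult:
  fixes f g :: "'a \<Rightarrow> complex"
  assumes M: "complex_manifold M" and f: "mdiff M f x" and g: "mdiff M g x"
  shows "mdiff M (\<lambda>y. f y * g y) x"
  using mdiff_cdiff_compose[OF M mdiff_Pair[OF M f g], of "\<lambda>p. fst p * snd p"]
  by (simp add: cdiff_mult)

lemma mdiff_diff:
  fixes f g :: "'a \<Rightarrow> complex"
  assumes M: "complex_manifold M" and f: "mdiff M f x" and g: "mdiff M g x"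
  shows "mdiff M (\<lambda>y. f y - g y) x"
  using mdiff_cdiff_compose[OF M mdiff_Pair[OF M f g], of "\<lambda>p. fst p - snd p"]
  by (simp add: cdiff_diff)

lemma mdiff_power:
  fixes f :: "'a \<Rightarrow> complex"
  assumes M: "complex_manifold M" and f: "mdiff M f x"
  shows "mdiff M (\<lambda>y. f y ^ n) x"
  using mdiff_cdiff_compose[OF M f, of "\<lambda>p. p ^ n"] by (simp add: cdiff_power)

lemma mdiff_sum:
  assumes M: "complex_manifold M" and x: "x \<in> points M" and f: "\<And>i. i \<in> A \<Longrightarrow> mdiff M (f i) x"
  shows "mdiff M (\<lambda>y. \<Sum>i\<in>A. f i y) x"
  using f by (induction A rule: infinite_finite_induct) (auto intro: mdiff_add mdiff_const M x)

lemma mdiff_vec_iff: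
  assumes M: "complex_manifold M"
  shows "mdiff M f x \<longleftrightarrow> (\<forall>i. mdiff M (\<lambda>y. f y $ i) x)"
proof (cases "x \<in> points M")
  case True
  then obtain K where K: "K \<in> atlas M" "x \<in> fst K" using atlas_cover[OF M] by blast
  have K': "coordinate M K" using M K(1) by (rule atlas_coordinate)
  show ?thesis
    unfolding mdiff_coordinate[OF M K' K(2)] cdiff_vec_iff[of "f \<circ> _"] by (simp add: o_def)
\<comment> \<open>Outside of the manifold both sides are false; \<open>undefined\<close> merely
  supplies an index at which the right-hand side fails.\<close>
qed (use mdiff_points[OF M, of f x] mdiff_points[OF M, of "\<lambda>y. f y $ undefined" x] in blast)

lemma mdiff_matrix_iff:
  assumes M: "complex_manifold M"
  shows "mdiff M f x \<longleftrightarrow> (\<forall>i j. mdiff M (\<lambda>y. f y $ i $ j) x)"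
  by (simp add: mdiff_vec_iff[OF M])

lemma mdiff_chart:
  assumes M: "complex_manifold M" and K: "coordinate M K" and x: "x \<in> fst K"
  shows "mdiff M (snd K) x"
  unfolding mdiff_coordinate[OF assms]
proof -
  note tc = coordinate_top_chart[OF K]
  have "cdiff (snd K \<circ> chart_inv K) (snd K x) \<longleftrightarrow> cdiff (\<lambda>z. z) (snd K x)"
    by (rule cdiff_cong_open[OF top_chart_image[OF tc top_chart_openin[OF tc]]]) (use x tc in auto)
  then show "cdiff (snd K \<circ> chart_inv K) (snd K x)" by simp
qed

lemma mdiff_chart_inv_compose:
  assumes M: "complex_manifold M" and K: "coordinate M K" and x: "x \<in> fst K" and g: "cdiff g (snd K x)"
  shows "mdiff M (\<lambda>y. g (snd K y)) x"
  by (rule mdiff_cdiff_compose[OF M mdiff_chart[OF M K x] g])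

lemma mdiff_holo_map:
  assumes M: "complex_manifold M" and N: "complex_manifold N" and f: "holo_map M N f"
    and x: "x \<in> points M" and u: "mdiff N u (f x)"
  shows "mdiff M (\<lambda>y. u (f y)) x"
proof -
  obtain K where K: "K \<in> atlas M" "x \<in> fst K" using atlas_cover[OF M x] by blast
  have K': "coordinate M K" using M K(1) by (rule atlas_coordinate)
  obtain L where L: "L \<in> atlas N" "f x \<in> fst L" "cdiff (u \<circ> chart_inv L) (snd L (f x))"
    using u by (auto simp: mdiff_def)
  have tL: "top_chart (mtop N) L" using N L(1) by (simp add: complex_manifold_def)
  note tK = coordinate_top_chart[OF K']
  have "openin (mtop M) {y \<in> topspace (mtop M). f y \<in> fst L}"
    using f top_chart_openin[OF tL] by (auto simp: holo_map_def intro: openin_continuous_map_preimage)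
  then have op: "open (snd K ` (fst K \<inter> {y \<in> topspace (mtop M). f y \<in> fst L}))"
    by (rule top_chart_image[OF tK])
  have "cdiff (snd L \<circ> f \<circ> chart_inv K) (snd K x)"
    using f K L by (auto simp: holo_map_def holo_on_iff_cdiff)
  then have "cdiff (\<lambda>z. (u \<circ> chart_inv L) ((snd L \<circ> f \<circ> chart_inv K) z)) (snd K x)"
    by (rule cdiff_compose) (use L tK K in \<open>simp add: o_def\<close>)
  moreover have "cdiff ((\<lambda>y. u (f y)) \<circ> chart_inv K) (snd K x) \<longleftrightarrow>
      cdiff (\<lambda>z. (u \<circ> chart_inv L) ((snd L \<circ> f \<circ> chart_inv K) z)) (snd K x)"
    by (rule cdiff_cong_open[OF op]) (use K L tK tL x in \<open>auto simp: points_def\<close>)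
  ultimately show ?thesis using K by (auto simp: mdiff_def)
qed

lemma mdiff_tendsto:
  assumes M: "complex_manifold M" and f: "mdiff M f x"
  shows "(f \<longlongrightarrow> f x) (nhdsin (mtop M) x)"
proof (rule topological_tendstoI)
  fix S assume S: "open S" "f x \<in> S"
  obtain K where K: "K \<in> atlas M" "x \<in> fst K" "cdiff (f \<circ> chart_inv K) (snd K x)"
    using f by (auto simp: mdiff_def)
  have tK: "top_chart (mtop M) K" using M K(1) by (simp add: complex_manifold_def)
  have "isCont (f \<circ> chart_inv K) (snd K x)" using K(3) by (rule cdiff_imp_isCont)
  then obtain V where V: "open V" "snd K x \<in> V" "\<And>z. z \<in> V \<Longrightarrow> (f \<circ> chart_inv K) z \<in> S"
    using S K tK unfolding continuous_at_open by (metis chart_inv_apply comp_apply)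
  have "openin (mtop M) (fst K \<inter> snd K -` V)" by (rule top_chart_vimage[OF tK V(1)])
  moreover have "f y \<in> S" if "y \<in> fst K \<inter> snd K -` V" for y
    using V(3)[of "snd K y"] that tK by auto
  ultimately show "\<forall>\<^sub>F y in nhdsin (mtop M) x. f y \<in> S"
    unfolding eventually_nhdsin using K V by (auto intro!: exI[of _ "fst K \<inter> snd K -` V"])
qed

lemma coordinateI:
  assumes M: "complex_manifold M" and tc: "top_chart (mtop M) K"
    and k: "\<And>x. x \<in> fst K \<Longrightarrow> mdiff M (snd K) x"
    and inv: "\<And>x L. L \<in> atlas M \<Longrightarrow> x \<in> fst K \<Longrightarrow> x \<in> fst L \<Longrightarrow> cdiff (snd L \<circ> chart_inv K) (snd K x)"
  shows "coordinate M K"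
  unfolding coordinate_def holo_transition_iff
  using tc inv k mdiff_coordinate[OF M atlas_coordinate[OF M]] by blast

section \<open>New coordinates from old ones\<close>

lemma top_chart_restrict:
  assumes K: "top_chart T K" and W: "openin T W"
  shows "top_chart T (fst K \<inter> W, snd K)"
proof (rule top_chartI)
  show "openin T (fst K \<inter> W)" using top_chart_openin[OF K] W by (rule openin_Int)
  show "inj_on (snd K) (fst K \<inter> W)" using top_chart_inj[OF K] by (rule inj_on_subset) auto
  show "openin T (fst K \<inter> W \<inter> snd K -` V)" if "open V" for V
    using openin_Int[OF top_chart_vimage[OF K that] W] by (simp add: Int_ac)
  show "open (snd K ` V)" if "openin T V" "V \<subseteq> fst K \<inter> W" for V
    using top_chart_image[OF K that(1)] that(2) by (simp add: Int_absorb1)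
qed

lemma chart_inv_restrict:
  assumes K: "top_chart T K" and x: "x \<in> fst K \<inter> W"
  shows "chart_inv (fst K \<inter> W, snd K) (snd K x) = x"
  unfolding chart_inv_def using top_chart_inj[OF K] x
  by (auto intro!: inv_into_f_f inj_on_subset[of _ "fst K"])

lemma coordinate_restrict:
  assumes M: "complex_manifold M" and K: "coordinate M K" and W: "openin (mtop M) W"
  shows "coordinate M (fst K \<inter> W, snd K)"
proof (rule coordinateI[OF M])
  note tc = coordinate_top_chart[OF K]
  show tc': "top_chart (mtop M) (fst K \<inter> W, snd K)" by (rule top_chart_restrict[OF tc W])
  show "mdiff M (snd (fst K \<inter> W, snd K)) x" if "x \<in> fst (fst K \<inter> W, snd K)" for x
    using mdiff_chart[OF M K] that by simp
  fix x L assume L: "L \<in> atlas M" "x \<in> fst (fst K \<inter> W, snd K)" "x \<in> fst L"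
  have "cdiff (snd L \<circ> chart_inv K) (snd K x)"
    using K L by (auto simp: coordinate_def holo_transition_iff)
  moreover have "cdiff (snd L \<circ> chart_inv (fst K \<inter> W, snd K)) (snd K x) \<longleftrightarrow> cdiff (snd L \<circ> chart_inv K) (snd K x)"
    by (rule cdiff_cong_open[OF top_chart_image[OF tc W]])
      (use L tc chart_inv_restrict[OF tc] in auto)
  ultimately show "cdiff (snd L \<circ> chart_inv (fst K \<inter> W, snd K)) (snd (fst K \<inter> W, snd K) x)" by simp
qed

text \<open>The assumptions on \<open>\<Theta>\<close> have the form delivered by
  \<open>graph_map_locally_biholomorphic\<close>. Holomorphy of the inverse is what makes the
  transitions out of the new chart holomorphic.\<close>

lemma coordinate_compose:
  fixes M :: "('a, 'm::complex_normed_space) cmanifold" and \<Theta> :: "'m \<Rightarrow> 'm"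
  assumes M: "complex_manifold M" and K: "coordinate M K"
    and V: "open V" and \<Theta>: "holo_on \<Theta> V" "inj_on \<Theta> V"
    and op: "\<And>V'. open V' \<Longrightarrow> V' \<subseteq> V \<Longrightarrow> open (\<Theta> ` V')"
    and inv: "holo_on (inv_into V \<Theta>) (\<Theta> ` V)"
  shows "coordinate M (fst K \<inter> snd K -` V, \<Theta> \<circ> snd K)"
proof (rule coordinateI[OF M])
  note tc = coordinate_top_chart[OF K]
  let ?U = "fst K \<inter> snd K -` V" and ?k = "\<Theta> \<circ> snd K"
  have inj: "inj_on ?k ?U"
    by (intro comp_inj_on inj_on_subset[OF top_chart_inj[OF tc]] inj_on_subset[OF \<Theta>(2)]) auto
  have oU: "openin (mtop M) ?U" by (rule top_chart_vimage[OF tc V])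
  show tc': "top_chart (mtop M) (?U, ?k)"
  proof (rule top_chartI[OF oU inj])
    fix B :: "'m set" assume B: "open B"
    have "continuous_on V \<Theta>" using \<Theta>(1) by (rule holo_on_continuous_on)
    then have "open (V \<inter> \<Theta> -` B)" using V B by (simp add: continuous_on_open_vimage Int_commute)
    from top_chart_vimage[OF tc this] show "openin (mtop M) (?U \<inter> ?k -` B)"
      by (rule back_subst[of "openin (mtop M)"]) auto
  next
    fix W assume W: "openin (mtop M) W" "W \<subseteq> ?U"
    have "open (snd K ` W)" using top_chart_image[OF tc W(1)] W(2) by (simp add: Int_absorb1)
    then have "open (\<Theta> ` (snd K ` W))" by (rule op) (use W in auto)
    then show "open (?k ` W)" by (simp add: image_comp)
  qed
  show "mdiff M (snd (?U, ?k)) x" if "x \<in> fst (?U, ?k)" for x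
    using mdiff_chart_inv_compose[OF M K, of x \<Theta>] that \<Theta>(1) by (simp add: o_def holo_on_iff_cdiff)
  fix x L assume L: "L \<in> atlas M" "x \<in> fst (?U, ?k)" "x \<in> fst L"
  have "cdiff (snd L \<circ> chart_inv K) (snd K x)"
    using K L by (auto simp: coordinate_def holo_transition_iff)
  moreover have "cdiff (inv_into V \<Theta>) (?k x)" "inv_into V \<Theta> (?k x) = snd K x"
    using L inv \<Theta>(2) by (auto simp: holo_on_iff_cdiff)
  ultimately have "cdiff (\<lambda>w. (snd L \<circ> chart_inv K) (inv_into V \<Theta> w)) (?k x)"
    using cdiff_compose[of "inv_into V \<Theta>" "?k x" "snd L \<circ> chart_inv K"] by simp
  moreover have "cdiff (snd L \<circ> chart_inv (?U, ?k)) (?k x) \<longleftrightarrow> cdiff (\<lambda>w. (snd L \<circ> chart_inv K) (inv_into V \<Theta> w)) (?k x)"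
  proof (rule cdiff_cong_open[OF top_chart_image[OF tc' oU]])
    show "?k x \<in> snd (?U, ?k) ` (fst (?U, ?k) \<inter> ?U)" using L by auto
    fix y assume "y \<in> snd (?U, ?k) ` (fst (?U, ?k) \<inter> ?U)"
    then obtain a where a: "a \<in> ?U" "y = ?k a" by auto
    show "(snd L \<circ> chart_inv (?U, ?k)) y = (snd L \<circ> chart_inv K) (inv_into V \<Theta> y)"
      using chart_inv_apply[OF tc', of a] a tc \<Theta>(2) by simp
  qed
  ultimately show "cdiff (snd L \<circ> chart_inv (?U, ?k)) (snd (?U, ?k) x)" by simp
qed

lemma holo_fun_coordinate:
  assumes M: "complex_manifold M" and K: "coordinate M K" and f: "holo_fun M W f"
  shows "holo_on (f \<circ> chart_inv K) (snd K ` (fst K \<inter> W))"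
  unfolding holo_on_iff_cdiff using holo_fun_mdiff[OF M f] mdiff_coordinate[OF M K] by blast

text \<open>Together with \<open>filterlim_chart\<close> it carries limits and Landau estimates
  between the manifold and its coordinates.\<close>

lemma filterlim_chart_inv:
  assumes K: "top_chart T K" and x: "x \<in> fst K"
  shows "filterlim (chart_inv K) (nhdsin T x) (nhds (snd K x))"
  unfolding filterlim_iff
proof (intro allI impI)
  fix P assume P: "\<forall>\<^sub>F y in nhdsin T x. P y"
  have "x \<in> topspace T" using x openin_subset[OF top_chart_openin[OF K]] by blast
  with P obtain W where W: "openin T W" "x \<in> W" "\<And>y. y \<in> W \<Longrightarrow> P y"
    by (auto simp: eventually_nhdsin)
  show "\<forall>\<^sub>F z in nhds (snd K x). P (chart_inv K z)"
    unfolding eventually_nhds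
    using top_chart_image[OF K W(1)] W x K by (intro exI[of _ "snd K ` (fst K \<inter> W)"]) auto
qed

lemma filterlim_chart:
  assumes K: "top_chart T K" and x: "x \<in> fst K"
  shows "filterlim (snd K) (nhds (snd K x)) (nhdsin T x)"
  unfolding filterlim_iff
proof (intro allI impI)
  fix P assume "\<forall>\<^sub>F z in nhds (snd K x). P z"
  then obtain V where V: "open V" "snd K x \<in> V" "\<And>z. z \<in> V \<Longrightarrow> P z" by (auto simp: eventually_nhds)
  show "\<forall>\<^sub>F y in nhdsin T x. P (snd K y)"
    unfolding eventually_nhdsin
    using top_chart_vimage[OF K V(1)] V x by (intro disjI2 exI[of _ "fst K \<inter> snd K -` V"]) auto
qed

lemma eventually_nhdsin_openin: "openin T W \<Longrightarrow> x \<in> W \<Longrightarrow> (\<And>y. y \<in> W \<Longrightarrow> P y) \<Longrightarrow> eventually P (nhdsin T x)"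
  by (auto simp: eventually_nhdsin)

lemma continuous_map_filterlim_nhdsin:
  assumes f: "continuous_map T S f" and x: "x \<in> topspace T"
  shows "filterlim f (nhdsin S (f x)) (nhdsin T x)"
  unfolding filterlim_iff
proof (intro allI impI)
  fix P assume P: "\<forall>\<^sub>F z in nhdsin S (f x). P z"
  have "f x \<in> topspace S" using f x by (auto simp: continuous_map_def)
  with P obtain V where V: "openin S V" "f x \<in> V" "\<And>z. z \<in> V \<Longrightarrow> P z" by (auto simp: eventually_nhdsin)
  show "\<forall>\<^sub>F y in nhdsin T x. P (f y)"
    by (rule eventually_nhdsin_openin[OF openin_continuous_map_preimage[OF f V(1)]]) (use V x in auto)
qed

section \<open>Coordinates on two-dimensional manifolds\<close>

lemma coordinate_swap:
  fixes M :: "('a, complex \<times> complex) cmanifold"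
  assumes M: "complex_manifold M" and K: "coordinate M K"
  shows "coordinate M (fst K, prod.swap \<circ> snd K)"
proof -
  have "coordinate M (fst K \<inter> snd K -` UNIV, prod.swap \<circ> snd K)"
  proof (rule coordinate_compose[OF M K])
    show "holo_on (prod.swap :: complex \<times> complex \<Rightarrow> _) UNIV" by (simp add: holo_on_iff_cdiff cdiff_swap)
    have "inv_into UNIV prod.swap = (prod.swap :: complex \<times> complex \<Rightarrow> _)"
      by (rule inv_equality) auto
    then show "holo_on (inv_into UNIV prod.swap) (prod.swap ` (UNIV :: (complex \<times> complex) set))"
      by (simp add: holo_on_iff_cdiff cdiff_swap)
  qed (auto intro: open_swap_image)
  then show ?thesis by simp
qed

text \<open>In this way the source, and later the target, becomes a coordinate function of the arrow
  space.\<close>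

lemma coordinate_graph:
  fixes M :: "('a, complex \<times> complex) cmanifold"
  assumes M: "complex_manifold M" and K: "coordinate M K" and W: "openin (mtop M) W"
    and x: "x \<in> fst K" "x \<in> W" and u: "\<And>y. y \<in> W \<Longrightarrow> mdiff M u y"
    and nz: "D2 (u \<circ> chart_inv K) (snd K x) \<noteq> 0"
  obtains K' where "coordinate M K'" "x \<in> fst K'" "fst K' \<subseteq> fst K \<inter> W"
    "\<forall>y\<in>fst K'. snd K' y = (fst (snd K y), u y)"
proof -
  note tc = coordinate_top_chart[OF K]
  let ?u = "u \<circ> chart_inv K"
  let ?W = "snd K ` (fst K \<inter> W)"
  have ho: "holo_on ?u ?W"
    unfolding holo_on_iff_cdiff using u mdiff_coordinate[OF M K] by blast
  have xin: "snd K x \<in> ?W" using x by blast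
  obtain V where V: "open V" "snd K x \<in> V" "V \<subseteq> ?W"
    "inj_on (\<lambda>w. (fst w, ?u w)) V"
    "\<forall>V'. open V' \<and> V' \<subseteq> V \<longrightarrow> open ((\<lambda>w. (fst w, ?u w)) ` V')"
    "holo_on (inv_into V (\<lambda>w. (fst w, ?u w))) ((\<lambda>w. (fst w, ?u w)) ` V)"
    using graph_map_locally_biholomorphic[OF top_chart_image[OF tc W] ho xin nz] .
  note u' = holo_on_subset[OF ho V(3)]
  have "holo_on (\<lambda>w. (fst w, ?u w)) V"
    using u' unfolding holo_on_iff_cdiff by (blast intro: cdiff_Pair cdiff_fst_proj)
  from coordinate_compose[OF M K V(1) this V(4) _ V(6)] V(5)
  have "coordinate M (fst K \<inter> snd K -` V, (\<lambda>w. (fst w, ?u w)) \<circ> snd K)" by blast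
  \<comment> \<open>\<open>V\<close> lies in the image of \<open>fst K \<inter> W\<close> and the
    chart is injective, so no point of \<open>fst K\<close> outside of \<open>W\<close> is mapped
    into \<open>V\<close>.\<close>
  moreover have "y \<in> W" if y: "y \<in> fst K" "snd K y \<in> V" for y
  proof -
    obtain y' where "y' \<in> fst K" "y' \<in> W" "snd K y' = snd K y" using V(3) y by force
    then show ?thesis using y top_chart_inj[OF tc] by (metis inj_onD)
  qed
  ultimately show ?thesis
    using x V(2) tc by (intro that[of "(fst K \<inter> snd K -` V, (\<lambda>w. (fst w, ?u w)) \<circ> snd K)"]) auto
qed

text \<open>Valid off the image of the chart too: both sides select from the same set of
  candidates.\<close>

lemma chart_inv_swap: "chart_inv (U, prod.swap \<circ> k) = chart_inv (U, k) \<circ> prod.swap"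
proof
  fix w
  have "(y \<in> U \<and> prod.swap (k y) = w) \<longleftrightarrow> (y \<in> U \<and> k y = prod.swap w)" for y
    by (metis swap_swap)
  then show "chart_inv (U, prod.swap \<circ> k) w = (chart_inv (U, k) \<circ> prod.swap) w"
    by (simp add: chart_inv_def inv_into_def)
qed

lemma coordinate_graph_swapped:
  fixes M :: "('a, complex \<times> complex) cmanifold"
  assumes M: "complex_manifold M" and K: "coordinate M K" and W: "openin (mtop M) W"
    and x: "x \<in> fst K" "x \<in> W" and u: "\<And>y. y \<in> W \<Longrightarrow> mdiff M u y"
    and nz: "D1 (u \<circ> chart_inv K) (snd K x) \<noteq> 0"
  obtains K' where "coordinate M K'" "x \<in> fst K'" "fst K' \<subseteq> fst K \<inter> W"
    "\<forall>y\<in>fst K'. snd K' y = (snd (snd K y), u y)"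
proof -
  let ?K = "(fst K, prod.swap \<circ> snd K)"
  have nz': "D2 (u \<circ> chart_inv ?K) (snd ?K x) \<noteq> 0"
    using nz by (simp add: chart_inv_swap D1_def D2_def)
  have x': "x \<in> fst ?K" using x by simp
  obtain K' where "coordinate M K'" "x \<in> fst K'" "fst K' \<subseteq> fst ?K \<inter> W"
    "\<forall>y\<in>fst K'. snd K' y = (fst (snd ?K y), u y)"
    using coordinate_graph[OF M coordinate_swap[OF M K] W x' x(2) u nz'] .
  then show ?thesis by (intro that[of K']) auto
qed

text \<open>A full box has convex slices, as needed for Hadamard's lemma and for the mean value
  inequality along one coordinate.\<close>

lemma coordinate_box:
  fixes M :: "('a, complex \<times> complex) cmanifold"
  assumes M: "complex_manifold M" and K: "coordinate M K" and W: "openin (mtop M) W"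
    and x: "x \<in> fst K" "x \<in> W"
  obtains r :: real and U where "r > 0" "coordinate M (U, snd K)" "x \<in> U" "U \<subseteq> fst K \<inter> W"
    "snd K ` U = ball (fst (snd K x)) r \<times> ball (snd (snd K x)) r"
proof -
  note tc = coordinate_top_chart[OF K]
  have o: "open (snd K ` (fst K \<inter> W))" "snd K x \<in> snd K ` (fst K \<inter> W)"
    using top_chart_image[OF tc W] x by auto
  obtain r where r: "r > 0" "cball (fst (snd K x)) r \<times> cball (snd (snd K x)) r \<subseteq> snd K ` (fst K \<inter> W)"
    by (rule product_box_in_open[OF o])
  define B where "B = ball (fst (snd K x)) r \<times> ball (snd (snd K x)) r"
  define U where "U = fst K \<inter> snd K -` B"
  have B: "B \<subseteq> snd K ` (fst K \<inter> W)" "open B"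
    using r by (auto simp: B_def open_Times intro!: subset_trans[OF _ r(2)])
  have U: "openin (mtop M) U" unfolding U_def by (rule top_chart_vimage[OF tc B(2)])
  have UW: "U \<subseteq> fst K \<inter> W"
  proof
    fix y assume y: "y \<in> U"
    then obtain y' where "y' \<in> fst K" "y' \<in> W" "snd K y' = snd K y" using B(1) by (force simp: U_def)
    then show "y \<in> fst K \<inter> W" using y top_chart_inj[OF tc] by (auto simp: U_def dest: inj_onD)
  qed
  have "snd K ` U = B"
  proof
    show "B \<subseteq> snd K ` U"
    proof
      fix z assume z: "z \<in> B"
      then obtain y where "y \<in> fst K" "z = snd K y" using B(1) by blast
      then show "z \<in> snd K ` U" using z by (auto simp: U_def)
    qed
  qed (auto simp: U_def)
  moreover have "coordinate M (U, snd K)"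
    using coordinate_restrict[OF M K U] UW by (simp add: Int_absorb1)
  moreover have "x \<in> U" using x r(1) by (auto simp: U_def B_def mem_Times_iff)
  ultimately show ?thesis using UW r(1) by (intro that[of r U]) (auto simp: B_def)
qed

lemma holo_fun_add:
  "complex_manifold M \<Longrightarrow> holo_fun M V f \<Longrightarrow> holo_fun M V g \<Longrightarrow> holo_fun M V (\<lambda>y. f y + g y)"
  by (simp add: holo_fun_iff mdiff_add)

lemma holo_fun_mult:
  "complex_manifold M \<Longrightarrow> holo_fun M V f \<Longrightarrow> holo_fun M V g \<Longrightarrow> holo_fun M V (\<lambda>y. f y * g y)"
  for f :: "_ \<Rightarrow> complex"
  by (simp add: holo_fun_iff mdiff_mult)

section \<open>Vector fields as derivations\<close>

context
  fixes M :: "('a, 'm::complex_normed_space) cmanifold" and W :: "'a set" and \<xi> :: "'a vf"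
  assumes M: "complex_manifold M" and vf: "vector_field M W \<xi>"
begin

lemmas vf_laws = vf[unfolded vector_field_def, THEN conjunct2, THEN spec, THEN spec, THEN mp, OF conjI]

lemma vf_cmult:
  assumes "holo_fun M V f" "V \<subseteq> W" "x \<in> V"
  shows "\<xi> (\<lambda>y. a * f y) x = a * \<xi> f x"
  using vf_laws[OF assms(2,1), THEN conjunct2, THEN conjunct1, THEN spec, THEN bspec, OF assms(3)] .

lemmas vf_laws2 = vf_laws[THEN conjunct2, THEN conjunct2, THEN spec, THEN mp]

lemma vf_plus:
  assumes "holo_fun M V f" "holo_fun M V g" "V \<subseteq> W" "x \<in> V"
  shows "\<xi> (\<lambda>y. f y + g y) x = \<xi> f x + \<xi> g x"
  using vf_laws2[OF assms(3,1,2), THEN conjunct1, THEN bspec, OF assms(4)] .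

lemma vf_times:
  assumes "holo_fun M V f" "holo_fun M V g" "V \<subseteq> W" "x \<in> V"
  shows "\<xi> (\<lambda>y. f y * g y) x = \<xi> f x * g x + f x * \<xi> g x"
  using vf_laws2[OF assms(3,1,2), THEN conjunct2, THEN conjunct1, THEN bspec, OF assms(4)] .

lemma vf_cong:
  assumes "holo_fun M V f" "holo_fun M V g" "V \<subseteq> W" "x \<in> V" "\<And>y. y \<in> V \<Longrightarrow> f y = g y"
  shows "\<xi> f x = \<xi> g x"
  using vf_laws2[OF assms(3,1,2), THEN conjunct2, THEN conjunct2] assms(4,5) by simp

lemma holo_fun_const: "openin (mtop M) V \<Longrightarrow> holo_fun M V (\<lambda>_. c)"
  by (rule holo_funI[OF M]) (auto intro: mdiff_const[OF M] openin_points)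

lemma vf_const: "openin (mtop M) V \<Longrightarrow> V \<subseteq> W \<Longrightarrow> x \<in> V \<Longrightarrow> \<xi> (\<lambda>_. c) x = 0"
proof -
  assume V: "openin (mtop M) V" "V \<subseteq> W" "x \<in> V"
  \<comment> \<open>Leibniz' rule for \<open>1 * 1\<close>.\<close>
  have "\<xi> (\<lambda>_. 1) x = 0"
    using vf_times[OF holo_fun_const[OF V(1)] holo_fun_const[OF V(1)] V(2,3), of 1 1] by simp
  then show ?thesis using vf_cmult[OF holo_fun_const[OF V(1)] V(2,3), of c 1] by simp
qed

lemma vf_sum:
  assumes "openin (mtop M) V" "V \<subseteq> W" "x \<in> V" "\<And>i. i \<in> A \<Longrightarrow> holo_fun M V (f i)"
  shows "\<xi> (\<lambda>y. \<Sum>i\<in>A. f i y) x = (\<Sum>i\<in>A. \<xi> (f i) x)"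
  using assms(4)
proof (induction A rule: infinite_finite_induct)
  case (insert a F)
  have "holo_fun M V (\<lambda>y. \<Sum>i\<in>F. f i y)"
    using insert assms by (auto simp: holo_fun_iff[OF M] intro!: mdiff_sum[OF M] openin_points)
  then show ?case
    using insert vf_plus[of V "f a" "\<lambda>y. \<Sum>i\<in>F. f i y" x] assms by simp
qed (use assms vf_const in auto)

end

text \<open>Near \<open>x\<close> Hadamard's lemma writes \<open>f\<close> as a constant plus
  products of recentred coordinates with \<open>H\<close> and \<open>L\<close>. At \<open>x\<close>
  the recentred coordinates vanish, so Leibniz' rule leaves their derivatives times \<open>H\<close>
  and \<open>L\<close>, whose values there are the partial derivatives.\<close>

lemma vf_in_coordinates:
  fixes M :: "('a, complex \<times> complex) cmanifold"
  assumes M: "complex_manifold M" and vf: "vector_field M W \<xi>" and K: "coordinate M K"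
    and f: "holo_fun M V f" and V: "V \<subseteq> W" and x: "x \<in> V" "x \<in> fst K"
  shows "\<xi> f x = \<xi> (\<lambda>y. fst (snd K y)) x * D1 (f \<circ> chart_inv K) (snd K x)
      + \<xi> (\<lambda>y. snd (snd K y)) x * D2 (f \<circ> chart_inv K) (snd K x)"
proof -
  obtain r U where U: "r > 0" "coordinate M (U, snd K)" "x \<in> U" "U \<subseteq> fst K \<inter> V"
    "snd K ` U = ball (fst (snd K x)) r \<times> ball (snd (snd K x)) r"
    using coordinate_box[OF M K holo_fun_openin[OF f] x(2,1)] .
  note tc = coordinate_top_chart[OF K]
  define a b where "a = fst (snd K x)" and "b = snd (snd K x)"
  have ab: "snd K x = (a, b)" by (simp add: a_def b_def)
  have oU: "openin (mtop M) U" using top_chart_openin[OF coordinate_top_chart[OF U(2)]] by simp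
  have ho: "holo_on (f \<circ> chart_inv K) (ball a r \<times> ball b r)"
    by (rule holo_on_subset[OF holo_fun_coordinate[OF M K f]]) (use U(4,5) image_mono[OF U(4), of "snd K"] in \<open>simp add: a_def b_def\<close>)
  obtain H L where HL: "holo_on H (ball a r \<times> ball b r)" "holo_on L (ball a r \<times> ball b r)"
    "H (a, b) = D1 (f \<circ> chart_inv K) (a, b)" "L (a, b) = D2 (f \<circ> chart_inv K) (a, b)"
    and eq: "\<forall>w\<in>ball a r \<times> ball b r. (f \<circ> chart_inv K) w =
        (f \<circ> chart_inv K) (a, b) + (fst w - a) * H w + (snd w - b) * L w"
    using hadamard_two_variables[OF ho U(1)] .
  have box: "snd K y \<in> ball a r \<times> ball b r" if "y \<in> U" for y using U(5) that a_def b_def by blast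
  have U_K: "y \<in> fst K" if "y \<in> U" for y using U(4) that by blast
  have hK: "holo_fun M U (\<lambda>y. g (snd K y))" if "holo_on g (ball a r \<times> ball b r)" for g :: "_ \<Rightarrow> complex"
  proof (rule holo_funI[OF M oU])
    fix y assume y: "y \<in> U"
    have "cdiff g (snd K y)" using that[unfolded holo_on_iff_cdiff] box[OF y] by (rule bspec)
    then show "mdiff M (\<lambda>y. g (snd K y)) y" by (rule mdiff_chart_inv_compose[OF M K U_K[OF y]])
  qed
  have h1: "holo_fun M U (\<lambda>y. H (snd K y))" "holo_fun M U (\<lambda>y. L (snd K y))"
    "holo_fun M U (\<lambda>y. fst (snd K y))" "holo_fun M U (\<lambda>y. snd (snd K y))"
    using HL by (auto intro!: hK simp: holo_on_iff_cdiff)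
  have h2: "holo_fun M U (\<lambda>y. fst (snd K y) - a)" "holo_fun M U (\<lambda>y. snd (snd K y) - b)"
    by (rule hK[of "\<lambda>w. fst w - a"] hK[of "\<lambda>w. snd w - b"], simp add: holo_on_iff_cdiff cdiff_diff)+
  have h3: "holo_fun M U (\<lambda>y. (fst (snd K y) - a) * H (snd K y))" "holo_fun M U (\<lambda>y. (snd (snd K y) - b) * L (snd K y))"
    by (rule holo_fun_mult[OF M h2(1) h1(1)] holo_fun_mult[OF M h2(2) h1(2)])+
  have UW: "U \<subseteq> W" using U(4) V by blast
  note c = holo_fun_const[OF M vf oU]
  have fU: "holo_fun M U f" using holo_fun_subset[OF M f oU] U(4) by blast
  have h4: "holo_fun M U (\<lambda>y. f x + (fst (snd K y) - a) * H (snd K y))"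
    by (rule holo_fun_add[OF M c h3(1)])
  have h5: "holo_fun M U (\<lambda>y. f x + (fst (snd K y) - a) * H (snd K y) + (snd (snd K y) - b) * L (snd K y))"
    by (rule holo_fun_add[OF M h4 h3(2)])
  have 0: "\<xi> (\<lambda>y. u y - d) x = \<xi> u x" if "holo_fun M U u" for u d
    using vf_plus[OF M vf that c UW U(3), of "- d"] vf_const[OF M vf oU UW U(3), of "- d"] by simp
  have "\<xi> f x = \<xi> (\<lambda>y. f x + (fst (snd K y) - a) * H (snd K y) + (snd (snd K y) - b) * L (snd K y)) x"
  proof (rule vf_cong[OF M vf fU h5 UW U(3)])
    show "f y = f x + (fst (snd K y) - a) * H (snd K y) + (snd (snd K y) - b) * L (snd K y)" if "y \<in> U" for y
      using bspec[OF eq box[OF that]] chart_inv_apply[OF tc U_K[OF that]] chart_inv_apply[OF tc x(2)] ab by simp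
  qed
  also have "\<dots> = \<xi> (\<lambda>y. (fst (snd K y) - a) * H (snd K y)) x + \<xi> (\<lambda>y. (snd (snd K y) - b) * L (snd K y)) x"
    by (simp add: vf_plus[OF M vf h4 h3(2) UW U(3)] vf_plus[OF M vf c h3(1) UW U(3)] vf_const[OF M vf oU UW U(3)])
  also have "\<dots> = \<xi> (\<lambda>y. fst (snd K y)) x * H (snd K x) + \<xi> (\<lambda>y. snd (snd K y)) x * L (snd K x)"
    using vf_times[OF M vf h2(1) h1(1) UW U(3)] vf_times[OF M vf h2(2) h1(2) UW U(3)] 0[OF h1(3)] 0[OF h1(4)]
    by (simp add: ab)
  finally show ?thesis using HL ab by simp
qed

section \<open>Lie groupoids\<close>

locale lie_groupoid_over_curve =
  fixes X :: "('x, complex) cmanifold" and G :: "('x, 'g) groupoid"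
  assumes curve: "complex_curve X" and lie: "lie_groupoid X G"
begin

abbreviation "AG \<equiv> arrows G"
abbreviation "s \<equiv> src G"
abbreviation "t \<equiv> tgt G"
abbreviation "\<mu> \<equiv> cmp G"
abbreviation "one \<equiv> idn G"
abbreviation "iv \<equiv> ginv G"
abbreviation "TG \<equiv> mtop (arrows G)"
abbreviation "TX \<equiv> mtop X"

lemma mX: "complex_manifold X" and hausX: "Hausdorff_space TX"
  using curve by (auto simp: complex_curve_def)

lemma mG: "complex_manifold AG" using lie by (simp add: lie_groupoid_def)

text \<open>Cited by position: 1-2 end points, 3-5 units, 6-8 composites, 9-10 unit laws, 11-13
  inverses and their end points, 14-15 inverse laws.\<close>

lemma gpd:
  "g \<in> points AG \<Longrightarrow> s g \<in> points X"
  "g \<in> points AG \<Longrightarrow> t g \<in> points X"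
  "x \<in> points X \<Longrightarrow> one x \<in> points AG"
  "x \<in> points X \<Longrightarrow> s (one x) = x"
  "x \<in> points X \<Longrightarrow> t (one x) = x"
  "g \<in> points AG \<Longrightarrow> h \<in> points AG \<Longrightarrow> s g = t h \<Longrightarrow> \<mu> g h \<in> points AG"
  "g \<in> points AG \<Longrightarrow> h \<in> points AG \<Longrightarrow> s g = t h \<Longrightarrow> s (\<mu> g h) = s h"
  "g \<in> points AG \<Longrightarrow> h \<in> points AG \<Longrightarrow> s g = t h \<Longrightarrow> t (\<mu> g h) = t g"
  "g \<in> points AG \<Longrightarrow> \<mu> g (one (s g)) = g"
  "g \<in> points AG \<Longrightarrow> \<mu> (one (t g)) g = g"
  "g \<in> points AG \<Longrightarrow> iv g \<in> points AG"
  "g \<in> points AG \<Longrightarrow> s (iv g) = t g"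
  "g \<in> points AG \<Longrightarrow> t (iv g) = s g"
  "g \<in> points AG \<Longrightarrow> \<mu> (iv g) g = one (s g)"
  "g \<in> points AG \<Longrightarrow> \<mu> g (iv g) = one (t g)"
  using lie by (auto simp: lie_groupoid_def is_groupoid_def Let_def)

lemma gpd_assoc:
  "g \<in> points AG \<Longrightarrow> h \<in> points AG \<Longrightarrow> k \<in> points AG \<Longrightarrow> s g = t h \<Longrightarrow> s h = t k \<Longrightarrow>
    \<mu> (\<mu> g h) k = \<mu> g (\<mu> h k)"
  using lie by (auto simp: lie_groupoid_def is_groupoid_def Let_def)

lemma hs: "holo_map AG X s" and ht: "holo_map AG X t" and hone: "holo_map X AG one" and hinv: "holo_map AG AG iv"
  using lie by (auto simp: lie_groupoid_def holo_submersion_def)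

lemma cs: "continuous_map TG TX s" and ct: "continuous_map TG TX t"
  and cone: "continuous_map TX TG one" and cinv: "continuous_map TG TG iv"
  using hs ht hone hinv by (auto simp: holo_map_def)

lemma openin_src_pre: "openin TX U \<Longrightarrow> openin TG (src_pre G U)"
  using openin_continuous_map_preimage[OF cs] by (simp add: src_pre_def points_def)

lemma openin_tgt_pre: "openin TX U \<Longrightarrow> openin TG (tgt_pre G U)"
  using openin_continuous_map_preimage[OF ct] by (simp add: tgt_pre_def points_def)

lemmas mdiff_s = mdiff_holo_map[OF mG mX hs]
lemmas mdiff_t = mdiff_holo_map[OF mG mX ht]

text \<open>Composition is only defined on composable pairs, so its continuity is expressed by two
  maps along a filter on which they are eventually composable. In charts it is the continuity of the
  ambient map of \<open>holo_composition\<close>.\<close>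

lemma filterlim_cmp:
  assumes g: "g \<in> points AG" and h: "h \<in> points AG" and gh: "s g = t h"
    and a: "filterlim a (nhdsin TG g) Fl" and b: "filterlim b (nhdsin TG h) Fl"
    and ab: "\<forall>\<^sub>F y in Fl. s (a y) = t (b y)"
  shows "filterlim (\<lambda>y. \<mu> (a y) (b y)) (nhdsin TG (\<mu> g h)) Fl"
proof -
  have m: "\<mu> g h \<in> points AG" using gpd g h gh by blast
  obtain K where K: "K \<in> atlas AG" "g \<in> fst K" using atlas_cover[OF mG g] by blast
  obtain L where L: "L \<in> atlas AG" "h \<in> fst L" using atlas_cover[OF mG h] by blast
  obtain M where M: "M \<in> atlas AG" "\<mu> g h \<in> fst M" using atlas_cover[OF mG m] by blast
  obtain N F where N: "open N" "(snd K g, snd L h) \<in> N" "holo_on F N"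
    and F: "\<forall>g'\<in>fst K. \<forall>h'\<in>fst L. s g' = t h' \<and> (snd K g', snd L h') \<in> N \<longrightarrow>
        \<mu> g' h' \<in> fst M \<and> snd M (\<mu> g' h') = F (snd K g', snd L h')"
  proof -
    have "holo_composition G" using lie by (simp add: lie_groupoid_def)
    from this[unfolded holo_composition_def, rule_format, OF K(1) L(1) M(1) K(2) L(2), OF conjI[OF gh M(2)]]
    show thesis using that by blast
  qed
  have tc: "top_chart TG K" "top_chart TG L" "top_chart TG M"
    using K L M mG by (auto simp: complex_manifold_def)
  have "filterlim (\<lambda>y. snd K (a y)) (nhds (snd K g)) Fl" "filterlim (\<lambda>y. snd L (b y)) (nhds (snd L h)) Fl"
    using filterlim_compose[OF filterlim_chart[OF tc(1) K(2)] a] filterlim_compose[OF filterlim_chart[OF tc(2) L(2)] b]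
    by auto
  then have lim: "((\<lambda>y. (snd K (a y), snd L (b y))) \<longlongrightarrow> (snd K g, snd L h)) Fl"
    by (rule tendsto_Pair)
  have "isCont F (snd K g, snd L h)" using N by (auto simp: holo_on_iff_cdiff intro: cdiff_imp_isCont)
  from isCont_tendsto_compose[OF this lim]
  have "((\<lambda>y. F (snd K (a y), snd L (b y))) \<longlongrightarrow> snd M (\<mu> g h)) Fl"
    using F K(2) L(2) gh N(2) by simp
  from filterlim_compose[OF filterlim_chart_inv[OF tc(3) M(2)] this]
  have "filterlim (\<lambda>y. chart_inv M (F (snd K (a y), snd L (b y)))) (nhdsin TG (\<mu> g h)) Fl" .
  moreover have "\<forall>\<^sub>F y in Fl. chart_inv M (F (snd K (a y), snd L (b y))) = \<mu> (a y) (b y)"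
  proof -
    have "\<forall>\<^sub>F y in Fl. (snd K (a y), snd L (b y)) \<in> N"
      by (rule topological_tendstoD[OF lim N(1,2)])
    moreover have "\<forall>\<^sub>F y in Fl. a y \<in> fst K"
      using filterlim_iff[THEN iffD1, OF a, rule_format, OF eventually_nhdsin_openin[OF top_chart_openin[OF tc(1)] K(2)]] .
    moreover have "\<forall>\<^sub>F y in Fl. b y \<in> fst L"
      using filterlim_iff[THEN iffD1, OF b, rule_format, OF eventually_nhdsin_openin[OF top_chart_openin[OF tc(2)] L(2)]] .
    ultimately show ?thesis
      using ab
    proof eventually_elim
      case (elim y)
      have "\<mu> (a y) (b y) \<in> fst M" "snd M (\<mu> (a y) (b y)) = F (snd K (a y), snd L (b y))"
        using F elim by blast+
      then show ?case using chart_inv_apply[OF tc(3), of "\<mu> (a y) (b y)"] by simp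
    qed
  qed
  ultimately show ?thesis by (rule filterlim_mono_eventually[OF _ order_refl order_refl])
qed

text \<open>As the source is a submersion, one of its two partial derivatives in an atlas chart is
  nonzero. The corresponding coordinate is replaced by the source, which is then moved to the first
  place, and a box is cut out.\<close>

lemma source_chart:
  assumes g: "g \<in> points AG" and M: "coordinate X M" "s g \<in> fst M" and W: "openin TG W" "g \<in> W"
  obtains K r where "coordinate AG K" "g \<in> fst K" "fst K \<subseteq> W" "r > 0"
    "\<forall>h\<in>fst K. s h \<in> fst M \<and> fst (snd K h) = snd M (s h)"
    "snd K ` fst K = ball (snd M (s g)) r \<times> ball (snd (snd K g)) r"
proof -
  obtain A where A: "A \<in> atlas AG" "g \<in> fst A" using atlas_cover[OF mG g] by blast
  have A': "coordinate AG A" using A(1) atlas_coordinate mG by blast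
  note tA = coordinate_top_chart[OF A']
  note tM = coordinate_top_chart[OF M(1)]
  obtain L where L: "L \<in> atlas X" "s g \<in> fst L" using atlas_cover[OF mX gpd(1)[OF g]] by blast
  have L': "coordinate X L" using L(1) atlas_coordinate mX by blast
  note tL = coordinate_top_chart[OF L']
  let ?u = "\<lambda>h. snd M (s h)"
  define W' where "W' = W \<inter> src_pre G (fst M)"
  have W': "openin TG W'" "g \<in> W'"
    unfolding W'_def using W M g openin_src_pre[OF top_chart_openin[OF tM]] by (auto simp: src_pre_def)
  have u: "mdiff AG ?u h" if "h \<in> W'" for h
    using mdiff_s[OF _ mdiff_chart[OF mX M(1)], of h] that by (auto simp: W'_def src_pre_def)
  have ucd: "cdiff (?u \<circ> chart_inv A) (snd A g)"
    using u[OF W'(2)] mdiff_coordinate[OF mG A' A(2)] by blast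
  \<comment> \<open>The submersion condition speaks of atlas charts of \<open>X\<close> only. A zero
    derivative in the given coordinate \<open>M\<close> would by the chain rule be zero in an atlas
    chart \<open>L\<close>, against surjectivity.\<close>
  have nz: "D1 (?u \<circ> chart_inv A) (snd A g) \<noteq> 0 \<or> D2 (?u \<circ> chart_inv A) (snd A g) \<noteq> 0"
  proof (rule ccontr)
    assume "\<not> ?thesis"
    with cdiff_has_derivative_D[OF ucd] have d0: "((?u \<circ> chart_inv A) has_derivative (\<lambda>h. 0)) (at (snd A g))" by simp
    have "mdiff X (snd L) (s g)" by (rule mdiff_chart[OF mX L' L(2)])
    then have "cdiff (snd L \<circ> chart_inv M) (snd M (s g))" using mdiff_coordinate[OF mX M] by blast
    then obtain \<mu>' where \<mu>': "((snd L \<circ> chart_inv M) has_derivative \<mu>') (at ((?u \<circ> chart_inv A) (snd A g)))"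
      using A tA by (auto simp: cdiff_def)
    interpret \<mu>': bounded_linear \<mu>' by (rule has_derivative_bounded_linear[OF \<mu>'])
    have z: "\<mu>' \<circ> (\<lambda>h. 0) = (\<lambda>h. 0)" by (simp add: fun_eq_iff \<mu>'.zero)
    have op: "open (snd A ` (fst A \<inter> W'))" by (rule top_chart_image[OF tA W'(1)])
    have "((snd L \<circ> s \<circ> chart_inv A) has_derivative (\<lambda>h. 0)) (at (snd A g))"
    proof (rule has_derivative_transform_within_open[OF diff_chain_at[OF d0 \<mu>', unfolded z] op])
      show "snd A g \<in> snd A ` (fst A \<inter> W')" using A W' by blast
      fix w assume "w \<in> snd A ` (fst A \<inter> W')"
      then obtain y where y: "y \<in> fst A" "s y \<in> fst M" "w = snd A y" by (auto simp: W'_def src_pre_def)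
      show "((snd L \<circ> chart_inv M) \<circ> (?u \<circ> chart_inv A)) w = (snd L \<circ> s \<circ> chart_inv A) w"
        using chart_inv_apply[OF tA y(1)] chart_inv_apply[OF tM y(2)] by (simp add: y(3))
    qed
    then have "frechet_derivative (snd L \<circ> s \<circ> chart_inv A) (at (snd A g)) = (\<lambda>h. 0)"
      using frechet_derivative_at by fastforce
    moreover have "surj (frechet_derivative (snd L \<circ> s \<circ> chart_inv A) (at (snd A g)))"
      using lie A L by (auto simp: lie_groupoid_def holo_submersion_def)
    ultimately show False by (metis surj_def zero_neq_one)
  qed
  obtain K where K: "coordinate AG K" "g \<in> fst K" "fst K \<subseteq> W'" "\<And>h. h \<in> fst K \<Longrightarrow> fst (snd K h) = ?u h"
  proof (cases "D2 (?u \<circ> chart_inv A) (snd A g) \<noteq> 0")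
    case True
    obtain K where K: "coordinate AG K" "g \<in> fst K" "fst K \<subseteq> fst A \<inter> W'"
      "\<forall>y\<in>fst K. snd K y = (fst (snd A y), ?u y)"
      using coordinate_graph[OF mG A' W'(1) A(2) W'(2) u True] .
    show ?thesis
      by (rule that[OF coordinate_swap[OF mG K(1)]]) (use K in auto)
  next
    case False
    with nz have D1: "D1 (?u \<circ> chart_inv A) (snd A g) \<noteq> 0" by blast
    obtain K where K: "coordinate AG K" "g \<in> fst K" "fst K \<subseteq> fst A \<inter> W'"
      "\<forall>y\<in>fst K. snd K y = (snd (snd A y), ?u y)"
      using coordinate_graph_swapped[OF mG A' W'(1) A(2) W'(2) u D1] .
    show ?thesis
      by (rule that[OF coordinate_swap[OF mG K(1)]]) (use K in auto)
  qed
  obtain r U where U: "r > 0" "coordinate AG (U, snd K)" "g \<in> U" "U \<subseteq> fst K \<inter> W'"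
    "snd K ` U = ball (fst (snd K g)) r \<times> ball (snd (snd K g)) r"
    using coordinate_box[OF mG K(1) W'(1) K(2) W'(2)] .
  show ?thesis
  proof (rule that[OF U(2)])
    show "snd (U, snd K) ` fst (U, snd K) = ball (snd M (s g)) r \<times> ball (snd (snd (U, snd K) g)) r"
      using U(5) K(4)[OF K(2)] by simp
  qed (use U K W' in \<open>auto simp: W'_def src_pre_def\<close>)
qed

end

lemma mdiff_tgt_pre_holo:
  assumes "lie_groupoid_over_curve X G" "holo_fun X V f"
  shows "holo_fun (arrows G) (tgt_pre G V) (f \<circ> tgt G)" "holo_fun (arrows G) (src_pre G V) (f \<circ> src G)"
proof -
  interpret lie_groupoid_over_curve X G by fact
  show "holo_fun AG (tgt_pre G V) (f \<circ> t)" unfolding o_def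
    by (rule holo_funI[OF mG openin_tgt_pre[OF holo_fun_openin[OF assms(2)]]])
      (auto simp: tgt_pre_def intro!: mdiff_t holo_fun_mdiff[OF mX assms(2)])
  show "holo_fun AG (src_pre G V) (f \<circ> s)" unfolding o_def
    by (rule holo_funI[OF mG openin_src_pre[OF holo_fun_openin[OF assms(2)]]])
      (auto simp: src_pre_def intro!: mdiff_s holo_fun_mdiff[OF mX assms(2)])
qed

section \<open>The source-simply connected integration\<close>

locale Pi1_groupoid = lie_groupoid_over_curve X G
  for X :: "('x, complex) cmanifold" and G :: "('x, 'g) groupoid" +
  fixes D :: "'x \<Rightarrow> nat" and \<theta> :: "'x vf \<Rightarrow> 'g vf"
  assumes div: "effective_divisor X D" and pi1: "is_Pi1 X D G \<theta>"
begin

section \<open>Right-invariant fields coming from vector fields on the curve\<close>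

lemma theta_right_invariant: "vf_vanishing X D U \<xi> \<Longrightarrow> right_invariant_vf X G U (\<theta> \<xi>)"
proof -
  assume x: "vf_vanishing X D U \<xi>"
  then have "openin TX U" by (simp add: vf_vanishing_def vector_field_def)
  with pi1 x show ?thesis by (simp add: is_Pi1_def lie_algebroid_iso_def Let_def)
qed

lemma theta_vf: "vf_vanishing X D U \<xi> \<Longrightarrow> vector_field AG (tgt_pre G U) (\<theta> \<xi>)"
  using theta_right_invariant by (auto simp: right_invariant_vf_def)

lemma theta_surj: "right_invariant_vf X G U \<zeta> \<Longrightarrow> \<exists>\<xi>. vf_vanishing X D U \<xi> \<and> vf_eq AG (tgt_pre G U) (\<theta> \<xi>) \<zeta>"
proof -
  assume x: "right_invariant_vf X G U \<zeta>"
  then have "openin TX U" by (simp add: right_invariant_vf_def)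
  with pi1 x show ?thesis by (simp add: is_Pi1_def lie_algebroid_iso_def Let_def)
qed

lemma theta_anchor:
  assumes x: "vf_vanishing X D U \<xi>" and f: "holo_fun X V f" "V \<subseteq> U" "a \<in> V"
  shows "\<theta> \<xi> (f \<circ> t) (one a) = \<xi> f a"
proof -
  have U: "openin TX U" using x by (simp add: vf_vanishing_def vector_field_def)
  from pi1 have "lie_algebroid_iso X D G \<theta>" by (simp add: is_Pi1_def)
  from this[unfolded lie_algebroid_iso_def, rule_format, OF U] x f show ?thesis
    by (simp add: Let_def)
qed

lemma theta_invariant:
  assumes x: "vf_vanishing X D U \<xi>"
    and "h \<in> W" "k \<in> points AG" "s h = t k" "\<mu> h k \<in> W'" "W \<subseteq> tgt_pre G U" "W' \<subseteq> tgt_pre G U"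
    "holo_fun AG W F'" "holo_fun AG W' F"
    "\<And>h'. h' \<in> W \<Longrightarrow> s h' = t k \<Longrightarrow> \<mu> h' k \<in> W' \<and> F' h' = F (\<mu> h' k)"
  shows "\<theta> \<xi> F' h = \<theta> \<xi> F (\<mu> h k)"
  using theta_right_invariant[OF x, unfolded right_invariant_vf_def, THEN conjunct2, THEN conjunct2, THEN conjunct2,
      rule_format, of h W k W' F' F] assms(2-) by blast

lemma theta_src:
  assumes x: "vf_vanishing X D U \<xi>" and f: "holo_fun X V f" and g: "g \<in> tgt_pre G U" "g \<in> src_pre G V"
  shows "\<theta> \<xi> (f \<circ> s) g = 0"
  using theta_right_invariant[OF x] f g unfolding right_invariant_vf_def by (metis IntI)

text \<open>At units this is the condition on the anchor. Right translation by \<open>g\<close>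
  carries the unit of \<open>t g\<close> to \<open>g\<close> and does not change targets, so
  invariance gives the general case.\<close>

lemma theta_tgt:
  assumes x: "vf_vanishing X D U \<xi>" and f: "holo_fun X V f" "V \<subseteq> U" and g: "g \<in> points AG" "t g \<in> V"
  shows "\<theta> \<xi> (f \<circ> t) g = \<xi> f (t g)"
proof -
  note tg = gpd(2)[OF g(1)]
  note hf = mdiff_tgt_pre_holo(1)[OF lie_groupoid_over_curve_axioms f(1)]
  have "\<theta> \<xi> (f \<circ> t) (one (t g)) = \<theta> \<xi> (f \<circ> t) (\<mu> (one (t g)) g)"
    by (rule theta_invariant[OF x _ g(1) _ _ _ _ hf hf])
      (use g tg f(2) in \<open>auto simp: tgt_pre_def gpd\<close>)
  then show ?thesis using theta_anchor[OF x f g(2)] g by (simp add: gpd)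
qed

lemma divisor_neighbourhood:
  assumes p: "p \<in> W" and W: "openin TX W"
  obtains U where "openin TX U" "p \<in> U" "U \<subseteq> W" "\<forall>q\<in>U. q \<noteq> p \<longrightarrow> D q = 0"
proof -
  have "p \<in> points X" by (rule openin_points[OF W p])
  from div[unfolded effective_divisor_def, rule_format, OF this]
  obtain U where U: "openin TX U" "p \<in> U" "finite {q \<in> U. D q \<noteq> 0}" by blast
  have "closedin TX ({q \<in> U. D q \<noteq> 0} - {p})"
  proof (rule t1_space_closedin_finite[THEN iffD1, rule_format])
    show "t1_space TX" using hausX by (rule Hausdorff_imp_t1_space)
  qed (use U openin_subset[OF U(1)] in auto)
  then have "openin TX (U \<inter> W - ({q \<in> U. D q \<noteq> 0} - {p}))"
    using U(1) W by (intro openin_diff openin_Int)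
  then show ?thesis by (rule that) (use U p in auto)
qed

lemma deriv_chart_mdiff:
  fixes f :: "'x \<Rightarrow> complex"
  assumes L: "coordinate X L" and V: "V \<subseteq> fst L" and f: "holo_fun X V f"
  shows "holo_fun X V (\<lambda>x. deriv (f \<circ> chart_inv L) (snd L x))"
    and "x \<in> V \<Longrightarrow> ((f \<circ> chart_inv L) has_field_derivative deriv (f \<circ> chart_inv L) (snd L x)) (at (snd L x))"
proof -
  have cd: "(f \<circ> chart_inv L) field_differentiable at (snd L x)" if "x \<in> V" for x
    using holo_fun_mdiff[OF mX f that] mdiff_coordinate[OF mX L, of x f] subsetD[OF V that]
    by (simp add: cdiff_complex_iff)
  show "((f \<circ> chart_inv L) has_field_derivative deriv (f \<circ> chart_inv L) (snd L x)) (at (snd L x))" if "x \<in> V"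
    using cd[OF that] by (simp add: DERIV_deriv_iff_field_differentiable)
  note tL = coordinate_top_chart[OF L]
  have o: "open (snd L ` V)"
    using top_chart_image[OF tL holo_fun_openin[OF f]] V by (simp add: Int_absorb1)
  have "(f \<circ> chart_inv L) holomorphic_on snd L ` V"
    unfolding holomorphic_on_def using cd field_differentiable_at_within by blast
  then have "deriv (f \<circ> chart_inv L) holomorphic_on snd L ` V" using o by (rule holomorphic_deriv)
  then have d: "deriv (f \<circ> chart_inv L) field_differentiable at (snd L x)" if "x \<in> V" for x
    using that o holomorphic_on_imp_differentiable_at by blast
  show "holo_fun X V (\<lambda>x. deriv (f \<circ> chart_inv L) (snd L x))"
  proof (rule holo_funI[OF mX holo_fun_openin[OF f]])
    fix x assume x: "x \<in> V"
    then show "mdiff X (\<lambda>x. deriv (f \<circ> chart_inv L) (snd L x)) x"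
      using mdiff_chart_inv_compose[OF mX L, of x "deriv (f \<circ> chart_inv L)"] d[OF x] V
      by (auto simp: cdiff_complex_iff)
  qed
qed

lemma vf_generator_vanishing:
  assumes L: "coordinate X L" and U: "openin TX U" "p \<in> U" "U \<subseteq> fst L" "\<forall>q\<in>U. q \<noteq> p \<longrightarrow> D q = 0"
  shows "vf_vanishing X D U (vf_generator L p (D p))"
proof -
  let ?\<xi> = "vf_generator L p (D p)"
  let ?d = "\<lambda>f x. deriv (f \<circ> chart_inv L) (snd L x)"
  note tL = coordinate_top_chart[OF L]
  have holo: "holo_fun X V (?\<xi> f)" "holo_fun X V (?d f)" if "V \<subseteq> U" "holo_fun X V f" for V and f :: "'x \<Rightarrow> complex"
  proof -
    have V: "V \<subseteq> fst L" using that U by blast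
    show d: "holo_fun X V (?d f)" by (rule deriv_chart_mdiff[OF L V that(2)])
    show "holo_fun X V (?\<xi> f)"
    proof (rule holo_funI[OF mX holo_fun_openin[OF that(2)]])
      fix x assume x: "x \<in> V"
      have "mdiff X (snd L) x" using V x by (intro mdiff_chart[OF mX L]) auto
      then have "mdiff X (\<lambda>x. snd L x - snd L p) x"
        by (rule mdiff_diff[OF mX]) (rule mdiff_const[OF mX mdiff_points[OF mX holo_fun_mdiff[OF mX d x]]])
      then show "mdiff X (?\<xi> f) x"
        unfolding vf_generator_def
        by (rule mdiff_mult[OF mX mdiff_power[OF mX] holo_fun_mdiff[OF mX d x]])
    qed
  qed
  have "vector_field X U ?\<xi>"
    unfolding vector_field_def
  proof (intro conjI allI impI ballI U(1))
    fix V and f :: "'x \<Rightarrow> complex" assume Vf: "V \<subseteq> U \<and> holo_fun X V f"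
    then have V: "V \<subseteq> fst L" and f: "holo_fun X V f" using U by auto
    show "holo_fun X V (?\<xi> f)" using holo Vf by blast
    note df = deriv_chart_mdiff(2)[OF L V f]
    show "?\<xi> (\<lambda>y. a * f y) x = a * ?\<xi> f x" if "x \<in> V" for a x
      using DERIV_imp_deriv[OF DERIV_cmult[OF df[OF that], of a]] by (simp add: vf_generator_def o_def)
    fix g :: "'x \<Rightarrow> complex" assume g: "holo_fun X V g"
    note dg = deriv_chart_mdiff(2)[OF L V g]
    show "?\<xi> (\<lambda>y. f y + g y) x = ?\<xi> f x + ?\<xi> g x" if "x \<in> V" for x
      using DERIV_imp_deriv[OF DERIV_add[OF df[OF that] dg[OF that]]]
      by (simp add: vf_generator_def o_def algebra_simps)
    show "?\<xi> (\<lambda>y. f y * g y) x = ?\<xi> f x * g x + f x * ?\<xi> g x" if "x \<in> V" for x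
      using DERIV_imp_deriv[OF DERIV_mult[OF df[OF that] dg[OF that]]] that V chart_inv_apply[OF tL, of x]
      by (auto simp: vf_generator_def o_def algebra_simps)
    show "?\<xi> f x = ?\<xi> g x" if "\<forall>x\<in>V. f x = g x" "x \<in> V" for x
    proof -
      have o: "open (snd L ` V)"
        using top_chart_image[OF tL holo_fun_openin[OF f]] V by (simp add: Int_absorb1)
      have "deriv (f \<circ> chart_inv L) (snd L x) = deriv (g \<circ> chart_inv L) (snd L x)"
      proof (rule deriv_cong_ev)
        have "(f \<circ> chart_inv L) z = (g \<circ> chart_inv L) z" if "z \<in> snd L ` V" for z
          using that \<open>\<forall>x\<in>V. f x = g x\<close> V tL by auto
        then show "\<forall>\<^sub>F z in nhds (snd L x). (f \<circ> chart_inv L) z = (g \<circ> chart_inv L) z"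
          using o that(2) unfolding eventually_nhds by (intro exI[of _ "snd L ` V"]) blast
      qed simp
      then show ?thesis by (simp add: vf_generator_def)
    qed
  qed
  moreover have "vanishes_to_order X (D q) q (?\<xi> f)" if Vf: "V \<subseteq> U" "holo_fun X V f" and q: "q \<in> V" for V q and f :: "'x \<Rightarrow> complex"
  proof -
    have V: "fst L \<inter> V = V" using Vf U by blast
    let ?K = "(V, snd L)"
    have K: "coordinate X ?K"
      using coordinate_restrict[OF mX L holo_fun_openin[OF Vf(2)]] by (simp add: V)
    show ?thesis
    proof (cases "q = p")
      case True
      show ?thesis unfolding vanishes_to_order_def
        by (intro exI[of _ ?K] exI[of _ "?d f"]) (use K q True holo(2)[OF Vf] in \<open>auto simp: vf_generator_def\<close>)
    next
      case False
      \<comment> \<open>Away from \<open>p\<close> there is nothing to divide out, so the function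
        itself serves as the cofactor.\<close>
      then have "D q = 0" using U q Vf by blast
      then show ?thesis unfolding vanishes_to_order_def
        by (intro exI[of _ ?K] exI[of _ "?\<xi> f"]) (use K q holo(1)[OF Vf] in auto)
    qed
  qed
  ultimately show ?thesis unfolding vf_vanishing_def by blast
qed

text \<open>Tangency to the source fibres kills the first coordinate, which is a function of the
  source. A single unknown coefficient remains, the value of the field on the second
  coordinate.\<close>

lemma theta_in_source_chart:
  assumes x: "vf_vanishing X D U \<xi>" and M: "coordinate X M"
    and K: "coordinate AG K" "\<forall>h\<in>fst K. s h \<in> fst M \<and> fst (snd K h) = snd M (s h)"
    and f: "holo_fun AG V f" and V: "V \<subseteq> tgt_pre G U" and g: "g \<in> V" "g \<in> fst K"
  shows "\<theta> \<xi> f g = \<theta> \<xi> (\<lambda>y. snd (snd K y)) g * D2 (f \<circ> chart_inv K) (snd K g)"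
proof -
  note vf = theta_vf[OF x]
  note tK = coordinate_top_chart[OF K(1)]
  define W where "W = V \<inter> fst K"
  have W: "openin TG W" "W \<subseteq> tgt_pre G U" "g \<in> W"
    unfolding W_def using holo_fun_openin[OF f] top_chart_openin[OF tK] V g by auto
  have M': "holo_fun X (fst M) (snd M)"
    by (rule holo_funI[OF mX top_chart_openin[OF coordinate_top_chart[OF M]] mdiff_chart[OF mX M]])
  have sub: "W \<subseteq> src_pre G (fst M)"
    using K(2) openin_points[OF W(1)] by (auto simp: W_def src_pre_def)
  have hs: "holo_fun AG W (snd M \<circ> s)"
    using holo_fun_subset[OF mG mdiff_tgt_pre_holo(2)[OF lie_groupoid_over_curve_axioms M'] W(1) sub] .
  have hK: "holo_fun AG W (\<lambda>y. fst (snd K y))"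
    by (rule holo_funI[OF mG W(1)], rule mdiff_chart_inv_compose[OF mG K(1)]) (auto simp: W_def)
  have "\<theta> \<xi> (\<lambda>y. fst (snd K y)) g = \<theta> \<xi> (snd M \<circ> s) g"
    by (rule vf_cong[OF mG vf hK hs W(2,3)]) (use K(2) in \<open>auto simp: W_def\<close>)
  also have "\<dots> = 0" using theta_src[OF x M'] W sub by blast
  finally show ?thesis
    using vf_in_coordinates[OF mG vf K(1) f V g] by simp
qed

text \<open>The form in which connectedness of source fibres is applied, once to the targets of
  arrows and once to the size of the defect. Local constancy makes both \<open>Q\<close> and its
  negation open in the fibre.\<close>

lemma fibre_connected_induct:
  assumes p: "p \<in> points X" and Q: "Q (one p)"
    and loc: "\<And>g. g \<in> points AG \<Longrightarrow> s g = p \<Longrightarrow> \<forall>\<^sub>F h in nhdsin TG g. s h = p \<longrightarrow> (Q h \<longleftrightarrow> Q g)"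
    and g: "g \<in> points AG" "s g = p"
  shows "Q g"
proof -
  define F where "F = {g \<in> points AG. s g = p}"
  define T where "T = subtopology TG F"
  have ts: "topspace T = F" by (auto simp: T_def F_def points_def)
  have "simply_connected_space T"
    using pi1 p by (auto simp: is_Pi1_def source_simply_connected_def T_def F_def)
  then have "connected_space T"
    by (simp add: simply_connected_space_def path_connected_imp_connected_space)
  moreover have op: "openin T {h \<in> F. Q h = c}" for c
  proof (subst openin_subopen, rule ballI)
    fix h assume h: "h \<in> {h \<in> F. Q h = c}"
    then have "h \<in> points AG" "s h = p" by (auto simp: F_def)
    from loc[OF this] obtain S where S: "openin TG S" "h \<in> S" "\<And>k. k \<in> S \<Longrightarrow> s k = p \<Longrightarrow> Q k = Q h"
      using \<open>h \<in> points AG\<close> by (auto simp: eventually_nhdsin points_def)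
    have "openin T (S \<inter> F)" unfolding T_def using S(1) by (auto simp: openin_subtopology)
    then show "\<exists>S. openin T S \<and> h \<in> S \<and> S \<subseteq> {h \<in> F. Q h = c}"
      using S h by (intro exI[of _ "S \<inter> F"]) (auto simp: F_def)
  qed
  moreover have "closedin T {h \<in> F. Q h = True}"
  proof -
    have "F - {h \<in> F. Q h = True} = {h \<in> F. Q h = False}" by auto
    then show ?thesis unfolding closedin_def ts using op[of False] by auto
  qed
  ultimately have "{h \<in> F. Q h = True} = {} \<or> {h \<in> F. Q h = True} = F"
    unfolding connected_space_clopen_in ts using op[of True] by blast
  moreover have "one p \<in> {h \<in> F. Q h = True}" using Q p by (auto simp: F_def gpd)
  ultimately show ?thesis using g by (auto simp: F_def)
qed

text \<open>The principal filter confines the limit to the source fibre over \<open>t k\<close>,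
  where translation by \<open>k\<close> is defined.\<close>

lemma filterlim_right_translation:
  assumes g: "g \<in> points AG" and k: "k \<in> points AG" and gk: "s g = t k"
  shows "filterlim (\<lambda>h. \<mu> h k) (nhdsin TG (\<mu> g k)) (inf (nhdsin TG g) (principal {h. s h = t k}))"
proof (rule filterlim_cmp[OF g k gk])
  show "filterlim (\<lambda>h. h) (nhdsin TG g) (inf (nhdsin TG g) (principal {h. s h = t k}))"
    by (auto simp: filterlim_def)
  show "filterlim (\<lambda>h. k) (nhdsin TG k) (inf (nhdsin TG g) (principal {h. s h = t k}))"
    using k by (auto simp: filterlim_iff eventually_nhdsin points_def)
  show "\<forall>\<^sub>F y in inf (nhdsin TG g) (principal {h. s h = t k}). s y = t k"
    by (simp add: eventually_inf_principal)
qed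

lemma right_translation_cancel:
  assumes "h \<in> points AG" "k \<in> points AG" "s h = t k"
  shows "\<mu> (\<mu> h k) (iv k) = h"
  using assms by (simp add: gpd_assoc gpd flip: assms(3))

lemma left_translation_cancel:
  assumes "h \<in> points AG" "k \<in> points AG" "t h = t k"
  shows "\<mu> h (\<mu> (iv h) k) = k"
  using assms by (simp add: gpd_assoc[symmetric] gpd)

end

lemma eventually_filterlim_nhdsin:
  assumes "filterlim f (nhdsin T a) F" "openin T V" "a \<in> V"
  shows "\<forall>\<^sub>F x in F. f x \<in> V"
  using assms(1)[unfolded filterlim_iff, rule_format, OF eventually_nhdsin_openin[OF assms(2,3)]] .

section \<open>The orbit of a point of the divisor\<close>

context Pi1_groupoid
begin

text \<open>With \<open>p\<close> the only point of the divisor in \<open>U\<close>, the generator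
  at \<open>p\<close> vanishes along the whole divisor over \<open>U\<close>, so
  \<open>\<theta>\<close> can be applied to it.\<close>

definition div_chart :: "'x \<Rightarrow> ('x, complex) chart \<Rightarrow> 'x set \<Rightarrow> bool" where
  "div_chart p L U \<longleftrightarrow> coordinate X L \<and> openin TX U \<and> p \<in> U \<and> U \<subseteq> fst L \<and> D p \<noteq> 0 \<and>
     (\<forall>q\<in>U. q \<noteq> p \<longrightarrow> D q = 0)"

text \<open>Facts after the sixth are consequences; item 12 makes the generator a section of the
  algebroid, item 13 makes the coordinate a holomorphic function on \<open>U\<close>.\<close>

lemma div_chartD:
  assumes "div_chart p L U"
  shows "coordinate X L" "openin TX U" "p \<in> U" "U \<subseteq> fst L" "D p \<noteq> 0" "\<forall>q\<in>U. q \<noteq> p \<longrightarrow> D q = 0"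
    "p \<in> fst L" "p \<in> points X" "one p \<in> points AG" "s (one p) = p" "t (one p) = p"
    "vf_vanishing X D U (vf_generator L p (D p))" "holo_fun X U (snd L)"
proof -
  from assms show *: "coordinate X L" "openin TX U" "p \<in> U" "U \<subseteq> fst L" "D p \<noteq> 0" "\<forall>q\<in>U. q \<noteq> p \<longrightarrow> D q = 0"
    by (auto simp: div_chart_def)
  show "p \<in> fst L" "p \<in> points X" using * openin_points by auto
  then show "one p \<in> points AG" "s (one p) = p" "t (one p) = p" by (auto simp: gpd)
  show "vf_vanishing X D U (vf_generator L p (D p))"
    by (rule vf_generator_vanishing[OF *(1-4,6)])
  show "holo_fun X U (snd L)"
    using * by (intro holo_funI[OF mX] mdiff_chart[OF mX]) auto
qed

lemma generator_coordinate:
  assumes "div_chart p L U" "x \<in> U"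
  shows "vf_generator L p n (snd L) x = (snd L x - snd L p) ^ n"
proof -
  note L = div_chartD[OF assms(1)]
  note tL = coordinate_top_chart[OF L(1)]
  have "deriv (snd L \<circ> chart_inv L) (snd L x) = deriv (\<lambda>z. z) (snd L x)"
  proof (rule deriv_cong_ev)
    show "\<forall>\<^sub>F z in nhds (snd L x). (snd L \<circ> chart_inv L) z = z"
      unfolding eventually_nhds using top_chart_image[OF tL L(2)] assms(2) L(4) tL
      by (intro exI[of _ "snd L ` (fst L \<inter> U)"]) auto
  qed simp
  then show ?thesis by (simp add: vf_generator_def)
qed

text \<open>An injective holomorphic function has no critical points. The two parameters found here
  give the two arrows with equal targets in both arguments below.\<close>

lemma not_injective_near_critical_point:
  fixes f :: "complex \<Rightarrow> complex"
  assumes "f holomorphic_on ball b r" "deriv f b = 0" "0 < e" "e \<le> r"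
  obtains b1 b2 where "b1 \<in> ball b e" "b2 \<in> ball b e" "b1 \<noteq> b2" "f b1 = f b2"
proof -
  have "\<not> inj_on f (ball b e)"
  proof
    assume "inj_on f (ball b e)"
    moreover have "f holomorphic_on ball b e"
      using assms by (auto intro: holomorphic_on_subset)
    ultimately have "deriv f b \<noteq> 0"
      using assms(3) by (intro holomorphic_injective_imp_regular[of f "ball b e"]) auto
    then show False using assms(2) by simp
  qed
  then show ?thesis using that by (auto simp: inj_on_def)
qed

text \<open>\<open>K\<close> straightens the source map: its first component is the coordinate of the source.\<close>

context
  fixes M :: "('x, complex) chart" and L :: "('x, complex) chart" and U :: "'x set"
    and K :: "('g, complex \<times> complex) chart" and g :: 'g and r :: real
  assumes L: "coordinate X L" and U: "openin TX U" "U \<subseteq> fst L"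
    and K: "coordinate AG K" "g \<in> fst K" "fst K \<subseteq> tgt_pre G U"
    and r: "r > 0" and KM: "\<forall>h\<in>fst K. s h \<in> fst M \<and> fst (snd K h) = snd M (s h)"
    and box: "snd K ` fst K = ball (snd M (s g)) r \<times> ball (snd (snd K g)) r"
    and M: "coordinate X M"
begin

text \<open>The second coordinate thus parametrises the part of the source fibre of \<open>g\<close>
  that lies in the chart.\<close>

lemma fibre_point:
  assumes "b \<in> ball (snd (snd K g)) r"
  shows "chart_inv K (snd M (s g), b) \<in> fst K" "snd K (chart_inv K (snd M (s g), b)) = (snd M (s g), b)"
    "s (chart_inv K (snd M (s g), b)) = s g"
proof -
  have "(snd M (s g), b) \<in> snd K ` fst K" using box assms r by auto
  then obtain h where h: "h \<in> fst K" "snd K h = (snd M (s g), b)" by force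
  have e: "chart_inv K (snd M (s g), b) = h"
    using chart_inv_apply[OF coordinate_top_chart[OF K(1)] h(1)] h(2) by simp
  show "chart_inv K (snd M (s g), b) \<in> fst K" "snd K (chart_inv K (snd M (s g), b)) = (snd M (s g), b)"
    using h e by auto
  have "snd M (s h) = snd M (s g)" "s h \<in> fst M" "s g \<in> fst M" using KM h K by auto
  then have "s h = s g" using top_chart_inj[OF coordinate_top_chart[OF M]] by (meson inj_onD)
  then show "s (chart_inv K (snd M (s g), b)) = s g" by (simp add: e)
qed

lemma tgt_mdiff: "h \<in> fst K \<Longrightarrow> mdiff AG (\<lambda>h. snd L (t h)) h"
  using K(3) U(2) by (intro mdiff_t mdiff_chart[OF mX L]) (auto simp: tgt_pre_def)

lemma tgt_cdiff: "h \<in> fst K \<Longrightarrow> cdiff ((\<lambda>h. snd L (t h)) \<circ> chart_inv K) (snd K h)"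
  using tgt_mdiff mdiff_coordinate[OF mG K(1)] by blast

lemma tgt_on_fibre_holomorphic:
  "(\<lambda>b. snd L (t (chart_inv K (snd M (s g), b)))) holomorphic_on ball (snd (snd K g)) r"
  unfolding holomorphic_on_def
proof
  fix b assume b: "b \<in> ball (snd (snd K g)) r"
  from tgt_cdiff[OF fibre_point(1)[OF b]]
  have "cdiff ((\<lambda>h. snd L (t h)) \<circ> chart_inv K) (snd M (s g), b)" by (simp add: fibre_point(2)[OF b])
  from cdiff_slice2[OF this]
  show "(\<lambda>b. snd L (t (chart_inv K (snd M (s g), b)))) field_differentiable at b within ball (snd (snd K g)) r"
    by (simp add: field_differentiable_at_within)
qed

lemma deriv_tgt_on_fibre:
  "deriv (\<lambda>b. snd L (t (chart_inv K (snd M (s g), b)))) (snd (snd K g)) = D2 ((\<lambda>h. snd L (t h)) \<circ> chart_inv K) (snd K g)"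
  using K KM by (simp add: D2_def)

end

lemma tendsto_fibre_point:
  assumes K: "top_chart T K" "g \<in> fst K" and a: "snd K g = (w, b)"
  shows "filterlim (\<lambda>b. chart_inv K (w, b)) (nhdsin T g) (nhds b)"
proof -
  have "((\<lambda>b. (w, b)) \<longlongrightarrow> snd K g) (nhds b)" unfolding a by (intro tendsto_intros filterlim_ident)
  then show ?thesis by (rule filterlim_compose[OF filterlim_chart_inv[OF K]])
qed

text \<open>The target is not injective on the source fibre near its critical point: there are \<open>k1 \<noteq> k2\<close> near the
  unit with the same target, and then \<open>k2\<^sup>-\<^sup>1 k1\<close> is a point of the fibre near, but distinct from, the unit whose target
  is \<open>p\<close>. Such points accumulate at the unit, so the target is constant near it.\<close>

lemma tgt_constant_near_unit_degenerate:
  assumes c: "div_chart p L U"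
    and K: "coordinate AG K" "one p \<in> fst K" "fst K \<subseteq> tgt_pre G U" "r > 0"
      "\<forall>h\<in>fst K. s h \<in> fst L \<and> fst (snd K h) = snd L (s h)"
      "snd K ` fst K = ball (snd L p) r \<times> ball (snd (snd K (one p))) r"
    and deg: "D2 ((\<lambda>h. snd L (t h)) \<circ> chart_inv K) (snd K (one p)) = 0"
    and h: "h \<in> fst K" "s h = p"
  shows "t h = p"
proof (rule ccontr)
  assume "t h \<noteq> p"
  note cD = div_chartD[OF c]
  note tL = coordinate_top_chart[OF cD(1)]
  note tK = coordinate_top_chart[OF K(1)]
  define b0 where "b0 = snd (snd K (one p))"
  define k where "k = (\<lambda>b. chart_inv K (snd L p, b))"
  define f where "f = (\<lambda>b. snd L (t (k b)))"
  have K0: "snd K (one p) = (snd L p, b0)"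
    using K(2,5) cD by (auto simp: b0_def prod_eq_iff)
  have kp: "k b \<in> fst K" "snd K (k b) = (snd L p, b)" "s (k b) = p" if "b \<in> ball b0 r" for b
    using fibre_point[where M=L and g="one p", OF cD(1,2,4) K(1-5) _ cD(1), of b] that K(6) cD
    unfolding b0_def k_def by simp_all
  have fh: "f holomorphic_on ball b0 r"
    using tgt_on_fibre_holomorphic[where M=L and g="one p", OF cD(1,2,4) K(1-5) _ cD(1)] K(6) cD
    unfolding b0_def k_def f_def by simp
  have df: "deriv f b0 = 0"
    using deriv_tgt_on_fibre[where M=L and g="one p", OF cD(1,2,4) K(1-5) _ cD(1)] K(6) cD deg
    unfolding b0_def k_def f_def by simp
  have Kpts: "y \<in> points AG" "t y \<in> U" "t y \<in> fst L" if "y \<in> fst K" for y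
    using K(3) that cD(4) by (auto simp: tgt_pre_def)
  have injL: "x = y" if "x \<in> fst L" "y \<in> fst L" "snd L x = snd L y" for x y
    using top_chart_inj[OF tL] that by (meson inj_onD)
  have injK: "x = y" if "x \<in> fst K" "y \<in> fst K" "snd K x = snd K y" for x y
    using top_chart_inj[OF tK] that by (meson inj_onD)
  define b' where "b' = snd (snd K h)"
  have Kh: "snd K h = (snd L p, b')" using K(5) h by (auto simp: b'_def prod_eq_iff)
  have b': "b' \<in> ball b0 r"
  proof -
    have "snd K h \<in> ball (snd L p) r \<times> ball b0 r" using K(6) h(1) by (auto simp: b0_def)
    then show ?thesis by (simp add: Kh)
  qed
  have "k b' = h" using chart_inv_apply[OF tK h(1)] by (simp add: k_def Kh)
  then have fb': "f b' - snd L p \<noteq> 0"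
    using \<open>t h \<noteq> p\<close> injL[of "t h" p] Kpts[OF h(1)] cD by (auto simp: f_def)
  have fb0: "f b0 - snd L p = 0"
    using chart_inv_apply[OF tK K(2)] cD by (simp add: f_def k_def K0)
  have fh': "(\<lambda>b. f b - snd L p) holomorphic_on ball b0 r"
    by (intro holomorphic_intros fh)
  have b0r: "b0 \<in> ball b0 r" using K(4) by simp
  \<comment> \<open>The arrow \<open>h\<close> shows that the target is not constant on the fibre in
    this chart, so the parameters with target \<open>p\<close> are isolated.\<close>
  have "\<exists>r1>0. \<forall>b\<in>ball b0 r1 - {b0}. f b - snd L p \<noteq> 0"
  proof (rule isolated_zeros[OF fh' open_ball connected_ball b0r fb0 b' fb'])
    fix \<rho> assume "\<rho> > 0" "\<And>z. z \<in> ball b0 \<rho> - {b0} \<Longrightarrow> f z - snd L p \<noteq> 0"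
    then show ?thesis by (intro exI[of _ \<rho>] conjI ballI)
  qed
  then obtain r1 where r1: "r1 > 0" "\<forall>b\<in>ball b0 r1 - {b0}. f b - snd L p \<noteq> 0"
    by (elim exE conjE)
  define V where "V = fst K \<inter> snd K -` (UNIV \<times> ball b0 r1)"
  have V: "openin TG V" unfolding V_def by (rule top_chart_vimage[OF tK]) (auto intro: open_Times)
  have pV: "one p \<in> V" using K(2) r1(1) by (auto simp: V_def K0)
  \<comment> \<open>Pairs of parameters close to \<open>b0\<close> with equal targets. Along this
    filter the quotient of the two arrows is defined and tends to the unit.\<close>
  define Fl where "Fl = inf (nhds (b0, b0)) (principal {x. f (fst x) = f (snd x) \<and> x \<in> ball b0 r \<times> ball b0 r})"
  have lim1: "filterlim (\<lambda>x. k (fst x)) (nhdsin TG (one p)) Fl" "filterlim (\<lambda>x. k (snd x)) (nhdsin TG (one p)) Fl"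
  proof -
    have id: "((\<lambda>x. x) \<longlongrightarrow> (b0, b0)) Fl"
      unfolding Fl_def by (rule filterlim_mono[OF filterlim_ident order_refl inf_le1])
    have "filterlim fst (nhds b0) Fl" "filterlim snd (nhds b0) Fl"
      using tendsto_fst[OF id] tendsto_snd[OF id] by simp_all
    then show "filterlim (\<lambda>x. k (fst x)) (nhdsin TG (one p)) Fl" "filterlim (\<lambda>x. k (snd x)) (nhdsin TG (one p)) Fl"
      unfolding k_def using filterlim_compose[OF tendsto_fibre_point[OF tK K(2) K0]] by blast+
  qed
  have tk: "t (k b1) = t (k b2)" if "f b1 = f b2" "b1 \<in> ball b0 r" "b2 \<in> ball b0 r" for b1 b2
    using injL[OF Kpts(3)[OF kp(1)[OF that(2)]] Kpts(3)[OF kp(1)[OF that(3)]]] that(1) by (simp add: f_def)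
  have ivp: "iv (one p) = one p"
    using gpd(9)[OF gpd(11)[OF cD(9)]] gpd(14)[OF cD(9)] cD(10,11) gpd(12)[OF cD(9)] by simp
  have one2: "\<mu> (one p) (one p) = one p" using gpd(9)[OF cD(9)] cD(10) by simp
  have "filterlim (\<lambda>x. \<mu> (iv (k (snd x))) (k (fst x))) (nhdsin TG (\<mu> (iv (one p)) (one p))) Fl"
  proof (rule filterlim_cmp)
    show "iv (one p) \<in> points AG" "one p \<in> points AG" "s (iv (one p)) = t (one p)"
      using cD gpd by auto
    show "filterlim (\<lambda>x. iv (k (snd x))) (nhdsin TG (iv (one p))) Fl"
      using cD(9) by (intro filterlim_compose[OF continuous_map_filterlim_nhdsin[OF cinv] lim1(2)]) (simp add: points_def)
    have "s (iv (k b2)) = t (k b1)" if "f b1 = f b2 \<and> (b1, b2) \<in> ball b0 r \<times> ball b0 r" for b1 b2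
      using that tk[of b1 b2] gpd(12)[OF Kpts(1)[OF kp(1)[of b2]]] by auto
    then show "\<forall>\<^sub>F x in Fl. s (iv (k (snd x))) = t (k (fst x))"
      unfolding Fl_def eventually_inf_principal by (intro always_eventually) auto
  qed (rule lim1)
  then have "\<forall>\<^sub>F x in Fl. \<mu> (iv (k (snd x))) (k (fst x)) \<in> V"
    unfolding ivp one2 by (rule eventually_filterlim_nhdsin[OF _ V pV])
  then have "\<forall>\<^sub>F x in nhds (b0, b0). f (fst x) = f (snd x) \<and> x \<in> ball b0 r \<times> ball b0 r \<longrightarrow> \<mu> (iv (k (snd x))) (k (fst x)) \<in> V"
    unfolding Fl_def eventually_inf_principal by simp
  then obtain S where S: "open S" "(b0, b0) \<in> S"
    "\<And>x. x \<in> S \<Longrightarrow> f (fst x) = f (snd x) \<and> x \<in> ball b0 r \<times> ball b0 r \<longrightarrow> \<mu> (iv (k (snd x))) (k (fst x)) \<in> V"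
    by (auto simp: eventually_nhds)
  obtain e where e: "e > 0" "cball b0 e \<times> cball b0 e \<subseteq> S"
    using product_box_in_open[OF S(1,2)] by auto
  obtain b1 b2 where b: "b1 \<in> ball b0 (min e r)" "b2 \<in> ball b0 (min e r)" "b1 \<noteq> b2" "f b1 = f b2"
    using not_injective_near_critical_point[OF fh df, of "min e r"] e(1) K(4) by auto
  have br: "b1 \<in> ball b0 r" "b2 \<in> ball b0 r" using b by auto
  have bS: "(b1, b2) \<in> S" using b e(2) by force
  define m where "m = \<mu> (iv (k b2)) (k b1)"
  have mV: "m \<in> V" using S(3)[OF bS] b(4) br by (simp add: m_def)
  note k1 = kp[OF br(1)] and k2 = kp[OF br(2)]
  note p1 = Kpts[OF k1(1)] and p2 = Kpts[OF k2(1)]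
  have teq: "t (k b2) = t (k b1)" using tk[OF b(4) br] by simp
  have sm: "s m = p" "t m = p"
    using gpd(7)[OF gpd(11)[OF p2(1)] p1(1)] gpd(8)[OF gpd(11)[OF p2(1)] p1(1)] gpd(12,13)[OF p2(1)] teq k1 k2
    by (simp_all add: m_def)
  have mK: "m \<in> fst K" using mV by (simp add: V_def)
  have Km: "snd K m = (snd L p, snd (snd K m))" using K(5) mK sm by (auto simp: prod_eq_iff)
  have km: "k (snd (snd K m)) = m" using chart_inv_apply[OF tK mK] Km by (simp add: k_def)
  then have fm: "f (snd (snd K m)) - snd L p = 0" by (simp add: f_def sm)
  have "snd (snd K m) \<in> ball b0 r1" using mV by (simp add: V_def mem_Times_iff)
  \<comment> \<open>\<open>m\<close> starts and ends at \<open>p\<close>, so its parameter is a zero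
    within the isolating radius \<open>r1\<close>.\<close>
  then have "snd (snd K m) = b0" using r1(2) fm by (metis Diff_iff singletonD)
  then have "snd K m = snd K (one p)" using Km K0 by simp
  then have "m = one p" using injK[OF mK K(2)] by simp
  then have "k b1 = k b2"
    using left_translation_cancel[OF p2(1) p1(1) teq] gpd(9)[OF p2(1)] k2(3) by (simp add: m_def)
  then show False using k1(2) k2(2) b(3) by simp
qed

text \<open>If the target were not critical at the unit of \<open>p\<close> along the source fibre, then source and target
  would be local coordinates over \<open>U\<close>, and the derivative with respect to the target would be a
  right-invariant vector field that does not vanish at \<open>p\<close>.\<close>

definition pair_chart ::
  "('x, complex) chart \<Rightarrow> 'x set \<Rightarrow> ('g, complex \<times> complex) chart \<Rightarrow> bool" where
  "pair_chart L U K \<longleftrightarrow> coordinate AG K \<and> fst K \<subseteq> tgt_pre G U \<and>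
     (\<exists>M. coordinate X M \<and> (\<forall>h\<in>fst K. s h \<in> fst M \<and> snd K h = (snd M (s h), snd L (t h))))"

text \<open>The derivative with respect to the target coordinate along a source fibre. The choice of
  the chart is immaterial by \<open>tgt_derivative_eq\<close>.\<close>

definition tgt_derivative :: "('x, complex) chart \<Rightarrow> 'x set \<Rightarrow> 'g vf" where
  "tgt_derivative L U F g = (let K = SOME K. pair_chart L U K \<and> g \<in> fst K in D2 (F \<circ> chart_inv K) (snd K g))"

lemma pair_chart_line:
  assumes L: "coordinate X L" and K: "pair_chart L U K" "g \<in> fst K" and V: "openin TG V" "g \<in> V"
  shows "\<forall>\<^sub>F y in nhds (snd L (t g)). chart_inv K (fst (snd K g), y) \<in> V \<inter> fst K \<and>
      s (chart_inv K (fst (snd K g), y)) = s g \<and> snd L (t (chart_inv K (fst (snd K g), y))) = y"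
proof -
  have K': "coordinate AG K" using K by (simp add: pair_chart_def)
  note tK = coordinate_top_chart[OF K']
  obtain M where M: "coordinate X M" "\<forall>h\<in>fst K. s h \<in> fst M \<and> snd K h = (snd M (s h), snd L (t h))"
    using K(1) by (auto simp: pair_chart_def)
  have Kg: "snd K g = (fst (snd K g), snd L (t g))" using M(2) K(2) by (simp add: prod_eq_iff)
  have o: "open (snd K ` (fst K \<inter> V))" by (rule top_chart_image[OF tK V(1)])
  have "((\<lambda>y. (fst (snd K g), y)) \<longlongrightarrow> snd K g) (nhds (snd L (t g)))"
    by (subst Kg) (intro tendsto_intros filterlim_ident)
  then have "\<forall>\<^sub>F y in nhds (snd L (t g)). (fst (snd K g), y) \<in> snd K ` (fst K \<inter> V)"
    using o K(2) V(2) by (intro topological_tendstoD) auto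
  then show ?thesis
  proof eventually_elim
    case (elim y)
    then obtain h where h: "h \<in> fst K" "h \<in> V" "snd K h = (fst (snd K g), y)" by force
    have e: "chart_inv K (fst (snd K g), y) = h"
      using chart_inv_apply[OF tK h(1)] h(3) by simp
    have "snd M (s h) = snd M (s g)" "snd L (t h) = y" "s h \<in> fst M" "s g \<in> fst M"
      using M(2) h K(2) by auto
    then show ?case
      unfolding e using h top_chart_inj[OF coordinate_top_chart[OF M(1)]] by (auto dest: inj_onD)
  qed
qed

lemma pair_chart_point_unique:
  assumes "pair_chart L U K" "g \<in> fst K" "h \<in> fst K" "s h = s g" "snd L (t h) = y"
  shows "chart_inv K (fst (snd K g), y) = h"
proof -
  have tK: "top_chart TG K" using assms by (auto simp: pair_chart_def intro: coordinate_top_chart)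
  obtain M where M: "coordinate X M" "\<forall>h\<in>fst K. s h \<in> fst M \<and> snd K h = (snd M (s h), snd L (t h))"
    using assms(1) unfolding pair_chart_def by blast
  have "snd K h = (fst (snd K g), y)" using M(2) assms(2-) by simp
  then show ?thesis using chart_inv_apply[OF tK assms(3)] by simp
qed

lemma D2_pair_chart:
  assumes "pair_chart L U K" "g \<in> fst K"
  shows "D2 (F \<circ> chart_inv K) (snd K g) = deriv (\<lambda>y. F (chart_inv K (fst (snd K g), y))) (snd L (t g))"
  using assms by (auto simp: D2_def pair_chart_def)

text \<open>All pair charts parametrise the source fibre through \<open>g\<close> by the same
  function, the target coordinate, so their lines through \<open>g\<close> agree near
  \<open>g\<close>.\<close>

lemma tgt_derivative_eq:
  assumes L: "coordinate X L" and K: "pair_chart L U K" "g \<in> fst K"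
  shows "tgt_derivative L U F g = D2 (F \<circ> chart_inv K) (snd K g)"
proof -
  define K1 where "K1 = (SOME K. pair_chart L U K \<and> g \<in> fst K)"
  have K1: "pair_chart L U K1" "g \<in> fst K1"
    using someI[of "\<lambda>K. pair_chart L U K \<and> g \<in> fst K" K] K by (auto simp: K1_def)
  have o: "openin TG (fst K)" using K(1) by (auto simp: pair_chart_def intro: top_chart_openin coordinate_top_chart)
  have "deriv (\<lambda>y. F (chart_inv K1 (fst (snd K1 g), y))) (snd L (t g)) =
      deriv (\<lambda>y. F (chart_inv K (fst (snd K g), y))) (snd L (t g))"
  proof (rule deriv_cong_ev)
    from pair_chart_line[OF L K1 o K(2)]
    show "\<forall>\<^sub>F y in nhds (snd L (t g)). F (chart_inv K1 (fst (snd K1 g), y)) = F (chart_inv K (fst (snd K g), y))"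
      by eventually_elim (use pair_chart_point_unique[OF K] in auto)
  qed simp
  then show ?thesis
    unfolding tgt_derivative_def Let_def K1_def[symmetric] D2_pair_chart[OF K1] D2_pair_chart[OF K] .
qed

text \<open>Right translation preserves targets, hence carries a source fibre parametrised by the
  target to another one with the same parameter. The derivation laws are those of the derivative in
  one variable.\<close>

lemma tgt_derivative_right_invariant:
  assumes L: "coordinate X L" and U: "openin TX U"
    and cov: "\<And>g. g \<in> tgt_pre G U \<Longrightarrow> \<exists>K. pair_chart L U K \<and> g \<in> fst K"
  shows "right_invariant_vf X G U (tgt_derivative L U)"
proof -
  let ?\<eta> = "tgt_derivative L U"
  have coord: "coordinate AG K" "top_chart TG K" "openin TG (fst K)" if "pair_chart L U K" for K
    using that by (auto simp: pair_chart_def intro: top_chart_openin coordinate_top_chart)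
  have d: "((\<lambda>y. F (chart_inv K (fst (snd K g), y))) has_field_derivative ?\<eta> F g) (at (snd L (t g)))"
    if K: "pair_chart L U K" "g \<in> fst K" and F: "holo_fun AG V F" "g \<in> V" for K g V F
  proof -
    have "cdiff (F \<circ> chart_inv K) (snd K g)"
      using holo_fun_mdiff[OF mG F] mdiff_coordinate[OF mG coord(1)[OF K(1)] K(2)] by blast
    moreover have "snd K g = (fst (snd K g), snd L (t g))" using K by (auto simp: pair_chart_def)
    ultimately have "cdiff (F \<circ> chart_inv K) (fst (snd K g), snd L (t g))" by simp
    from cdiff_DERIV2[OF this] show ?thesis
      using \<open>snd K g = _\<close> by (simp add: tgt_derivative_eq[OF L K] o_def)
  qed
  have e: "chart_inv K (fst (snd K g), snd L (t g)) = g" if K: "pair_chart L U K" "g \<in> fst K" for K g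
    by (rule pair_chart_point_unique[OF K K(2)]) auto
  have vf: "vector_field AG (tgt_pre G U) ?\<eta>"
    unfolding vector_field_def
  proof (intro conjI allI impI ballI openin_tgt_pre U)
    fix V and F :: "'g \<Rightarrow> complex" assume "V \<subseteq> tgt_pre G U \<and> holo_fun AG V F"
    then have V: "V \<subseteq> tgt_pre G U" and F: "holo_fun AG V F" by auto
    note oV = holo_fun_openin[OF F]
    show "holo_fun AG V (?\<eta> F)"
    proof (rule holo_funI[OF mG oV])
      fix g assume g: "g \<in> V"
      then obtain K where K: "pair_chart L U K" "g \<in> fst K" using cov V by blast
      note ho = holo_fun_coordinate[OF mG coord(1)[OF K(1)] F]
      note o = top_chart_image[OF coord(2)[OF K(1)] oV]
      have "cdiff (D2 (F \<circ> chart_inv K)) (snd K g)"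
        by (rule D2_cdiff[OF o ho]) (use K g in blast)
      from mdiff_chart_inv_compose[OF mG coord(1)[OF K(1)] K(2) this]
      show "mdiff AG (?\<eta> F) g"
        by (subst mdiff_cong[OF mG coord(3)[OF K(1)] K(2)]) (auto simp: tgt_derivative_eq[OF L K(1)])
    qed
    show "?\<eta> (\<lambda>y. a * F y) g = a * ?\<eta> F g" if g: "g \<in> V" for a g
    proof -
      obtain K where K: "pair_chart L U K" "g \<in> fst K" using cov V g by blast
      have aF: "holo_fun AG V (\<lambda>y. a * F y)"
        using F by (auto simp: holo_fun_iff[OF mG] intro!: mdiff_mult[OF mG] mdiff_const[OF mG] openin_points[OF oV])
      show ?thesis using DERIV_unique[OF d[OF K aF g] DERIV_cmult[OF d[OF K F g]]] .
    qed
    fix F' :: "'g \<Rightarrow> complex" assume F': "holo_fun AG V F'"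
    show "?\<eta> (\<lambda>y. F y + F' y) g = ?\<eta> F g + ?\<eta> F' g" if g: "g \<in> V" for g
    proof -
      obtain K where K: "pair_chart L U K" "g \<in> fst K" using cov V g by blast
      show ?thesis
        using DERIV_unique[OF d[OF K holo_fun_add[OF mG F F'] g] DERIV_add[OF d[OF K F g] d[OF K F' g]]] .
    qed
    show "?\<eta> (\<lambda>y. F y * F' y) g = ?\<eta> F g * F' g + F g * ?\<eta> F' g" if g: "g \<in> V" for g
    proof -
      obtain K where K: "pair_chart L U K" "g \<in> fst K" using cov V g by blast
      show ?thesis
        using DERIV_unique[OF d[OF K holo_fun_mult[OF mG F F'] g] DERIV_mult[OF d[OF K F g] d[OF K F' g]]]
        by (simp add: e[OF K] algebra_simps)
    qed
    show "?\<eta> F g = ?\<eta> F' g" if FF: "\<forall>g\<in>V. F g = F' g" and g: "g \<in> V" for g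
    proof -
      obtain K where K: "pair_chart L U K" "g \<in> fst K" using cov V g by blast
      have ev: "\<forall>\<^sub>F y in nhds (snd L (t g)). F (chart_inv K (fst (snd K g), y)) = F' (chart_inv K (fst (snd K g), y))"
        using pair_chart_line[OF L K oV g] by eventually_elim (use FF in auto)
      show ?thesis
        using d[OF K F g] unfolding DERIV_cong_ev[OF refl ev refl] by (rule DERIV_unique) (rule d[OF K F' g])
    qed
  qed
  show ?thesis
    unfolding right_invariant_vf_def
  proof (intro conjI allI impI ballI U vf)
    fix V and f :: "'x \<Rightarrow> complex" and g assume f: "holo_fun X V f" and g: "g \<in> tgt_pre G U \<inter> src_pre G V"
    obtain K where K: "pair_chart L U K" "g \<in> fst K" using cov g by blast
    have gV: "g \<in> src_pre G V" using g by blast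
    have ev: "\<forall>\<^sub>F y in nhds (snd L (t g)). (f \<circ> s) (chart_inv K (fst (snd K g), y)) = f (s g)"
      using pair_chart_line[OF L K coord(3)[OF K(1)] K(2)] by eventually_elim auto
    show "?\<eta> (f \<circ> s) g = 0"
      using d[OF K mdiff_tgt_pre_holo(2)[OF lie_groupoid_over_curve_axioms f] gV]
      unfolding DERIV_cong_ev[OF refl ev refl] by (rule DERIV_unique) simp
  next
    fix h k W W' and F F' :: "'g \<Rightarrow> complex"
    assume a: "h \<in> W \<and> k \<in> points AG \<and> s h = t k \<and> \<mu> h k \<in> W' \<and> W \<subseteq> tgt_pre G U \<and> W' \<subseteq> tgt_pre G U \<and>
        holo_fun AG W F' \<and> holo_fun AG W' F \<and>
        (\<forall>h'\<in>W. s h' = t k \<longrightarrow> \<mu> h' k \<in> W' \<and> F' h' = F (\<mu> h' k))"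
    then have h: "h \<in> W" "h \<in> tgt_pre G U" "h \<in> points AG" and k: "k \<in> points AG" "s h = t k" and hk: "\<mu> h k \<in> W'" "\<mu> h k \<in> tgt_pre G U"
      and F': "holo_fun AG W F'" and F: "holo_fun AG W' F"
      and eq: "\<And>h'. h' \<in> W \<Longrightarrow> s h' = t k \<Longrightarrow> F' h' = F (\<mu> h' k)"
      by (auto simp: tgt_pre_def)
    obtain K where K: "pair_chart L U K" "h \<in> fst K" using cov h by blast
    obtain K2 where K2: "pair_chart L U K2" "\<mu> h k \<in> fst K2" using cov hk by blast
    have tt: "t (\<mu> h k) = t h" "s (\<mu> h k) = s k" using gpd(7,8)[OF h(3) k] by auto
    \<comment> \<open>The arc through \<open>h\<close> in its source fibre, with target coordinate
      \<open>y\<close>. Its translate by \<open>k\<close> is the corresponding arc through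
      \<open>\<mu> h k\<close>.\<close>
    let ?c = "\<lambda>y. chart_inv K (fst (snd K h), y)"
    have Kh: "snd K h = (fst (snd K h), snd L (t h))" using K by (auto simp: pair_chart_def)
    note line = pair_chart_line[OF L K holo_fun_openin[OF F'] h(1)]
    have "filterlim ?c (nhdsin TG h) (nhds (snd L (t h)))"
      by (rule tendsto_fibre_point[OF coord(2)[OF K(1)] K(2) Kh])
    moreover have "\<forall>\<^sub>F y in nhds (snd L (t h)). ?c y \<in> {h. s h = t k}"
      using line by eventually_elim (use k in auto)
    ultimately have "filterlim ?c (inf (nhdsin TG h) (principal {h. s h = t k})) (nhds (snd L (t h)))"
      by (simp add: filterlim_inf filterlim_principal)
    from filterlim_compose[OF filterlim_right_translation[OF h(3) k] this]
    have "\<forall>\<^sub>F y in nhds (snd L (t h)). \<mu> (?c y) k \<in> fst K2"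
      by (rule eventually_filterlim_nhdsin[OF _ coord(3)[OF K2(1)] K2(2)])
    with line have ev: "\<forall>\<^sub>F y in nhds (snd L (t h)). F' (?c y) = F (chart_inv K2 (fst (snd K2 (\<mu> h k)), y))"
    proof eventually_elim
      case (elim y)
      then have c: "?c y \<in> W" "s (?c y) = t k" "snd L (t (?c y)) = y" "\<mu> (?c y) k \<in> fst K2" using k by auto
      have cp: "?c y \<in> points AG" using openin_points[OF holo_fun_openin[OF F'] c(1)] .
      have "chart_inv K2 (fst (snd K2 (\<mu> h k)), y) = \<mu> (?c y) k"
        by (rule pair_chart_point_unique[OF K2 c(4)]) (use gpd(7,8)[OF cp k(1) c(2)] tt c in auto)
      then show ?case using eq[OF c(1,2)] by simp
    qed
    show "?\<eta> F' h = ?\<eta> F (\<mu> h k)"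
      using d[OF K F' h(1)] unfolding DERIV_cong_ev[OF refl ev refl]
      by (rule DERIV_unique) (use d[OF K2 F hk(1)] tt in simp)
  qed
qed

end

context Pi1_groupoid
begin

text \<open>The target must be regular along the source fibre at every arrow ending in
  \<open>U\<close>. Where the target differs from \<open>p\<close>, the generator does not vanish
  and forces this. Where it equals \<open>p\<close>, translation by the inverse of \<open>g\<close>
  reduces to the unit of \<open>p\<close>, the one place where regularity is assumed.\<close>

lemma pair_chart_exists:
  assumes c: "div_chart p L U"
    and K: "coordinate AG K" "one p \<in> fst K" "fst K \<subseteq> tgt_pre G U" "r > 0"
      "\<forall>h\<in>fst K. s h \<in> fst L \<and> fst (snd K h) = snd L (s h)"
      "snd K ` fst K = ball (snd L p) r \<times> ball (snd (snd K (one p))) r"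
    and nondeg: "D2 ((\<lambda>h. snd L (t h)) \<circ> chart_inv K) (snd K (one p)) \<noteq> 0"
    and g: "g \<in> tgt_pre G U"
  shows "\<exists>K. pair_chart L U K \<and> g \<in> fst K"
proof -
  note cD = div_chartD[OF c]
  note tL = coordinate_top_chart[OF cD(1)]
  note tK = coordinate_top_chart[OF K(1)]
  have gp: "g \<in> points AG" "t g \<in> U" using g by (auto simp: tgt_pre_def)
  obtain M where M: "M \<in> atlas X" "s g \<in> fst M" using atlas_cover[OF mX gpd(1)[OF gp(1)]] by blast
  have M': "coordinate X M" using atlas_coordinate[OF mX M(1)] .
  note tM = coordinate_top_chart[OF M']
  obtain N \<rho> where N: "coordinate AG N" "g \<in> fst N" "fst N \<subseteq> tgt_pre G U" "\<rho> > 0"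
    "\<forall>h\<in>fst N. s h \<in> fst M \<and> fst (snd N h) = snd M (s h)"
    "snd N ` fst N = ball (snd M (s g)) \<rho> \<times> ball (snd (snd N g)) \<rho>"
    using source_chart[OF gp(1) M' M(2) openin_tgt_pre[OF cD(2)] g] .
  note tN = coordinate_top_chart[OF N(1)]
  let ?u = "\<lambda>h. snd L (t h)"
  note fp = fibre_point[OF cD(1,2,4) N M'] and fh = tgt_on_fibre_holomorphic[OF cD(1,2,4) N M']
    and fd = deriv_tgt_on_fibre[OF cD(1,2,4) N M']
  have u: "mdiff AG ?u h" if "h \<in> fst N" for h
    by (rule tgt_mdiff[OF cD(1,2,4) N M' that])
  have "D2 (?u \<circ> chart_inv N) (snd N g) \<noteq> 0"
  proof (cases "t g = p")
    case False
    have hu: "holo_fun AG (tgt_pre G U) (snd L \<circ> t)"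
      by (rule mdiff_tgt_pre_holo(1)[OF lie_groupoid_over_curve_axioms cD(13)])
    \<comment> \<open>This value is the unknown coefficient times the derivative in question, so
      that derivative is nonzero.\<close>
    have "\<theta> (vf_generator L p (D p)) (snd L \<circ> t) g = (snd L (t g) - snd L p) ^ D p"
      using theta_tgt[OF cD(12,13) subset_refl gp] generator_coordinate[OF c gp(2)] by simp
    also have "\<dots> \<noteq> 0"
      using False top_chart_inj[OF tL] gp(2) cD(4,7) by (auto dest: inj_onD)
    finally show ?thesis
      using theta_in_source_chart[OF cD(12) M' N(1,5) hu subset_refl g N(2)] by (auto simp: o_def)
  next
    case True
    show ?thesis
    proof
      assume deg: "D2 (?u \<circ> chart_inv N) (snd N g) = 0"
      define b where "b = snd (snd N g)"
      define k where "k = (\<lambda>c. chart_inv N (snd M (s g), c))"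
      have Ng: "snd N g = (snd M (s g), b)" using N(2,5) by (simp add: b_def prod_eq_iff)
      define b0 where "b0 = snd (snd K (one p))"
      have K0: "snd K (one p) = (snd L p, b0)"
        using K(2,5) cD by (auto simp: b0_def prod_eq_iff)
      define f0 where "f0 = (\<lambda>b. snd L (t (chart_inv K (snd L p, b))))"
      have f0: "f0 holomorphic_on ball b0 r"
        using tgt_on_fibre_holomorphic[where M=L and g="one p", OF cD(1,2,4) K(1-5) _ cD(1)] K(6) cD
        unfolding b0_def f0_def by simp
      have "deriv f0 b0 \<noteq> 0"
        using deriv_tgt_on_fibre[where M=L and g="one p", OF cD(1,2,4) K(1-5) _ cD(1)] K(6) cD nondeg
        unfolding b0_def f0_def by simp
      then obtain r1 where r1: "r1 > 0" "inj_on f0 (ball b0 r1)"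
        using has_complex_derivative_locally_injective[OF f0, of b0] K(4) by auto
      define V where "V = fst K \<inter> snd K -` (UNIV \<times> ball b0 r1)"
      have V: "openin TG V" unfolding V_def by (rule top_chart_vimage[OF tK]) (auto intro: open_Times)
      have pV: "one p \<in> V" using K(2) r1(1) by (auto simp: V_def K0)
      have ivg: "iv g \<in> points AG" "s g = t (iv g)" "\<mu> g (iv g) = one p" "s (iv g) = p"
        using gpd(11-15)[OF gp(1)] True by auto
      have ev: "\<forall>\<^sub>F c in nhds b. c \<in> ball b \<rho>"
        using eventually_nhds_in_open[of "ball b \<rho>" b] N(4) by simp
      have kp: "k c \<in> fst N" "snd N (k c) = (snd M (s g), c)" "s (k c) = t (iv g)" "k c \<in> points AG"
        "t (k c) \<in> fst L" if "c \<in> ball b \<rho>" for c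
        using fp[OF that[unfolded b_def]] coordinate_points[OF N(1)] ivg(2) N(3) cD(4)
        by (auto simp: k_def tgt_pre_def)
      have "filterlim k (nhdsin TG g) (nhds b)"
        unfolding k_def by (rule tendsto_fibre_point[OF tN N(2) Ng])
      moreover have "\<forall>\<^sub>F c in nhds b. k c \<in> {h. s h = t (iv g)}"
        using ev by eventually_elim (use kp in auto)
      ultimately have "filterlim k (inf (nhdsin TG g) (principal {h. s h = t (iv g)})) (nhds b)"
        by (simp add: filterlim_inf filterlim_principal)
      from filterlim_compose[OF filterlim_right_translation[OF gp(1) ivg(1,2)] this]
      have "\<forall>\<^sub>F c in nhds b. \<mu> (k c) (iv g) \<in> V"
        unfolding ivg(3) by (rule eventually_filterlim_nhdsin[OF _ V pV])
      then obtain e where e: "e > 0" "\<And>c. dist c b < e \<Longrightarrow> \<mu> (k c) (iv g) \<in> V"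
        unfolding eventually_nhds_metric by blast
      have fh': "(\<lambda>c. snd L (t (k c))) holomorphic_on ball b \<rho>" "deriv (\<lambda>c. snd L (t (k c))) b = 0"
        using fh fd deg by (simp_all add: b_def k_def)
      obtain c1 c2 where c12: "c1 \<in> ball b (min e \<rho>)" "c2 \<in> ball b (min e \<rho>)" "c1 \<noteq> c2"
        "snd L (t (k c1)) = snd L (t (k c2))"
        using not_injective_near_critical_point[OF fh', of "min e \<rho>"] e(1) N(4) by auto
      have cr: "c1 \<in> ball b \<rho>" "c2 \<in> ball b \<rho>" using c12 by auto
      have tt: "t (k c1) = t (k c2)"
        using top_chart_inj[OF tL] kp(5)[OF cr(1)] kp(5)[OF cr(2)] c12(4) by (meson inj_onD)
      \<comment> \<open>Translation into the source fibre of \<open>p\<close> keeps targets. The two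
        translates lie close to the unit, where the target is injective on the fibre, so they
        coincide; translating back contradicts the choice of \<open>c1\<close> and
        \<open>c2\<close>.\<close>
      define m where "m = (\<lambda>c. \<mu> (k c) (iv g))"
      have mV: "m c1 \<in> V" "m c2 \<in> V" using e(2) c12 by (auto simp: m_def dist_commute)
      have ms: "s (m c) = p" "t (m c) = t (k c)" if "c \<in> ball b \<rho>" for c
        using gpd(7,8)[OF kp(4)[OF that] ivg(1) kp(3)[OF that]] ivg(4) by (auto simp: m_def)
      have mK: "m c \<in> fst K" "snd K (m c) = (snd L p, snd (snd K (m c)))" "snd (snd K (m c)) \<in> ball b0 r1"
        "chart_inv K (snd L p, snd (snd K (m c))) = m c"
        if "c \<in> ball b \<rho>" "m c \<in> V" for c
      proof -
        show 1: "m c \<in> fst K" "snd (snd K (m c)) \<in> ball b0 r1" using that by (auto simp: V_def)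
        show 2: "snd K (m c) = (snd L p, snd (snd K (m c)))" using K(5) 1(1) ms(1)[OF that(1)] by (auto simp: prod_eq_iff)
        show "chart_inv K (snd L p, snd (snd K (m c))) = m c" using chart_inv_apply[OF tK 1(1)] 2 by simp
      qed
      have "f0 (snd (snd K (m c1))) = f0 (snd (snd K (m c2)))"
        unfolding f0_def mK(4)[OF cr(1) mV(1)] mK(4)[OF cr(2) mV(2)] ms(2)[OF cr(1)] ms(2)[OF cr(2)] tt ..
      then have cc: "snd (snd K (m c1)) = snd (snd K (m c2))"
        using r1(2) mK(3)[OF cr(1) mV(1)] mK(3)[OF cr(2) mV(2)] by (meson inj_onD)
      have mm: "m c1 = m c2"
        by (rule trans[OF mK(4)[OF cr(1) mV(1), symmetric] mK(4)[OF cr(2) mV(2), folded cc]])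
      have r: "\<mu> (m c) (iv (iv g)) = k c" if "c \<in> ball b \<rho>" for c
        unfolding m_def by (rule right_translation_cancel[OF kp(4)[OF that] ivg(1) kp(3)[OF that]])
      have kk: "k c1 = k c2" by (rule trans[OF r[OF cr(1), symmetric] r[OF cr(2), folded mm]])
      have "(snd M (s g), c1) = (snd M (s g), c2)"
        by (rule trans[OF kp(2)[OF cr(1), symmetric] kp(2)[OF cr(2), folded kk]])
      then show False using c12(3) by simp
    qed
  qed
  from coordinate_graph[OF mG N(1) top_chart_openin[OF tN] N(2,2) u this]
  obtain K' where K': "coordinate AG K'" "g \<in> fst K'" "fst K' \<subseteq> fst N \<inter> fst N"
    "\<forall>y\<in>fst K'. snd K' y = (fst (snd N y), ?u y)" by blast
  have "pair_chart L U K'"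
    unfolding pair_chart_def
  proof (intro conjI exI[of _ M] ballI M' K')
    show "fst K' \<subseteq> tgt_pre G U" using K'(3) N(3) by blast
    show "s h \<in> fst M" "snd K' h = (snd M (s h), snd L (t h))" if "h \<in> fst K'" for h
      using K'(3,4) N(5) that by auto
  qed
  then show ?thesis using K'(2) by blast
qed

text \<open>Surjectivity of \<open>\<theta>\<close> yields a vector field \<open>\<xi>\<close> that
  induces \<open>tgt_derivative\<close>. Evaluated on the target coordinate at the unit it gives
  \<open>1\<close> by construction, yet \<open>0\<close> by the anchor, because \<open>\<xi>\<close>
  vanishes at \<open>p\<close>.\<close>

lemma tgt_degenerate_at_unit:
  assumes c: "div_chart p L U"
    and K: "coordinate AG K" "one p \<in> fst K" "fst K \<subseteq> tgt_pre G U" "r > 0"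
      "\<forall>h\<in>fst K. s h \<in> fst L \<and> fst (snd K h) = snd L (s h)"
      "snd K ` fst K = ball (snd L p) r \<times> ball (snd (snd K (one p))) r"
  shows "D2 ((\<lambda>h. snd L (t h)) \<circ> chart_inv K) (snd K (one p)) = 0"
proof (rule ccontr)
  assume nd: "D2 ((\<lambda>h. snd L (t h)) \<circ> chart_inv K) (snd K (one p)) \<noteq> 0"
  note cD = div_chartD[OF c]
  note ex = pair_chart_exists[OF c K nd]
  let ?\<eta> = "tgt_derivative L U"
  obtain \<xi> where \<xi>: "vf_vanishing X D U \<xi>" "vf_eq AG (tgt_pre G U) (\<theta> \<xi>) ?\<eta>"
    using theta_surj[OF tgt_derivative_right_invariant[OF cD(1,2) ex]] by blast
  have hu: "holo_fun AG (tgt_pre G U) (snd L \<circ> t)"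
    by (rule mdiff_tgt_pre_holo(1)[OF lie_groupoid_over_curve_axioms cD(13)])
  have p: "one p \<in> tgt_pre G U" using cD by (simp add: tgt_pre_def)
  obtain N where N: "pair_chart L U N" "one p \<in> fst N" using ex[OF p] by blast
  have oN: "openin TG (fst N)" using N(1) by (auto simp: pair_chart_def intro: top_chart_openin coordinate_top_chart)
  have "?\<eta> (snd L \<circ> t) (one p) = deriv (\<lambda>y. (snd L \<circ> t) (chart_inv N (fst (snd N (one p)), y))) (snd L (t (one p)))"
    by (simp add: tgt_derivative_eq[OF cD(1) N] D2_pair_chart[OF N])
  also have "\<dots> = deriv (\<lambda>y. y) (snd L (t (one p)))"
  proof (rule deriv_cong_ev)
    from pair_chart_line[OF cD(1) N oN N(2)]
    show "\<forall>\<^sub>F y in nhds (snd L (t (one p))). (snd L \<circ> t) (chart_inv N (fst (snd N (one p)), y)) = y"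
      by eventually_elim simp
  qed simp
  finally have "?\<eta> (snd L \<circ> t) (one p) = 1" by simp
  moreover have "\<theta> \<xi> (snd L \<circ> t) (one p) = ?\<eta> (snd L \<circ> t) (one p)"
    using \<xi>(2) hu p unfolding vf_eq_def by blast
  moreover have "\<theta> \<xi> (snd L \<circ> t) (one p) = \<xi> (snd L) p"
    by (rule theta_anchor[OF \<xi>(1) cD(13) subset_refl cD(3)])
  moreover have "\<xi> (snd L) p = 0"
  proof -
    have "vanishes_to_order X (D p) p (\<xi> (snd L))"
      using \<xi>(1) cD(13,3) unfolding vf_vanishing_def by blast
    then show ?thesis using cD(5) by (auto simp: vanishes_to_order_def zero_power)
  qed
  ultimately show False by simp
qed

lemma div_chart_exists:
  assumes "p \<in> div_support X D" "coordinate X L" "p \<in> fst L" "openin TX W" "p \<in> W"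
  obtains U where "div_chart p L U" "U \<subseteq> W"
proof -
  have "openin TX (fst L \<inter> W)"
    using top_chart_openin[OF coordinate_top_chart[OF assms(2)]] assms(4) by (rule openin_Int)
  moreover have "p \<in> fst L \<inter> W" using assms by simp
  ultimately obtain U where "openin TX U" "p \<in> U" "U \<subseteq> fst L \<inter> W" "\<forall>q\<in>U. q \<noteq> p \<longrightarrow> D q = 0"
    using divisor_neighbourhood by metis
  then show ?thesis using assms that by (auto simp: div_chart_def div_support_def)
qed

text \<open>The target is constant on the fibre near the unit. Near any other arrow of the fibre
  that ends at \<open>p\<close>, translation by its inverse leads back to the unit with targets
  preserved. Ending away from \<open>p\<close> is an open condition since points of \<open>X\<close>
  are closed, so connectedness concludes.\<close>

lemma tgt_eq_of_src_eq:
  assumes p: "p \<in> div_support X D" and g: "g \<in> points AG" "s g = p"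
  shows "t g = p"
proof -
  have pX: "p \<in> points X" using p by (simp add: div_support_def)
  obtain L where L: "L \<in> atlas X" "p \<in> fst L" using atlas_cover[OF mX pX] by blast
  have L': "coordinate X L" using atlas_coordinate[OF mX L(1)] .
  obtain U where c: "div_chart p L U"
    using div_chart_exists[OF p L' L(2) top_chart_openin[OF coordinate_top_chart[OF L']] L(2)] .
  note cD = div_chartD[OF c]
  have "one p \<in> tgt_pre G U" using cD by (simp add: tgt_pre_def)
  moreover have "s (one p) \<in> fst L" using cD by simp
  ultimately obtain K r where K: "coordinate AG K" "one p \<in> fst K" "fst K \<subseteq> tgt_pre G U" "r > 0"
      "\<forall>h\<in>fst K. s h \<in> fst L \<and> fst (snd K h) = snd L (s h)"
      "snd K ` fst K = ball (snd L (s (one p))) r \<times> ball (snd (snd K (one p))) r"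
    using source_chart[OF cD(9) L' _ openin_tgt_pre[OF cD(2)]] by metis
  note K6 = K(6)[unfolded cD(10)]
  have near: "t h = p" if "h \<in> fst K" "s h = p" for h
    by (rule tgt_constant_near_unit_degenerate[OF c K(1-5) K6 tgt_degenerate_at_unit[OF c K(1-5) K6] that])
  note oK = top_chart_openin[OF coordinate_top_chart[OF K(1)]]
  show ?thesis
  proof (rule fibre_connected_induct[where Q="\<lambda>g. t g = p", OF pX cD(11) _ g])
    fix g assume g: "g \<in> points AG" "s g = p"
    show "\<forall>\<^sub>F h in nhdsin TG g. s h = p \<longrightarrow> (t h = p) = (t g = p)"
    proof (cases "t g = p")
      case True
      have ivg: "iv g \<in> points AG" "t (iv g) = p" "\<mu> g (iv g) = one p" "s (iv g) = p"
        using gpd(11-15)[OF g(1)] True g by auto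
      have "filterlim (\<lambda>h. \<mu> h (iv g)) (nhdsin TG (one p)) (inf (nhdsin TG g) (principal {h. s h = p}))"
        using filterlim_right_translation[OF g(1) ivg(1)] g ivg by simp
      then have "\<forall>\<^sub>F h in inf (nhdsin TG g) (principal {h. s h = p}). \<mu> h (iv g) \<in> fst K"
        by (rule eventually_filterlim_nhdsin[OF _ oK K(2)])
      then have "\<forall>\<^sub>F h in nhdsin TG g. s h = p \<longrightarrow> \<mu> h (iv g) \<in> fst K"
        by (simp add: eventually_inf_principal)
      moreover have "\<forall>\<^sub>F h in nhdsin TG g. h \<in> points AG"
        by (rule eventually_nhdsin_openin[of _ "topspace TG"]) (use g in \<open>auto simp: points_def\<close>)
      ultimately show ?thesis
      proof eventually_elim
        case (elim h)
        show ?case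
        proof
          assume sh: "s h = p"
          then have "s (\<mu> h (iv g)) = p" "t (\<mu> h (iv g)) = t h" using elim gpd(7,8)[of h "iv g"] ivg by auto
          then show "(t h = p) = (t g = p)" using near elim sh True by auto
        qed
      qed
    next
      case False
      have "closedin TX {p}"
        using hausX pX by (intro closedin_Hausdorff_sing_eq[THEN iffD2]) (auto simp: points_def)
      then have "openin TX (points X - {p})" by (auto simp: points_def closedin_def)
      from openin_tgt_pre[OF this] show ?thesis
        by (rule eventually_nhdsin_openin) (use g False in \<open>auto simp: tgt_pre_def gpd\<close>)
    qed
  qed
qed

lemma src_eq_iff_tgt_eq:
  assumes "p \<in> div_support X D" "g \<in> points AG"
  shows "s g = p \<longleftrightarrow> t g = p"
  using tgt_eq_of_src_eq[OF assms(1), of g] tgt_eq_of_src_eq[OF assms(1), of "iv g"] assms(2) gpd(11-13)[OF assms(2)]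
  by auto

end

section \<open>Frames of vector bundles\<close>

definition fibre_linear ::
  "('x, 'e, 'r::finite) vbundle \<Rightarrow> ('x, 'f, 'q::finite) vbundle \<Rightarrow> 'x \<Rightarrow> 'x \<Rightarrow> ('e \<Rightarrow> 'f) \<Rightarrow> bool" where
  "fibre_linear E F x y T \<longleftrightarrow> (\<forall>v\<in>fibre E x. T v \<in> fibre F y) \<and>
     (\<forall>v\<in>fibre E x. \<forall>w\<in>fibre E x. T (vadd E v w) = vadd F (T v) (T w)) \<and>
     (\<forall>a. \<forall>v\<in>fibre E x. T (vscale E a v) = vscale F a (T v))"

lemma fibre_linear_id: "fibre_linear E E x x id"
  by (simp add: fibre_linear_def)

lemma fibrewise_chart:
  assumes "fibrewise_linear_chart X E \<tau>" "x \<in> fst \<tau>"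
  shows "bij_betw (snd \<tau>) (fibre E x) UNIV"
    "v \<in> fibre E x \<Longrightarrow> w \<in> fibre E x \<Longrightarrow> vadd E v w \<in> fibre E x \<and> snd \<tau> (vadd E v w) = snd \<tau> v + snd \<tau> w"
    "v \<in> fibre E x \<Longrightarrow> vscale E a v \<in> fibre E x \<and> snd \<tau> (vscale E a v) = a *s snd \<tau> v"
    "inv_into (fibre E x) (snd \<tau>) c \<in> fibre E x" "snd \<tau> (inv_into (fibre E x) (snd \<tau>) c) = c"
    "v \<in> fibre E x \<Longrightarrow> inv_into (fibre E x) (snd \<tau>) (snd \<tau> v) = v"
    "frame E \<tau> x j \<in> fibre E x" "snd \<tau> (frame E \<tau> x j) = axis j 1"
proof -
  show b: "bij_betw (snd \<tau>) (fibre E x) UNIV"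
    using assms unfolding fibrewise_linear_chart_def by blast
  then have c: "c \<in> snd \<tau> ` fibre E x" for c by (auto simp: bij_betw_def)
  show "inv_into (fibre E x) (snd \<tau>) c \<in> fibre E x" "snd \<tau> (inv_into (fibre E x) (snd \<tau>) c) = c" for c
    using inv_into_into[OF c] f_inv_into_f[OF c] by auto
  then show "frame E \<tau> x j \<in> fibre E x" "snd \<tau> (frame E \<tau> x j) = axis j 1" by (auto simp: frame_def)
  show "inv_into (fibre E x) (snd \<tau>) (snd \<tau> v) = v" if "v \<in> fibre E x"
    using b that by (simp add: bij_betw_def)
  show "vadd E v w \<in> fibre E x \<and> snd \<tau> (vadd E v w) = snd \<tau> v + snd \<tau> w" if "v \<in> fibre E x" "w \<in> fibre E x"
    using assms that unfolding fibrewise_linear_chart_def by blast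
  show "vscale E a v \<in> fibre E x \<and> snd \<tau> (vscale E a v) = a *s snd \<tau> v" if "v \<in> fibre E x"
    using assms that unfolding fibrewise_linear_chart_def by blast
qed

lemma frame_matrix_apply:
  fixes E :: "('x, 'e, 'r::finite) vbundle" and F :: "('x, 'f, 'q::finite) vbundle"
  assumes \<tau>: "fibrewise_linear_chart X E \<tau>" "x \<in> fst \<tau>" and \<sigma>: "fibrewise_linear_chart X F \<sigma>" "y \<in> fst \<sigma>"
    and T: "fibre_linear E F x y T" and v: "v \<in> fibre E x"
  shows "snd \<sigma> (T v) = frame_matrix E \<tau> \<sigma> T x *v snd \<tau> v"
proof -
  define i where "i = inv_into (fibre E x) (snd \<tau>)"
  define L where "L c = snd \<sigma> (T (i c))" for c
  note e = fibrewise_chart[OF \<tau>] and f = fibrewise_chart[OF \<sigma>]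
  have i: "i c \<in> fibre E x" "snd \<tau> (i c) = c" "w \<in> fibre E x \<Longrightarrow> i (snd \<tau> w) = w" for c w
    using e(4-6) by (auto simp: i_def)
  have Tf: "T w \<in> fibre F y" if "w \<in> fibre E x" for w using T that by (auto simp: fibre_linear_def)
  have "i (c + d) = vadd E (i c) (i d)" for c d
    using e(2)[OF i(1) i(1), of c d] i by metis
  then have L_add: "L (c + d) = L c + L d" for c d
    using T i(1) f(2)[OF Tf Tf] by (simp add: L_def fibre_linear_def)
  have "i (a *s c) = vscale E a (i c)" for a c
    using e(3)[OF i(1), of a c] i by metis
  then have L_scale: "L (a *s c) = a *s L c" for a c
    using T i(1) f(3)[OF Tf] by (simp add: L_def fibre_linear_def)
  have L0: "L 0 = 0" using L_add[of 0 0] by simp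
  have "L (sum g A) = (\<Sum>j\<in>A. L (g j))" for g and A :: "'r set"
    by (induction A rule: infinite_finite_induct) (auto simp: L_add L0)
  from this[of "\<lambda>j. snd \<tau> v $ j *s axis j 1" UNIV]
  have "L (snd \<tau> v) = (\<Sum>j\<in>UNIV. snd \<tau> v $ j *s L (axis j 1))"
    by (simp add: basis_expansion L_scale)
  moreover have "L (axis j 1) = snd \<sigma> (T (frame E \<tau> x j))" for j by (simp add: L_def i_def frame_def)
  ultimately show ?thesis
    by (simp add: L_def i(3)[OF v] vec_eq_iff frame_matrix_def matrix_vector_mult_def mult.commute)
qed

lemma frame_matrix_compose:
  fixes E :: "('x, 'e, 'r::finite) vbundle" and F :: "('x, 'f, 'q::finite) vbundle" and H :: "('x, 'h, 'u::finite) vbundle"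
  assumes \<tau>: "fibrewise_linear_chart X E \<tau>" "x \<in> fst \<tau>" and \<sigma>: "fibrewise_linear_chart X F \<sigma>" "y \<in> fst \<sigma>"
    and \<rho>: "fibrewise_linear_chart X H \<rho>" "z \<in> fst \<rho>"
    and T: "fibre_linear E F x y T" and S: "fibre_linear F H y z S"
    and eq: "\<And>v. v \<in> fibre E x \<Longrightarrow> R v = S (T v)"
  shows "frame_matrix E \<tau> \<rho> R x = frame_matrix F \<sigma> \<rho> S y ** frame_matrix E \<tau> \<sigma> T x"
proof -
  have "snd \<rho> (R (frame E \<tau> x j)) $ i = (\<Sum>k\<in>UNIV. frame_matrix F \<sigma> \<rho> S y $ i $ k * snd \<sigma> (T (frame E \<tau> x j)) $ k)" for i j
  proof -
    have fr: "frame E \<tau> x j \<in> fibre E x" using fibrewise_chart(7)[OF \<tau>] .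
    then have "T (frame E \<tau> x j) \<in> fibre F y" using T by (auto simp: fibre_linear_def)
    from frame_matrix_apply[OF \<sigma> \<rho> S this] eq[OF fr] show ?thesis
      by (simp add: matrix_vector_mult_def)
  qed
  then show ?thesis by (simp add: vec_eq_iff matrix_matrix_mult_def frame_matrix_def)
qed

lemma frame_matrix_id:
  assumes "fibrewise_linear_chart X E \<tau>" "x \<in> fst \<tau>"
  shows "frame_matrix E \<tau> \<tau> id x = mat 1"
  using fibrewise_chart(8)[OF assms] by (simp add: frame_matrix_def vec_eq_iff axis_def mat_def)

lemma mdiff_matrix_mult:
  fixes A :: "'a \<Rightarrow> complex^'n::finite^'m::finite" and B :: "'a \<Rightarrow> complex^'k::finite^'n"
  assumes M: "complex_manifold M" and A: "mdiff M A x" and B: "mdiff M B x"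
  shows "mdiff M (\<lambda>y. A y ** B y) x"
  unfolding mdiff_matrix_iff[OF M] matrix_matrix_mult_def vec_lambda_beta
  using A B unfolding mdiff_matrix_iff[OF M]
  by (intro allI mdiff_sum[OF M mdiff_points[OF M A]] mdiff_mult[OF M]) auto

lemma mdiff_matrix_vector_mult:
  fixes A :: "'a \<Rightarrow> complex^'n::finite^'m::finite"
  assumes M: "complex_manifold M" and A: "mdiff M A x" and B: "mdiff M B x"
  shows "mdiff M (\<lambda>y. A y *v B y) x"
proof (subst mdiff_vec_iff[OF M], rule allI)
  fix i
  have "mdiff M (\<lambda>y. A y $ i $ j) x" "mdiff M (\<lambda>y. B y $ j) x" for j
    using A[unfolded mdiff_matrix_iff[OF M]] B[unfolded mdiff_vec_iff[OF M, of B]] by blast+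
  then have "mdiff M (\<lambda>y. \<Sum>j\<in>UNIV. A y $ i $ j * B y $ j) x"
    by (intro mdiff_sum[OF M mdiff_points[OF M A]] mdiff_mult[OF M])
  then show "mdiff M (\<lambda>y. (A y *v B y) $ i) x" by (simp add: matrix_vector_mult_def)
qed

lemma mdiff_transform:
  assumes "complex_manifold M" "mdiff M g x" "openin (mtop M) V" "x \<in> V" "\<And>y. y \<in> V \<Longrightarrow> f y = g y"
  shows "mdiff M f x"
  using mdiff_cong[of M V x f g] assms by blast

lemma local_frame_chart: "local_frame X E \<tau> \<Longrightarrow> fibrewise_linear_chart X E \<tau>"
  by (simp add: local_frame_def)

lemma trivs_chart: "vector_bundle X E \<Longrightarrow> \<tau> \<in> trivs E \<Longrightarrow> fibrewise_linear_chart X E \<tau>"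
  by (simp add: vector_bundle_def)

lemma trivs_local_frame: "vector_bundle X E \<Longrightarrow> \<tau> \<in> trivs E \<Longrightarrow> local_frame X E \<tau>"
  by (simp add: vector_bundle_def local_frame_def)

lemma trivs_cover: "vector_bundle X E \<Longrightarrow> x \<in> points X \<Longrightarrow> \<exists>\<tau>\<in>trivs E. x \<in> fst \<tau>"
  unfolding vector_bundle_def by blast

lemma chart_open: "fibrewise_linear_chart X E \<tau> \<Longrightarrow> openin (mtop X) (fst \<tau>)"
  by (simp add: fibrewise_linear_chart_def)

text \<open>Local frames are tied to each other only through the distinguished trivializations, so
  the change of frame is factored through one of them.\<close>

lemma mdiff_frame_change:
  assumes X: "complex_manifold X" and E: "vector_bundle X E" and \<tau>: "local_frame X E \<tau>" "x \<in> fst \<tau>"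
    and \<sigma>: "local_frame X E \<sigma>" "x \<in> fst \<sigma>"
  shows "mdiff X (frame_matrix E \<tau> \<sigma> id) x"
proof -
  note c\<tau> = local_frame_chart[OF \<tau>(1)] and c\<sigma> = local_frame_chart[OF \<sigma>(1)]
  obtain \<rho> where \<rho>: "\<rho> \<in> trivs E" "x \<in> fst \<rho>"
    using trivs_cover[OF E openin_points[OF chart_open[OF c\<tau>] \<tau>(2)]] by blast
  note c\<rho> = trivs_chart[OF E \<rho>(1)]
  let ?W = "fst \<tau> \<inter> fst \<sigma> \<inter> fst \<rho>"
  have W: "openin (mtop X) ?W" by (intro openin_Int chart_open[OF c\<tau>] chart_open[OF c\<sigma>] chart_open[OF c\<rho>])
  have "holo_fun X (fst \<tau> \<inter> fst \<rho>) (frame_matrix E \<tau> \<rho> id)" "holo_fun X (fst \<rho> \<inter> fst \<sigma>) (frame_matrix E \<rho> \<sigma> id)"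
    using \<tau>(1) \<sigma>(1) \<rho>(1) by (auto simp: local_frame_def triv_transition_def)
  then have "mdiff X (frame_matrix E \<tau> \<rho> id) x" "mdiff X (frame_matrix E \<rho> \<sigma> id) x"
    using holo_fun_mdiff[OF X] \<tau> \<sigma> \<rho> by blast+
  from mdiff_matrix_mult[OF X this(2,1)]
  have m: "mdiff X (\<lambda>y. frame_matrix E \<rho> \<sigma> id y ** frame_matrix E \<tau> \<rho> id y) x" .
  have eq: "frame_matrix E \<tau> \<sigma> id y = frame_matrix E \<rho> \<sigma> id y ** frame_matrix E \<tau> \<rho> id y" if "y \<in> ?W" for y
    using that by (intro frame_matrix_compose[OF c\<tau> _ c\<rho> _ c\<sigma> _ fibre_linear_id fibre_linear_id]) auto
  show ?thesis by (rule mdiff_transform[OF X m W _ eq]) (use \<tau> \<sigma> \<rho> in auto)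
qed

lemma mdiff_section:
  assumes X: "complex_manifold X" and E: "vector_bundle X E" and u: "holo_section X E U u" and x: "x \<in> U"
    and \<sigma>: "local_frame X E \<sigma>" "x \<in> fst \<sigma>"
  shows "mdiff X (\<lambda>y. snd \<sigma> (u y)) x"
proof -
  have U: "openin (mtop X) U" using u by (simp add: holo_section_def)
  obtain \<rho> where \<rho>: "\<rho> \<in> trivs E" "x \<in> fst \<rho>"
    using trivs_cover[OF E openin_points[OF U x]] by blast
  note c\<rho> = trivs_chart[OF E \<rho>(1)] and c\<sigma> = local_frame_chart[OF \<sigma>(1)]
  have "holo_fun X (U \<inter> fst \<rho>) (snd \<rho> \<circ> u)" using u \<rho>(1) by (auto simp: holo_section_def)
  then have "mdiff X (snd \<rho> \<circ> u) x" using holo_fun_mdiff[OF X] x \<rho>(2) by blast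
  from mdiff_matrix_vector_mult[OF X mdiff_frame_change[OF X E trivs_local_frame[OF E \<rho>(1)] \<rho>(2) \<sigma>] this]
  have m: "mdiff X (\<lambda>y. frame_matrix E \<rho> \<sigma> id y *v (snd \<rho> \<circ> u) y) x" .
  have W: "openin (mtop X) (U \<inter> fst \<rho> \<inter> fst \<sigma>)" by (intro openin_Int U chart_open[OF c\<sigma>] chart_open[OF c\<rho>])
  have eq: "snd \<sigma> (u y) = frame_matrix E \<rho> \<sigma> id y *v (snd \<rho> \<circ> u) y" if "y \<in> U \<inter> fst \<rho> \<inter> fst \<sigma>" for y
    using frame_matrix_apply[OF c\<rho> _ c\<sigma> _ fibre_linear_id, of y "u y"] that u by (auto simp: holo_section_def)
  show ?thesis by (rule mdiff_transform[OF X m W _ eq]) (use x \<sigma> \<rho> in auto)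
qed

lemma holo_section_frame:
  assumes X: "complex_manifold X" and E: "vector_bundle X E" and \<tau>: "local_frame X E \<tau>"
    and U: "openin (mtop X) U" "U \<subseteq> fst \<tau>"
  shows "holo_section X E U (\<lambda>y. frame E \<tau> y j)"
  unfolding holo_section_def
proof (intro conjI ballI U(1))
  note c\<tau> = local_frame_chart[OF \<tau>]
  show "frame E \<tau> x j \<in> fibre E x" if "x \<in> U" for x using fibrewise_chart(7)[OF c\<tau>] that U by blast
  fix \<rho> assume \<rho>: "\<rho> \<in> trivs E"
  note c\<rho> = trivs_chart[OF E \<rho>]
  show "holo_fun X (U \<inter> fst \<rho>) (snd \<rho> \<circ> (\<lambda>y. frame E \<tau> y j))"
  proof (rule holo_funI[OF X openin_Int[OF U(1) chart_open[OF c\<rho>]]])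
    fix x assume "x \<in> U \<inter> fst \<rho>"
    then have "mdiff X (frame_matrix E \<tau> \<rho> id) x"
      using U by (intro mdiff_frame_change[OF X E \<tau> _ trivs_local_frame[OF E \<rho>]]) auto
    then have "mdiff X (\<lambda>y. frame_matrix E \<tau> \<rho> id y $ i $ j) x" for i
      unfolding mdiff_matrix_iff[OF X] by blast
    then show "mdiff X (snd \<rho> \<circ> (\<lambda>y. frame E \<tau> y j)) x"
      unfolding mdiff_vec_iff[OF X, of "snd \<rho> \<circ> _"] by (simp add: frame_matrix_def)
  qed
qed

section \<open>Representations of the groupoid in frames\<close>

context lie_groupoid_over_curve
begin

context
  fixes E :: "('x, 'e, 'r::finite) vbundle" and \<Psi> :: "'g \<Rightarrow> 'e \<Rightarrow> 'e"
  assumes E: "vector_bundle X E" and rep: "groupoid_rep X G E \<Psi>"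
begin

lemma rep_fibre_linear: "g \<in> points AG \<Longrightarrow> fibre_linear E E (s g) (t g) (\<Psi> g)"
  using rep unfolding groupoid_rep_def fibre_linear_def by (auto dest!: bij_betwE)

lemma rep_mult: "g \<in> points AG \<Longrightarrow> h \<in> points AG \<Longrightarrow> s g = t h \<Longrightarrow> v \<in> fibre E (s h) \<Longrightarrow> \<Psi> (\<mu> g h) v = \<Psi> g (\<Psi> h v)"
  using rep unfolding groupoid_rep_def by blast

text \<open>By multiplicativity the action of a unit is idempotent, and it is injective.\<close>

lemma rep_one:
  assumes x: "x \<in> points X" and v: "v \<in> fibre E x"
  shows "\<Psi> (one x) v = v"
proof -
  note o = gpd(3-5)[OF x]
  have b: "bij_betw (\<Psi> (one x)) (fibre E x) (fibre E x)"
    using rep o unfolding groupoid_rep_def by metis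
  have "\<mu> (one x) (one x) = one x" using gpd(9)[OF o(1)] o by simp
  then have "\<Psi> (one x) (\<Psi> (one x) v) = \<Psi> (one x) v"
    using rep_mult[OF o(1,1)] o v by simp
  then show ?thesis using b v by (metis bij_betw_def bij_betwE inj_onD)
qed

definition rep_matrix where "rep_matrix \<tau> \<sigma> h = frame_matrix E \<tau> \<sigma> (\<Psi> h) (s h)"

lemma rep_matrix_mult:
  assumes g: "g \<in> points AG" and h: "h \<in> points AG" and gh: "s g = t h"
    and \<tau>: "local_frame X E \<tau>" "s h \<in> fst \<tau>" and \<sigma>: "local_frame X E \<sigma>" "t h \<in> fst \<sigma>"
    and \<rho>: "local_frame X E \<rho>" "t g \<in> fst \<rho>"
  shows "rep_matrix \<tau> \<rho> (\<mu> g h) = rep_matrix \<sigma> \<rho> g ** rep_matrix \<tau> \<sigma> h"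
proof -
  have T: "fibre_linear E E (s h) (t h) (\<Psi> h)" "fibre_linear E E (t h) (t g) (\<Psi> g)"
    using rep_fibre_linear[OF g] rep_fibre_linear[OF h] gh by auto
  have "frame_matrix E \<tau> \<rho> (\<Psi> (\<mu> g h)) (s h) = frame_matrix E \<sigma> \<rho> (\<Psi> g) (t h) ** frame_matrix E \<tau> \<sigma> (\<Psi> h) (s h)"
    by (rule frame_matrix_compose[OF local_frame_chart[OF \<tau>(1)] \<tau>(2) local_frame_chart[OF \<sigma>(1)] \<sigma>(2)
          local_frame_chart[OF \<rho>(1)] \<rho>(2) T]) (rule rep_mult[OF g h gh])
  then show ?thesis using gpd(7)[OF g h gh] gh by (simp add: rep_matrix_def)
qed

lemma rep_matrix_one:
  assumes "x \<in> points X" "local_frame X E \<tau>" "x \<in> fst \<tau>"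
  shows "rep_matrix \<tau> \<tau> (one x) = mat 1"
proof -
  have "frame_matrix E \<tau> \<tau> (\<Psi> (one x)) x = frame_matrix E \<tau> \<tau> id x"
    using rep_one[OF assms(1)] fibrewise_chart(7)[OF local_frame_chart[OF assms(2)] assms(3)]
    by (simp add: frame_matrix_def)
  then show ?thesis
    using frame_matrix_id[OF local_frame_chart[OF assms(2)] assms(3)] gpd(4)[OF assms(1)] by (simp add: rep_matrix_def)
qed

lemma rep_matrix_change_src:
  assumes h: "h \<in> points AG" and \<tau>: "local_frame X E \<tau>" "s h \<in> fst \<tau>" and \<tau>': "local_frame X E \<tau>'" "s h \<in> fst \<tau>'"
    and \<sigma>: "local_frame X E \<sigma>" "t h \<in> fst \<sigma>"
  shows "rep_matrix \<tau> \<sigma> h = rep_matrix \<tau>' \<sigma> h ** frame_matrix E \<tau> \<tau>' id (s h)"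
  unfolding rep_matrix_def
  by (rule frame_matrix_compose[OF local_frame_chart[OF \<tau>(1)] \<tau>(2) local_frame_chart[OF \<tau>'(1)] \<tau>'(2)
        local_frame_chart[OF \<sigma>(1)] \<sigma>(2) fibre_linear_id rep_fibre_linear[OF h]]) simp

lemma rep_matrix_change_tgt:
  assumes h: "h \<in> points AG" and \<tau>: "local_frame X E \<tau>" "s h \<in> fst \<tau>" and \<sigma>: "local_frame X E \<sigma>" "t h \<in> fst \<sigma>"
    and \<sigma>': "local_frame X E \<sigma>'" "t h \<in> fst \<sigma>'"
  shows "rep_matrix \<tau> \<sigma> h = frame_matrix E \<sigma>' \<sigma> id (t h) ** rep_matrix \<tau> \<sigma>' h"
  unfolding rep_matrix_def
  by (rule frame_matrix_compose[OF local_frame_chart[OF \<tau>(1)] \<tau>(2) local_frame_chart[OF \<sigma>'(1)] \<sigma>'(2)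
        local_frame_chart[OF \<sigma>(1)] \<sigma>(2) rep_fibre_linear[OF h] fibre_linear_id]) simp

lemma mdiff_rep_matrix:
  assumes h: "h \<in> points AG" and \<tau>: "local_frame X E \<tau>" "s h \<in> fst \<tau>" and \<sigma>: "local_frame X E \<sigma>" "t h \<in> fst \<sigma>"
  shows "mdiff AG (rep_matrix \<tau> \<sigma>) h"
proof -
  obtain \<tau>' where \<tau>': "\<tau>' \<in> trivs E" "s h \<in> fst \<tau>'" using trivs_cover[OF E gpd(1)[OF h]] by blast
  obtain \<sigma>' where \<sigma>': "\<sigma>' \<in> trivs E" "t h \<in> fst \<sigma>'" using trivs_cover[OF E gpd(2)[OF h]] by blast
  note lf = trivs_local_frame[OF E \<tau>'(1)] trivs_local_frame[OF E \<sigma>'(1)]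
  let ?W = "src_pre G (fst \<tau> \<inter> fst \<tau>') \<inter> tgt_pre G (fst \<sigma> \<inter> fst \<sigma>')"
  have W: "openin TG ?W"
    by (intro openin_Int openin_src_pre openin_tgt_pre chart_open[of X E] local_frame_chart lf \<tau> \<sigma>)
  have "holo_fun AG (src_pre G (fst \<tau>') \<inter> tgt_pre G (fst \<sigma>')) (rep_matrix \<tau>' \<sigma>')"
    using rep \<tau>'(1) \<sigma>'(1) unfolding groupoid_rep_def rep_matrix_def by blast
  then have "mdiff AG (rep_matrix \<tau>' \<sigma>') h"
    by (rule holo_fun_mdiff[OF mG]) (use h \<tau>' \<sigma>' in \<open>auto simp: src_pre_def tgt_pre_def\<close>)
  moreover have "mdiff AG (\<lambda>h. frame_matrix E \<tau> \<tau>' id (s h)) h"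
    by (rule mdiff_s[OF h mdiff_frame_change[OF mX E \<tau> lf(1) \<tau>'(2)]])
  moreover have "mdiff AG (\<lambda>h. frame_matrix E \<sigma>' \<sigma> id (t h)) h"
    by (rule mdiff_t[OF h mdiff_frame_change[OF mX E lf(2) \<sigma>'(2) \<sigma>]])
  ultimately have m: "mdiff AG (\<lambda>h. frame_matrix E \<sigma>' \<sigma> id (t h) ** (rep_matrix \<tau>' \<sigma>' h ** frame_matrix E \<tau> \<tau>' id (s h))) h"
    by (intro mdiff_matrix_mult[OF mG])
  have eq: "rep_matrix \<tau> \<sigma> h = frame_matrix E \<sigma>' \<sigma> id (t h) ** (rep_matrix \<tau>' \<sigma>' h ** frame_matrix E \<tau> \<tau>' id (s h))"
    if "h \<in> ?W" for h
  proof -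
    have h: "h \<in> points AG" "s h \<in> fst \<tau>" "s h \<in> fst \<tau>'" "t h \<in> fst \<sigma>" "t h \<in> fst \<sigma>'"
      using that by (auto simp: src_pre_def tgt_pre_def)
    show ?thesis
      using rep_matrix_change_tgt[OF h(1) \<tau>(1) h(2) \<sigma>(1) h(4) lf(2) h(5)]
        rep_matrix_change_src[OF h(1) \<tau>(1) h(2) lf(1) h(3) lf(2) h(5)] by simp
  qed
  have "h \<in> ?W" using h \<tau> \<sigma> \<tau>' \<sigma>' by (auto simp: src_pre_def tgt_pre_def)
  then show ?thesis by (rule mdiff_transform[OF mG m W _ eq])
qed

end

end

section \<open>The parallel transport equation near the divisor\<close>

text \<open>The connection matrix in the frame \<open>\<tau>\<close>, contracted with the generator
  \<open>z ^ n * d/dz\<close>: in components, the covariant derivative is the derivation plus this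
  matrix.\<close>

definition conn_matrix ::
  "('x, 'e, 'r::finite) vbundle \<Rightarrow> ('x, 'e) connection \<Rightarrow> ('x, complex) chart \<Rightarrow> 'x \<Rightarrow> nat \<Rightarrow>
    ('x, 'e, 'r) trivialization \<Rightarrow> 'x \<Rightarrow> complex^'r^'r" where
  "conn_matrix E nabla L p n \<tau> x =
     (\<chi> i j. snd \<tau> (nabla (vf_generator L p n) (\<lambda>y. frame E \<tau> y j) x) $ i)"

section \<open>Derivatives of matrix-valued functions of arrows\<close>

context Pi1_groupoid
begin

definition \<open>over U = src_pre G U \<inter> tgt_pre G U\<close>

lemma over_iff: "h \<in> over U \<longleftrightarrow> h \<in> points AG \<and> s h \<in> U \<and> t h \<in> U"
  by (auto simp: over_def src_pre_def tgt_pre_def)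

lemma openin_over: "openin TX U \<Longrightarrow> openin TG (over U)"
  unfolding over_def by (intro openin_Int openin_src_pre openin_tgt_pre)

lemma over_sub: "over U \<subseteq> tgt_pre G U"
  by (auto simp: over_def)

lemma over_iv: "h \<in> over U \<Longrightarrow> iv h \<in> over U"
  by (auto simp: over_iff gpd)

lemma mdiff_iv: "h \<in> points AG \<Longrightarrow> mdiff AG f (iv h) \<Longrightarrow> mdiff AG (\<lambda>h. f (iv h)) h"
  by (rule mdiff_holo_map[OF mG mG hinv])

definition theta_matrix where
  "theta_matrix \<xi> A g = (\<chi> i j. \<theta> \<xi> (\<lambda>h. A h $ i $ j) g)"

lemma theta_matrix_mult:
  fixes A :: "'g \<Rightarrow> complex^'n::finite^'m::finite" and B :: "'g \<Rightarrow> complex^'k::finite^'n"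
  assumes \<xi>: "vf_vanishing X D U \<xi>" and A: "\<And>h. h \<in> over U \<Longrightarrow> mdiff AG A h"
    and B: "\<And>h. h \<in> over U \<Longrightarrow> mdiff AG B h" and g: "g \<in> over U"
  shows "theta_matrix \<xi> (\<lambda>h. A h ** B h) g = theta_matrix \<xi> A g ** B g + A g ** theta_matrix \<xi> B g"
proof -
  note vf = theta_vf[OF \<xi>]
  have U: "openin TX U" using \<xi> by (simp add: vf_vanishing_def vector_field_def)
  note O = openin_over[OF U]
  have hA: "holo_fun AG (over U) (\<lambda>h. A h $ i $ k)" and hB: "holo_fun AG (over U) (\<lambda>h. B h $ k $ j)" for i k j
    using A[unfolded mdiff_matrix_iff[OF mG]] B[unfolded mdiff_matrix_iff[OF mG]] by (intro holo_funI[OF mG O]; blast)+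
  have "\<theta> \<xi> (\<lambda>h. \<Sum>k\<in>UNIV. A h $ i $ k * B h $ k $ j) g =
      (\<Sum>k\<in>UNIV. \<theta> \<xi> (\<lambda>h. A h $ i $ k) g * B g $ k $ j + A g $ i $ k * \<theta> \<xi> (\<lambda>h. B h $ k $ j) g)" for i j
    by (subst vf_sum[OF mG vf O over_sub g holo_fun_mult[OF mG hA hB]])
      (simp add: vf_times[OF mG vf hA hB over_sub g])
  then show ?thesis
    by (simp add: theta_matrix_def matrix_matrix_mult_def vec_eq_iff sum.distrib)
qed

lemma theta_matrix_cong:
  fixes A B :: "'g \<Rightarrow> complex^'n::finite^'m::finite"
  assumes \<xi>: "vf_vanishing X D U \<xi>" and A: "\<And>h. h \<in> over U \<Longrightarrow> mdiff AG A h"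
    and eq: "\<And>h. h \<in> over U \<Longrightarrow> A h = B h" and g: "g \<in> over U"
  shows "theta_matrix \<xi> A g = theta_matrix \<xi> B g"
proof -
  have U: "openin TX U" using \<xi> by (simp add: vf_vanishing_def vector_field_def)
  note O = openin_over[OF U]
  have B: "mdiff AG B h" if "h \<in> over U" for h
    by (rule mdiff_transform[OF mG A[OF that] O that]) (use eq in simp)
  have hA: "holo_fun AG (over U) (\<lambda>h. A h $ i $ k)" and hB: "holo_fun AG (over U) (\<lambda>h. B h $ i $ k)" for i k
    using A[unfolded mdiff_matrix_iff[OF mG]] B[unfolded mdiff_matrix_iff[OF mG]] by (intro holo_funI[OF mG O]; blast)+
  show ?thesis
    unfolding theta_matrix_def by (simp add: vec_eq_iff, intro allI vf_cong[OF mG theta_vf[OF \<xi>] hA hB over_sub g])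
      (use eq in simp)
qed

lemma theta_matrix_const:
  assumes \<xi>: "vf_vanishing X D U \<xi>" and g: "g \<in> over U"
  shows "theta_matrix \<xi> (\<lambda>_. A) g = 0"
proof -
  have U: "openin TX U" using \<xi> by (simp add: vf_vanishing_def vector_field_def)
  show ?thesis
    using vf_const[OF mG theta_vf[OF \<xi>] openin_over[OF U] over_sub g] by (simp add: theta_matrix_def vec_eq_iff)
qed

lemma theta_matrix_diff:
  fixes A B :: "'g \<Rightarrow> complex^'n::finite^'m::finite"
  assumes \<xi>: "vf_vanishing X D U \<xi>" and A: "\<And>h. h \<in> over U \<Longrightarrow> mdiff AG A h"
    and B: "\<And>h. h \<in> over U \<Longrightarrow> mdiff AG B h" and g: "g \<in> over U"
  shows "theta_matrix \<xi> (\<lambda>h. A h - B h) g = theta_matrix \<xi> A g - theta_matrix \<xi> B g"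
proof -
  have U: "openin TX U" using \<xi> by (simp add: vf_vanishing_def vector_field_def)
  note O = openin_over[OF U] and vf = theta_vf[OF \<xi>]
  have hA: "holo_fun AG (over U) (\<lambda>h. A h $ i $ k)" and hB: "holo_fun AG (over U) (\<lambda>h. B h $ i $ k)" for i k
    using A[unfolded mdiff_matrix_iff[OF mG]] B[unfolded mdiff_matrix_iff[OF mG]] by (intro holo_funI[OF mG O]; blast)+
  have hB': "holo_fun AG (over U) (\<lambda>h. - 1 * B h $ i $ k)" for i k
    by (rule holo_fun_mult[OF mG holo_fun_const[OF mG vf O] hB])
  have "\<theta> \<xi> (\<lambda>h. A h $ i $ k + - 1 * B h $ i $ k) g = \<theta> \<xi> (\<lambda>h. A h $ i $ k) g + - 1 * \<theta> \<xi> (\<lambda>h. B h $ i $ k) g" for i k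
    using vf_plus[OF mG vf hA hB' over_sub g] vf_cmult[OF mG vf hB over_sub g, of "-1"] by metis
  then show ?thesis by (simp add: theta_matrix_def vec_eq_iff)
qed

lemma theta_matrix_src:
  fixes P :: "'x \<Rightarrow> complex^'n::finite^'m::finite"
  assumes \<xi>: "vf_vanishing X D U \<xi>" and P: "\<And>x. x \<in> U \<Longrightarrow> mdiff X P x" and g: "g \<in> over U"
  shows "theta_matrix \<xi> (\<lambda>h. P (s h)) g = 0"
proof -
  have U: "openin TX U" using \<xi> by (simp add: vf_vanishing_def vector_field_def)
  have "holo_fun X U (\<lambda>x. P x $ i $ j)" for i j
    using P[unfolded mdiff_matrix_iff[OF mX]] by (intro holo_funI[OF mX U]) blast
  from theta_src[OF \<xi> this] g show ?thesis
    by (simp add: theta_matrix_def vec_eq_iff o_def over_def)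
qed

lemma theta_matrix_tgt:
  fixes P :: "'x \<Rightarrow> complex^'n::finite^'m::finite"
  assumes \<xi>: "vf_vanishing X D U \<xi>" and P: "\<And>x. x \<in> U \<Longrightarrow> mdiff X P x" and g: "g \<in> over U"
  shows "theta_matrix \<xi> (\<lambda>h. P (t h)) g = (\<chi> i j. \<xi> (\<lambda>x. P x $ i $ j) (t g))"
proof -
  have U: "openin TX U" using \<xi> by (simp add: vf_vanishing_def vector_field_def)
  have "holo_fun X U (\<lambda>x. P x $ i $ j)" for i j
    using P[unfolded mdiff_matrix_iff[OF mX]] by (intro holo_funI[OF mX U]) blast
  from theta_tgt[OF \<xi> this subset_refl] g show ?thesis
    by (simp add: theta_matrix_def vec_eq_iff o_def over_iff)
qed

context
  fixes E :: "('x, 'e, 'r::finite) vbundle" and nabla :: "('x, 'e) connection" and \<Psi> :: "'g \<Rightarrow> 'e \<Rightarrow> 'e"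
    and \<tau> :: "('x, 'e, 'r) trivialization" and p :: 'x and L :: "('x, complex) chart" and U :: "'x set"
  assumes arep: "algebroid_rep X D E nabla" and int: "integrates_connection X D G \<theta> E nabla \<Psi>"
    and \<tau>: "local_frame X E \<tau>" and c: "div_chart p L U" and U\<tau>: "U \<subseteq> fst \<tau>"
begin

lemma vbE: "vector_bundle X E" using arep by (simp add: algebroid_rep_def)

lemma repE: "groupoid_rep X G E \<Psi>" using int by (simp add: integrates_connection_def)

abbreviation (input) "\<xi> \<equiv> vf_generator L p (D p)"
abbreviation (input) "\<Phi> \<equiv> rep_matrix E \<Psi> \<tau> \<tau>"
abbreviation (input) "B \<equiv> conn_matrix E nabla L p (D p) \<tau>"

lemma generator_section: "holo_section X E U (nabla \<xi> (\<lambda>y. frame E \<tau> y j))"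
proof -
  have "holo_section X E U (\<lambda>y. frame E \<tau> y j)"
    by (rule holo_section_frame[OF mX vbE \<tau> div_chartD(2)[OF c] U\<tau>])
  moreover have "flat_connection X D E nabla" using arep by (simp add: algebroid_rep_def)
  ultimately show ?thesis
    using div_chartD(12)[OF c] unfolding flat_connection_def by blast
qed

lemma mdiff_conn_matrix: "x \<in> U \<Longrightarrow> mdiff X B x"
proof -
  assume x: "x \<in> U"
  have "mdiff X (\<lambda>y. snd \<tau> (nabla \<xi> (\<lambda>y. frame E \<tau> y j) y)) x" for j
    by (rule mdiff_section[OF mX vbE generator_section x \<tau>]) (use x U\<tau> in blast)
  then have "mdiff X (\<lambda>y. snd \<tau> (nabla \<xi> (\<lambda>y. frame E \<tau> y j) y) $ i) x" for i j
    using mdiff_vec_iff[OF mX, of "\<lambda>y. snd \<tau> (nabla \<xi> (\<lambda>y. frame E \<tau> y j) y)" x] by blast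
  then show ?thesis by (simp add: mdiff_matrix_iff[OF mX] conn_matrix_def)
qed

lemma mdiff_\<Phi>: "h \<in> over U \<Longrightarrow> mdiff AG \<Phi> h"
  by (rule mdiff_rep_matrix[OF vbE repE _ \<tau> _ \<tau>]) (use U\<tau> in \<open>auto simp: over_iff\<close>)

lemma mdiff_\<Phi>_iv: "h \<in> over U \<Longrightarrow> mdiff AG (\<lambda>h. \<Phi> (iv h)) h"
  by (rule mdiff_iv[OF _ mdiff_\<Phi>[OF over_iv]]) (auto simp: over_iff)

lemma \<Phi>_mult: "g \<in> over U \<Longrightarrow> h \<in> over U \<Longrightarrow> s g = t h \<Longrightarrow> \<Phi> (\<mu> g h) = \<Phi> g ** \<Phi> h"
  by (rule rep_matrix_mult[OF vbE repE _ _ _ \<tau> _ \<tau> _ \<tau>]) (use U\<tau> in \<open>auto simp: over_iff\<close>)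

lemma \<Phi>_one: "x \<in> U \<Longrightarrow> \<Phi> (one x) = mat 1"
  by (rule rep_matrix_one[OF vbE repE openin_points[OF div_chartD(2)[OF c]] \<tau>]) (use U\<tau> in auto)

lemma one_over: "x \<in> U \<Longrightarrow> one x \<in> over U"
  using openin_points[OF div_chartD(2)[OF c]] by (simp add: over_iff gpd)

lemma \<Phi>_iv:
  assumes "h \<in> over U"
  shows "\<Phi> h ** \<Phi> (iv h) = mat 1" "\<Phi> (iv h) ** \<Phi> h = mat 1"
proof -
  have h: "h \<in> points AG" "s h \<in> U" "t h \<in> U" using assms by (auto simp: over_iff)
  note i = gpd(11-15)[OF h(1)]
  show "\<Phi> h ** \<Phi> (iv h) = mat 1"
    using \<Phi>_mult[OF assms over_iv[OF assms] i(3)[symmetric]] \<Phi>_one[OF h(3)] i(5) by simp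
  show "\<Phi> (iv h) ** \<Phi> h = mat 1"
    using \<Phi>_mult[OF over_iv[OF assms] assms i(2)] \<Phi>_one[OF h(2)] i(4) by simp
qed

text \<open>\<open>integrates_connection\<close> is formulated in the distinguished trivializations.
  The matrix is therefore read in such a frame \<open>\<rho>\<close> at the source and then changed
  to \<open>\<tau>\<close>; the factor of change is a function of the source, so the vector field
  kills it.\<close>

lemma theta_\<Phi>_iv_one:
  assumes x: "x \<in> U"
  shows "theta_matrix \<xi> (\<lambda>h. \<Phi> (iv h)) (one x) = B x"
proof -
  note cD = div_chartD[OF c]
  note vf = theta_vf[OF cD(12)]
  have xp: "x \<in> points X" using openin_points[OF cD(2) x] .
  obtain \<rho> where \<rho>: "\<rho> \<in> trivs E" "x \<in> fst \<rho>" using trivs_cover[OF vbE xp] by blast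
  note l\<rho> = trivs_local_frame[OF vbE \<rho>(1)]
  note c\<rho> = local_frame_chart[OF l\<rho>] and c\<tau> = local_frame_chart[OF \<tau>]
  define W where "W = src_pre G (U \<inter> fst \<rho>) \<inter> tgt_pre G U"
  have oU: "openin TX (U \<inter> fst \<rho>)" by (rule openin_Int[OF cD(2) chart_open[OF c\<rho>]])
  have W: "openin TG W" unfolding W_def by (intro openin_Int openin_src_pre openin_tgt_pre oU cD(2))
  have Wsub: "W \<subseteq> tgt_pre G U" "W \<subseteq> over U" "W \<subseteq> src_pre G (U \<inter> fst \<rho>)" by (auto simp: W_def over_iff src_pre_def tgt_pre_def)
  have Wp: "h \<in> points AG" "s h \<in> U" "s h \<in> fst \<rho>" "s h \<in> fst \<tau>" "t h \<in> U" "t h \<in> fst \<tau>" if "h \<in> W" for h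
    using that U\<tau> by (auto simp: W_def src_pre_def tgt_pre_def)
  have xW: "one x \<in> W" using x xp \<rho> by (auto simp: W_def src_pre_def tgt_pre_def gpd)
  let ?M = "frame_matrix E \<rho> \<tau> id"
  \<comment> \<open>Column \<open>j\<close> is the \<open>\<rho>\<close>-component vector of
    \<open>\<Psi> (iv h)\<close> applied to the frame vector at \<open>t h\<close>, the function
    occurring in \<open>integrates_connection\<close> with a frame section for
    \<open>u\<close>.\<close>
  let ?H = "\<lambda>k j h. rep_matrix E \<Psi> \<tau> \<rho> (iv h) $ k $ j"
  have ivp: "iv h \<in> points AG" "s (iv h) = t h" "t (iv h) = s h" if "h \<in> W" for h
    using gpd(11-13)[OF Wp(1)[OF that]] by auto
  have hH: "holo_fun AG W (?H k j)" for k j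
  proof (rule holo_funI[OF mG W])
    fix h assume h: "h \<in> W"
    have "mdiff AG (rep_matrix E \<Psi> \<tau> \<rho>) (iv h)"
      by (rule mdiff_rep_matrix[OF vbE repE ivp(1)[OF h] \<tau> _ l\<rho>]) (use Wp[OF h] ivp[OF h] in simp_all)
    from mdiff_iv[OF Wp(1)[OF h] this] show "mdiff AG (?H k j) h"
      unfolding mdiff_matrix_iff[OF mG] by blast
  qed
  have hM: "holo_fun X (U \<inter> fst \<rho>) (\<lambda>x. ?M x $ i $ k)" for i k
  proof (rule holo_funI[OF mX oU])
    fix y assume "y \<in> U \<inter> fst \<rho>"
    then have "mdiff X ?M y" using U\<tau> by (intro mdiff_frame_change[OF mX vbE l\<rho> _ \<tau>]) auto
    then show "mdiff X (\<lambda>x. ?M x $ i $ k) y" unfolding mdiff_matrix_iff[OF mX] by blast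
  qed
  have hMs: "holo_fun AG W ((\<lambda>x. ?M x $ i $ k) \<circ> s)" for i k
    using holo_fun_subset[OF mG mdiff_tgt_pre_holo(2)[OF lie_groupoid_over_curve_axioms hM] W Wsub(3)] .
  have \<Phi>W: "holo_fun AG W (\<lambda>h. \<Phi> (iv h) $ i $ j)" for i j
    using mdiff_\<Phi>_iv[unfolded mdiff_matrix_iff[OF mG]] Wsub(2) by (intro holo_funI[OF mG W]) blast
  have eq: "\<Phi> (iv h) $ i $ j = (\<Sum>k\<in>UNIV. ((\<lambda>x. ?M x $ i $ k) \<circ> s) h * ?H k j h)" if h: "h \<in> W" for h i j
  proof -
    have "\<Phi> (iv h) = ?M (t (iv h)) ** rep_matrix E \<Psi> \<tau> \<rho> (iv h)"
      by (rule rep_matrix_change_tgt[OF vbE repE ivp(1)[OF h] \<tau> _ \<tau> _ l\<rho>]) (use Wp[OF h] ivp[OF h] in simp_all)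
    then show ?thesis by (simp add: matrix_matrix_mult_def ivp(3)[OF h])
  qed
  have hsum: "holo_fun AG W (\<lambda>h. ((\<lambda>x. ?M x $ i $ k) \<circ> s) h * ?H k j h)" for i j k
    by (rule holo_fun_mult[OF mG hMs hH])
  have hS: "holo_fun AG W (\<lambda>h. \<Sum>k\<in>UNIV. ((\<lambda>x. ?M x $ i $ k) \<circ> s) h * ?H k j h)" for i j
    by (rule holo_funI[OF mG W], rule mdiff_sum[OF mG openin_points[OF W]], assumption,
        rule holo_fun_mdiff[OF mG hsum])
  have "\<theta> \<xi> (\<lambda>h. \<Phi> (iv h) $ i $ j) (one x) = B x $ i $ j" for i j
  proof -
    have sec: "holo_section X E U (\<lambda>y. frame E \<tau> y j)"
      by (rule holo_section_frame[OF mX vbE \<tau> cD(2) U\<tau>])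
    let ?v = "nabla \<xi> (\<lambda>y. frame E \<tau> y j) x"
    have v: "?v \<in> fibre E x" using generator_section x by (auto simp: holo_section_def)
    have Hk: "\<theta> \<xi> (?H k j) (one x) = snd \<rho> ?v $ k" for k
    proof -
      have "\<theta> \<xi> (\<lambda>g. snd \<rho> (\<Psi> (iv g) (frame E \<tau> (t g) j)) $ k) (one x) = snd \<rho> ?v $ k"
        using int cD(12) sec \<rho> x unfolding integrates_connection_def by blast
      moreover have "\<theta> \<xi> (?H k j) (one x) = \<theta> \<xi> (\<lambda>g. snd \<rho> (\<Psi> (iv g) (frame E \<tau> (t g) j)) $ k) (one x)"
      proof (rule vf_cong[OF mG vf hH _ Wsub(1) xW])
        show e: "?H k j h = snd \<rho> (\<Psi> (iv h) (frame E \<tau> (t h) j)) $ k" if "h \<in> W" for h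
          using ivp(2)[OF that] by (simp add: rep_matrix_def[OF vbE repE] frame_matrix_def)
        show "holo_fun AG W (\<lambda>g. snd \<rho> (\<Psi> (iv g) (frame E \<tau> (t g) j)) $ k)"
        proof (rule holo_funI[OF mG W])
          fix h assume h: "h \<in> W"
          show "mdiff AG (\<lambda>g. snd \<rho> (\<Psi> (iv g) (frame E \<tau> (t g) j)) $ k) h"
            by (rule mdiff_transform[OF mG holo_fun_mdiff[OF mG hH[of k j] h] W h]) (simp add: e)
        qed
      qed
      ultimately show ?thesis by simp
    qed
    have "\<theta> \<xi> (\<lambda>h. \<Phi> (iv h) $ i $ j) (one x) = \<theta> \<xi> (\<lambda>h. \<Sum>k\<in>UNIV. ((\<lambda>x. ?M x $ i $ k) \<circ> s) h * ?H k j h) (one x)"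
      by (rule vf_cong[OF mG vf \<Phi>W hS Wsub(1) xW]) (rule eq)
    also have "\<dots> = (\<Sum>k\<in>UNIV. \<theta> \<xi> (\<lambda>h. ((\<lambda>x. ?M x $ i $ k) \<circ> s) h * ?H k j h) (one x))"
      by (rule vf_sum[OF mG vf W Wsub(1) xW hsum])
    also have "\<dots> = (\<Sum>k\<in>UNIV. ?M x $ i $ k * snd \<rho> ?v $ k)"
    proof (rule sum.cong[OF refl])
      fix k
      have z: "\<theta> \<xi> ((\<lambda>x. ?M x $ i $ k) \<circ> s) (one x) = 0"
        by (rule theta_src[OF cD(12) hM]) (use xW Wsub in auto)
      show "\<theta> \<xi> (\<lambda>h. ((\<lambda>x. ?M x $ i $ k) \<circ> s) h * ?H k j h) (one x) = ?M x $ i $ k * snd \<rho> ?v $ k"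
        unfolding vf_times[OF mG vf hMs hH Wsub(1) xW] z Hk by (simp add: gpd(4)[OF xp])
    qed
    also have "\<dots> = snd \<tau> ?v $ i"
      using frame_matrix_apply[OF c\<rho> \<rho>(2) c\<tau> _ fibre_linear_id v] U\<tau> x by (auto simp: matrix_vector_mult_def)
    finally show ?thesis by (simp add: conn_matrix_def)
  qed
  then show ?thesis by (simp add: theta_matrix_def vec_eq_iff)
qed

text \<open>Differentiate the product of \<open>\<Phi> h\<close> and \<open>\<Phi> (iv h)\<close>,
  which is constant, at a unit.\<close>

lemma theta_\<Phi>_one:
  assumes x: "x \<in> U"
  shows "theta_matrix \<xi> \<Phi> (one x) = - B x"
proof -
  note cD = div_chartD[OF c]
  note ox = one_over[OF x]
  have xp: "x \<in> points X" using openin_points[OF cD(2) x] .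
  have "iv (one x) = one x"
    using gpd(9)[OF gpd(11)[OF gpd(3)[OF xp]]] gpd(14)[OF gpd(3)[OF xp]] gpd(4,5)[OF xp] gpd(12)[OF gpd(3)[OF xp]] by simp
  then have o: "\<Phi> (one x) = mat 1" "\<Phi> (iv (one x)) = mat 1" using \<Phi>_one[OF x] by auto
  have "theta_matrix \<xi> (\<lambda>h. \<Phi> h ** \<Phi> (iv h)) (one x) = theta_matrix \<xi> (\<lambda>_. mat 1) (one x)"
    by (rule theta_matrix_cong[OF cD(12) _ _ ox])
      (use \<Phi>_iv mdiff_matrix_mult[OF mG mdiff_\<Phi> mdiff_\<Phi>_iv] in blast)+
  then have "theta_matrix \<xi> \<Phi> (one x) + theta_matrix \<xi> (\<lambda>h. \<Phi> (iv h)) (one x) = 0"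
    using theta_matrix_mult[OF cD(12) mdiff_\<Phi> mdiff_\<Phi>_iv ox] theta_matrix_const[OF cD(12) ox] o by simp
  then show ?thesis unfolding theta_\<Phi>_iv_one[OF x] by (rule eq_neg_iff_add_eq_0[THEN iffD2])
qed

text \<open>Right translation by \<open>g\<close> multiplies \<open>\<Phi>\<close> by the constant
  matrix \<open>\<Phi> g\<close>, so right invariance carries the equation at the unit of
  \<open>t g\<close> to \<open>g\<close>.\<close>

lemma theta_\<Phi>:
  assumes g: "g \<in> over U"
  shows "theta_matrix \<xi> \<Phi> g = - (B (t g) ** \<Phi> g)"
proof -
  note cD = div_chartD[OF c]
  note vf = theta_vf[OF cD(12)]
  note O = openin_over[OF cD(2)]
  have gp: "g \<in> points AG" "s g \<in> U" "t g \<in> U" using g by (auto simp: over_iff)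
  have tp: "t g \<in> points X" using gpd(2)[OF gp(1)] .
  note ot = one_over[OF gp(3)]
  have h\<Phi>: "holo_fun AG (over U) (\<lambda>h. \<Phi> h $ i $ j)" for i j
    using mdiff_\<Phi>[unfolded mdiff_matrix_iff[OF mG]] by (intro holo_funI[OF mG O]) blast
  have "theta_matrix \<xi> (\<lambda>h. \<Phi> h ** \<Phi> g) (one (t g)) = theta_matrix \<xi> \<Phi> g"
  proof -
    have "\<theta> \<xi> (\<lambda>h. (\<Phi> h ** \<Phi> g) $ i $ j) (one (t g)) = \<theta> \<xi> (\<lambda>h. \<Phi> h $ i $ j) (\<mu> (one (t g)) g)" for i j
    proof (rule theta_invariant[OF cD(12) ot gp(1) _ _ over_sub over_sub _ h\<Phi>])
      show "s (one (t g)) = t g" using gpd(4)[OF tp] .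
      show "\<mu> (one (t g)) g \<in> over U" using gpd(10)[OF gp(1)] g by simp
      have "mdiff AG (\<lambda>h. \<Phi> h ** \<Phi> g) h" if "h \<in> over U" for h
        by (rule mdiff_matrix_mult[OF mG mdiff_\<Phi>[OF that] mdiff_const[OF mG openin_points[OF O that]]])
      then show "holo_fun AG (over U) (\<lambda>h. (\<Phi> h ** \<Phi> g) $ i $ j)"
        unfolding mdiff_matrix_iff[OF mG] by (intro holo_funI[OF mG O]) blast
      show "\<mu> h' g \<in> over U \<and> (\<Phi> h' ** \<Phi> g) $ i $ j = \<Phi> (\<mu> h' g) $ i $ j" if "h' \<in> over U" "s h' = t g" for h'
        using \<Phi>_mult[OF that(1) g that(2)] that gp gpd(6-8)[OF _ gp(1) that(2)] by (simp add: over_iff)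
    qed
    then show ?thesis by (simp add: theta_matrix_def gpd(10)[OF gp(1)])
  qed
  moreover have "theta_matrix \<xi> (\<lambda>h. \<Phi> h ** \<Phi> g) (one (t g)) = theta_matrix \<xi> \<Phi> (one (t g)) ** \<Phi> g"
    using theta_matrix_mult[OF cD(12) mdiff_\<Phi> mdiff_const[OF mG openin_points[OF O]] ot, of "\<Phi> g"]
      theta_matrix_const[OF cD(12) ot, of "\<Phi> g"] by simp
  moreover have "- B (t g) ** \<Phi> g = - (B (t g) ** \<Phi> g)"
    by (simp add: matrix_matrix_mult_def vec_eq_iff sum_negf)
  ultimately show ?thesis using theta_\<Phi>_one[OF gp(3)] by simp
qed

lemma theta_\<Phi>_iv:
  assumes g: "g \<in> over U"
  shows "theta_matrix \<xi> (\<lambda>h. \<Phi> (iv h)) g = \<Phi> (iv g) ** B (t g)"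
proof -
  note cD = div_chartD[OF c]
  have "theta_matrix \<xi> (\<lambda>h. \<Phi> h ** \<Phi> (iv h)) g = theta_matrix \<xi> (\<lambda>_. mat 1) g"
    by (rule theta_matrix_cong[OF cD(12) _ _ g])
      (use \<Phi>_iv mdiff_matrix_mult[OF mG mdiff_\<Phi> mdiff_\<Phi>_iv] in blast)+
  then have "- (B (t g) ** \<Phi> g) ** \<Phi> (iv g) + \<Phi> g ** theta_matrix \<xi> (\<lambda>h. \<Phi> (iv h)) g = 0"
    using theta_matrix_mult[OF cD(12) mdiff_\<Phi> mdiff_\<Phi>_iv g] theta_matrix_const[OF cD(12) g] theta_\<Phi>[OF g] by simp
  moreover have "- (B (t g) ** \<Phi> g) ** \<Phi> (iv g) = - B (t g)"
  proof -
    have "- (B (t g) ** \<Phi> g) ** \<Phi> (iv g) = - (B (t g) ** \<Phi> g ** \<Phi> (iv g))"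
      by (simp add: matrix_matrix_mult_def vec_eq_iff sum_negf)
    then show ?thesis using \<Phi>_iv(1)[OF g] by (simp add: matrix_mul_assoc[symmetric])
  qed
  ultimately have "\<Phi> g ** theta_matrix \<xi> (\<lambda>h. \<Phi> (iv h)) g = B (t g)" by simp
  then have "\<Phi> (iv g) ** (\<Phi> g ** theta_matrix \<xi> (\<lambda>h. \<Phi> (iv h)) g) = \<Phi> (iv g) ** B (t g)" by simp
  then show ?thesis using \<Phi>_iv(2)[OF g] by (simp add: matrix_mul_assoc)
qed

end

end

section \<open>Comparison of two representations\<close>

lemma matrix_mult_diff_left: "(A - B) ** C = A ** C - B ** C"
  for A B :: "'a::ring_1^'n^'m" and C :: "'a^'k^'n"
  by (simp add: matrix_matrix_mult_def vec_eq_iff left_diff_distrib sum_subtractf)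

lemma matrix_mult_diff_right: "A ** (B - C) = A ** B - A ** C"
  for A :: "'a::ring_1^'n^'m" and B C :: "'a^'k^'n"
  by (simp add: matrix_matrix_mult_def vec_eq_iff right_diff_distrib sum_subtractf)

lemma matrix_mult_minus_right: "A ** (- B) = - (A ** B)"
  for A :: "'a::ring_1^'n^'m" and B :: "'a^'k^'n"
  by (simp add: matrix_matrix_mult_def vec_eq_iff sum_negf)

section \<open>Landau estimates for matrices\<close>

definition matrix_bigo ::
  "('a \<Rightarrow> complex^'n::finite^'m::finite) \<Rightarrow> 'a filter \<Rightarrow> ('a \<Rightarrow> complex) \<Rightarrow> bool" where
  "matrix_bigo A F w \<longleftrightarrow> (\<forall>i j. (\<lambda>h. A h $ i $ j) \<in> O[F](w))"

lemma matrix_bigo_mult: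
  fixes A :: "'a \<Rightarrow> complex^'n::finite^'m::finite" and B :: "'a \<Rightarrow> complex^'k::finite^'n"
    and w v :: "'a \<Rightarrow> complex"
  assumes "matrix_bigo A F w" "matrix_bigo B F v"
  shows "matrix_bigo (\<lambda>h. A h ** B h) F (\<lambda>h. w h * v h)"
  unfolding matrix_bigo_def matrix_matrix_mult_def vec_lambda_beta
  using assms unfolding matrix_bigo_def
  by (intro allI big_sum_in_bigo landau_o.big.mult) auto

lemma matrix_bigo_mult1:
  fixes A :: "'a \<Rightarrow> complex^'n::finite^'m::finite" and B :: "'a \<Rightarrow> complex^'k::finite^'n"
    and w v :: "'a \<Rightarrow> complex"
  assumes "matrix_bigo A F (\<lambda>_. 1 :: complex)" "matrix_bigo B F v"
  shows "matrix_bigo (\<lambda>h. A h ** B h) F v"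
  using matrix_bigo_mult[OF assms] by simp

lemma matrix_bigo_mult2:
  fixes A :: "'a \<Rightarrow> complex^'n::finite^'m::finite" and B :: "'a \<Rightarrow> complex^'k::finite^'n"
    and w v :: "'a \<Rightarrow> complex"
  assumes "matrix_bigo A F w" "matrix_bigo B F (\<lambda>_. 1 :: complex)"
  shows "matrix_bigo (\<lambda>h. A h ** B h) F w"
  using matrix_bigo_mult[OF assms] by simp

lemma matrix_bigo_add:
  fixes A B :: "'a \<Rightarrow> complex^'n::finite^'m::finite"
  shows "matrix_bigo A F w \<Longrightarrow> matrix_bigo B F w \<Longrightarrow> matrix_bigo (\<lambda>h. A h + B h) F w"
  by (simp add: matrix_bigo_def sum_in_bigo)

lemma matrix_bigo_diff:
  fixes A B :: "'a \<Rightarrow> complex^'n::finite^'m::finite"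
  shows "matrix_bigo A F w \<Longrightarrow> matrix_bigo B F w \<Longrightarrow> matrix_bigo (\<lambda>h. A h - B h) F w"
  by (simp add: matrix_bigo_def sum_in_bigo)

lemma matrix_bigo_compose:
  fixes A :: "'a \<Rightarrow> complex^'n::finite^'m::finite"
  shows "matrix_bigo A F w \<Longrightarrow> filterlim f F F' \<Longrightarrow> matrix_bigo (\<lambda>h. A (f h)) F' (\<lambda>h. w (f h))"
  unfolding matrix_bigo_def
proof (intro allI)
  fix i j
  assume "\<forall>i j. (\<lambda>h. A h $ i $ j) \<in> O[F](w)" "filterlim f F F'"
  then show "(\<lambda>h. A (f h) $ i $ j) \<in> O[F'](\<lambda>h. w (f h))"
    using landau_o.big.compose[of "\<lambda>h. A h $ i $ j" F w f F'] by blast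
qed

lemma matrix_bigo_trans:
  fixes w v :: "'a \<Rightarrow> complex" and A :: "'a \<Rightarrow> complex^'n::finite^'m::finite"
  shows "matrix_bigo A F w \<Longrightarrow> w \<in> O[F](v) \<Longrightarrow> matrix_bigo A F v"
  unfolding matrix_bigo_def by (blast intro: landau_o.big_trans)

lemma matrix_bigo_cong:
  fixes A B :: "'a \<Rightarrow> complex^'n::finite^'m::finite"
  assumes "matrix_bigo A F w" "\<forall>\<^sub>F h in F. A h = B h"
  shows "matrix_bigo B F w"
  unfolding matrix_bigo_def
proof (intro allI)
  fix i j
  have "\<forall>\<^sub>F h in F. A h $ i $ j = B h $ i $ j" using assms(2) by eventually_elim simp
  from landau_o.big.in_cong[OF this] assms(1)[unfolded matrix_bigo_def, rule_format, of i j]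
  show "(\<lambda>h. B h $ i $ j) \<in> O[F](w)" by (rule iffD1)
qed

lemma mdiff_bigo_1:
  assumes "complex_manifold M" "mdiff M f x"
  shows "f \<in> O[nhdsin (mtop M) x](\<lambda>_. 1 :: complex)"
  using mdiff_tendsto[OF assms] by (intro bigoI_tendsto[of _ _ "f x"]) auto

lemma mdiff_matrix_bigo_1:
  assumes "complex_manifold M" "mdiff M A x"
  shows "matrix_bigo A (nhdsin (mtop M) x) (\<lambda>_. 1 :: complex)"
  unfolding matrix_bigo_def using assms mdiff_bigo_1[OF assms(1)] mdiff_matrix_iff[OF assms(1)] by blast

section \<open>Sources and targets near a source fibre over the divisor\<close>

context Pi1_groupoid
begin

lemma div_chart_support: "div_chart p L U \<Longrightarrow> p \<in> div_support X D"
  using div_chartD[of p L U] by (auto simp: div_support_def)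

text \<open>On the source fibre of \<open>p\<close> the target is \<open>p\<close>, so in a source
  chart the recentred target coordinate vanishes where the source coordinate does. The mean value
  inequality in the first variable gives the bound.\<close>

lemma tgt_bigo_src:
  assumes c: "div_chart p L U" and g: "g \<in> points AG" "s g = p"
  shows "(\<lambda>h. snd L (t h) - snd L p) \<in> O[nhdsin TG g](\<lambda>h. snd L (s h) - snd L p)"
proof -
  note cD = div_chartD[OF c]
  note sup = div_chart_support[OF c]
  have tg: "t g = p" using src_eq_iff_tgt_eq[OF sup g(1)] g(2) by simp
  have gW: "g \<in> tgt_pre G U" using g tg cD by (simp add: tgt_pre_def)
  have sL: "s g \<in> fst L" using g cD by simp
  obtain K r where K: "coordinate AG K" "g \<in> fst K" "fst K \<subseteq> tgt_pre G U" "r > 0"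
      "\<forall>h\<in>fst K. s h \<in> fst L \<and> fst (snd K h) = snd L (s h)"
      "snd K ` fst K = ball (snd L (s g)) r \<times> ball (snd (snd K g)) r"
    using source_chart[OF g(1) cD(1) sL openin_tgt_pre[OF cD(2)] gW] .
  note tK = coordinate_top_chart[OF K(1)]
  note fp = fibre_point[OF cD(1,2,4) K cD(1)]
  define b where "b = snd (snd K g)"
  define u where "u = (\<lambda>h. snd L (t h)) \<circ> chart_inv K"
  let ?B = "ball (snd L p) r \<times> ball b r"
  have box: "snd K ` fst K = ?B" using K(6) g by (simp add: b_def)
  have ho: "holo_on u ?B"
    unfolding holo_on_iff_cdiff u_def box[symmetric]
    using tgt_cdiff[OF cD(1,2,4) K cD(1)] by blast
  define \<rho> where "\<rho> = r / 2"
  have \<rho>: "\<rho> > 0" "cball (snd L p) \<rho> \<times> cball b \<rho> \<subseteq> ?B"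
    using K(4) by (auto simp: \<rho>_def)
  have oB: "open ?B" by (intro open_Times) auto
  have "continuous_on (cball (snd L p) \<rho> \<times> cball b \<rho>) (D1 u)"
    by (rule continuous_on_subset[OF holo_on_2_continuous_D(1)[OF oB ho] \<rho>(2)])
  then have "compact (D1 u ` (cball (snd L p) \<rho> \<times> cball b \<rho>))"
    by (intro compact_continuous_image compact_Times compact_cball)
  then obtain C where C: "\<And>z. z \<in> cball (snd L p) \<rho> \<times> cball b \<rho> \<Longrightarrow> norm (D1 u z) \<le> C"
    using compact_imp_bounded[THEN bounded_normE] by (metis imageI)
  define V where "V = fst K \<inter> snd K -` (ball (snd L p) \<rho> \<times> ball b \<rho>)"
  have V: "openin TG V" unfolding V_def by (rule top_chart_vimage[OF tK]) (auto intro: open_Times)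
  have gV: "g \<in> V" using K(2,5) g \<rho>(1) by (auto simp: V_def b_def mem_Times_iff)
  have bd: "norm (snd L (t h) - snd L p) \<le> C * norm (snd L (s h) - snd L p)" if h: "h \<in> V" for h
  proof -
    define w d where "w = fst (snd K h)" and "d = snd (snd K h)"
    have wd: "snd K h = (w, d)" "w \<in> ball (snd L p) \<rho>" "d \<in> ball b \<rho>" "w = snd L (s h)"
      using h K(5) by (auto simp: w_def d_def V_def)
    have hK: "h \<in> fst K" using h by (simp add: V_def)
    have "norm (u (w, d) - u (snd L p, d)) \<le> C * norm (w - snd L p)"
    proof (rule field_differentiable_bound[of "ball (snd L p) \<rho>" _ "\<lambda>w. D1 u (w, d)"])
      fix w' assume w': "w' \<in> ball (snd L p) \<rho>"
      then have m: "(w', d) \<in> cball (snd L p) \<rho> \<times> cball b \<rho>" using wd by auto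
      then have "cdiff u (w', d)" using ho \<rho>(2) unfolding holo_on_iff_cdiff by blast
      then show "((\<lambda>w. u (w, d)) has_field_derivative D1 u (w', d)) (at w' within ball (snd L p) \<rho>)"
        by (rule has_field_derivative_at_within[OF cdiff_DERIV1])
      show "norm (D1 u (w', d)) \<le> C" by (rule C[OF m])
    qed (use wd \<rho> in auto)
    moreover have "u (w, d) = snd L (t h)" using chart_inv_apply[OF tK hK] wd by (simp add: u_def)
    \<comment> \<open>The base point of the mean value inequality lies on the source fibre of
      \<open>p\<close>, whose arrows all end at \<open>p\<close>.\<close>
    moreover have "u (snd L p, d) = snd L p"
    proof -
      have d: "d \<in> ball (snd (snd K g)) r" using wd(3) \<rho>(2) K(4) by (auto simp: b_def \<rho>_def)
      from fp[OF d] have f: "chart_inv K (snd L p, d) \<in> fst K" "s (chart_inv K (snd L p, d)) = p"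
        using g by simp_all
      have "t (chart_inv K (snd L p, d)) = p"
        using src_eq_iff_tgt_eq[OF sup coordinate_points[OF K(1) f(1)]] f(2) by simp
      then show ?thesis by (simp add: u_def)
    qed
    ultimately show ?thesis using wd(4) by simp
  qed
  show ?thesis
    by (rule bigoI[of _ C]) (rule eventually_nhdsin_openin[OF V gV bd])
qed

text \<open>The section keeps the second coordinate of a source chart constant. It serves to factor
  the arrows near a product.\<close>

lemma src_section:
  assumes c: "div_chart p L U" and g: "g \<in> points AG" "s g = p"
  obtains \<sigma> where "filterlim \<sigma> (nhdsin TG g) (nhdsin TX p)"
    "\<forall>\<^sub>F x in nhdsin TX p. s (\<sigma> x) = x \<and> \<sigma> x \<in> points AG"
proof -
  note cD = div_chartD[OF c]
  have sL: "s g \<in> fst L" using g cD by simp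
  have gT: "openin TG (topspace TG)" "g \<in> topspace TG" using g by (auto simp: points_def)
  obtain K r where K: "coordinate AG K" "g \<in> fst K" "fst K \<subseteq> topspace TG" "r > 0"
      "\<forall>h\<in>fst K. s h \<in> fst L \<and> fst (snd K h) = snd L (s h)"
      "snd K ` fst K = ball (snd L (s g)) r \<times> ball (snd (snd K g)) r"
    using source_chart[OF g(1) cD(1) sL gT] .
  note tK = coordinate_top_chart[OF K(1)] and tL = coordinate_top_chart[OF cD(1)]
  define b where "b = snd (snd K g)"
  have Kg: "snd K g = (snd L p, b)" using K(2,5) g by (simp add: b_def prod_eq_iff)
  define \<sigma> where "\<sigma> = (\<lambda>x. chart_inv K (snd L x, b))"
  have l: "((\<lambda>x. (snd L x, b)) \<longlongrightarrow> snd K g) (nhdsin TX p)"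
    unfolding Kg by (intro tendsto_Pair filterlim_chart[OF tL cD(7)] tendsto_const)
  have "filterlim \<sigma> (nhdsin TG g) (nhdsin TX p)"
    unfolding \<sigma>_def by (rule filterlim_compose[OF filterlim_chart_inv[OF tK K(2)] l])
  moreover have "\<forall>\<^sub>F x in nhdsin TX p. s (\<sigma> x) = x \<and> \<sigma> x \<in> points AG"
  proof -
    have op: "open (snd K ` fst K)" using top_chart_image[OF tK top_chart_openin[OF tK]] by simp
    have "\<forall>\<^sub>F x in nhdsin TX p. (snd L x, b) \<in> snd K ` fst K"
      using topological_tendstoD[OF l op] K(2) by blast
    moreover have "\<forall>\<^sub>F x in nhdsin TX p. x \<in> fst L"
      using eventually_nhdsin_openin[OF top_chart_openin[OF tL] cD(7)] .
    ultimately show ?thesis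
    proof eventually_elim
      case (elim x)
      then obtain h where h: "h \<in> fst K" "snd K h = (snd L x, b)" by force
      have e: "\<sigma> x = h" using chart_inv_apply[OF tK h(1)] h(2) by (simp add: \<sigma>_def)
      have "snd L (s h) = snd L x" "s h \<in> fst L" using K(5) h by auto
      then have "s h = x" using elim(2) top_chart_inj[OF tL] by (meson inj_onD)
      then show ?case using e coordinate_points[OF K(1) h(1)] by simp
    qed
  qed
  ultimately show ?thesis by (rule that)
qed

end

lemma bigo_bound:
  assumes "f \<in> O[F](g)"
  shows "\<exists>C. \<forall>\<^sub>F x in F. norm (f x) \<le> C * norm (g x)"
  using assms by (auto elim!: landau_o.bigE)

text \<open>\<open>P\<close> stands for the truncated isomorphism, of which only the order of the
  error is retained. \<open>D p\<close> orders get lost on the way to the defect; \<open>N\<close>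
  exceeds this so that a positive order remains.\<close>

locale approximate_intertwiner = Pi1_groupoid X G D \<theta>
  for X :: "('x, complex) cmanifold" and G :: "('x, 'g) groupoid" and D :: "'x \<Rightarrow> nat" and \<theta> :: "'x vf \<Rightarrow> 'g vf" +
  fixes E1 :: "('x, 'e, 'r::finite) vbundle" and nabla1 :: "('x, 'e) connection" and \<Psi>1 :: "'g \<Rightarrow> 'e \<Rightarrow> 'e"
    and E2 :: "('x, 'f, 'q::finite) vbundle" and nabla2 :: "('x, 'f) connection" and \<Psi>2 :: "'g \<Rightarrow> 'f \<Rightarrow> 'f"
    and \<tau> :: "('x, 'e, 'r) trivialization" and \<sigma> :: "('x, 'f, 'q) trivialization"
    and p :: 'x and L :: "('x, complex) chart" and U :: "'x set" and P :: "'x \<Rightarrow> complex^'r^'q" and N :: nat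
  assumes arep1: "algebroid_rep X D E1 nabla1" and int1: "integrates_connection X D G \<theta> E1 nabla1 \<Psi>1"
    and arep2: "algebroid_rep X D E2 nabla2" and int2: "integrates_connection X D G \<theta> E2 nabla2 \<Psi>2"
    and \<tau>: "local_frame X E1 \<tau>" and \<sigma>: "local_frame X E2 \<sigma>" and c: "div_chart p L U"
    and U\<tau>: "U \<subseteq> fst \<tau>" and U\<sigma>: "U \<subseteq> fst \<sigma>" and P: "\<And>x. x \<in> U \<Longrightarrow> mdiff X P x" and N: "D p < N"
    and residual: "matrix_bigo (\<lambda>x. P x ** conn_matrix E1 nabla1 L p (D p) \<tau> x
        - (\<chi> i j. vf_generator L p (D p) (\<lambda>x. P x $ i $ j) x)
        - conn_matrix E2 nabla2 L p (D p) \<sigma> x ** P x) (nhdsin (mtop X) p) (\<lambda>x. (snd L x - snd L p) ^ N)"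
begin

abbreviation "\<Phi>1 \<equiv> rep_matrix E1 \<Psi>1 \<tau> \<tau>"
abbreviation "\<Phi>2 \<equiv> rep_matrix E2 \<Psi>2 \<sigma> \<sigma>"
abbreviation "B1 \<equiv> conn_matrix E1 nabla1 L p (D p) \<tau>"
abbreviation "B2 \<equiv> conn_matrix E2 nabla2 L p (D p) \<sigma>"
abbreviation "gen \<equiv> vf_generator L p (D p)"
abbreviation "zs h \<equiv> snd L (s h) - snd L p"
abbreviation "zt h \<equiv> snd L (t h) - snd L p"

definition "residual x = P x ** B1 x - (\<chi> i j. gen (\<lambda>x. P x $ i $ j) x) - B2 x ** P x"
definition "defect h = P (t h) ** \<Phi>1 h - \<Phi>2 h ** P (s h)"
text \<open>Carrying everything back to the source makes this, along a source fibre, a curve in a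
  fixed space of matrices that starts at zero at the unit. Its derivative involves the residual
  alone.\<close>

definition "transported h = \<Phi>2 (iv h) ** (P (t h) ** \<Phi>1 h) - P (s h)"

lemmas cD = div_chartD[OF c]
lemmas frame1 = arep1 int1 \<tau> c U\<tau>
lemmas frame2 = arep2 int2 \<sigma> c U\<sigma>
lemmas sup = div_chart_support[OF c]
lemmas O = openin_over[OF cD(2)]

lemma fibre_over:
  assumes "g \<in> points AG" "s g = p"
  shows "t g = p" "g \<in> over U"
  using src_eq_iff_tgt_eq[OF sup assms(1)] assms cD(3) by (auto simp: over_iff)

lemma mdiff_Pt: "h \<in> over U \<Longrightarrow> mdiff AG (\<lambda>h. P (t h)) h"
  and mdiff_Ps: "h \<in> over U \<Longrightarrow> mdiff AG (\<lambda>h. P (s h)) h"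
  by (auto simp: over_iff intro!: mdiff_t mdiff_s P)

lemmas mdiff_\<Phi>1 = mdiff_\<Phi>[OF frame1] and mdiff_\<Phi>2 = mdiff_\<Phi>[OF frame2]
  and mdiff_\<Phi>2_iv = mdiff_\<Phi>_iv[OF frame2]

lemma mdiff_P\<Phi>: "h \<in> over U \<Longrightarrow> mdiff AG (\<lambda>h. P (t h) ** \<Phi>1 h) h"
  by (rule mdiff_matrix_mult[OF mG mdiff_Pt mdiff_\<Phi>1])

lemma mdiff_\<Phi>P\<Phi>: "h \<in> over U \<Longrightarrow> mdiff AG (\<lambda>h. \<Phi>2 (iv h) ** (P (t h) ** \<Phi>1 h)) h"
  by (rule mdiff_matrix_mult[OF mG mdiff_\<Phi>2_iv mdiff_P\<Phi>])

lemma mdiff_matrix_diff: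
  fixes A B :: "'a \<Rightarrow> complex^'n::finite^'m::finite"
  assumes "complex_manifold M" "mdiff M A x" "mdiff M B x"
  shows "mdiff M (\<lambda>y. A y - B y) x"
  using assms mdiff_diff[OF assms(1)] unfolding mdiff_matrix_iff[OF assms(1)] by simp

lemma mdiff_transported: "h \<in> over U \<Longrightarrow> mdiff AG transported h"
  unfolding transported_def[abs_def]
  by (rule mdiff_matrix_diff[OF mG mdiff_\<Phi>P\<Phi> mdiff_Ps])

text \<open>The two transport equations and the derivative of \<open>P\<close> along the generator
  combine to the residual at the target; the last term of \<open>transported\<close> is constant
  along source fibres.\<close>

lemma theta_transported:
  assumes g: "g \<in> over U"
  shows "theta_matrix gen transported g = - (\<Phi>2 (iv g) ** (residual (t g) ** \<Phi>1 g))"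
proof -
  note x = cD(12)
  have "theta_matrix gen transported g =
      (\<Phi>2 (iv g) ** B2 (t g)) ** (P (t g) ** \<Phi>1 g) +
      \<Phi>2 (iv g) ** ((\<chi> i j. gen (\<lambda>x. P x $ i $ j) (t g)) ** \<Phi>1 g + P (t g) ** (- (B1 (t g) ** \<Phi>1 g))) - 0"
    unfolding transported_def[abs_def]
    by (simp only: theta_matrix_diff[OF x mdiff_\<Phi>P\<Phi> mdiff_Ps g] theta_matrix_mult[OF x mdiff_\<Phi>2_iv mdiff_P\<Phi> g]
        theta_matrix_mult[OF x mdiff_Pt mdiff_\<Phi>1 g] theta_\<Phi>[OF frame1 g] theta_\<Phi>_iv[OF frame2 g]
        theta_matrix_tgt[OF x P g] theta_matrix_src[OF x P g])
  then show ?thesis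
    by (simp add: residual_def matrix_mult_diff_left matrix_mult_diff_right matrix_mult_minus_right
        matrix_mul_assoc matrix_add_ldistrib)
qed

lemma transported_one: "x \<in> U \<Longrightarrow> transported (one x) = 0"
proof -
  assume x: "x \<in> U"
  have xp: "x \<in> points X" using openin_points[OF cD(2) x] .
  have "\<Phi>2 (one x) ** \<Phi>2 (iv (one x)) = mat 1" using \<Phi>_iv[OF frame2 one_over[OF frame2 x]] by simp
  then have "\<Phi>2 (iv (one x)) = mat 1" using \<Phi>_one[OF frame2 x] by simp
  then show ?thesis using \<Phi>_one[OF frame1 x] gpd(4,5)[OF xp] by (simp add: transported_def)
qed

lemma defect_eq:
  assumes "h \<in> over U"
  shows "defect h = \<Phi>2 h ** transported h"
  using \<Phi>_iv(1)[OF frame2 assms]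
  by (simp add: defect_def transported_def matrix_mult_diff_right matrix_mul_assoc)

text \<open>Permits cancelling \<open>zt h ^ D p\<close> off the source fibre of
  \<open>p\<close>.\<close>

lemma zt_nonzero:
  assumes "h \<in> over U" "zs h \<noteq> 0"
  shows "zt h \<noteq> 0"
proof
  assume "zt h = 0"
  then have "snd L (t h) = snd L p" by simp
  moreover have "t h \<in> fst L" using assms(1) cD(4) by (auto simp: over_iff)
  ultimately have "t h = p" using cD(7) top_chart_inj[OF coordinate_top_chart[OF cD(1)]] by (meson inj_onD)
  then have "s h = p" using src_eq_iff_tgt_eq[OF sup] assms(1) by (auto simp: over_iff)
  then show False using assms(2) by simp
qed

lemma theta_transported_bigo:
  "matrix_bigo (\<lambda>h. theta_matrix gen transported h) (nhdsin TG (one p)) (\<lambda>h. zt h ^ N)"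
proof -
  have op: "one p \<in> over U" using one_over[OF frame1 cD(3)] .
  have "filterlim t (nhdsin TX (t (one p))) (nhdsin TG (one p))"
    using continuous_map_filterlim_nhdsin[OF ct] cD(9) by (simp add: points_def)
  then have lt: "filterlim t (nhdsin TX p) (nhdsin TG (one p))" by (simp add: cD)
  have r: "matrix_bigo (\<lambda>h. residual (t h)) (nhdsin TG (one p)) (\<lambda>h. zt h ^ N)"
    using matrix_bigo_compose[OF residual lt] by (simp add: residual_def)
  have b: "matrix_bigo (\<lambda>h. \<Phi>2 (iv h) ** (residual (t h) ** \<Phi>1 h)) (nhdsin TG (one p)) (\<lambda>h. zt h ^ N)"
    by (rule matrix_bigo_mult1[OF mdiff_matrix_bigo_1[OF mG mdiff_\<Phi>2_iv[OF op]]
          matrix_bigo_mult2[OF r mdiff_matrix_bigo_1[OF mG mdiff_\<Phi>1[OF op]]]])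
  have z: "matrix_bigo (\<lambda>h. 0 :: complex^'r^'q) (nhdsin TG (one p)) (\<lambda>h. zt h ^ N)"
    by (simp add: matrix_bigo_def)
  have ev: "\<forall>\<^sub>F h in nhdsin TG (one p). 0 - (\<Phi>2 (iv h) ** (residual (t h) ** \<Phi>1 h)) = theta_matrix gen transported h"
    by (rule eventually_nhdsin_openin[OF O op]) (simp add: theta_transported)
  show ?thesis by (rule matrix_bigo_cong[OF matrix_bigo_diff[OF z b] ev])
qed

text \<open>In a chart \<open>(z \<circ> s, b)\<close> the vector field \<open>\<theta> gen\<close> is a multiple of the derivative in \<open>b\<close>, and it maps
  \<open>z \<circ> t\<close> to \<open>zt ^ D p\<close>; eliminating the unknown factor bounds the derivative in \<open>b\<close> of \<open>transported\<close>
  off the fibre of \<open>p\<close>, hence everywhere by continuity.\<close>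

lemma transported_bigo_one:
  "matrix_bigo transported (nhdsin TG (one p)) (\<lambda>h. zs h ^ (N - D p))"
  unfolding matrix_bigo_def
proof (intro allI)
  fix i j
  define e where "e = (\<lambda>h. transported h $ i $ j)"
  define M where "M = N - D p"
  have M: "M > 0" using N by (simp add: M_def)
  have op: "one p \<in> over U" using one_over[OF frame1 cD(3)] .
  have opT: "one p \<in> tgt_pre G U" using op over_sub by blast
  have sL: "s (one p) \<in> fst L" using cD by simp
  obtain K r0 where K: "coordinate AG K" "one p \<in> fst K" "fst K \<subseteq> over U" "r0 > 0"
      "\<forall>h\<in>fst K. s h \<in> fst L \<and> fst (snd K h) = snd L (s h)"
      "snd K ` fst K = ball (snd L (s (one p))) r0 \<times> ball (snd (snd K (one p))) r0"
    using source_chart[OF cD(9) cD(1) sL O op] .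
  note tK = coordinate_top_chart[OF K(1)]
  have KU: "fst K \<subseteq> tgt_pre G U" using K(3) over_sub by blast
  let ?e = "e \<circ> chart_inv K" and ?t = "(snd L \<circ> t) \<circ> chart_inv K"
  have he: "holo_fun AG (over U) e"
    unfolding e_def using mdiff_transported[unfolded mdiff_matrix_iff[OF mG]] by (intro holo_funI[OF mG O]) blast
  have ht: "holo_fun AG (tgt_pre G U) (snd L \<circ> t)"
    by (rule mdiff_tgt_pre_holo(1)[OF lie_groupoid_over_curve_axioms cD(13)])
  \<comment> \<open>The unknown coefficient of the field occurs once in its value on
    \<open>transported\<close> and once in its value on the target coordinate, which is
    \<open>zt h ^ D p\<close>. Cross-multiplication removes it.\<close>
  have key: "zt h ^ D p * D2 ?e (snd K h) = D2 ?t (snd K h) * theta_matrix gen transported h $ i $ j" if h: "h \<in> fst K" for h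
  proof -
    have hO: "h \<in> over U" "h \<in> tgt_pre G U" "h \<in> points AG" "t h \<in> U" using h K(3) over_sub by (auto simp: over_iff)
    let ?\<beta> = "\<theta> gen (\<lambda>y. snd (snd K y)) h"
    have 1: "\<theta> gen e h = ?\<beta> * D2 ?e (snd K h)"
      by (rule theta_in_source_chart[OF cD(12,1) K(1,5) he over_sub hO(1) h])
    have 2: "\<theta> gen (snd L \<circ> t) h = ?\<beta> * D2 ?t (snd K h)"
      by (rule theta_in_source_chart[OF cD(12,1) K(1,5) ht subset_refl hO(2) h])
    have 3: "\<theta> gen (snd L \<circ> t) h = zt h ^ D p"
      using theta_tgt[OF cD(12,13) subset_refl hO(3,4)] generator_coordinate[OF c hO(4)] by simp
    have "theta_matrix gen transported h $ i $ j = \<theta> gen e h" by (simp add: theta_matrix_def e_def)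
    then show ?thesis using 1 2 3 by (simp add: algebra_simps)
  qed
  obtain C1 where C1: "\<forall>\<^sub>F h in nhdsin TG (one p). norm (theta_matrix gen transported h $ i $ j) \<le> C1 * norm (zt h ^ N)"
    using bigo_bound[OF theta_transported_bigo[unfolded matrix_bigo_def, rule_format, of i j]] by (elim exE)
  obtain C2 where C2: "\<forall>\<^sub>F h in nhdsin TG (one p). norm (zt h) \<le> C2 * norm (zs h)"
    using bigo_bound[OF tgt_bigo_src[OF c cD(9,10)]] by (elim exE)
  have "mdiff AG (\<lambda>h. D2 ?t (snd K h)) (one p)"
  proof (rule mdiff_chart_inv_compose[OF mG K(1,2)])
    have o: "open (snd K ` (fst K \<inter> tgt_pre G U))" by (rule top_chart_image[OF tK openin_tgt_pre[OF cD(2)]])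
    show "cdiff (D2 ?t) (snd K (one p))"
      by (rule D2_cdiff[OF o holo_fun_coordinate[OF mG K(1) ht]]) (use K(2) KU in blast)
  qed
  from bigo_bound[OF mdiff_bigo_1[OF mG this]] obtain C3 where C3: "\<forall>\<^sub>F h in nhdsin TG (one p). norm (D2 ?t (snd K h)) \<le> C3 * norm (1::complex)"
    by (elim exE)
  \<comment> \<open>\<open>C1\<close> bounds the derivative along the field by
    \<open>zt h ^ N\<close>, \<open>C3\<close> bounds the derivative of the target coordinate, and
    \<open>C2\<close> passes from target to source in the remaining \<open>M\<close> factors. Landau
    constants need not be nonnegative, hence the absolute values.\<close>
  define C where "C = \<bar>C3\<bar> * (\<bar>C1\<bar> * \<bar>C2\<bar> ^ M)"
  have "\<forall>\<^sub>F h in nhdsin TG (one p). h \<in> fst K"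
    by (rule eventually_nhdsin_openin[OF top_chart_openin[OF tK] K(2)])
  with C1 C2 C3 have "\<forall>\<^sub>F h in nhdsin TG (one p). h \<in> fst K \<and> (zs h \<noteq> 0 \<longrightarrow> norm (D2 ?e (snd K h)) \<le> C * norm (zs h) ^ M)"
  proof eventually_elim
    case (elim h)
    show ?case
    proof (intro conjI impI elim(4))
      assume z: "zs h \<noteq> 0"
      have hO: "h \<in> over U" using elim(4) K(3) by blast
      have zt: "zt h \<noteq> 0" by (rule zt_nonzero[OF hO z])
      have NM: "N = D p + M" using N by (simp add: M_def)
      have "norm (zt h) ^ D p * norm (D2 ?e (snd K h)) = norm (D2 ?t (snd K h)) * norm (theta_matrix gen transported h $ i $ j)"
        using arg_cong[OF key[OF elim(4)], of norm] by (simp add: norm_mult norm_power)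
      also have "\<dots> \<le> \<bar>C3\<bar> * (\<bar>C1\<bar> * norm (zt h) ^ N)"
      proof (intro mult_mono)
        show "norm (D2 ?t (snd K h)) \<le> \<bar>C3\<bar>" using elim(3) by simp
        show "norm (theta_matrix gen transported h $ i $ j) \<le> \<bar>C1\<bar> * norm (zt h) ^ N"
          using elim(1) by (simp add: norm_power) (meson abs_ge_self mult_right_mono norm_ge_zero order_trans zero_le_power)
      qed auto
      also have "\<dots> = norm (zt h) ^ D p * (\<bar>C3\<bar> * (\<bar>C1\<bar> * norm (zt h) ^ M))"
        by (simp add: NM power_add mult_ac)
      finally have "norm (D2 ?e (snd K h)) \<le> \<bar>C3\<bar> * (\<bar>C1\<bar> * norm (zt h) ^ M)"
        using zt by (simp add: mult_le_cancel_left_pos)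
      also have "norm (zt h) ^ M \<le> (\<bar>C2\<bar> * norm (zs h)) ^ M"
        by (rule power_mono[OF order_trans[OF elim(2) mult_right_mono[OF abs_ge_self norm_ge_zero]] norm_ge_zero])
      then have "\<bar>C3\<bar> * (\<bar>C1\<bar> * norm (zt h) ^ M) \<le> \<bar>C3\<bar> * (\<bar>C1\<bar> * (\<bar>C2\<bar> * norm (zs h)) ^ M)"
        by (intro mult_left_mono) auto
      finally show "norm (D2 ?e (snd K h)) \<le> C * norm (zs h) ^ M"
        by (simp add: C_def power_mult_distrib mult_ac)
    qed
  qed
  then obtain V where V: "openin TG V" "one p \<in> V" and
    Vb: "\<And>h. h \<in> V \<Longrightarrow> h \<in> fst K \<and> (zs h \<noteq> 0 \<longrightarrow> norm (D2 ?e (snd K h)) \<le> C * norm (zs h) ^ M)"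
    using cD(9) by (auto simp: eventually_nhdsin points_def)
  obtain r Q where r: "r > 0" "coordinate AG (Q, snd K)" "one p \<in> Q" "Q \<subseteq> fst K \<inter> V"
    "snd K ` Q = ball (fst (snd K (one p))) r \<times> ball (snd (snd K (one p))) r"
    using coordinate_box[OF mG K(1) V(1) K(2) V(2)] .
  define w0 b0 where "w0 = snd L p" and "b0 = snd (snd K (one p))"
  have K0: "snd K (one p) = (w0, b0)" using K(2,5) cD by (simp add: w0_def b0_def prod_eq_iff)
  have box: "snd K ` Q = ball w0 r \<times> ball b0 r" using r(5) K0 by simp
  have oQ: "openin TG Q" using top_chart_openin[OF coordinate_top_chart[OF r(2)]] by simp
  have inQ: "\<exists>h\<in>Q. snd K h = (w, b) \<and> zs h = w - w0" if wb: "w \<in> ball w0 r" "b \<in> ball b0 r" for w b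
  proof -
    have "(w, b) \<in> snd K ` Q" unfolding box using wb by simp
    then obtain h where h: "h \<in> Q" "snd K h = (w, b)" by force
    then have "h \<in> fst K" using r(4) by blast
    then have "snd L (s h) = w" using bspec[OF K(5)] h(2) by (metis fst_conv)
    then show ?thesis using h by (intro bexI[of _ h]) (auto simp: w0_def)
  qed
  have oe: "open (snd K ` (fst K \<inter> over U))" by (rule top_chart_image[OF tK O])
  note hoe = holo_fun_coordinate[OF mG K(1) he]
  have Qsub: "snd K ` Q \<subseteq> snd K ` (fst K \<inter> over U)" using r(4) K(3) by blast
  have b1: "norm (D2 ?e (w, b)) \<le> C * norm (w - w0) ^ M" if wb: "w \<in> ball w0 r" "b \<in> ball b0 r" "w \<noteq> w0" for w b
  proof -
    obtain h where h: "h \<in> Q" "snd K h = (w, b)" "zs h = w - w0" using inQ[OF wb(1,2)] by blast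
    then show ?thesis using Vb[of h] r(4) wb(3) by auto
  qed
  have b2: "norm (D2 ?e (w, b)) \<le> C * norm (w - w0) ^ M" if wb: "w \<in> ball w0 r" "b \<in> ball b0 r" for w b
  proof (cases "w = w0")
    case True
    have mem: "(w0, b) \<in> snd K ` (fst K \<inter> over U)" using wb r(1) box Qsub True by blast
    have "cdiff (D2 ?e) (w0, b)" by (rule D2_cdiff[OF oe hoe mem])
    then have "isCont (\<lambda>w. D2 ?e (w, b)) w0"
      using cdiff_slice1 field_differentiable_imp_continuous_at by blast
    then have l1: "((\<lambda>w. norm (D2 ?e (w, b))) \<longlongrightarrow> norm (D2 ?e (w0, b))) (at w0)"
      unfolding isCont_def by (rule tendsto_norm)
    have l2: "((\<lambda>w. C * norm (w - w0) ^ M) \<longlongrightarrow> C * norm (w0 - w0) ^ M) (at w0)"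
      by (intro tendsto_intros)
    have ev: "\<forall>\<^sub>F w in at w0. norm (D2 ?e (w, b)) \<le> C * norm (w - w0) ^ M"
      unfolding eventually_at using r(1) b1[OF _ wb(2)] by (intro exI[of _ r]) (auto simp: dist_commute)
    show ?thesis unfolding True by (rule tendsto_le[OF _ l2 l1 ev]) simp
  qed (use b1[OF wb] in simp)
  have eK: "?e (snd K h) = e h" if "h \<in> fst K" for h using chart_inv_apply[OF tK that] by simp
  \<comment> \<open>\<open>h\<close> is joined to the unit \<open>one (s h)\<close>, which has the
    same first coordinate and where \<open>transported\<close> is zero, by a segment in the second
    coordinate. For \<open>h\<close> near \<open>one p\<close> both ends lie in the box, and the
    length of the segment is at most \<open>2 * r\<close>.\<close>
  have "filterlim s (nhdsin TX p) (nhdsin TG (one p))"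
    using continuous_map_filterlim_nhdsin[OF cs, of "one p"] cD(9,10) by (simp add: points_def)
  moreover have "filterlim one (nhdsin TG (one p)) (nhdsin TX p)"
    using continuous_map_filterlim_nhdsin[OF cone, of p] cD(8) by (simp add: points_def)
  ultimately have l: "filterlim (\<lambda>h. one (s h)) (nhdsin TG (one p)) (nhdsin TG (one p))"
    using filterlim_compose by blast
  have "\<forall>\<^sub>F h in nhdsin TG (one p). one (s h) \<in> Q" by (rule eventually_filterlim_nhdsin[OF l oQ r(3)])
  moreover have "\<forall>\<^sub>F h in nhdsin TG (one p). h \<in> Q" by (rule eventually_nhdsin_openin[OF oQ r(3)])
  ultimately have "\<forall>\<^sub>F h in nhdsin TG (one p). norm (e h) \<le> (C * (2 * r)) * norm (zs h ^ M)"
  proof eventually_elim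
    case (elim h)
    have hK: "h \<in> fst K" "one (s h) \<in> fst K" using elim r(4) by auto
    have sU: "s h \<in> U" "s h \<in> points X" using hK(1) K(3) gpd(1) by (auto simp: over_iff)
    define w b \<beta> where "w = snd L (s h)" and "b = snd (snd K h)" and "\<beta> = snd (snd K (one (s h)))"
    have k1: "snd K h = (w, b)" "snd K (one (s h)) = (w, \<beta>)"
      using K(5) hK gpd(4)[OF sU(2)] by (auto simp: w_def b_def \<beta>_def prod_eq_iff)
    have "snd K h \<in> ball w0 r \<times> ball b0 r" "snd K (one (s h)) \<in> ball w0 r \<times> ball b0 r"
      using box elim by blast+
    then have wb: "w \<in> ball w0 r" "b \<in> ball b0 r" "\<beta> \<in> ball b0 r" unfolding k1 by auto
    have n1: "norm (?e (w, b) - ?e (w, \<beta>)) \<le> (C * norm (w - w0) ^ M) * norm (b - \<beta>)"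
    proof (rule field_differentiable_bound[of "ball b0 r" _ "\<lambda>b. D2 ?e (w, b)"])
      fix b' assume b': "b' \<in> ball b0 r"
      then have "(w, b') \<in> snd K ` (fst K \<inter> over U)" using wb(1) box Qsub by blast
      then have "cdiff ?e (w, b')" using hoe unfolding holo_on_iff_cdiff by blast
      then show "((\<lambda>b. ?e (w, b)) has_field_derivative D2 ?e (w, b')) (at b' within ball b0 r)"
        by (rule has_field_derivative_at_within[OF cdiff_DERIV2])
      show "norm (D2 ?e (w, b')) \<le> C * norm (w - w0) ^ M" by (rule b2[OF wb(1) b'])
    qed (use wb in auto)
    have n2: "?e (w, \<beta>) = 0"
      using eK[OF hK(2)] transported_one[OF sU(1)] by (simp add: k1 e_def)
    have n3: "?e (w, b) = e h" using eK[OF hK(1)] by (simp add: k1)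
    have n4: "norm (b - \<beta>) \<le> 2 * r"
    proof -
      have "dist b \<beta> \<le> dist b0 b + dist b0 \<beta>" by (metis dist_commute dist_triangle)
      then show ?thesis using wb by (simp add: dist_norm)
    qed
    have "0 \<le> C * norm (w - w0) ^ M" by (simp add: C_def)
    from order_trans[OF n1 mult_left_mono[OF n4 this]]
    have "norm (e h) \<le> (C * norm (w - w0) ^ M) * (2 * r)" unfolding n2 n3 by simp
    then show ?case by (simp add: w_def w0_def norm_power mult_ac)
  qed
  then show "(\<lambda>h. transported h $ i $ j) \<in> O[nhdsin TG (one p)](\<lambda>h. zs h ^ (N - D p))"
    unfolding e_def M_def by (rule bigoI)
qed

abbreviation "small g \<equiv> matrix_bigo defect (nhdsin TG g) (\<lambda>h. zs h ^ (N - D p))"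

lemma small_one: "small (one p)"
proof -
  have op: "one p \<in> over U" using one_over[OF frame1 cD(3)] .
  have "matrix_bigo (\<lambda>h. \<Phi>2 h ** transported h) (nhdsin TG (one p)) (\<lambda>h. zs h ^ (N - D p))"
    by (rule matrix_bigo_mult1[OF mdiff_matrix_bigo_1[OF mG mdiff_\<Phi>2[OF op]] transported_bigo_one])
  then show ?thesis
    by (rule matrix_bigo_cong) (rule eventually_nhdsin_openin[OF O op], simp add: defect_eq)
qed

text \<open>With \<open>\<kappa>\<close> a section of the source map through \<open>k\<close>, every \<open>h\<close> near \<open>g k\<close> is a product \<open>\<gamma> \<kappa>\<close> with \<open>\<gamma>\<close>
  near \<open>g\<close> and \<open>\<kappa>\<close> near \<open>k\<close>, and the defect is a cocycle:
  \<open>defect (\<gamma> \<kappa>) = defect \<gamma> ** \<Phi>1 \<kappa> + \<Phi>2 \<gamma> ** defect \<kappa>\<close>.\<close>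

lemma small_mult:
  assumes g: "g \<in> points AG" "s g = p" and k: "k \<in> points AG" "s k = p" and sg: "small g" and sk: "small k"
  shows "small (\<mu> g k)"
proof -
  have tg: "t g = p" "g \<in> over U" and tk: "t k = p" "k \<in> over U" using fibre_over g k by auto
  have gk: "s g = t k" using g tk by simp
  define m where "m = \<mu> g k"
  have m: "m \<in> points AG" "s m = p" "t m = p" using gpd(6-8)[OF g(1) k(1) gk] k tg by (auto simp: m_def)
  let ?F = "nhdsin TG m"
  have "m \<in> topspace TG" using m by (simp add: points_def)
  from continuous_map_filterlim_nhdsin[OF cs this] have ls: "filterlim s (nhdsin TX p) ?F" by (simp add: m)
  obtain \<sigma>' where \<sigma>': "filterlim \<sigma>' (nhdsin TG k) (nhdsin TX p)"
    "\<forall>\<^sub>F x in nhdsin TX p. s (\<sigma>' x) = x \<and> \<sigma>' x \<in> points AG"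
    using src_section[OF c k] .
  define \<kappa> where "\<kappa> = (\<lambda>h. \<sigma>' (s h))"
  have l\<kappa>: "filterlim \<kappa> (nhdsin TG k) ?F"
    unfolding \<kappa>_def by (rule filterlim_compose[OF \<sigma>'(1) ls])
  have e\<kappa>: "\<forall>\<^sub>F h in ?F. s (\<kappa> h) = s h \<and> \<kappa> h \<in> points AG"
    unfolding \<kappa>_def using filterlim_iff[THEN iffD1, OF ls, rule_format, OF \<sigma>'(2)] .
  define \<gamma> where "\<gamma> = (\<lambda>h. \<mu> h (iv (\<kappa> h)))"
  have "filterlim \<gamma> (nhdsin TG (\<mu> m (iv k))) ?F"
    unfolding \<gamma>_def
  proof (rule filterlim_cmp)
    show "m \<in> points AG" "iv k \<in> points AG" "s m = t (iv k)" using m k gpd by auto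
    show "filterlim (\<lambda>h. h) ?F ?F" by (rule filterlim_ident)
    show "filterlim (\<lambda>h. iv (\<kappa> h)) (nhdsin TG (iv k)) ?F"
      by (rule filterlim_compose[OF continuous_map_filterlim_nhdsin[OF cinv] l\<kappa>]) (use k in \<open>simp add: points_def\<close>)
    show "\<forall>\<^sub>F h in ?F. s h = t (iv (\<kappa> h))"
      using e\<kappa> by eventually_elim (simp add: gpd)
  qed
  moreover have "\<mu> m (iv k) = g" unfolding m_def by (rule right_translation_cancel[OF g(1) k(1) gk])
  ultimately have l\<gamma>: "filterlim \<gamma> (nhdsin TG g) ?F" by simp
  have e\<kappa>O: "\<forall>\<^sub>F h in ?F. \<kappa> h \<in> over U" by (rule eventually_filterlim_nhdsin[OF l\<kappa> O tk(2)])
  have e\<gamma>O: "\<forall>\<^sub>F h in ?F. \<gamma> h \<in> over U" by (rule eventually_filterlim_nhdsin[OF l\<gamma> O tg(2)])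
  have em: "\<forall>\<^sub>F h in ?F. h \<in> points AG"
    by (rule eventually_nhdsin_openin[of _ "topspace TG"]) (use m in \<open>auto simp: points_def\<close>)
  have fact: "\<forall>\<^sub>F h in ?F. s (\<gamma> h) = t (\<kappa> h) \<and> \<mu> (\<gamma> h) (\<kappa> h) = h \<and> s (\<kappa> h) = s h"
    using e\<kappa> em
  proof eventually_elim
    case (elim h)
    then have \<kappa>h: "\<kappa> h \<in> points AG" and e: "s (\<kappa> h) = s h" by auto
    note i = gpd(11-15)[OF \<kappa>h]
    have he: "s h = t (iv (\<kappa> h))" using i e by simp
    have "\<mu> (\<gamma> h) (\<kappa> h) = \<mu> h (\<mu> (iv (\<kappa> h)) (\<kappa> h))"
      unfolding \<gamma>_def by (rule gpd_assoc[OF elim(2) i(1) \<kappa>h he i(2)])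
    also have "\<dots> = h" using i(4) e gpd(9)[OF elim(2)] by simp
    finally show ?case using gpd(7)[OF elim(2) i(1) he] i(2) e by (simp add: \<gamma>_def)
  qed
  have split: "\<forall>\<^sub>F h in ?F. defect (\<gamma> h) ** \<Phi>1 (\<kappa> h) + \<Phi>2 (\<gamma> h) ** defect (\<kappa> h) = defect h"
    using fact e\<kappa>O e\<gamma>O
  proof eventually_elim
    case (elim h)
    then have st: "s (\<gamma> h) = t (\<kappa> h)" and mu: "\<mu> (\<gamma> h) (\<kappa> h) = h" and ss: "s (\<kappa> h) = s h" by auto
    have tt: "t h = t (\<gamma> h)"
      using gpd(8)[of "\<gamma> h" "\<kappa> h"] elim st mu by (simp add: over_iff)
    have "\<Phi>1 h = \<Phi>1 (\<gamma> h) ** \<Phi>1 (\<kappa> h)" "\<Phi>2 h = \<Phi>2 (\<gamma> h) ** \<Phi>2 (\<kappa> h)"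
      using \<Phi>_mult[OF frame1 elim(3,2) st] \<Phi>_mult[OF frame2 elim(3,2) st] mu by auto
    then show ?case
      by (simp add: defect_def tt st ss[symmetric] matrix_mult_diff_left matrix_mult_diff_right matrix_mul_assoc)
  qed
  \<comment> \<open>The source of \<open>\<gamma> h\<close> is the target of
    \<open>\<kappa> h\<close>, and targets are bounded by sources; the source of
    \<open>\<kappa> h\<close> is that of \<open>h\<close>.\<close>
  have zz: "(\<lambda>h. zs (\<gamma> h)) \<in> O[?F](zs)"
  proof -
    have e1: "\<forall>\<^sub>F h in ?F. zt (\<kappa> h) = zs (\<gamma> h)" and e2: "\<forall>\<^sub>F h in ?F. zs (\<kappa> h) = zs h"
      using fact by (eventually_elim, simp)+
    have "(\<lambda>h. zt (\<kappa> h)) \<in> O[?F](\<lambda>h. zs (\<kappa> h))"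
      by (rule landau_o.big.compose[OF tgt_bigo_src[OF c k] l\<kappa>])
    then show ?thesis
      unfolding landau_o.big.cong[OF e2] by (rule landau_o.big.in_cong[OF e1, THEN iffD1])
  qed
  have s1: "matrix_bigo (\<lambda>h. defect (\<gamma> h)) ?F (\<lambda>h. zs h ^ (N - D p))"
    by (rule matrix_bigo_trans[OF matrix_bigo_compose[OF sg l\<gamma>] landau_o.big_power[OF zz]])
  have s2: "matrix_bigo (\<lambda>h. defect (\<kappa> h)) ?F (\<lambda>h. zs h ^ (N - D p))"
  proof (rule matrix_bigo_trans[OF matrix_bigo_compose[OF sk l\<kappa>] landau_o.big_power])
    have "\<forall>\<^sub>F h in ?F. zs (\<kappa> h) = zs h" using fact by eventually_elim simp
    then show "(\<lambda>h. zs (\<kappa> h)) \<in> O[?F](zs)" by (rule landau_o.big.in_cong[THEN iffD2]) simp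
  qed
  have p1: "matrix_bigo (\<lambda>h. \<Phi>1 (\<kappa> h)) ?F (\<lambda>_. 1)"
    using matrix_bigo_compose[OF mdiff_matrix_bigo_1[OF mG mdiff_\<Phi>1[OF tk(2)]] l\<kappa>] .
  have p2: "matrix_bigo (\<lambda>h. \<Phi>2 (\<gamma> h)) ?F (\<lambda>_. 1)"
    using matrix_bigo_compose[OF mdiff_matrix_bigo_1[OF mG mdiff_\<Phi>2[OF tg(2)]] l\<gamma>] .
  show ?thesis
    unfolding m_def[symmetric]
    by (rule matrix_bigo_cong[OF matrix_bigo_add[OF matrix_bigo_mult2[OF s1 p1] matrix_bigo_mult1[OF p2 s2]] split])
qed

text \<open>The weight does not involve \<open>g\<close>, so a bound valid on an open set around
  \<open>g\<close> gives the estimate at each of its points.\<close>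

lemma small_near:
  assumes g: "g \<in> points AG" and sm: "small g"
  shows "\<forall>\<^sub>F h in nhdsin TG g. small h"
proof -
  have *: "\<exists>C. \<forall>\<^sub>F h in nhdsin TG g. norm (defect h $ i $ j) \<le> C * norm (zs h ^ (N - D p))" for i j
    by (rule bigo_bound[OF sm[unfolded matrix_bigo_def, rule_format, of i j]])
  \<comment> \<open>One constant per entry, chosen in advance, lets the finitely many bounds hold on
    a common neighbourhood.\<close>
  define C where "C i j = (SOME C. \<forall>\<^sub>F h in nhdsin TG g. norm (defect h $ i $ j) \<le> C * norm (zs h ^ (N - D p)))" for i j
  have "\<forall>\<^sub>F h in nhdsin TG g. norm (defect h $ i $ j) \<le> C i j * norm (zs h ^ (N - D p))" for i j
    unfolding C_def by (rule someI_ex) (rule *)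
  then have "\<forall>\<^sub>F h in nhdsin TG g. \<forall>i j. norm (defect h $ i $ j) \<le> C i j * norm (zs h ^ (N - D p))"
    by (intro eventually_all_finite)
  then obtain V where V: "openin TG V" "g \<in> V" "\<And>h. h \<in> V \<Longrightarrow> \<forall>i j. norm (defect h $ i $ j) \<le> C i j * norm (zs h ^ (N - D p))"
    using g unfolding eventually_nhdsin points_def by blast
  have sV: "small h" if "h \<in> V" for h
    unfolding matrix_bigo_def
  proof (intro allI)
    fix i j
    show "(\<lambda>h. defect h $ i $ j) \<in> O[nhdsin TG h](\<lambda>h. zs h ^ (N - D p))"
      by (rule bigoI[of _ "C i j"]) (rule eventually_nhdsin_openin[OF V(1) that], use V(3) in blast)
  qed
  show ?thesis by (rule eventually_nhdsin_openin[OF V(1,2) sV])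
qed

text \<open>For \<open>h\<close> near \<open>g\<close> in the fibre, \<open>h\<close> is
  \<open>k\<close> composed with \<open>g\<close>, where \<open>k\<close> is close to the unit. The
  estimate holds at \<open>k\<close> and at its inverse by \<open>small_near\<close>, so
  \<open>small_mult\<close> transfers it from \<open>g\<close> to \<open>h\<close> and back.\<close>

lemma defect_small:
  assumes g: "g \<in> points AG" "s g = p"
  shows "small g"
proof (rule fibre_connected_induct[where Q=small, OF cD(8) small_one _ g])
  fix g assume g: "g \<in> points AG" "s g = p"
  have tg: "t g = p" using fibre_over g by auto
  have ivg: "iv g \<in> points AG" "t (iv g) = p" "\<mu> g (iv g) = one p" "s (iv g) = p"
    using gpd(11-15)[OF g(1)] tg g by auto
  have l1: "filterlim (\<lambda>h. \<mu> h (iv g)) (nhdsin TG (one p)) (inf (nhdsin TG g) (principal {h. s h = p}))"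
    using filterlim_right_translation[OF g(1) ivg(1)] g ivg by simp
  have ivp: "iv (one p) = one p"
    using gpd(9)[OF gpd(11)[OF cD(9)]] gpd(14)[OF cD(9)] cD(10,11) gpd(12)[OF cD(9)] by simp
  have "one p \<in> topspace TG" using cD(9) by (simp add: points_def)
  from continuous_map_filterlim_nhdsin[OF cinv this]
  have li: "filterlim iv (nhdsin TG (one p)) (nhdsin TG (one p))" by (simp add: ivp)
  have n1: "\<forall>\<^sub>F k in nhdsin TG (one p). small k" by (rule small_near[OF cD(9) small_one])
  have n2: "\<forall>\<^sub>F k in nhdsin TG (one p). small (iv k)"
    using filterlim_iff[THEN iffD1, OF li, rule_format, OF n1] .
  have "\<forall>\<^sub>F h in inf (nhdsin TG g) (principal {h. s h = p}). small (\<mu> h (iv g)) \<and> small (iv (\<mu> h (iv g)))"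
    using filterlim_iff[THEN iffD1, OF l1, rule_format, OF eventually_conj[OF n1 n2]] .
  then have "\<forall>\<^sub>F h in nhdsin TG g. s h = p \<longrightarrow> small (\<mu> h (iv g)) \<and> small (iv (\<mu> h (iv g)))"
    by (simp add: eventually_inf_principal)
  moreover have "\<forall>\<^sub>F h in nhdsin TG g. h \<in> points AG"
    by (rule eventually_nhdsin_openin[of _ "topspace TG"]) (use g in \<open>auto simp: points_def\<close>)
  ultimately show "\<forall>\<^sub>F h in nhdsin TG g. s h = p \<longrightarrow> small h = small g"
  proof eventually_elim
    case (elim h)
    show ?case
    proof
      assume sh: "s h = p"
      define k where "k = \<mu> h (iv g)"
      have sk: "small k" "small (iv k)" using elim sh by (auto simp: k_def)
      have he: "s h = t (iv g)" using sh ivg by simp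
      have k: "k \<in> points AG" "s k = p" using gpd(6,7)[OF elim(2) ivg(1) he] ivg by (auto simp: k_def)
      have ik: "iv k \<in> points AG" "s (iv k) = p" using gpd(11,12)[OF k(1)] fibre_over[OF k] by auto
      have "\<mu> k g = \<mu> h (\<mu> (iv g) g)"
        unfolding k_def by (rule gpd_assoc[OF elim(2) ivg(1) g(1) he]) (use gpd(12)[OF g(1)] in simp)
      also have "\<dots> = h" using gpd(14)[OF g(1)] gpd(9)[OF elim(2)] g sh by simp
      finally have kg: "\<mu> k g = h" .
      have kt: "s k = t g" using k tg by simp
      have "\<mu> (iv k) h = \<mu> (\<mu> (iv k) k) g"
        unfolding kg[symmetric] by (rule gpd_assoc[symmetric, OF ik(1) k(1) g(1) _ kt]) (use gpd(12)[OF k(1)] in simp)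
      also have "\<dots> = g" using gpd(14)[OF k(1)] gpd(10)[OF g(1)] k tg by simp
      finally have gk: "\<mu> (iv k) h = g" .
      show "small h = small g"
        using small_mult[OF k g sk(1)] small_mult[OF ik elim(2) sh sk(2)] unfolding kg gk by blast
    qed
  qed
qed

end

section \<open>Expansions in one variable\<close>

definition fps_ord_ge :: "nat \<Rightarrow> 'a::comm_ring_1 fps \<Rightarrow> bool" where
  "fps_ord_ge N F \<longleftrightarrow> (\<forall>k<N. fps_nth F k = 0)"

lemma fps_ord_ge_add: "fps_ord_ge N F \<Longrightarrow> fps_ord_ge N G \<Longrightarrow> fps_ord_ge N (F + G)"
  and fps_ord_ge_diff: "fps_ord_ge N F \<Longrightarrow> fps_ord_ge N G \<Longrightarrow> fps_ord_ge N (F - G)"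
  and fps_ord_ge_sum: "(\<And>i. i \<in> A \<Longrightarrow> fps_ord_ge N (H i)) \<Longrightarrow> fps_ord_ge N (sum H A)"
  by (simp_all add: fps_ord_ge_def fps_sum_nth)

lemma fps_ord_ge_mult_left: "fps_ord_ge N F \<Longrightarrow> fps_ord_ge N (G * F)"
  by (auto simp: fps_ord_ge_def fps_mult_nth intro!: sum.neutral)

lemma fps_ord_ge_mult_right: "fps_ord_ge N F \<Longrightarrow> fps_ord_ge N (F * G)"
  using fps_ord_ge_mult_left[of N F G] by (simp add: mult.commute)

text \<open>A truncated formal series as a genuine function near \<open>p\<close>, on which vector
  fields can act.\<close>

definition pol :: "('x, complex) chart \<Rightarrow> 'x \<Rightarrow> nat \<Rightarrow> complex fps \<Rightarrow> 'x \<Rightarrow> complex" where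
  "pol L p N a x = (\<Sum>k<N. fps_nth a k * (snd L x - snd L p) ^ k)"

context Pi1_groupoid
begin

context
  fixes L :: "('x, complex) chart" and p :: 'x and U :: "'x set"
  assumes L: "coordinate X L" and U: "openin TX U" "U \<subseteq> fst L" and p: "p \<in> U"
begin

lemma chart_analytic:
  assumes "holo_fun X U f"
  shows "(f \<circ> chart_inv L) analytic_on {snd L p}"
proof -
  note tL = coordinate_top_chart[OF L]
  have o: "open (snd L ` U)" using top_chart_image[OF tL U(1)] U(2) by (simp add: Int_absorb1)
  have cd: "(f \<circ> chart_inv L) field_differentiable at (snd L x)" if "x \<in> U" for x
    using holo_fun_mdiff[OF mX assms that] mdiff_coordinate[OF mX L, of x f] subsetD[OF U(2) that]
    by (simp add: cdiff_complex_iff)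
  have "(f \<circ> chart_inv L) holomorphic_on snd L ` U"
    unfolding holomorphic_on_def using cd field_differentiable_at_within by blast
  then show ?thesis using o p analytic_at by blast
qed

lemma expand_has:
  assumes "holo_fun X U f"
  shows "(\<lambda>w. f (chart_inv L (snd L p + w))) has_fps_expansion expand L p f"
  using analytic_at_imp_has_fps_expansion[OF chart_analytic[OF assms]] by (simp add: expand_def)

lemma expand_unique:
  assumes "holo_fun X U f" "(\<lambda>w. f (chart_inv L (snd L p + w))) has_fps_expansion F"
  shows "expand L p f = F"
  using fps_expansion_unique_complex[OF expand_has[OF assms(1)] assms(2)] .

lemma expand_mult: "holo_fun X U f \<Longrightarrow> holo_fun X U g \<Longrightarrow> expand L p (\<lambda>x. f x * g x) = expand L p f * expand L p g"
  by (rule expand_unique[OF holo_fun_mult[OF mX]]) (auto intro: has_fps_expansion_mult expand_has)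

lemma holo_fun_diff': "holo_fun X U f \<Longrightarrow> holo_fun X U g \<Longrightarrow> holo_fun X U (\<lambda>x. f x - g x)"
  for f :: "'x \<Rightarrow> complex"
  using mdiff_diff[OF mX] by (simp add: holo_fun_iff[OF mX])

lemma expand_diff: "holo_fun X U f \<Longrightarrow> holo_fun X U g \<Longrightarrow> expand L p (\<lambda>x. f x - g x) = expand L p f - expand L p g"
  by (rule expand_unique[OF holo_fun_diff']) (auto intro: has_fps_expansion_diff expand_has)

lemma holo_fun_sum': "(\<And>i. i \<in> A \<Longrightarrow> holo_fun X U (f i)) \<Longrightarrow> holo_fun X U (\<lambda>x. \<Sum>i\<in>A. f i x)"
  for f :: "'i \<Rightarrow> 'x \<Rightarrow> complex"
proof -
  assume f: "\<And>i. i \<in> A \<Longrightarrow> holo_fun X U (f i)"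
  show ?thesis
    by (rule holo_funI[OF mX U(1)]) (rule mdiff_sum[OF mX openin_points[OF U(1)]], assumption, rule holo_fun_mdiff[OF mX f])
qed

lemma expand_sum:
  "(\<And>i. i \<in> A \<Longrightarrow> holo_fun X U (f i)) \<Longrightarrow> expand L p (\<lambda>x. \<Sum>i\<in>A. f i x) = (\<Sum>i\<in>A. expand L p (f i))"
  for f :: "'i \<Rightarrow> 'x \<Rightarrow> complex"
  by (rule expand_unique[OF holo_fun_sum' has_fps_expansion_sum]) (auto intro: expand_has)

lemma eventually_chart_near: "\<forall>\<^sub>F w in nhds 0. chart_inv L (snd L p + w) \<in> U \<and> snd L (chart_inv L (snd L p + w)) = snd L p + w"
proof -
  note tL = coordinate_top_chart[OF L]
  have o: "open (snd L ` U)" using top_chart_image[OF tL U(1)] U(2) by (simp add: Int_absorb1)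
  have "((\<lambda>w. snd L p + w) \<longlongrightarrow> snd L p + 0) (nhds 0)" by (intro tendsto_intros filterlim_ident)
  then have "\<forall>\<^sub>F w in nhds 0. snd L p + w \<in> snd L ` U" using o p by (intro topological_tendstoD) auto
  then show ?thesis
  proof eventually_elim
    case (elim w)
    then obtain x where x: "x \<in> U" "snd L p + w = snd L x" by blast
    then show ?case using chart_inv_apply[OF tL, of x] U(2) by auto
  qed
qed

lemma holo_fun_coord: "coordinate X M \<Longrightarrow> U \<subseteq> fst M \<Longrightarrow> holo_fun X U (\<lambda>x. snd M x - snd M p)"
  by (rule holo_fun_diff'[OF holo_funI[OF mX U(1)] holo_funI[OF mX U(1) mdiff_const[OF mX openin_points[OF U(1)]]]])
    (auto intro: mdiff_chart[OF mX])

lemma holo_fun_pol: "coordinate X M \<Longrightarrow> U \<subseteq> fst M \<Longrightarrow> holo_fun X U (pol M p N a)"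
proof -
  assume M: "coordinate X M" "U \<subseteq> fst M"
  have "mdiff X (\<lambda>x. \<Sum>k<N. fps_nth a k * (snd M x - snd M p) ^ k) x" if x: "x \<in> U" for x
    using holo_fun_mdiff[OF mX holo_fun_coord[OF M] x] openin_points[OF U(1) x]
    by (intro mdiff_sum[OF mX] mdiff_mult[OF mX] mdiff_const[OF mX] mdiff_power[OF mX])
  then show ?thesis unfolding pol_def[abs_def] by (intro holo_funI[OF mX U(1)])
qed

lemma expand_pol:
  assumes M: "coordinate X M" "U \<subseteq> fst M"
  shows "expand L p (pol M p N a) = (\<Sum>k<N. fps_const (fps_nth a k) * expand L p (\<lambda>x. snd M x - snd M p) ^ k)"
proof (rule expand_unique[OF holo_fun_pol[OF M]])
  show "(\<lambda>w. pol M p N a (chart_inv L (snd L p + w))) has_fps_expansion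
      (\<Sum>k<N. fps_const (fps_nth a k) * expand L p (\<lambda>x. snd M x - snd M p) ^ k)"
    unfolding pol_def
    by (intro has_fps_expansion_sum has_fps_expansion_mult has_fps_expansion_const has_fps_expansion_power
        expand_has[OF holo_fun_coord[OF M]])
qed

lemma expand_coord: "expand L p (\<lambda>x. snd L x - snd L p) = fps_X"
proof (rule expand_unique[OF holo_fun_coord[OF L U(2)]])
  have ev: "\<forall>\<^sub>F w in nhds 0. snd L (chart_inv L (snd L p + w)) - snd L p = w"
    using eventually_chart_near by eventually_elim simp
  show "(\<lambda>w. snd L (chart_inv L (snd L p + w)) - snd L p) has_fps_expansion fps_X"
    unfolding has_fps_expansion_cong[OF ev refl] by (rule has_fps_expansion_fps_X)
qed

lemma expand_coord_0: "coordinate X M \<Longrightarrow> U \<subseteq> fst M \<Longrightarrow> fps_nth (expand L p (\<lambda>x. snd M x - snd M p)) 0 = 0"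
proof -
  have "chart_inv L (snd L p) = p" using chart_inv_apply[OF coordinate_top_chart[OF L]] p U by auto
  then show ?thesis by (simp add: expand_def fps_expansion_def)
qed

text \<open>The substituted series has no constant term, so powers from \<open>N\<close> on do not
  reach degrees below \<open>N\<close>. Two coordinates are allowed because the series at the source
  and at the target are given in different ones.\<close>

lemma expand_pol_compose:
  assumes M: "coordinate X M" "U \<subseteq> fst M"
  shows "fps_ord_ge N (expand L p (pol M p N a) - fps_compose a (expand L p (\<lambda>x. snd M x - snd M p)))"
proof -
  let ?C = "expand L p (\<lambda>x. snd M x - snd M p)"
  have "fps_nth (expand L p (pol M p N a)) n = fps_nth (fps_compose a ?C) n" if n: "n < N" for n
  proof -
    have "fps_nth (?C ^ k) n = 0" if "n < k" for k
      using startsby_zero_power_prefix[OF expand_coord_0[OF M]] that by blast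
    then have "(\<Sum>k<N. fps_nth a k * fps_nth (?C ^ k) n) = (\<Sum>k=0..n. fps_nth a k * fps_nth (?C ^ k) n)"
      using n by (intro sum.mono_neutral_right) auto
    then show ?thesis by (simp add: expand_pol[OF M] fps_sum_nth fps_compose_nth)
  qed
  then show ?thesis by (simp add: fps_ord_ge_def)
qed

lemma expand_pol_same: "fps_ord_ge N (expand L p (pol L p N a) - a)"
  using expand_pol_compose[OF L U(2), of N a] by (simp add: expand_coord)

lemma expand_generator:
  assumes f: "holo_fun X U f"
  shows "holo_fun X U (vf_generator L p n f)"
    "expand L p (vf_generator L p n f) = fps_X ^ n * fps_deriv (expand L p f)"
proof -
  note d = deriv_chart_mdiff(1)[OF L U(2) f]
  have "holo_fun X U (\<lambda>x. (snd L x - snd L p) ^ n)"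
    using holo_fun_coord[OF L U(2)] mdiff_power[OF mX] by (simp add: holo_fun_iff[OF mX])
  from holo_fun_mult[OF mX this d] show h: "holo_fun X U (vf_generator L p n f)"
    by (simp add: vf_generator_def[abs_def])
  have e: "deriv (\<lambda>w. f (chart_inv L (snd L p + w))) has_fps_expansion fps_deriv (expand L p f)"
    by (rule has_fps_expansion_deriv[OF expand_has[OF f]])
  have "(\<lambda>w. w ^ n * deriv (\<lambda>w. f (chart_inv L (snd L p + w))) w) has_fps_expansion (fps_X ^ n * fps_deriv (expand L p f))"
    by (intro has_fps_expansion_mult has_fps_expansion_power has_fps_expansion_fps_X e)
  moreover have ev: "\<forall>\<^sub>F w in nhds 0. vf_generator L p n f (chart_inv L (snd L p + w)) =
      w ^ n * deriv (\<lambda>w. f (chart_inv L (snd L p + w))) w"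
    using eventually_chart_near
  proof eventually_elim
    case (elim w)
    let ?x = "chart_inv L (snd L p + w)"
    have "((f \<circ> chart_inv L) has_field_derivative deriv (f \<circ> chart_inv L) (snd L ?x)) (at (snd L ?x))"
      using deriv_chart_mdiff(2)[OF L U(2) f] elim by blast
    then have "((f \<circ> chart_inv L) has_field_derivative deriv (f \<circ> chart_inv L) (snd L ?x)) (at (snd L p + w))"
      using elim by simp
    then have "((\<lambda>w. f (chart_inv L (snd L p + w))) has_field_derivative deriv (f \<circ> chart_inv L) (snd L ?x)) (at w)"
      using DERIV_shift[of "\<lambda>z. f (chart_inv L z)" _ w "snd L p"] by (simp add: o_def add.commute)
    then show ?case using elim by (simp add: vf_generator_def DERIV_imp_deriv)
  qed
  ultimately have "(\<lambda>w. vf_generator L p n f (chart_inv L (snd L p + w))) has_fps_expansion (fps_X ^ n * fps_deriv (expand L p f))"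
    unfolding has_fps_expansion_cong[OF ev refl] by simp
  then show "expand L p (vf_generator L p n f) = fps_X ^ n * fps_deriv (expand L p f)"
    by (rule expand_unique[OF h])
qed

lemma expand_ord_bigo:
  assumes f: "holo_fun X U f" and N: "fps_ord_ge N (expand L p f)"
  shows "f \<in> O[nhdsin TX p](\<lambda>x. (snd L x - snd L p) ^ N)"
proof -
  note tL = coordinate_top_chart[OF L]
  have "(\<lambda>w. f (chart_inv L (snd L p + w))) \<in> O[nhds 0](\<lambda>w. w ^ N)"
    using has_fps_expansion_bigo[OF expand_has[OF f]] N by (simp add: fps_ord_ge_def)
  moreover have "filterlim (\<lambda>x. snd L x - snd L p) (nhds 0) (nhdsin TX p)"
  proof -
    have "p \<in> fst L" using p U by blast
    have "((\<lambda>x. snd L x - snd L p) \<longlongrightarrow> snd L p - snd L p) (nhdsin TX p)"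
      by (intro tendsto_diff filterlim_chart[OF tL \<open>p \<in> fst L\<close>] tendsto_const)
    then show ?thesis by simp
  qed
  ultimately have "(\<lambda>x. f (chart_inv L (snd L p + (snd L x - snd L p)))) \<in> O[nhdsin TX p](\<lambda>x. (snd L x - snd L p) ^ N)"
    by (rule landau_o.big.compose)
  moreover have ev: "\<forall>\<^sub>F x in nhdsin TX p. f (chart_inv L (snd L p + (snd L x - snd L p))) = f x"
    by (rule eventually_nhdsin_openin[OF U(1) p]) (use tL U(2) in auto)
  ultimately show ?thesis using landau_o.big.in_cong[OF ev] by simp
qed

definition holo_matrix :: "('x \<Rightarrow> complex^'n::finite^'m::finite) \<Rightarrow> bool" where
  "holo_matrix A \<longleftrightarrow> (\<forall>i j. holo_fun X U (\<lambda>x. A x $ i $ j))"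

lemma holo_matrixI: "(\<And>x. x \<in> U \<Longrightarrow> mdiff X A x) \<Longrightarrow> holo_matrix A"
  unfolding holo_matrix_def mdiff_matrix_iff[OF mX] by (intro allI holo_funI[OF mX U(1)]) blast

lemma expand_matrix_mult:
  assumes "holo_matrix A" "holo_matrix A'"
  shows "expand_matrix L p (\<lambda>x. A x ** A' x) = expand_matrix L p A ** expand_matrix L p A'"
proof -
  have "expand L p (\<lambda>x. \<Sum>k\<in>UNIV. A x $ i $ k * A' x $ k $ j) = (\<Sum>k\<in>UNIV. expand L p (\<lambda>x. A x $ i $ k) * expand L p (\<lambda>x. A' x $ k $ j))" for i j
    using assms unfolding holo_matrix_def
    by (subst expand_sum) (auto intro: holo_fun_mult[OF mX] simp: expand_mult)
  then show ?thesis by (simp add: expand_matrix_def matrix_matrix_mult_def vec_eq_iff)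
qed

lemma expand_matrix_diff:
  assumes "holo_matrix A" "holo_matrix A'"
  shows "expand_matrix L p (\<lambda>x. A x - A' x) = expand_matrix L p A - expand_matrix L p A'"
  using assms by (simp add: expand_matrix_def vec_eq_iff holo_matrix_def expand_diff)

lemma holo_matrix_mult: "holo_matrix A \<Longrightarrow> holo_matrix A' \<Longrightarrow> holo_matrix (\<lambda>x. A x ** A' x)"
  unfolding holo_matrix_def matrix_matrix_mult_def vec_lambda_beta
  by (intro allI holo_fun_sum' holo_fun_mult[OF mX]) auto

lemma holo_matrix_diff: "holo_matrix A \<Longrightarrow> holo_matrix A' \<Longrightarrow> holo_matrix (\<lambda>x. A x - A' x)"
  unfolding holo_matrix_def by (auto intro: holo_fun_diff')

lemma expand_matrix_bigo:
  assumes "holo_matrix A" "\<And>i j. fps_ord_ge N (expand_matrix L p A $ i $ j)"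
  shows "matrix_bigo A (nhdsin TX p) (\<lambda>x. (snd L x - snd L p) ^ N)"
  unfolding matrix_bigo_def
proof (intro allI)
  fix i j
  show "(\<lambda>x. A x $ i $ j) \<in> O[nhdsin TX p](\<lambda>x. (snd L x - snd L p) ^ N)"
  proof (rule expand_ord_bigo)
    show "holo_fun X U (\<lambda>x. A x $ i $ j)" using assms(1) by (simp add: holo_matrix_def)
    show "fps_ord_ge N (expand L p (\<lambda>x. A x $ i $ j))" using assms(2)[of i j] by (simp add: expand_matrix_def)
  qed
qed

end

section \<open>Truncation of the formal isomorphism\<close>

definition mat_ord_ge :: "nat \<Rightarrow> 'a::comm_ring_1 fps^'n^'m \<Rightarrow> bool" where
  "mat_ord_ge N A \<longleftrightarrow> (\<forall>i j. fps_ord_ge N (A $ i $ j))"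

lemma mat_ord_ge_mult:
  fixes A :: "'a::comm_ring_1 fps^'n::finite^'m::finite" and A' :: "'a fps^'k::finite^'n"
  shows "mat_ord_ge N A \<Longrightarrow> mat_ord_ge N (A ** A')" "mat_ord_ge N A' \<Longrightarrow> mat_ord_ge N (A ** A')"
  by (simp_all add: mat_ord_ge_def matrix_matrix_mult_def fps_ord_ge_sum fps_ord_ge_mult_left fps_ord_ge_mult_right)

lemma mat_ord_ge_diff: "mat_ord_ge N A \<Longrightarrow> mat_ord_ge N A' \<Longrightarrow> mat_ord_ge N (A - A')"
  by (simp add: mat_ord_ge_def fps_ord_ge_diff)

definition pol_matrix :: "('x, complex) chart \<Rightarrow> 'x \<Rightarrow> nat \<Rightarrow> (complex fps)^'n::finite^'m::finite \<Rightarrow> 'x \<Rightarrow> complex^'n^'m" where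
  "pol_matrix L p N a x = (\<chi> i j. pol L p N (a $ i $ j) x)"

text \<open>Column \<open>j\<close> is the intertwining relation for the constant section
  \<open>axis j 1\<close>, whose entries have derivative zero.\<close>

lemma formal_intertwining_matrix:
  fixes \<phi> :: "('x, 'e, 'r::finite, 'f, 'q::finite) formal_hom"
  assumes f: "formally_intertwines X D E1 nabla1 E2 nabla2 \<phi>" and p: "p \<in> div_support X D"
    and a: "adapted X E1 E2 p L \<tau> \<sigma>"
  shows "\<phi> p L \<tau> \<sigma> ** expand_matrix L p (conn_matrix E1 nabla1 L p (D p) \<tau>) =
    (\<chi> i j. fps_X ^ D p * fps_deriv (\<phi> p L \<tau> \<sigma> $ i $ j)) +
    expand_matrix L p (conn_matrix E2 nabla2 L p (D p) \<sigma>) ** \<phi> p L \<tau> \<sigma>"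
proof -
  let ?a = "\<phi> p L \<tau> \<sigma>"
  let ?B1 = "expand_matrix L p (conn_matrix E1 nabla1 L p (D p) \<tau>)"
  let ?B2 = "expand_matrix L p (conn_matrix E2 nabla2 L p (D p) \<sigma>)"
  have fc1: "formal_connection D E1 nabla1 p L \<tau> u = (\<chi> i. fps_X ^ D p * fps_deriv (u $ i)) + ?B1 *v u" for u
    by (simp add: formal_connection_def expand_matrix_def conn_matrix_def)
  have fc2: "formal_connection D E2 nabla2 p L \<sigma> u = (\<chi> i. fps_X ^ D p * fps_deriv (u $ i)) + ?B2 *v u" for u
    by (simp add: formal_connection_def expand_matrix_def conn_matrix_def)
  have ax: "A *v axis j 1 = (\<chi> i. A $ i $ j)" for A :: "(complex fps)^'k::finite^'l::finite" and j
    by (simp add: matrix_vector_mult_def axis_def vec_eq_iff if_distrib cong: if_cong)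
  have "(?a ** ?B1) $ i $ j = fps_X ^ D p * fps_deriv (?a $ i $ j) + (?B2 ** ?a) $ i $ j" for i j
  proof -
    have "?a *v formal_connection D E1 nabla1 p L \<tau> (axis j 1) = formal_connection D E2 nabla2 p L \<sigma> (?a *v axis j 1)"
      using f p a unfolding formally_intertwines_def by blast
    moreover have "(\<chi> i. fps_X ^ D p * fps_deriv (axis j 1 $ i)) = (0 :: (complex fps)^'r)"
      by (simp add: vec_eq_iff axis_def)
    ultimately have "?a *v (?B1 *v axis j 1) = (\<chi> i. fps_X ^ D p * fps_deriv ((?a *v axis j 1) $ i)) + ?B2 *v (?a *v axis j 1)"
      unfolding fc1 fc2 by simp
    then have "(?a *v (?B1 *v axis j 1)) $ i = ((\<chi> i. fps_X ^ D p * fps_deriv ((?a *v axis j 1) $ i)) + ?B2 *v (?a *v axis j 1)) $ i"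
      by simp
    then show ?thesis unfolding ax by (simp add: matrix_vector_mult_def matrix_matrix_mult_def)
  qed
  then show ?thesis by (simp add: vec_eq_iff)
qed

text \<open>For the full formal matrix the residual is zero. Replacing it by its truncation changes
  every term in orders at least \<open>N\<close> only.\<close>

lemma residual_estimate:
  fixes \<phi> :: "('x, 'e, 'r::finite, 'f, 'q::finite) formal_hom" and N :: nat
  assumes f: "formally_intertwines X D E1 nabla1 E2 nabla2 \<phi>"
    and c: "div_chart p L U" and a: "adapted X E1 E2 p L \<tau> \<sigma>"
    and h1: "\<And>x. x \<in> U \<Longrightarrow> mdiff X (conn_matrix E1 nabla1 L p (D p) \<tau>) x"
    and h2: "\<And>x. x \<in> U \<Longrightarrow> mdiff X (conn_matrix E2 nabla2 L p (D p) \<sigma>) x"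
  defines "P \<equiv> pol_matrix L p N (\<phi> p L \<tau> \<sigma>)"
  shows "matrix_bigo (\<lambda>x. P x ** conn_matrix E1 nabla1 L p (D p) \<tau> x
        - (\<chi> i j. vf_generator L p (D p) (\<lambda>x. P x $ i $ j) x)
        - conn_matrix E2 nabla2 L p (D p) \<sigma> x ** P x) (nhdsin TX p) (\<lambda>x. (snd L x - snd L p) ^ N)"
proof -
  note cD = div_chartD[OF c]
  note ctx = cD(1,2,4,3)
  let ?a = "\<phi> p L \<tau> \<sigma>"
  let ?B1 = "conn_matrix E1 nabla1 L p (D p) \<tau>" and ?B2 = "conn_matrix E2 nabla2 L p (D p) \<sigma>"
  let ?d = "\<lambda>x. \<chi> i j. vf_generator L p (D p) (\<lambda>x. P x $ i $ j) x"
  let ?e = "\<lambda>A. expand_matrix L p A"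
  have hp: "holo_fun X U (\<lambda>x. P x $ i $ j)" for i j
    using holo_fun_pol[OF ctx cD(1,4)] by (simp add: P_def pol_matrix_def)
  have hP: "holo_matrix U P" using hp by (simp add: holo_matrix_def[OF ctx])
  have hB: "holo_matrix U ?B1" "holo_matrix U ?B2" by (rule holo_matrixI[OF ctx h1], assumption) (rule holo_matrixI[OF ctx h2], assumption)
  have hd: "holo_matrix U ?d"
    using expand_generator(1)[OF ctx hp] by (simp add: holo_matrix_def[OF ctx])
  have hPB: "holo_matrix U (\<lambda>x. P x ** ?B1 x)" "holo_matrix U (\<lambda>x. ?B2 x ** P x)"
    by (intro holo_matrix_mult[OF ctx] hP hB)+
  have hPBd: "holo_matrix U (\<lambda>x. P x ** ?B1 x - ?d x)" by (rule holo_matrix_diff[OF ctx hPB(1) hd])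
  have ex: "?e (\<lambda>x. P x ** ?B1 x - ?d x - ?B2 x ** P x) = ?e P ** ?e ?B1 - ?e ?d - ?e ?B2 ** ?e P"
    by (simp only: expand_matrix_diff[OF ctx hPBd hPB(2)] expand_matrix_diff[OF ctx hPB(1) hd]
        expand_matrix_mult[OF ctx hP hB(1)] expand_matrix_mult[OF ctx hB(2) hP])
  have ep: "mat_ord_ge N (?e P - ?a)"
    using expand_pol_same[OF ctx] by (simp add: mat_ord_ge_def expand_matrix_def P_def pol_matrix_def)
  let ?da = "\<chi> i j. fps_X ^ D p * fps_deriv (?a $ i $ j)"
  have ed: "mat_ord_ge N (?e ?d - ?da)"
  proof -
    \<comment> \<open>Differentiation costs one order, and the factor \<open>fps_X ^ D p\<close>
      restores it since \<open>D p\<close> is positive.\<close>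
    have o: "fps_ord_ge N (fps_X ^ D p * fps_deriv F)" if "fps_ord_ge N F" for F :: "complex fps"
      using that cD(5) by (auto simp: fps_ord_ge_def fps_X_power_mult_nth)
    have "fps_ord_ge N (fps_X ^ D p * fps_deriv F - fps_X ^ D p * fps_deriv G)" if "fps_ord_ge N (F - G)" for F G :: "complex fps"
      using o[OF that] by (simp add: right_diff_distrib)
    then show ?thesis
      using ep expand_generator(2)[OF ctx hp] by (simp add: mat_ord_ge_def expand_matrix_def)
  qed
  have z: "?a ** ?e ?B1 - ?da - ?e ?B2 ** ?a = 0"
    using formal_intertwining_matrix[OF f div_chart_support[OF c] a] by simp
  \<comment> \<open>Subtract the exact relation \<open>z\<close>, so that only differences between
    truncation and formal series remain.\<close>
  have "?e (\<lambda>x. P x ** ?B1 x - ?d x - ?B2 x ** P x) =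
      (?e P - ?a) ** ?e ?B1 - (?e ?d - ?da) - ?e ?B2 ** (?e P - ?a) + (?a ** ?e ?B1 - ?da - ?e ?B2 ** ?a)"
    unfolding ex by (simp add: matrix_mult_diff_left matrix_mult_diff_right)
  also have "\<dots> = (?e P - ?a) ** ?e ?B1 - (?e ?d - ?da) - ?e ?B2 ** (?e P - ?a)" unfolding z by simp
  finally have "mat_ord_ge N (?e (\<lambda>x. P x ** ?B1 x - ?d x - ?B2 x ** P x))"
    using ep ed by (simp add: mat_ord_ge_diff mat_ord_ge_mult)
  then show ?thesis
    by (intro expand_matrix_bigo[OF ctx] holo_matrix_diff[OF ctx hPBd hPB(2)]) (simp add: mat_ord_ge_def)
qed

end

section \<open>Expansions in two variables\<close>

definition mat2_ord_ge :: "nat \<Rightarrow> ('a::comm_ring_1 fps fps)^'n^'m \<Rightarrow> bool" where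
  "mat2_ord_ge N A \<longleftrightarrow> (\<forall>i j. ord2_ge N (A $ i $ j))"

lemma mat2_ord_ge_mult_left:
  fixes A :: "('a::comm_ring_1 fps fps)^'n::finite^'m::finite" and C :: "('a fps fps)^'k::finite^'n"
  assumes "mat2_ord_ge N C"
  shows "mat2_ord_ge N (A ** C)"
  unfolding mat2_ord_ge_def matrix_matrix_mult_def vec_lambda_beta
proof (intro allI ord2_ge_sum)
  fix i j k
  show "ord2_ge N (A $ i $ k * C $ k $ j)"
    using ord2_ge_mult[OF ord2_ge_0[of "A $ i $ k"], of N "C $ k $ j"] assms by (simp add: mat2_ord_ge_def)
qed

lemma mat2_ord_ge_mult_right:
  fixes A :: "('a::comm_ring_1 fps fps)^'n::finite^'m::finite" and C :: "('a fps fps)^'k::finite^'n"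
  assumes "mat2_ord_ge N A"
  shows "mat2_ord_ge N (A ** C)"
  unfolding mat2_ord_ge_def matrix_matrix_mult_def vec_lambda_beta
proof (intro allI ord2_ge_sum)
  fix i j k
  show "ord2_ge N (A $ i $ k * C $ k $ j)"
    using ord2_ge_mult[of N "A $ i $ k" 0 "C $ k $ j"] assms by (simp add: mat2_ord_ge_def)
qed

lemma mat2_ord_ge_add: "mat2_ord_ge N A \<Longrightarrow> mat2_ord_ge N C \<Longrightarrow> mat2_ord_ge N (A + C)"
  and mat2_ord_ge_diff: "mat2_ord_ge N A \<Longrightarrow> mat2_ord_ge N C \<Longrightarrow> mat2_ord_ge N (A - C)"
  by (simp_all add: mat2_ord_ge_def ord2_ge_add ord2_ge_diff)

lemma mat2_ord_ge_mono: "mat2_ord_ge N A \<Longrightarrow> M \<le> N \<Longrightarrow> mat2_ord_ge M A"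
  unfolding mat2_ord_ge_def by (blast intro: ord2_ge_mono)

lemma mat2_ord_ge_all_imp_0: "(\<And>N. mat2_ord_ge N A) \<Longrightarrow> A = 0"
  by (simp add: mat2_ord_ge_def vec_eq_iff ord2_ge_all_imp_0)

lemma map_matrix_fps2_subst_mult:
  fixes A :: "(complex fps)^'n::finite^'m::finite" and C :: "(complex fps)^'k::finite^'n"
  assumes "ord2_ge 1 F"
  shows "map_matrix (\<lambda>a. fps2_subst a F) (A ** C) = map_matrix (\<lambda>a. fps2_subst a F) A ** map_matrix (\<lambda>a. fps2_subst a F) C"
  by (simp add: vec_eq_iff map_matrix_def matrix_matrix_mult_def fps2_subst_sum fps2_subst_mult[OF assms])

lemma map_matrix_fps2_subst_1: "map_matrix (\<lambda>a. fps2_subst a F) (mat 1) = mat 1"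
  by (simp add: vec_eq_iff map_matrix_def mat_def fps2_subst_0 fps2_subst_1)

lemma invertible_map_fps2_subst:
  fixes A :: "(complex fps)^'n::finite^'m::finite"
  assumes "ord2_ge 1 F" "invertible A"
  shows "invertible (map_matrix (\<lambda>a. fps2_subst a F) A)"
proof -
  obtain C where C: "A ** C = mat 1" "C ** A = mat 1" using assms(2) unfolding invertible_def by blast
  then show ?thesis
    unfolding invertible_def
    by (metis map_matrix_fps2_subst_mult[OF assms(1)] map_matrix_fps2_subst_1)
qed

text \<open>Stated for rectangular matrices, as the two bundles are indexed by different
  types.\<close>

lemma invertible_mult_matrix_inv:
  fixes A :: "'a::semiring_1^'n^'m"
  assumes "invertible A"
  shows "A ** matrix_inv A = mat 1"
  unfolding matrix_inv_def using assms[unfolded invertible_def] by (rule someI2_ex) simp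

section \<open>Expansions at an arrow\<close>

context Pi1_groupoid
begin

context
  fixes K :: "('g, complex \<times> complex) chart" and g :: 'g and V :: "'g set"
  assumes K: "coordinate AG K" and V: "openin TG V" "V \<subseteq> fst K" and g: "g \<in> V"
begin

lemma chart_range: "open (snd K ` V)" "snd K g \<in> snd K ` V"
  using top_chart_image[OF coordinate_top_chart[OF K] V(1)] V(2) g by (simp_all add: Int_absorb1)

lemma chart_inv_base: "chart_inv K (snd K g) = g"
  using chart_inv_apply[OF coordinate_top_chart[OF K]] V g by auto

lemma chart_holo_on: "holo_fun AG V f \<Longrightarrow> holo_on (f \<circ> chart_inv K) (snd K ` V)"
  using holo_fun_coordinate[OF mG K, of V f] V(2) by (simp add: Int_absorb1)

lemma expand2_mult: "holo_fun AG V f \<Longrightarrow> holo_fun AG V h \<Longrightarrow> expand2 K g (\<lambda>x. f x * h x) = expand2 K g f * expand2 K g h"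
  using fps2_expansion_mult[OF chart_range(1) chart_holo_on chart_holo_on chart_range(2), of f h]
  by (simp add: expand2_def o_def)

lemma expand2_sum: "(\<And>i. i \<in> A \<Longrightarrow> holo_fun AG V (f i)) \<Longrightarrow> expand2 K g (\<lambda>x. \<Sum>i\<in>A. f i x) = (\<Sum>i\<in>A. expand2 K g (f i))"
  using fps2_expansion_sum[OF chart_range(1) chart_holo_on chart_range(2), of A f]
  by (simp add: expand2_def o_def)

lemma expand2_power: "holo_fun AG V f \<Longrightarrow> expand2 K g (\<lambda>x. f x ^ n) = expand2 K g f ^ n"
  using fps2_expansion_power[OF chart_range(1) chart_holo_on chart_range(2), of f n]
  by (simp add: expand2_def o_def)

lemma expand2_cmult: "holo_fun AG V f \<Longrightarrow> expand2 K g (\<lambda>x. c * f x) = fps_const (fps_const c) * expand2 K g f"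
  using fps2_expansion_cmult[OF chart_range(1) chart_holo_on chart_range(2), of f c]
  by (simp add: expand2_def o_def)

lemma holo2_mult: "holo_fun AG V f \<Longrightarrow> holo_fun AG V h \<Longrightarrow> holo_fun AG V (\<lambda>x. f x * h x)" for f :: "'g \<Rightarrow> complex"
  by (rule holo_fun_mult[OF mG])

lemma holo2_const: "holo_fun AG V (\<lambda>x. c :: complex)"
  by (rule holo_funI[OF mG V(1) mdiff_const[OF mG openin_points[OF V(1)]]])

lemma holo2_sum: "(\<And>i. i \<in> A \<Longrightarrow> holo_fun AG V (f i)) \<Longrightarrow> holo_fun AG V (\<lambda>x. \<Sum>i\<in>A. f i x)"
  for f :: "'i \<Rightarrow> 'g \<Rightarrow> complex"
proof -
  assume f: "\<And>i. i \<in> A \<Longrightarrow> holo_fun AG V (f i)"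
  show ?thesis
    by (rule holo_funI[OF mG V(1)]) (rule mdiff_sum[OF mG openin_points[OF V(1)]], assumption, rule holo_fun_mdiff[OF mG f])
qed

lemma holo2_power: "holo_fun AG V f \<Longrightarrow> holo_fun AG V (\<lambda>x. f x ^ n)" for f :: "'g \<Rightarrow> complex"
  using mdiff_power[OF mG] by (simp add: holo_fun_iff[OF mG])

lemma expand2_diff:
  assumes f: "holo_fun AG V f" and h: "holo_fun AG V h"
  shows "expand2 K g (\<lambda>x. f x - h x) = expand2 K g f - expand2 K g h"
proof -
  have "holo_fun AG V (\<lambda>x. (-1) * h x)" by (rule holo2_mult[OF holo2_const h])
  from fps2_expansion_add[OF chart_range(1) chart_holo_on[OF f] chart_holo_on[OF this] chart_range(2)]
  show ?thesis
    using expand2_cmult[OF h, of "-1"] by (simp add: expand2_def o_def flip: fps_const_neg)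
qed

lemma expand2_matrix_mult:
  fixes A :: "'g \<Rightarrow> complex^'n::finite^'m::finite" and C :: "'g \<Rightarrow> complex^'k::finite^'n"
  assumes "\<And>i j. holo_fun AG V (\<lambda>x. A x $ i $ j)" "\<And>i j. holo_fun AG V (\<lambda>x. C x $ i $ j)"
  shows "expand2_matrix K g (\<lambda>x. A x ** C x) = expand2_matrix K g A ** expand2_matrix K g C"
proof -
  have "expand2 K g (\<lambda>x. \<Sum>k\<in>UNIV. A x $ i $ k * C x $ k $ j) =
      (\<Sum>k\<in>UNIV. expand2 K g (\<lambda>x. A x $ i $ k) * expand2 K g (\<lambda>x. C x $ k $ j))" for i j
    using expand2_sum[of UNIV "\<lambda>k x. A x $ i $ k * C x $ k $ j", OF holo2_mult[OF assms]]
    by (simp add: expand2_mult[OF assms])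
  then show ?thesis by (simp add: expand2_matrix_def matrix_matrix_mult_def vec_eq_iff)
qed

lemma holo2_matrix_mult:
  fixes A :: "'g \<Rightarrow> complex^'n::finite^'m::finite" and C :: "'g \<Rightarrow> complex^'k::finite^'n"
  assumes "\<And>i j. holo_fun AG V (\<lambda>x. A x $ i $ j)" "\<And>i j. holo_fun AG V (\<lambda>x. C x $ i $ j)"
  shows "holo_fun AG V (\<lambda>x. (A x ** C x) $ i $ j)"
  unfolding matrix_matrix_mult_def vec_lambda_beta by (rule holo2_sum) (rule holo2_mult[OF assms])

text \<open>Differentiability at a zero gives a linear bound. The distance is embedded into the
  complex numbers so that it can serve as a weight in \<open>matrix_bigo\<close>.\<close>

lemma chart_distance_bigo:
  fixes f :: "'g \<Rightarrow> complex"
  assumes f: "mdiff AG f g" "f g = 0"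
  shows "f \<in> O[nhdsin TG g](\<lambda>h. of_real (norm (snd K h - snd K g)) :: complex)"
proof -
  note tK = coordinate_top_chart[OF K]
  have gK: "g \<in> fst K" using g V by blast
  let ?F = "f \<circ> chart_inv K" and ?z = "snd K g"
  obtain F' where "(?F has_derivative F') (at ?z)"
    using f(1) unfolding mdiff_coordinate[OF mG K gK] cdiff_def by blast
  then have bl: "bounded_linear F'" and
    al: "\<forall>e>0. \<exists>d>0. \<forall>y. norm (y - ?z) < d \<longrightarrow> norm (?F y - ?F ?z - F' (y - ?z)) \<le> e * norm (y - ?z)"
    by (auto simp: has_derivative_at_alt)
  obtain B where B: "\<And>x. norm (F' x) \<le> norm x * B" using bounded_linear.bounded[OF bl] by blast
  obtain d where d: "d > 0" "\<And>y. norm (y - ?z) < d \<Longrightarrow> norm (?F y - ?F ?z - F' (y - ?z)) \<le> 1 * norm (y - ?z)"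
    using al zero_less_one by blast
  have z0: "?F ?z = 0" using f(2) by (simp add: chart_inv_base)
  have "\<forall>\<^sub>F w in nhds ?z. norm (?F w) \<le> (1 + B) * norm (w - ?z)"
  proof (rule eventually_mono[OF eventually_nhds_in_open[OF open_ball, of ?z ?z d]])
    show "?z \<in> ball ?z d" using d(1) by simp
    fix w assume "w \<in> ball ?z d"
    then have "norm (?F w - F' (w - ?z)) \<le> norm (w - ?z)" using d(2)[of w] z0 by (simp add: dist_norm norm_minus_commute)
    then have "norm (?F w) \<le> norm (w - ?z) + norm (F' (w - ?z))" using norm_triangle_sub[of "?F w" "F' (w - ?z)"] by linarith
    then show "norm (?F w) \<le> (1 + B) * norm (w - ?z)" using B[of "w - ?z"] by (simp add: algebra_simps)
  qed
  from filterlim_chart[OF tK gK, unfolded filterlim_iff, rule_format, OF this]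
  have 1: "\<forall>\<^sub>F h in nhdsin TG g. norm (?F (snd K h)) \<le> (1 + B) * norm (snd K h - ?z)" .
  have 2: "\<forall>\<^sub>F h in nhdsin TG g. ?F (snd K h) = f h"
    by (rule eventually_nhdsin_openin[OF V(1) g]) (use tK V(2) in \<open>auto simp: chart_inv_apply\<close>)
  show ?thesis
  proof (rule bigoI)
    show "\<forall>\<^sub>F h in nhdsin TG g. norm (f h) \<le> (1 + B) * norm (of_real (norm (snd K h - ?z)) :: complex)"
      using 1 2 by eventually_elim simp
  qed
qed

lemma expand2_ord_bigo:
  assumes f: "holo_fun AG V f"
    and o: "f \<in> O[nhdsin TG g](\<lambda>h. (of_real (norm (snd K h - snd K g)) :: complex) ^ M)"
  shows "ord2_ge M (expand2 K g f)"
proof -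
  note tK = coordinate_top_chart[OF K]
  have gK: "g \<in> fst K" using g V by blast
  let ?z = "snd K g"
  obtain C where C: "\<forall>\<^sub>F h in nhdsin TG g. norm (f h) \<le> C * norm ((of_real (norm (snd K h - ?z)) :: complex) ^ M)"
    using bigo_bound[OF o] by blast
  from filterlim_chart_inv[OF tK gK, unfolded filterlim_iff, rule_format, OF this]
  have 1: "\<forall>\<^sub>F w in nhds ?z. norm (f (chart_inv K w)) \<le> C * norm ((of_real (norm (snd K (chart_inv K w) - ?z)) :: complex) ^ M)" .
  have 2: "\<forall>\<^sub>F w in nhds ?z. snd K (chart_inv K w) = w"
    by (rule eventually_mono[OF eventually_nhds_in_open[OF chart_range]]) (use tK V(2) in \<open>auto simp: chart_inv_apply\<close>)
  have "\<forall>\<^sub>F w in nhds ?z. norm ((f \<circ> chart_inv K) w) \<le> C * norm (w - ?z) ^ M"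
    using 1 2 by eventually_elim (simp add: norm_power)
  from ord2_ge_expansion[OF chart_range(1) chart_holo_on[OF f] chart_range(2) this]
  show ?thesis unfolding expand2_def .
qed

lemma expand2_convergent: "holo_fun AG V f \<Longrightarrow> fps2_convergent (expand2 K g f)"
  using fps2_convergent_expansion[OF chart_range(1) chart_holo_on chart_range(2)] by (simp add: expand2_def)

text \<open>With the source or target map for \<open>f\<close>: substituting the expansion of the
  coordinate into a formal series agrees up to order \<open>N\<close> with expanding the pullback of
  its truncation.\<close>

lemma expand2_pol:
  assumes f: "holo_fun AG V (\<lambda>h. snd L (f h) - snd L (f g))"
  defines "C \<equiv> expand2 K g (\<lambda>h. snd L (f h) - snd L (f g))"
  shows "holo_fun AG V (\<lambda>h. pol L (f g) N a (f h))"
    "ord2_ge 1 C"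
    "ord2_ge N (fps2_subst a C - expand2 K g (\<lambda>h. pol L (f g) N a (f h)))"
proof -
  have h: "holo_fun AG V (\<lambda>h. fps_nth a k * (snd L (f h) - snd L (f g)) ^ k)" for k
    by (rule holo2_mult[OF holo2_const holo2_power[OF f]])
  show "holo_fun AG V (\<lambda>h. pol L (f g) N a (f h))" unfolding pol_def by (rule holo2_sum[OF h])
  show 1: "ord2_ge 1 C" by (simp add: ord2_ge_def C_def expand2_def fps2_expansion_def chart_inv_base)
  have "expand2 K g (\<lambda>h. pol L (f g) N a (f h)) = (\<Sum>k<N. fps_const (fps_const (fps_nth a k)) * C ^ k)"
    unfolding pol_def expand2_sum[OF h] C_def
    by (simp add: expand2_cmult[OF holo2_power[OF f]] expand2_power[OF f])
  then show "ord2_ge N (fps2_subst a C - expand2 K g (\<lambda>h. pol L (f g) N a (f h)))"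
    using ord2_ge_subst_truncation[OF 1] by simp
qed

end

text \<open>The defect is formed with one coordinate and one pair of frames, while the theorem
  allows different choices at source and target. The transformation law of a formal isomorphism
  survives truncation up to order \<open>N\<close>.\<close>

lemma frame_change_estimate:
  fixes \<phi> :: "('x, 'e, 'r::finite, 'f, 'q::finite) formal_hom"
  assumes iso: "formal_isomorphism X D E1 E2 \<phi>" and E1: "vector_bundle X E1" and E2: "vector_bundle X E2"
    and p: "p \<in> div_support X D" and a: "adapted X E1 E2 p L \<tau> \<sigma>" and a': "adapted X E1 E2 p L' \<tau>' \<sigma>'"
  shows "matrix_bigo (\<lambda>x. pol_matrix L p N (\<phi> p L \<tau> \<sigma>) x ** frame_matrix E1 \<tau>' \<tau> id x
      - frame_matrix E2 \<sigma>' \<sigma> id x ** pol_matrix L' p N (\<phi> p L' \<tau>' \<sigma>') x)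
    (nhdsin TX p) (\<lambda>x. (snd L' x - snd L' p) ^ N)"
proof -
  note A = a[unfolded adapted_def] and A' = a'[unfolded adapted_def]
  define U where "U = fst L \<inter> fst L' \<inter> (fst \<tau> \<inter> fst \<tau>') \<inter> (fst \<sigma> \<inter> fst \<sigma>')"
  have c: "coordinate X L" "coordinate X L'" and lf: "local_frame X E1 \<tau>" "local_frame X E1 \<tau>'" "local_frame X E2 \<sigma>" "local_frame X E2 \<sigma>'"
    using A A' by auto
  have U: "openin TX U"
    unfolding U_def using c lf by (intro openin_Int top_chart_openin coordinate_top_chart chart_open local_frame_chart)
  have UU: "U \<subseteq> fst L" "U \<subseteq> fst L'" and pU: "p \<in> U" using A A' by (auto simp: U_def)
  note ctx = c(2) U UU(2) pU
  define P where "P = pol_matrix L p N (\<phi> p L \<tau> \<sigma>)"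
  define P' where "P' = pol_matrix L' p N (\<phi> p L' \<tau>' \<sigma>')"
  define T where "T = frame_matrix E1 \<tau>' \<tau> id"
  define S where "S = frame_matrix E2 \<sigma>' \<sigma> id"
  define S' where "S' = frame_matrix E2 \<sigma> \<sigma>' id"
  let ?e = "\<lambda>A. expand_matrix L' p A"
  define C where "C = expand L' p (\<lambda>x. snd L x - snd L p)"
  define ac where "ac = map_matrix (\<lambda>a. fps_compose a C) (\<phi> p L \<tau> \<sigma>)"
  have hP: "holo_matrix U P" "holo_matrix U P'"
    using holo_fun_pol[OF ctx c(1) UU(1)] holo_fun_pol[OF ctx c(2) UU(2)]
    by (simp_all add: holo_matrix_def[OF ctx] P_def P'_def pol_matrix_def)
  have hT: "holo_matrix U T"
    unfolding T_def by (rule holo_matrixI[OF ctx mdiff_frame_change[OF mX E1 lf(2) _ lf(1)]]) (auto simp: U_def)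
  have "holo_matrix U S"
    unfolding S_def by (rule holo_matrixI[OF ctx mdiff_frame_change[OF mX E2 lf(4) _ lf(3)]]) (auto simp: U_def)
  moreover have "holo_matrix U S'"
    unfolding S'_def by (rule holo_matrixI[OF ctx mdiff_frame_change[OF mX E2 lf(3) _ lf(4)]]) (auto simp: U_def)
  ultimately have hS: "holo_matrix U S" "holo_matrix U S'" .
  have eP: "mat_ord_ge N (?e P - ac)"
    using expand_pol_compose[OF ctx c(1) UU(1)]
    by (simp add: mat_ord_ge_def expand_matrix_def P_def pol_matrix_def ac_def map_matrix_def C_def)
  have eP': "mat_ord_ge N (?e P' - \<phi> p L' \<tau>' \<sigma>')"
    using expand_pol_same[OF ctx] by (simp add: mat_ord_ge_def expand_matrix_def P'_def pol_matrix_def)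
  have law: "\<phi> p L' \<tau>' \<sigma>' = ?e S' ** ac ** ?e T"
    using iso[unfolded formal_isomorphism_def, rule_format, OF p a', THEN conjunct2, rule_format, OF a]
    by (simp add: S'_def T_def ac_def C_def)
  have hSS: "holo_matrix U (\<lambda>x. S x ** S' x)" by (rule holo_matrix_mult[OF ctx hS])
  have SS: "S x ** S' x = mat 1" if x: "x \<in> U" for x
  proof -
    have xs: "x \<in> fst \<sigma>" "x \<in> fst \<sigma>'" using x by (auto simp: U_def)
    note f = local_frame_chart[OF lf(3)] and f' = local_frame_chart[OF lf(4)]
    show ?thesis
      using frame_matrix_compose[OF f xs(1) f' xs(2) f xs(1) fibre_linear_id fibre_linear_id, of id]
        frame_matrix_id[OF f xs(1)] by (simp add: S_def S'_def)
  qed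
  have "expand L' p (\<lambda>x. (S x ** S' x) $ i $ j) = mat 1 $ i $ j" for i j
  proof -
    have ev: "\<forall>\<^sub>F w in nhds 0. (S (chart_inv L' (snd L' p + w)) ** S' (chart_inv L' (snd L' p + w))) $ i $ j = mat 1 $ i $ j"
      using eventually_chart_near[OF ctx] by eventually_elim (simp add: SS)
    have "(\<lambda>w. (S (chart_inv L' (snd L' p + w)) ** S' (chart_inv L' (snd L' p + w))) $ i $ j) has_fps_expansion fps_const (mat 1 $ i $ j)"
      unfolding has_fps_expansion_cong[OF ev refl] by (rule has_fps_expansion_const)
    from expand_unique[OF ctx _ this] hSS show ?thesis
      by (simp add: holo_matrix_def[OF ctx] mat_def)
  qed
  \<comment> \<open>Moves the frame change of the second bundle to the other side of the
    transformation law, where it multiplies \<open>P'\<close>.\<close>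
  then have inv: "?e S ** ?e S' = mat 1"
    unfolding expand_matrix_mult[OF ctx hS, symmetric] by (simp add: expand_matrix_def vec_eq_iff)
  have S\<phi>: "?e S ** \<phi> p L' \<tau>' \<sigma>' = ac ** ?e T"
    unfolding law matrix_mul_assoc inv by simp
  have hPT: "holo_matrix U (\<lambda>x. P x ** T x)" and hSP: "holo_matrix U (\<lambda>x. S x ** P' x)"
    by (rule holo_matrix_mult[OF ctx hP(1) hT]) (rule holo_matrix_mult[OF ctx hS(1) hP(2)])
  have "?e (\<lambda>x. P x ** T x - S x ** P' x) = ?e P ** ?e T - ?e S ** ?e P'"
    by (simp only: expand_matrix_diff[OF ctx hPT hSP] expand_matrix_mult[OF ctx hP(1) hT] expand_matrix_mult[OF ctx hS(1) hP(2)])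
  also have "\<dots> = (?e P - ac) ** ?e T - ?e S ** (?e P' - \<phi> p L' \<tau>' \<sigma>')"
    by (simp add: matrix_mult_diff_left matrix_mult_diff_right S\<phi>)
  finally have "mat_ord_ge N (?e (\<lambda>x. P x ** T x - S x ** P' x))"
    using eP eP' by (simp add: mat_ord_ge_diff mat_ord_ge_mult)
  then have "matrix_bigo (\<lambda>x. P x ** T x - S x ** P' x) (nhdsin TX p) (\<lambda>x. (snd L' x - snd L' p) ^ N)"
    by (intro expand_matrix_bigo[OF ctx] holo_matrix_diff[OF ctx hPT hSP]) (simp add: mat_ord_ge_def)
  then show ?thesis by (simp add: P_def P'_def T_def S_def)
qed

end

section \<open>From estimates of every order to equality of series\<close>

context Pi1_groupoid
begin

text \<open>The defect is small in powers of the source coordinate, which is bounded by the distance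
  in any chart at \<open>g\<close>. The choice of \<open>N\<close> leaves order \<open>Suc M\<close>
  after the loss of \<open>D p\<close>, and guarantees \<open>D p < N\<close> even when
  \<open>M = 0\<close>.\<close>

lemma intertwining_estimate:
  fixes E1 :: "('x, 'e, 'r::finite) vbundle" and E2 :: "('x, 'f, 'q::finite) vbundle"
    and \<phi> :: "('x, 'e, 'r, 'f, 'q) formal_hom" and M :: nat
  assumes arep1: "algebroid_rep X D E1 nabla1" and int1: "integrates_connection X D G \<theta> E1 nabla1 \<Psi>1"
    and arep2: "algebroid_rep X D E2 nabla2" and int2: "integrates_connection X D G \<theta> E2 nabla2 \<Psi>2"
    and iso: "formal_isomorphism X D E1 E2 \<phi>" and f: "formally_intertwines X D E1 nabla1 E2 nabla2 \<phi>"
    and g: "g \<in> points AG" "s g = p" and p: "p \<in> div_support X D"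
    and K: "coordinate AG K" "g \<in> fst K"
    and as: "adapted X E1 E2 p Ls \<tau>s \<sigma>s" and at: "adapted X E1 E2 p Lt \<tau>t \<sigma>t"
  defines "N \<equiv> D p + Suc M"
  shows "matrix_bigo (\<lambda>h. pol_matrix Lt p N (\<phi> p Lt \<tau>t \<sigma>t) (t h) ** rep_matrix E1 \<Psi>1 \<tau>s \<tau>t h
      - rep_matrix E2 \<Psi>2 \<sigma>s \<sigma>t h ** pol_matrix Ls p N (\<phi> p Ls \<tau>s \<sigma>s) (s h))
    (nhdsin TG g) (\<lambda>h. (of_real (norm (snd K h - snd K g)) :: complex) ^ M)"
proof -
  note as' = as[unfolded adapted_def] and at' = at[unfolded adapted_def]
  have co: "coordinate X Ls" "coordinate X Lt" and lf: "local_frame X E1 \<tau>s" "local_frame X E1 \<tau>t" "local_frame X E2 \<sigma>s" "local_frame X E2 \<sigma>t"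
    and pin: "p \<in> fst Ls" "p \<in> fst \<tau>s" "p \<in> fst \<sigma>s" "p \<in> fst Lt" "p \<in> fst \<tau>t" "p \<in> fst \<sigma>t"
    using as' at' by auto
  have vb1: "vector_bundle X E1" and vb2: "vector_bundle X E2" using arep1 arep2 by (simp_all add: algebroid_rep_def)
  have rep1: "groupoid_rep X G E1 \<Psi>1" and rep2: "groupoid_rep X G E2 \<Psi>2"
    using int1 int2 by (simp_all add: integrates_connection_def)
  define W where "W = fst Ls \<inter> (fst \<tau>s \<inter> fst \<tau>t) \<inter> (fst \<sigma>s \<inter> fst \<sigma>t)"
  have W: "openin TX W" "p \<in> W"
    unfolding W_def using co lf pin by (auto intro!: openin_Int top_chart_openin coordinate_top_chart chart_open local_frame_chart)
  obtain U where U: "div_chart p Lt U" "U \<subseteq> W"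
    using div_chart_exists[OF p co(2) pin(4) W] .
  note cD = div_chartD[OF U(1)]
  have sub: "U \<subseteq> fst Ls" "U \<subseteq> fst \<tau>s" "U \<subseteq> fst \<tau>t" "U \<subseteq> fst \<sigma>s" "U \<subseteq> fst \<sigma>t" using U(2) by (auto simp: W_def)
  define P where "P = pol_matrix Lt p N (\<phi> p Lt \<tau>t \<sigma>t)"
  define P' where "P' = pol_matrix Ls p N (\<phi> p Ls \<tau>s \<sigma>s)"
  define T where "T = frame_matrix E1 \<tau>s \<tau>t id"
  define S where "S = frame_matrix E2 \<sigma>s \<sigma>t id"
  have res: "matrix_bigo (\<lambda>x. P x ** conn_matrix E1 nabla1 Lt p (D p) \<tau>t x
        - (\<chi> i j. vf_generator Lt p (D p) (\<lambda>x. P x $ i $ j) x)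
        - conn_matrix E2 nabla2 Lt p (D p) \<sigma>t x ** P x) (nhdsin TX p) (\<lambda>x. (snd Lt x - snd Lt p) ^ N)"
    unfolding P_def
    by (rule residual_estimate[OF f U(1) at]) (erule mdiff_conn_matrix[OF arep1 int1 lf(2) U(1) sub(3)]
        mdiff_conn_matrix[OF arep2 int2 lf(4) U(1) sub(5)])+
  have mP: "mdiff X P x" if "x \<in> U" for x
    unfolding mdiff_matrix_iff[OF mX]
    using holo_fun_mdiff[OF mX holo_fun_pol[OF cD(1,2,4,3) cD(1,4)] that] by (simp add: P_def pol_matrix_def)
  interpret approximate_intertwiner X G D \<theta> E1 nabla1 \<Psi>1 E2 nabla2 \<Psi>2 \<tau>t \<sigma>t p Lt U P N
    by standard (use arep1 arep2 int1 int2 lf U(1) sub mP res in \<open>auto simp: N_def\<close>)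
  have gU: "g \<in> over U" and tg: "t g = p"
    using src_eq_iff_tgt_eq[OF p g(1)] g cD(3) by (auto simp: over_iff)
  let ?\<kappa> = "\<lambda>h. of_real (norm (snd K h - snd K g)) :: complex"
  define V where "V = over U \<inter> fst K"
  have V: "openin TG V" "V \<subseteq> fst K" "g \<in> V"
    using openin_over[OF cD(2)] top_chart_openin[OF coordinate_top_chart[OF K(1)]] gU K(2) by (auto simp: V_def)
  have \<kappa>0: "?\<kappa> \<in> O[nhdsin TG g](\<lambda>_. 1)"
  proof -
    have "(?\<kappa> \<longlongrightarrow> of_real (norm (snd K g - snd K g))) (nhdsin TG g)"
      by (intro tendsto_of_real tendsto_norm tendsto_diff tendsto_const filterlim_chart[OF coordinate_top_chart[OF K(1)] K(2)])
    then show ?thesis by (intro bigoI_tendsto[of _ _ 0]) auto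
  qed
  \<comment> \<open>The recentred source coordinate is bounded by the chart distance; the surplus
    factors beyond \<open>M\<close> are bounded near \<open>g\<close>.\<close>
  have \<kappa>: "(\<lambda>h. (snd L (s h) - snd L p) ^ k) \<in> O[nhdsin TG g](\<lambda>h. ?\<kappa> h ^ M)"
    if "coordinate X L" "p \<in> fst L" "M \<le> k" for L k
  proof -
    have "mdiff X (\<lambda>x. snd L x - snd L p) p"
      using that by (intro mdiff_diff[OF mX] mdiff_chart[OF mX] mdiff_const[OF mX] cD(8))
    then have "mdiff AG (\<lambda>h. snd L (s h) - snd L p) g" using mdiff_s[OF g(1)] g(2) by simp
    from chart_distance_bigo[OF K(1) V this] have 1: "(\<lambda>h. snd L (s h) - snd L p) \<in> O[nhdsin TG g](?\<kappa>)" by (simp add: g(2))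
    have "(\<lambda>h. ?\<kappa> h ^ (k - M)) \<in> O[nhdsin TG g](\<lambda>_. 1)" using landau_o.big_power[OF \<kappa>0, of "k - M"] by simp
    from landau_o.big.mult[OF landau_o.big_refl[of "\<lambda>h. ?\<kappa> h ^ M"] this]
    have 2: "(\<lambda>h. ?\<kappa> h ^ k) \<in> O[nhdsin TG g](\<lambda>h. ?\<kappa> h ^ M)" using that(3) by (simp flip: power_add)
    show ?thesis by (rule landau_o.big_trans[OF landau_o.big_power[OF 1] 2])
  qed
  have mT: "mdiff X T x" if "x \<in> U" for x
    unfolding T_def using that sub by (intro mdiff_frame_change[OF mX vb1 lf(1) _ lf(2)]) auto
  have "matrix_bigo defect (nhdsin TG g) (\<lambda>h. (snd Lt (s h) - snd Lt p) ^ (N - D p))" by (rule defect_small[OF g])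
  then have 1: "matrix_bigo defect (nhdsin TG g) (\<lambda>h. ?\<kappa> h ^ M)"
    by (rule matrix_bigo_trans) (rule \<kappa>[OF co(2) pin(4)], simp add: N_def)
  have 2: "matrix_bigo (\<lambda>h. T (s h)) (nhdsin TG g) (\<lambda>_. 1)"
    by (rule mdiff_matrix_bigo_1[OF mG mdiff_s[OF g(1)]]) (simp add: g(2) mT cD)
  have 3: "matrix_bigo \<Phi>2 (nhdsin TG g) (\<lambda>_. 1)"
    by (rule mdiff_matrix_bigo_1[OF mG mdiff_\<Phi>2[OF gU]])
  have ls: "filterlim s (nhdsin TX p) (nhdsin TG g)"
    using continuous_map_filterlim_nhdsin[OF cs, of g] g by (simp add: points_def)
  have "matrix_bigo (\<lambda>h. P (s h) ** T (s h) - S (s h) ** P' (s h)) (nhdsin TG g) (\<lambda>h. (snd Ls (s h) - snd Ls p) ^ N)"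
    using matrix_bigo_compose[OF frame_change_estimate[OF iso vb1 vb2 p at as, of N] ls]
    by (simp add: P_def P'_def T_def S_def)
  then have 4: "matrix_bigo (\<lambda>h. P (s h) ** T (s h) - S (s h) ** P' (s h)) (nhdsin TG g) (\<lambda>h. ?\<kappa> h ^ M)"
    by (rule matrix_bigo_trans) (rule \<kappa>[OF co(1) pin(1)], simp add: N_def)
  \<comment> \<open>The defect uses the frames of the target at both ends. Correcting the frames at
    the source adds the second summand, and the mixed terms cancel.\<close>
  have "matrix_bigo (\<lambda>h. defect h ** T (s h) + \<Phi>2 h ** (P (s h) ** T (s h) - S (s h) ** P' (s h))) (nhdsin TG g) (\<lambda>h. ?\<kappa> h ^ M)"
    by (rule matrix_bigo_add[OF matrix_bigo_mult2[OF 1 2] matrix_bigo_mult1[OF 3 4]])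
  then have "matrix_bigo (\<lambda>h. P (t h) ** rep_matrix E1 \<Psi>1 \<tau>s \<tau>t h - rep_matrix E2 \<Psi>2 \<sigma>s \<sigma>t h ** P' (s h)) (nhdsin TG g) (\<lambda>h. ?\<kappa> h ^ M)"
  proof (rule matrix_bigo_cong, intro eventually_nhdsin_openin[OF openin_over[OF cD(2)] gU])
    fix h assume "h \<in> over U"
    then have h: "h \<in> points AG" "s h \<in> U" "t h \<in> U" by (auto simp: over_iff)
    have "rep_matrix E1 \<Psi>1 \<tau>s \<tau>t h = \<Phi>1 h ** T (s h)"
      unfolding T_def using h sub by (intro rep_matrix_change_src[OF vb1 rep1 h(1) lf(1) _ lf(2) _ lf(2)]) auto
    moreover have "rep_matrix E2 \<Psi>2 \<sigma>s \<sigma>t h = \<Phi>2 h ** S (s h)"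
      unfolding S_def using h sub by (intro rep_matrix_change_src[OF vb2 rep2 h(1) lf(3) _ lf(4) _ lf(4)]) auto
    ultimately show "defect h ** T (s h) + \<Phi>2 h ** (P (s h) ** T (s h) - S (s h) ** P' (s h)) =
        P (t h) ** rep_matrix E1 \<Psi>1 \<tau>s \<tau>t h - rep_matrix E2 \<Psi>2 \<sigma>s \<sigma>t h ** P' (s h)"
      by (simp add: defect_def matrix_mult_diff_left matrix_mult_diff_right matrix_mul_assoc)
  qed
  then show ?thesis by (simp add: P_def P'_def)
qed

text \<open>Cleared of the inverse, the claim is an identity between products of series, whose two
  sides differ by order \<open>M\<close> for every \<open>M\<close>. Convergence is then that of the
  expansion of the holomorphic \<open>\<Psi>2\<close>.\<close>

lemma formal_Sigma_eq_convergent: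
  fixes E1 :: "('x, 'e, 'r::finite) vbundle" and E2 :: "('x, 'f, 'q::finite) vbundle"
    and \<phi> :: "('x, 'e, 'r, 'f, 'q) formal_hom"
  assumes arep1: "algebroid_rep X D E1 nabla1" and int1: "integrates_connection X D G \<theta> E1 nabla1 \<Psi>1"
    and arep2: "algebroid_rep X D E2 nabla2" and int2: "integrates_connection X D G \<theta> E2 nabla2 \<Psi>2"
    and iso: "formal_isomorphism X D E1 E2 \<phi>" and f: "formally_intertwines X D E1 nabla1 E2 nabla2 \<phi>"
    and g: "g \<in> arrows_over X D G" and K: "coordinate AG K" "g \<in> fst K"
    and as: "adapted X E1 E2 (s g) Ls \<tau>s \<sigma>s" and at: "adapted X E1 E2 (t g) Lt \<tau>t \<sigma>t"
  shows "formal_Sigma G E1 \<Psi>1 \<phi> g K Ls Lt \<tau>s \<tau>t \<sigma>s \<sigma>t = formal_groupoid_rep G E2 \<Psi>2 g K \<sigma>s \<sigma>t"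
    and "fps2_convergent (formal_Sigma G E1 \<Psi>1 \<phi> g K Ls Lt \<tau>s \<tau>t \<sigma>s \<sigma>t $ i $ j)"
proof -
  define p where "p = s g"
  have gA: "g \<in> points AG" and p: "p \<in> div_support X D" using g by (auto simp: arrows_over_def src_pre_def p_def)
  \<comment> \<open>Both ends of \<open>g\<close> are the same point of the divisor, so both
    pullbacks use series of \<open>\<phi>\<close> at \<open>p\<close>.\<close>
  have tg: "t g = p" using src_eq_iff_tgt_eq[OF p gA] by (simp add: p_def)
  note as = as[folded p_def] and at = at[unfolded tg]
  note as' = as[unfolded adapted_def] and at' = at[unfolded adapted_def]
  have c: "coordinate X Ls" "coordinate X Lt" and lf: "local_frame X E1 \<tau>s" "local_frame X E1 \<tau>t" "local_frame X E2 \<sigma>s" "local_frame X E2 \<sigma>t"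
    and pin: "p \<in> fst Ls" "p \<in> fst \<tau>s" "p \<in> fst \<sigma>s" "p \<in> fst Lt" "p \<in> fst \<tau>t" "p \<in> fst \<sigma>t"
    using as' at' by auto
  have vb1: "vector_bundle X E1" and vb2: "vector_bundle X E2" using arep1 arep2 by (simp_all add: algebroid_rep_def)
  have rep1: "groupoid_rep X G E1 \<Psi>1" and rep2: "groupoid_rep X G E2 \<Psi>2"
    using int1 int2 by (simp_all add: integrates_connection_def)
  define U where "U = (fst Ls \<inter> fst Lt) \<inter> (fst \<tau>s \<inter> fst \<tau>t) \<inter> (fst \<sigma>s \<inter> fst \<sigma>t)"
  have U: "openin TX U" "p \<in> U"
    unfolding U_def using c lf pin by (auto intro!: openin_Int top_chart_openin coordinate_top_chart chart_open local_frame_chart)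
  define V where "V = over U \<inter> fst K"
  have V: "openin TG V" "V \<subseteq> fst K" "g \<in> V"
    using openin_over[OF U(1)] top_chart_openin[OF coordinate_top_chart[OF K(1)]] gA U(2) tg K(2)
    by (auto simp: V_def over_iff p_def)
  note ctx = K(1) V
  have hV: "h \<in> points AG" "s h \<in> U" "t h \<in> U" if "h \<in> V" for h using that by (auto simp: V_def over_iff)
  define M1 where "M1 = rep_matrix E1 \<Psi>1 \<tau>s \<tau>t"
  define M2 where "M2 = rep_matrix E2 \<Psi>2 \<sigma>s \<sigma>t"
  have entries: "holo_fun AG V (\<lambda>h. A h $ i $ j)" if "\<And>h. h \<in> V \<Longrightarrow> mdiff AG A h"
    for A :: "'g \<Rightarrow> complex^'k::finite^'l::finite" and i j
    by (rule holo_funI[OF mG V(1)]) (use that mdiff_matrix_iff[OF mG] in blast)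
  have hM1: "holo_fun AG V (\<lambda>h. M1 h $ i $ j)" for i j
    unfolding M1_def
    by (rule entries, rule mdiff_rep_matrix[OF vb1 rep1 _ lf(1) _ lf(2)]) (use hV in \<open>auto simp: U_def\<close>)
  have hM2: "holo_fun AG V (\<lambda>h. M2 h $ i $ j)" for i j
    unfolding M2_def
    by (rule entries, rule mdiff_rep_matrix[OF vb2 rep2 _ lf(3) _ lf(4)]) (use hV in \<open>auto simp: U_def\<close>)
  have m: "mdiff X (\<lambda>x. snd L x - snd L p) x" if "coordinate X L" "x \<in> fst L" for L x
    using that by (intro mdiff_diff[OF mX] mdiff_chart[OF mX] mdiff_const[OF mX]) (auto dest: coordinate_points)
  have hs: "holo_fun AG V (\<lambda>h. snd Ls (s h) - snd Ls (s g))"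
    by (rule holo_funI[OF mG V(1)], rule mdiff_s[OF hV(1)]) (use hV m[OF c(1)] in \<open>auto simp: U_def p_def\<close>)
  have ht: "holo_fun AG V (\<lambda>h. snd Lt (t h) - snd Lt (t g))"
    by (rule holo_funI[OF mG V(1)], rule mdiff_t[OF hV(1)]) (use hV m[OF c(2)] in \<open>auto simp: U_def tg\<close>)
  let ?a = "\<phi> p Lt \<tau>t \<sigma>t" and ?a' = "\<phi> p Ls \<tau>s \<sigma>s"
  let ?e = "\<lambda>A. expand2_matrix K g A"
  define A where "A = formal_pullback t \<phi> g K Lt \<tau>t \<sigma>t"
  define C where "C = formal_pullback s \<phi> g K Ls \<tau>s \<sigma>s"
  have "mat2_ord_ge M (A ** ?e M1 - ?e M2 ** C)" for M
  proof -
    define N where "N = D p + Suc M"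
    define Pt where "Pt = (\<lambda>h. pol_matrix Lt p N ?a (t h))"
    define Ps where "Ps = (\<lambda>h. pol_matrix Ls p N ?a' (s h))"
    have hPt: "holo_fun AG V (\<lambda>h. Pt h $ i $ j)" for i j
      using expand2_pol(1)[OF ctx ht] by (simp add: Pt_def pol_matrix_def tg)
    have hPs: "holo_fun AG V (\<lambda>h. Ps h $ i $ j)" for i j
      using expand2_pol(1)[OF ctx hs] by (simp add: Ps_def pol_matrix_def p_def)
    have "mat2_ord_ge N (A - ?e Pt)"
      using expand2_pol(3)[OF ctx ht] 
      by (simp add: mat2_ord_ge_def A_def formal_pullback_def map_matrix_def expand2_matrix_def Pt_def pol_matrix_def tg)
    moreover have "mat2_ord_ge N (C - ?e Ps)"
      using expand2_pol(3)[OF ctx hs] 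
      by (simp add: mat2_ord_ge_def C_def formal_pullback_def map_matrix_def expand2_matrix_def Ps_def pol_matrix_def p_def)
    moreover have "M \<le> N" by (simp add: N_def)
    ultimately have 1: "mat2_ord_ge M (A - ?e Pt)" "mat2_ord_ge M (C - ?e Ps)"
      by (blast intro: mat2_ord_ge_mono)+
    let ?F = "\<lambda>h. Pt h ** M1 h - M2 h ** Ps h"
    have h12: "holo_fun AG V (\<lambda>h. (Pt h ** M1 h) $ i $ j)" "holo_fun AG V (\<lambda>h. (M2 h ** Ps h) $ i $ j)" for i j
      by (rule holo2_matrix_mult[OF ctx hPt hM1]) (rule holo2_matrix_mult[OF ctx hM2 hPs])
    have hF: "holo_fun AG V (\<lambda>h. ?F h $ i $ j)" for i j
      using holo_fun_mdiff[OF mG h12(1)] holo_fun_mdiff[OF mG h12(2)] mdiff_diff[OF mG]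
      by (intro holo_funI[OF mG V(1)]) simp
    have "matrix_bigo ?F (nhdsin TG g) (\<lambda>h. (of_real (norm (snd K h - snd K g)) :: complex) ^ M)"
      unfolding Pt_def Ps_def M1_def M2_def N_def
      by (rule intertwining_estimate[OF arep1 int1 arep2 int2 iso f gA p_def[symmetric] p K as at])
    then have 2: "mat2_ord_ge M (?e ?F)"
      using expand2_ord_bigo[OF ctx hF] by (simp add: mat2_ord_ge_def expand2_matrix_def matrix_bigo_def)
    have "?e ?F = ?e (\<lambda>h. Pt h ** M1 h) - ?e (\<lambda>h. M2 h ** Ps h)"
      using expand2_diff[OF ctx h12(1) h12(2)] by (simp add: expand2_matrix_def vec_eq_iff)
    also have "\<dots> = ?e Pt ** ?e M1 - ?e M2 ** ?e Ps"
      by (simp only: expand2_matrix_mult[OF ctx hPt hM1] expand2_matrix_mult[OF ctx hM2 hPs])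
    finally have eF: "?e ?F = ?e Pt ** ?e M1 - ?e M2 ** ?e Ps" .
    \<comment> \<open>Replacing the pullbacks by expansions of truncations costs order
      \<open>N\<close> on each side; the middle term is the expansion of the function estimated
      above.\<close>
    have "A ** ?e M1 - ?e M2 ** C = (A - ?e Pt) ** ?e M1 + ?e ?F - ?e M2 ** (C - ?e Ps)"
      unfolding eF by (simp add: matrix_mult_diff_left matrix_mult_diff_right)
    then show ?thesis
      using mat2_ord_ge_diff[OF mat2_ord_ge_add[OF mat2_ord_ge_mult_right[OF 1(1)] 2] mat2_ord_ge_mult_left[OF 1(2)]] by simp
  qed
  from mat2_ord_ge_all_imp_0[OF this] have AC: "A ** ?e M1 = ?e M2 ** C" by simp
  have "invertible ?a'" using iso[unfolded formal_isomorphism_def, rule_format, OF p as] by simp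
  from invertible_map_fps2_subst[OF expand2_pol(2)[OF ctx hs] this] have "invertible C"
    by (simp add: C_def formal_pullback_def p_def)
  from invertible_mult_matrix_inv[OF this] have inv: "C ** matrix_inv C = mat 1" .
  have r1: "formal_groupoid_rep G E1 \<Psi>1 g K \<tau>s \<tau>t = ?e M1" and r2: "formal_groupoid_rep G E2 \<Psi>2 g K \<sigma>s \<sigma>t = ?e M2"
    unfolding formal_groupoid_rep_def M1_def M2_def rep_matrix_def[OF vb1 rep1, abs_def] rep_matrix_def[OF vb2 rep2, abs_def]
    by (rule refl)+
  have "formal_Sigma G E1 \<Psi>1 \<phi> g K Ls Lt \<tau>s \<tau>t \<sigma>s \<sigma>t = A ** ?e M1 ** matrix_inv C"
    by (simp add: formal_Sigma_def r1 A_def C_def)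
  also have "\<dots> = ?e M2" unfolding AC matrix_mul_assoc[symmetric] inv by simp
  finally have e: "formal_Sigma G E1 \<Psi>1 \<phi> g K Ls Lt \<tau>s \<tau>t \<sigma>s \<sigma>t = ?e M2" .
  then show "formal_Sigma G E1 \<Psi>1 \<phi> g K Ls Lt \<tau>s \<tau>t \<sigma>s \<sigma>t = formal_groupoid_rep G E2 \<Psi>2 g K \<sigma>s \<sigma>t"
    unfolding r2 .
  show "fps2_convergent (formal_Sigma G E1 \<Psi>1 \<phi> g K Ls Lt \<tau>s \<tau>t \<sigma>s \<sigma>t $ i $ j)"
    unfolding e using expand2_convergent[OF ctx hM2] by (simp add: expand2_matrix_def)
qed

end

theorem theorem5p3:
  fixes X :: "('x, complex) cmanifold"
    and D :: "'x \<Rightarrow> nat"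
    and G :: "('x, 'g) groupoid"
    and \<theta> :: "'x vf \<Rightarrow> 'g vf"
    and E1 :: "('x, 'e, 'r::finite) vbundle"
    and E2 :: "('x, 'f, 'q::finite) vbundle"
    and nabla1 :: "('x, 'e) connection"
    and nabla2 :: "('x, 'f) connection"
    and \<phi> :: "('x, 'e, 'r, 'f, 'q) formal_hom"
    and \<Psi>1 :: "'g \<Rightarrow> 'e \<Rightarrow> 'e"
    and \<Psi>2 :: "'g \<Rightarrow> 'f \<Rightarrow> 'f"
  assumes "complex_curve X"
    and "effective_divisor X D"
    and "is_Pi1 X D G \<theta>"
    and "algebroid_rep X D E1 nabla1"
    and "algebroid_rep X D E2 nabla2"
    and "formal_isomorphism X D E1 E2 \<phi>"
    and "formally_intertwines X D E1 nabla1 E2 nabla2 \<phi>"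
    and "integrates_connection X D G \<theta> E1 nabla1 \<Psi>1"
    and "integrates_connection X D G \<theta> E2 nabla2 \<Psi>2"
  shows "\<forall>g \<in> arrows_over X D G. \<forall>K Ls Lt \<tau>s \<tau>t \<sigma>s \<sigma>t.
           coordinate (arrows G) K \<and> g \<in> fst K \<and>
           adapted X E1 E2 (src G g) Ls \<tau>s \<sigma>s \<and>
           adapted X E1 E2 (tgt G g) Lt \<tau>t \<sigma>t \<longrightarrow>
             formal_Sigma G E1 \<Psi>1 \<phi> g K Ls Lt \<tau>s \<tau>t \<sigma>s \<sigma>t = formal_groupoid_rep G E2 \<Psi>2 g K \<sigma>s \<sigma>t \<and>
             (\<forall>i j. fps2_convergent (formal_Sigma G E1 \<Psi>1 \<phi> g K Ls Lt \<tau>s \<tau>t \<sigma>s \<sigma>t $ i $ j))"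
proof -
  interpret Pi1_groupoid X G D \<theta>
    by standard (use assms in \<open>simp_all add: is_Pi1_def\<close>)
  show ?thesis
    using formal_Sigma_eq_convergent[OF assms(4,8,5,9,6,7)] by blast
qed

end
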